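(* Let $N\ge1$ be an integer, $0<\alpha<2$, $H=(H_1,\ldots,H_N)\in(0,1)^N$, and let $Z^H=\{Z^H(t),\,t\in\mathbb{R}^N\}$ be the harmonizable fractional $\alpha$-stable sheet with index $H$. For a constant $M>0$ and $n\in\mathbb{N}$, let $$D_{n,M}=\{(j,k)\in\mathbb{Z}^2:\ |j|\le n\text{ and }|k|\le M2^{n+1}\},$$ $$D_{n,M}^N=\{(J,K)\in\mathbb{Z}^N\times\mathbb{Z}^N:\ (j_l,k_l)\in D_{n,M}\text{ for each }l=1,\ldots,N\},$$ and define for every $t\in\mathbb{R}^N$ $$U_n^*(t)=\mathrm{Re}\sum_{(J,K)\in D_{n,M}^N}2^{-\langle J,H\rangle}\,\epsilon_{J,K}\prod_{l=1}^N\big\{\psi^{H_l}(2^{j_l}t_l-k_l)-\psi^{H_l}(-k_l)\big\}.$$ Then, for any $M>0$: (i) with probability $1$, $\{U_n^*\}_{n\in\mathbb{N}}$ is a Cauchy sequence in the Hölder space $C^\gamma([-M,M]^N)$ of any order $\gamma\in(0,\min\{H_1,\ldots,H_N\})$; denote its limit by $U^*$; (ii) the random field $U^*=\{U^*(t)\}_{t\in[-M,M]^N}$ is a version of $\{Z^H(t)\}_{t\in[-M,M]^N}$.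
   Context: $\widetilde M_\alpha$ is a complex-valued rotationally invariant $\alpha$-stable random measure on $\mathbb{R}^N$ with Lebesgue control measure: the integral $f\mapsto\int_{\mathbb{R}^N} f\,d\widetilde M_\alpha$ is complex-linear on the complex space $L^\alpha(\mathbb{R}^N)$ and $\mathbb{E}\exp\big(i\,\mathrm{Re}\int f\,d\widetilde M_\alpha\big)=\exp\big(-\int_{\mathbb{R}^N}|f(\lambda)|^\alpha d\lambda\big)$. The harmonizable fractional $\alpha$-stable sheet is $$Z^H(t)=\mathrm{Re}\int_{\mathbb{R}^N}\prod_{j=1}^N\frac{e^{it_j\lambda_j}-1}{|\lambda_j|^{H_j+1/\alpha}}\,\widetilde M_\alpha(d\lambda).$$ $\psi$ is a fixed Lemarié–Meyer mother wavelet: $\psi$ is real-valued and in the Schwartz class $S(\mathbb{R})$; its Fourier transform $\widehat\psi(\xi)=(2\pi)^{-1/2}\int_{\mathbb{R}}e^{-is\xi}\psi(s)\,ds$ is supported in $\{\xi\in\mathbb{R}:\frac{2\pi}{3}\le|\xi|\le\frac{8\pi}{3}\}$; and $\{2^{j/2}\psi(2^j\cdot-k):(j,k)\in\mathbb{Z}^2\}$ is an orthonormal basis of $L^2(\mathbb{R})$. For $v\in(0,1)$, $\psi^v(y)=\int_{\mathbb{R}}e^{iy\eta}\,\dfrac{\widehat\psi(\eta)}{|\eta|^{v+1/\alpha}}\,d\eta$ for $y\in\mathbb{R}$ (a real-valued function in $S(\mathbb{R})$). For $(j,k)\in\mathbb{Z}^2$, $\widehat\psi_{\alpha,j,k}(\xi)=2^{-j/\alpha}e^{-ik2^{-j}\xi}\widehat\psi(2^{-j}\xi)$.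 For $J=(j_1,\ldots,j_N)$, $K=(k_1,\ldots,k_N)\in\mathbb{Z}^N$, $\widehat\Psi_{\alpha,J,K}(\lambda)=\prod_{l=1}^N\widehat\psi_{\alpha,j_l,k_l}(\lambda_l)$ and $$\epsilon_{J,K}=\int_{\mathbb{R}^N}\overline{\widehat\Psi_{\alpha,J,K}(\lambda)}\,\widetilde M_\alpha(d\lambda),$$ with the same random measure $\widetilde M_\alpha$ as in the definition of $Z^H$. Also $\langle J,H\rangle=\sum_{l=1}^N j_lH_l$. $C^\gamma([-M,M]^N)$ is the Banach space of $\gamma$-Hölder continuous functions on $[-M,M]^N$ with norm $\sup|f|+\sup_{s\ne t}|f(s)-f(t)|/|s-t|^\gamma$. *)

theory Defs
  imports "HOL-Probability.Probability"
begin

text \<open>Functions rather than classes modulo null sets; every Lebesgue class has a Borel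
  representative. For \<open>p < 1\<close> this is only a quasi-normed space.\<close>

definition Lp_fun :: "real \<Rightarrow> ('a::euclidean_space \<Rightarrow> complex) set" where
  "Lp_fun p = {f. f \<in> borel_measurable lborel \<and> integrable lborel (\<lambda>x. norm (f x) powr p)}"

text \<open>A complex rotationally invariant \<open>\<alpha>\<close>-stable random measure with Lebesgue control measure is
  given by its integral: \<open>I f \<omega>\<close> stands for \<open>\<integral> f d\<tilde>M\<close> at the outcome \<open>\<omega>\<close>; the
  measure itself is \<open>A \<mapsto> I (indicator A)\<close> on Borel sets of finite Lebesgue measure. Applying the
  third clause to complex linear combinations determines all joint laws, hence independence on
  disjoint sets and \<open>\<sigma>\<close>-additivity.\<close>

definition stable_random_integral ::
  "'w measure \<Rightarrow> real \<Rightarrow> (('a::euclidean_space \<Rightarrow> complex) \<Rightarrow> 'w \<Rightarrow> complex) \<Rightarrow> bool" where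
  "stable_random_integral P \<alpha> I \<longleftrightarrow>
     (\<forall>f\<in>Lp_fun \<alpha>. I f \<in> borel_measurable P) \<and>
     (\<forall>f\<in>Lp_fun \<alpha>. \<forall>g\<in>Lp_fun \<alpha>. \<forall>a b.
        AE \<omega> in P. I (\<lambda>x. a * f x + b * g x) \<omega> = a * I f \<omega> + b * I g \<omega>) \<and>
     (\<forall>f\<in>Lp_fun \<alpha>.
        (LINT \<omega>|P. exp (\<i> * complex_of_real (Re (I f \<omega>)))) =
        complex_of_real (exp (- (LINT x|lborel. norm (f x) powr \<alpha>))))"

text \<open>At \<open>x $ l = 0\<close> the kernel takes the value \<open>0\<close> (division by zero), on a null set.\<close>

definition sheet_kernel :: "real \<Rightarrow> real^'n \<Rightarrow> real^'n \<Rightarrow> real^'n \<Rightarrow> complex" where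
  "sheet_kernel \<alpha> H t x =
     (\<Prod>l\<in>UNIV. (exp (\<i> * complex_of_real (t $ l * x $ l)) - 1) /
        complex_of_real (\<bar>x $ l\<bar> powr (H $ l + 1 / \<alpha>)))"

definition harmonizable_sheet ::
  "real \<Rightarrow> real^'n \<Rightarrow> ((real^'n \<Rightarrow> complex) \<Rightarrow> 'w \<Rightarrow> complex) \<Rightarrow> real^'n \<Rightarrow> 'w \<Rightarrow> real" where
  "harmonizable_sheet \<alpha> H I t \<omega> = Re (I (sheet_kernel \<alpha> H t) \<omega>)"

definition schwartz :: "(real \<Rightarrow> real) \<Rightarrow> bool" where
  "schwartz f \<longleftrightarrow>
     (\<forall>k x. (deriv ^^ k) f differentiable (at x)) \<and>
     (\<forall>m k. bounded (range (\<lambda>x. x ^ m * (deriv ^^ k) f x)))"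

definition fourier :: "(real \<Rightarrow> real) \<Rightarrow> real \<Rightarrow> complex" where
  "fourier f \<xi> =
     complex_of_real (1 / sqrt (2 * pi)) *
     (LINT s|lborel. exp (- \<i> * complex_of_real (s * \<xi>)) * complex_of_real (f s))"

definition orthonormal_basis_L2 :: "('i \<Rightarrow> real \<Rightarrow> complex) \<Rightarrow> bool" where
  "orthonormal_basis_L2 e \<longleftrightarrow>
     (\<forall>i. e i \<in> Lp_fun 2) \<and>
     (\<forall>i i'. (LINT x|lborel. e i x * cnj (e i' x)) = (if i = i' then 1 else 0)) \<and>
     (\<forall>f\<in>Lp_fun 2. \<forall>\<epsilon>>0. \<exists>F c. finite F \<and>
        (LINT x|lborel. (norm (f x - (\<Sum>i\<in>F. c i * e i x)))\<^sup>2) < \<epsilon>)"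

definition lemarie_meyer_wavelet :: "(real \<Rightarrow> real) \<Rightarrow> bool" where
  "lemarie_meyer_wavelet \<psi> \<longleftrightarrow>
     schwartz \<psi> \<and>
     closure {\<xi>. fourier \<psi> \<xi> \<noteq> 0} \<subseteq> {\<xi>. 2 * pi / 3 \<le> \<bar>\<xi>\<bar> \<and> \<bar>\<xi>\<bar> \<le> 8 * pi / 3} \<and>
     orthonormal_basis_L2 (\<lambda>(j::int, k::int) x. complex_of_real
       (2 powr (real_of_int j / 2) * \<psi> (2 powr real_of_int j * x - real_of_int k)))"

text \<open>\<open>psi_frac \<psi> \<alpha> v\<close> is \<open>\<psi>\<^sup>v\<close>. It is real-valued for a real \<open>\<psi>\<close>, but is kept complex here as
  the integral defining it is.\<close>

definition psi_frac :: "(real \<Rightarrow> real) \<Rightarrow> real \<Rightarrow> real \<Rightarrow> real \<Rightarrow> complex" where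
  "psi_frac \<psi> \<alpha> v y =
     (LINT \<eta>|lborel. exp (\<i> * complex_of_real (y * \<eta>)) *
        (fourier \<psi> \<eta> / complex_of_real (\<bar>\<eta>\<bar> powr (v + 1 / \<alpha>))))"

definition psi_hat :: "(real \<Rightarrow> real) \<Rightarrow> real \<Rightarrow> int \<Rightarrow> int \<Rightarrow> real \<Rightarrow> complex" where
  "psi_hat \<psi> \<alpha> j k \<xi> =
     complex_of_real (2 powr (- real_of_int j / \<alpha>)) *
     exp (- \<i> * complex_of_real (real_of_int k * 2 powr (- real_of_int j) * \<xi>)) *
     fourier \<psi> (2 powr (- real_of_int j) * \<xi>)"

definition Psi_hat :: "(real \<Rightarrow> real) \<Rightarrow> real \<Rightarrow> int^'n \<Rightarrow> int^'n \<Rightarrow> real^'n \<Rightarrow> complex" where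
  "Psi_hat \<psi> \<alpha> J K x = (\<Prod>l\<in>UNIV. psi_hat \<psi> \<alpha> (J $ l) (K $ l) (x $ l))"

definition wavelet_coeff ::
  "(real \<Rightarrow> real) \<Rightarrow> real \<Rightarrow> ((real^'n \<Rightarrow> complex) \<Rightarrow> 'w \<Rightarrow> complex) \<Rightarrow>
     int^'n \<Rightarrow> int^'n \<Rightarrow> 'w \<Rightarrow> complex" where
  "wavelet_coeff \<psi> \<alpha> I J K \<omega> = I (\<lambda>x. cnj (Psi_hat \<psi> \<alpha> J K x)) \<omega>"

definition D_index :: "nat \<Rightarrow> real \<Rightarrow> (int \<times> int) set" where
  "D_index n M = {(j, k). \<bar>j\<bar> \<le> int n \<and> real_of_int \<bar>k\<bar> \<le> M * 2 ^ (n + 1)}"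

definition D_index_prod :: "nat \<Rightarrow> real \<Rightarrow> ((int^'n) \<times> (int^'n)) set" where
  "D_index_prod n M = {(J, K). \<forall>l. (J $ l, K $ l) \<in> D_index n M}"

definition U_star ::
  "(real \<Rightarrow> real) \<Rightarrow> real \<Rightarrow> real^'n \<Rightarrow> ((real^'n \<Rightarrow> complex) \<Rightarrow> 'w \<Rightarrow> complex) \<Rightarrow>
     real \<Rightarrow> nat \<Rightarrow> real^'n \<Rightarrow> 'w \<Rightarrow> real" where
  "U_star \<psi> \<alpha> H I M n t \<omega> =
     Re (\<Sum>(J, K)\<in>D_index_prod n M.
       complex_of_real (2 powr (- (\<Sum>l\<in>UNIV. real_of_int (J $ l) * H $ l))) *
       wavelet_coeff \<psi> \<alpha> I J K \<omega> *
       (\<Prod>l\<in>UNIV.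
          psi_frac \<psi> \<alpha> (H $ l) (2 powr real_of_int (J $ l) * t $ l - real_of_int (K $ l)) -
          psi_frac \<psi> \<alpha> (H $ l) (- real_of_int (K $ l))))"

definition cube :: "real \<Rightarrow> (real^'n) set" where
  "cube M = {t. \<forall>l. t $ l \<in> {-M..M}}"

text \<open>The space \<open>C\<^sup>\<gamma>(S)\<close>: a function on \<open>S\<close> is represented by any total function extending it, and
  only the values on \<open>S\<close> matter. The suprema in the norm are real-valued, hence meaningful only on
  \<open>holder_space\<close>.\<close>

definition holder_quotients :: "real \<Rightarrow> 'a::real_normed_vector set \<Rightarrow> ('a \<Rightarrow> real) \<Rightarrow> real set" where
  "holder_quotients \<gamma> S f =
     {\<bar>f s - f t\<bar> / norm (s - t) powr \<gamma> | s t. s \<in> S \<and> t \<in> S \<and> s \<noteq> t}"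

definition holder_space :: "real \<Rightarrow> 'a::real_normed_vector set \<Rightarrow> ('a \<Rightarrow> real) set" where
  "holder_space \<gamma> S =
     {f. bdd_above ((\<lambda>t. \<bar>f t\<bar>) ` S) \<and> bdd_above (holder_quotients \<gamma> S f)}"

definition holder_norm :: "real \<Rightarrow> 'a::real_normed_vector set \<Rightarrow> ('a \<Rightarrow> real) \<Rightarrow> real" where
  "holder_norm \<gamma> S f = (SUP t\<in>S. \<bar>f t\<bar>) + Sup (holder_quotients \<gamma> S f)"

definition holder_Cauchy ::
  "real \<Rightarrow> 'a::real_normed_vector set \<Rightarrow> (nat \<Rightarrow> 'a \<Rightarrow> real) \<Rightarrow> bool" where
  "holder_Cauchy \<gamma> S X \<longleftrightarrow>
     (\<forall>n. X n \<in> holder_space \<gamma> S) \<and>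
     (\<forall>\<epsilon>>0. \<exists>n0. \<forall>m\<ge>n0. \<forall>n\<ge>n0. holder_norm \<gamma> S (\<lambda>t. X m t - X n t) < \<epsilon>)"

definition holder_limit ::
  "real \<Rightarrow> 'a::real_normed_vector set \<Rightarrow> (nat \<Rightarrow> 'a \<Rightarrow> real) \<Rightarrow> ('a \<Rightarrow> real) \<Rightarrow> bool" where
  "holder_limit \<gamma> S X f \<longleftrightarrow>
     f \<in> holder_space \<gamma> S \<and> (\<lambda>n. holder_norm \<gamma> S (\<lambda>t. X n t - f t)) \<longlonglongrightarrow> 0"

text \<open>Two random fields on the same probability space are versions of each other on \<open>T\<close> if they
  agree almost surely at each point of \<open>T\<close>; in particular they have the same
  finite-dimensional distributions.\<close>

definition version_on ::
  "'w measure \<Rightarrow> 'a set \<Rightarrow> ('a \<Rightarrow> 'w \<Rightarrow> real) \<Rightarrow> ('a \<Rightarrow> 'w \<Rightarrow> real) \<Rightarrow> bool" where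
  "version_on P T X Y \<longleftrightarrow>
     (\<forall>t\<in>T. X t \<in> borel_measurable P \<and> Y t \<in> borel_measurable P \<and> (AE \<omega> in P. X t \<omega> = Y t \<omega>))"

end

theory Submission
  imports Defs
begin

text \<open>
  Flipping the sign of an integrand on the cells of a partition does not change \<open>\<integral>|f|\<^sup>\<alpha>\<close>, so by
  the characteristic function the integrals of a function over disjoint cells are unconditional:
  their joint law is invariant under sign changes. Khinchine's inequality for the signs bounds high
  moments by the square function, and a Paley-Zygmund argument, again for the signs, bounds the
  square function in probability. The result is a maximal inequality: if \<open>|f k| \<le> g \<in> L\<^sup>\<alpha>\<close> for all
  \<open>k\<close>, then almost surely \<open>|I (f k)| = O(w k)\<close> whenever some power of \<open>1 / w k\<close> is summable. It plays
  the part of a LePage series representation. Applied to the functions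
  \<open>\<Psi>\<^bsub>\<alpha>,J,K\<^esub>\<close>, suitably normalised, it shows that the \<open>\<epsilon>\<^bsub>J,K\<^esub>\<close> grow more slowly than any positive
  power of the weights \<open>\<Prod>l. 2\<^bsup>|J l|\<^esup> (1 + |K l|)\<close>. The increments of the rapidly decaying functions
  \<open>\<psi>\<^sup>v\<close>, multiplied by small powers of these weights, are summable in Hoelder norm; this gives the
  almost sure convergence.

  The limit is identified through the wavelet expansion of the one-dimensional kernel on the Fourier
  side. The kernel need not be square integrable, so the basis is used only to expand smooth bumps
  supported away from the origin, against which the kernel and the limit of the partial sums, both
  continuous there, are tested. A common \<open>L\<^sup>\<alpha>\<close> envelope of the partial sums then
  turns pointwise convergence of the kernels into convergence in probability of the integrals.
\<close>

section \<open>Sign changes and unconditional random variables\<close>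

text \<open>For \<open>\<alpha>\<close> < 2 only moments of order below \<open>\<alpha>\<close> are
  finite, too few to sum over all indices against small powers of the weights. Dividing by the
  square function repairs this: with the absolute values of the cell integrals frozen, only signs
  are random, and a signed sum divided by its Euclidean length has moments of every order, bounded
  independently of the partition. The square function is shared by all integrands dominated by the
  same \<open>g\<close>, so its heavy tail is paid for once, while a high self-normalised moment
  makes the sum over the indices converge.

  About \<open>I\<close> one knows only one-dimensional characteristic functions and a linearity
  that holds almost surely for each pair of integrands. Hence partitions are finite, general
  integrands are reached by rounding the quotients \<open>f k / g\<close> to a grid, and null sets
  are collected over countable families. The rounding error is small in \<open>power_norm\<close>,
  not for each outcome, so it is controlled by the tail of a single stable law.\<close>

definition flip :: "'a set \<Rightarrow> 'a \<Rightarrow> real" where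
  "flip B a = (if a \<in> B then -1 else 1)"

section \<open>Sums with random signs\<close>

lemma abs_flip [simp]: "\<bar>flip B a\<bar> = 1" and flip_squared [simp]: "flip B a * flip B a = 1"
  by (auto simp: flip_def)

text \<open>This is cosh x <= exp(x^2 / 2): the inequality behind Hoeffding's lemma, taken for the
  fair two-point law on an interval of length \<open>2 * x\<close>, together with symmetry in
  x.\<close>

lemma exp_add_exp_minus_le: "exp x + exp (- x) \<le> 2 * exp (x\<^sup>2 / 2)" for x :: real
proof -
  have *: "exp x + exp (- x) \<le> 2 * exp (x\<^sup>2 / 2)" if "x \<ge> 0" for x :: real
  proof -
    have pos: "1 + 1/2 * (exp (2*x) - 1) > (0::real)"
      using that by (simp add: add_pos_nonneg)
    have "- (2*x) * (1/2) + ln (1 + 1/2 * (exp (2*x) - 1)) \<le> (2*x)\<^sup>2 / 8"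
      using Hoeffdings_lemma_aux[of "2*x" "1/2"] that by simp
    hence "ln (1 + 1/2 * (exp (2*x) - 1)) \<le> x + x\<^sup>2/2"
      by (simp add: power2_eq_square)
    hence "1 + 1/2 * (exp (2*x) - 1) \<le> exp (x + x\<^sup>2/2)"
      using pos by (metis exp_ln exp_le_cancel_iff)
    hence "1 + exp (2*x) \<le> 2 * exp (x + x\<^sup>2/2)"
      by (simp add: field_simps)
    hence "exp (-x) * (1 + exp (2*x)) \<le> exp (-x) * (2 * exp (x + x\<^sup>2/2))"
      by (intro mult_left_mono) auto
    thus ?thesis
      by (simp add: algebra_simps flip: exp_add)
  qed
  show ?thesis
    using *[of x] *[of "-x"] by (cases "x \<ge> 0") (auto simp: add.commute)
qed

text \<open>A subset \<open>B\<close> stands for an outcome of independent fair signs, so a sum over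
  \<open>Pow A\<close> is \<open>2 ^ card A\<close> times an expectation and no second probability
  space appears. Independence of the signs is the distributive law for a product of two-term
  sums.\<close>

lemma sum_Pow_flip_exp:
  assumes "finite A"
  shows "(\<Sum>B\<in>Pow A. exp (\<Sum>a\<in>A. flip B a * x a)) = (\<Prod>a\<in>A. exp (- x a) + exp (x a))"
proof -
  have "(\<Sum>B\<in>Pow A. exp (\<Sum>a\<in>A. flip B a * x a)) =
      (\<Sum>B\<in>Pow A. (\<Prod>a\<in>B. exp (- x a)) * (\<Prod>a\<in>A - B. exp (x a)))"
  proof (intro sum.cong refl)
    fix B assume B: "B \<in> Pow A"
    have "exp (\<Sum>a\<in>A. flip B a * x a) = (\<Prod>a\<in>A. exp (flip B a * x a))"
      using assms by (simp add: exp_sum)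
    also have "\<dots> = (\<Prod>a\<in>A - B. exp (flip B a * x a)) * (\<Prod>a\<in>B. exp (flip B a * x a))"
      using assms B by (intro prod.subset_diff) auto
    also have "\<dots> = (\<Prod>a\<in>B. exp (- x a)) * (\<Prod>a\<in>A - B. exp (x a))"
      by (subst mult.commute, intro arg_cong2[where f="(*)"] prod.cong) (auto simp: flip_def)
    finally show "exp (\<Sum>a\<in>A. flip B a * x a) =
        (\<Prod>a\<in>B. exp (- x a)) * (\<Prod>a\<in>A - B. exp (x a))" .
  qed
  also have "\<dots> = (\<Prod>a\<in>A. exp (- x a) + exp (x a))"
    by (rule prod_add[OF assms, symmetric])
  finally show ?thesis .
qed

lemma even_power_le_fact_exp: "y ^ (2*m) \<le> fact (2*m) * (exp y + exp (- y))" for y :: real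
proof -
  have *: "y ^ n \<le> fact n * exp y" if "y \<ge> 0" for y :: real and n
  proof -
    have "y ^ n / fact n = (\<Sum>k\<in>{n}. y ^ k /\<^sub>R fact k)"
      by (simp add: divide_inverse_commute)
    also have "\<dots> \<le> (\<Sum>k. y ^ k /\<^sub>R fact k)"
      using that summable_exp_generic[of y] by (intro sum_le_suminf) auto
    also have "\<dots> = exp y"
      by (simp add: exp_def)
    finally show ?thesis by (simp add: field_simps)
  qed
  have "y ^ (2*m) = \<bar>y\<bar> ^ (2*m)"
    by (simp add: power_even_abs)
  also have "\<dots> \<le> fact (2*m) * exp \<bar>y\<bar>"
    by (rule *) simp
  also have "\<dots> \<le> fact (2*m) * (exp y + exp (- y))"
    by (intro mult_left_mono) (auto simp: abs_if)
  finally show ?thesis .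
qed

text \<open>At unit variance the exponential moment is at most exp(1/2) <= 2, and one Taylor term of
  the exponential turns this into a bound on every even moment. The factor 4 is 2 for this bound
  times 2 for the two signs of the exponent. The growth in \<open>m\<close> is far from sharp; what
  counts is that it does not depend on \<open>A\<close>.\<close>

lemma Khinchine_aux:
  assumes "finite A" "(\<Sum>a\<in>A. (x a)\<^sup>2) = 1"
  shows "(\<Sum>B\<in>Pow A. (\<Sum>a\<in>A. flip B a * x a) ^ (2*m)) \<le> 2 ^ card A * (4 * fact (2*m))"
proof -
  have P: "(\<Sum>B\<in>Pow A. exp (\<Sum>a\<in>A. flip B a * y a)) \<le> 2 ^ card A * 2"
    if y: "(\<Sum>a\<in>A. (y a)\<^sup>2) = 1" for y
  proof -
    have "(\<Sum>B\<in>Pow A. exp (\<Sum>a\<in>A. flip B a * y a)) = (\<Prod>a\<in>A. exp (- y a) + exp (y a))"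
      by (rule sum_Pow_flip_exp) fact
    also have "\<dots> \<le> (\<Prod>a\<in>A. 2 * exp ((y a)\<^sup>2 / 2))"
      using exp_add_exp_minus_le by (intro prod_mono) (auto simp: add.commute add_nonneg_nonneg)
    also have "\<dots> = 2 ^ card A * exp (1/2)"
      using assms y by (simp add: prod.distrib exp_sum[symmetric] sum_divide_distrib[symmetric])
    also have "exp (1/2) \<le> (2::real)"
      by (rule exp_half_le2)
    finally show ?thesis by simp
  qed
  have "(\<Sum>B\<in>Pow A. (\<Sum>a\<in>A. flip B a * x a) ^ (2*m)) \<le>
      (\<Sum>B\<in>Pow A. fact (2*m) * (exp (\<Sum>a\<in>A. flip B a * x a) + exp (- (\<Sum>a\<in>A. flip B a * x a))))"
    by (intro sum_mono even_power_le_fact_exp)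
  also have "\<dots> = fact (2*m) * ((\<Sum>B\<in>Pow A. exp (\<Sum>a\<in>A. flip B a * x a)) +
      (\<Sum>B\<in>Pow A. exp (\<Sum>a\<in>A. flip B a * (- x a))))"
    by (simp add: sum_distrib_left[symmetric] sum.distrib sum_negf)
  also have "\<dots> \<le> fact (2*m) * (2 ^ card A * 2 + 2 ^ card A * 2)"
    using assms by (intro mult_left_mono add_mono P) auto
  finally show ?thesis by (simp add: mult_ac)
qed

lemma Khinchine:
  assumes "finite A"
  shows "(\<Sum>B\<in>Pow A. (\<Sum>a\<in>A. flip B a * x a) ^ (2*m)) \<le>
    2 ^ card A * (4 * fact (2*m)) * (\<Sum>a\<in>A. (x a)\<^sup>2) ^ m"
proof (cases "(\<Sum>a\<in>A. (x a)\<^sup>2) = 0")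
  case True
  hence z: "x a = 0" if "a \<in> A" for a
    using assms that by (simp add: sum_nonneg_eq_0_iff)
  have "(\<Sum>B\<in>Pow A. (\<Sum>a\<in>A. flip B a * x a) ^ (2*m)) = 2 ^ card A * 0 ^ m"
    using assms z by (simp add: card_Pow power_0_left)
  also have "\<dots> \<le> 2 ^ card A * (4 * fact (2*m)) * 0 ^ m"
    by (cases m) auto
  finally show ?thesis using True by simp
next
  case False
  define s where "s = sqrt (\<Sum>a\<in>A. (x a)\<^sup>2)"
  have s0: "s > 0"
    using False by (auto simp: s_def sum_nonneg order.strict_iff_order)
  have s2: "s\<^sup>2 = (\<Sum>a\<in>A. (x a)\<^sup>2)"
    by (simp add: s_def sum_nonneg)
  have "(\<Sum>a\<in>A. (x a / s)\<^sup>2) = s\<^sup>2 / s\<^sup>2"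
    unfolding s2 by (simp add: power_divide s2 sum_divide_distrib[symmetric])
  hence "(\<Sum>a\<in>A. (x a / s)\<^sup>2) = 1"
    using s0 by simp
  hence "(\<Sum>B\<in>Pow A. (\<Sum>a\<in>A. flip B a * (x a / s)) ^ (2*m)) \<le> 2 ^ card A * (4 * fact (2*m))"
    by (rule Khinchine_aux[OF assms])
  also have "(\<lambda>B. (\<Sum>a\<in>A. flip B a * (x a / s)) ^ (2*m)) =
      (\<lambda>B. (\<Sum>a\<in>A. flip B a * x a) ^ (2*m) / (s\<^sup>2) ^ m)"
    by (simp add: sum_divide_distrib[symmetric] power_divide power_mult)
  also have "(\<Sum>B\<in>Pow A. (\<Sum>a\<in>A. flip B a * x a) ^ (2*m) / (s\<^sup>2) ^ m) =
      (\<Sum>B\<in>Pow A. (\<Sum>a\<in>A. flip B a * x a) ^ (2*m)) / (s\<^sup>2) ^ m"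
    by (simp add: sum_divide_distrib)
  finally show ?thesis
    using s0 unfolding s2[symmetric] by (simp add: divide_le_eq)
qed

text \<open>Orthogonality of the Rademacher functions: pairing \<open>B\<close> with
  \<open>insert b B\<close> cancels the cross term of the coordinate \<open>b\<close>.\<close>

lemma sum_Pow_flip_squared:
  assumes "finite A"
  shows "(\<Sum>B\<in>Pow A. (\<Sum>a\<in>A. flip B a * x a)\<^sup>2) = 2 ^ card A * (\<Sum>a\<in>A. (x a)\<^sup>2)"
  using assms
proof (induction A)
  case (insert b A)
  have inj: "inj_on (insert b) (Pow A)"
    using insert.hyps by (auto simp: inj_on_def)
  have disj: "Pow A \<inter> insert b ` Pow A = {}"
    using insert.hyps by auto
  have 1: "(\<Sum>a\<in>insert b A. flip B a * x a) = x b + (\<Sum>a\<in>A. flip B a * x a)" if "B \<in> Pow A" for B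
    using insert.hyps that by (auto simp: flip_def)
  have 2: "(\<Sum>a\<in>insert b A. flip (insert b B) a * x a) = - x b + (\<Sum>a\<in>A. flip B a * x a)"
    if "B \<in> Pow A" for B
    using insert.hyps that by (subst sum.insert) (auto simp: flip_def intro!: sum.cong)
  have "(\<Sum>B\<in>Pow (insert b A). (\<Sum>a\<in>insert b A. flip B a * x a)\<^sup>2) =
      (\<Sum>B\<in>Pow A. (\<Sum>a\<in>insert b A. flip B a * x a)\<^sup>2) +
      (\<Sum>B\<in>Pow A. (\<Sum>a\<in>insert b A. flip (insert b B) a * x a)\<^sup>2)"
    using insert.hyps inj disj by (simp only: Pow_insert) (subst sum.union_disjoint; simp add: sum.reindex)
  also have "\<dots> = (\<Sum>B\<in>Pow A. (x b + (\<Sum>a\<in>A. flip B a * x a))\<^sup>2 + (- x b + (\<Sum>a\<in>A. flip B a * x a))\<^sup>2)"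
    using 1 2 by (simp add: sum.distrib)
  also have "\<dots> = (\<Sum>B\<in>Pow A. 2 * (x b)\<^sup>2 + 2 * (\<Sum>a\<in>A. flip B a * x a)\<^sup>2)"
    by (intro sum.cong refl) (simp add: power2_eq_square algebra_simps)
  also have "\<dots> = 2 ^ card (insert b A) * (\<Sum>a\<in>insert b A. (x a)\<^sup>2)"
    using insert by (simp add: sum.distrib sum_distrib_left[symmetric] card_Pow algebra_simps)
  finally show ?case .
qed simp

text \<open>Paley-Zygmund for signs. Khinchine's inequality with \<open>m = 2\<close> bounds the
  fourth moment by 96 = 4 * 4! times the squared variance, and comparing it with the second moment
  gives 384 = 4 * 96.\<close>

lemma sign_sum_large_often:
  assumes A: "finite A"
  shows "2 ^ card A \<le> 384 * real (card {B\<in>Pow A. (\<Sum>a\<in>A. (x a)\<^sup>2) / 2 \<le> (\<Sum>a\<in>A. flip B a * x a)\<^sup>2})"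
proof -
  define S where "S = (\<Sum>a\<in>A. (x a)\<^sup>2)"
  define Y where "Y B = (\<Sum>a\<in>A. flip B a * x a)" for B
  define G where "G = {B\<in>Pow A. S / 2 \<le> (Y B)\<^sup>2}"
  have fin: "finite (Pow A)" "G \<subseteq> Pow A" "finite G"
    using A by (auto simp: G_def intro: finite_subset[of _ "Pow A"])
  show ?thesis
  proof (cases "S = 0")
    case True
    hence "G = Pow A" by (auto simp: G_def)
    thus ?thesis unfolding G_def[symmetric] S_def[symmetric] Y_def[symmetric]
      using A by (simp add: card_Pow)
  next
    case False
    hence S: "S > 0" by (auto simp: S_def sum_nonneg order.strict_iff_order)
    \<comment> \<open>A pointwise substitute for the Cauchy-Schwarz step: off \<open>G\<close> the
      square is at most S/2, and on \<open>G\<close> it is split by the inequality of arithmetic and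
      geometric means. With the coefficient 384 the fourth moments add up to an average of S/4,
      which leaves S/4 for \<open>G\<close>.\<close>
    have pw: "(Y B)\<^sup>2 \<le> S / 2 + (Y B) ^ 4 / (384 * S) + (if B \<in> G then 96 * S else 0)" if "B \<in> Pow A" for B
    proof (cases "B \<in> G")
      case True
      have "0 \<le> ((Y B)\<^sup>2 / (384 * S) - 1/2)\<^sup>2 * (384 * S)"
        using S by (intro mult_nonneg_nonneg) auto
      also have "\<dots> = (Y B) ^ 4 / (384 * S) - (Y B)\<^sup>2 + 96 * S"
        using S by (simp add: field_simps power2_eq_square power4_eq_xxxx)
      finally show ?thesis using True S by simp
    next
      case False
      hence "(Y B)\<^sup>2 \<le> S / 2" using that by (auto simp: G_def)
      moreover have "0 \<le> (Y B) ^ 4 / (384 * S)" using S by simp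
      ultimately show ?thesis using False by simp
    qed
    have "2 ^ card A * S = (\<Sum>B\<in>Pow A. (Y B)\<^sup>2)"
      unfolding S_def Y_def by (rule sum_Pow_flip_squared[OF A, symmetric])
    also have "\<dots> \<le> (\<Sum>B\<in>Pow A. S / 2 + (Y B) ^ 4 / (384 * S) + (if B \<in> G then 96 * S else 0))"
      by (intro sum_mono pw)
    also have "\<dots> = 2 ^ card A * S / 2 + (\<Sum>B\<in>Pow A. (Y B) ^ 4) / (384 * S) + card G * (96 * S)"
      using fin A by (simp add: sum.distrib sum_divide_distrib[symmetric] card_Pow sum.If_cases Int_absorb1)
    also have "(\<Sum>B\<in>Pow A. (Y B) ^ 4) \<le> 2 ^ card A * 96 * S\<^sup>2"
      using Khinchine[OF A, of x 2] by (simp add: Y_def S_def fact_numeral)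
    hence "(\<Sum>B\<in>Pow A. (Y B) ^ 4) / (384 * S) \<le> 2 ^ card A * 96 * S\<^sup>2 / (384 * S)"
      using S by (intro divide_right_mono) auto
    also have "2 ^ card A * 96 * S\<^sup>2 / (384 * S) = 2 ^ card A * S / 4"
      using S by (simp add: power2_eq_square)
    finally have "2 ^ card A * S \<le> 384 * card G * S"
      by (simp add: algebra_simps)
    thus ?thesis
      using S by (simp add: G_def S_def Y_def)
  qed
qed

section \<open>Unconditional families\<close>

definition unconditional :: "'w measure \<Rightarrow> 'a set \<Rightarrow> ('a \<Rightarrow> 'w \<Rightarrow> real) \<Rightarrow> bool" where
  "unconditional P A \<zeta> \<longleftrightarrow> (\<forall>a\<in>A. \<zeta> a \<in> borel_measurable P) \<and>
     (\<forall>u B. (CLINT \<omega>|P. iexp (\<Sum>a\<in>A. u a * (flip B a * \<zeta> a \<omega>))) =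
            (CLINT \<omega>|P. iexp (\<Sum>a\<in>A. u a * \<zeta> a \<omega>)))"

text \<open>Finite combinations of characters are the test functions whose expectations a joint
  characteristic function determines directly. They form an algebra containing the sines of the
  coordinates, so \<open>unconditional\<close> carries over to polynomials in truncated
  coordinates.\<close>

inductive trig_poly :: "'a set \<Rightarrow> (('a \<Rightarrow> real) \<Rightarrow> complex) \<Rightarrow> bool" for A where
  trig_poly_iexp: "trig_poly A (\<lambda>z. iexp (\<Sum>a\<in>A. u a * z a))"
| trig_poly_add: "trig_poly A f \<Longrightarrow> trig_poly A g \<Longrightarrow> trig_poly A (\<lambda>z. f z + g z)"
| trig_poly_scale: "trig_poly A f \<Longrightarrow> trig_poly A (\<lambda>z. c * f z)"

lemma trig_poly_const: "trig_poly A (\<lambda>z. c)"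
  using trig_poly_scale[OF trig_poly_iexp[of A "\<lambda>_. 0"], of c] by simp

lemma trig_poly_mult:
  assumes "trig_poly A f" "trig_poly A g"
  shows "trig_poly A (\<lambda>z. f z * g z)"
  using assms(1)
proof induction
  case (trig_poly_iexp u)
  show ?case using assms(2)
  proof induction
    case (trig_poly_iexp v)
    have "trig_poly A (\<lambda>z. iexp (\<Sum>a\<in>A. (u a + v a) * z a))"
      by (rule trig_poly.trig_poly_iexp)
    thus ?case
      by (simp add: exp_add[symmetric] sum.distrib distrib_left distrib_right)
  next
    case (trig_poly_add f g)
    thus ?case by (simp add: distrib_left trig_poly.trig_poly_add)
  next
    case (trig_poly_scale f c)
    show ?case
      using trig_poly.trig_poly_scale[OF trig_poly_scale.IH, of c] by (simp add: mult_ac)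
  qed
next
  case (trig_poly_add f g)
  thus ?case by (simp add: distrib_right trig_poly.trig_poly_add)
next
  case (trig_poly_scale f c)
  show ?case
    using trig_poly.trig_poly_scale[OF trig_poly_scale.IH, of c] by (simp add: mult_ac)
qed

lemma trig_poly_sum:
  assumes "\<And>i. i \<in> T \<Longrightarrow> trig_poly A (f i)"
  shows "trig_poly A (\<lambda>z. \<Sum>i\<in>T. f i z)"
  using assms
  by (induction T rule: infinite_finite_induct) (auto intro!: trig_poly_const trig_poly_add)

lemma trig_poly_power: "trig_poly A f \<Longrightarrow> trig_poly A (\<lambda>z. f z ^ n)"
  by (induction n) (auto intro!: trig_poly_const trig_poly_mult)

lemma trig_poly_sin:
  assumes "finite A" "a \<in> A"
  shows "trig_poly A (\<lambda>z. complex_of_real (sin (c * z a)))"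
proof -
  have eq: "(\<Sum>b\<in>A. (if b = a then d else 0) * z b) = d * z a" for d and z :: "'a \<Rightarrow> real"
    using assms by (subst sum.remove[of _ a]) auto
  have "trig_poly A (\<lambda>z. 1 / (2 * \<i>) * (iexp (\<Sum>b\<in>A. (if b = a then c else 0) * z b) +
      (-1) * iexp (\<Sum>b\<in>A. (if b = a then -c else 0) * z b)))"
    by (intro trig_poly_scale trig_poly_add trig_poly_iexp)
  moreover have "1 / (2 * \<i>) * (iexp (\<Sum>b\<in>A. (if b = a then c else 0) * z b) +
      (-1) * iexp (\<Sum>b\<in>A. (if b = a then -c else 0) * z b)) = complex_of_real (sin (c * z a))" for z :: "'a \<Rightarrow> real"
    unfolding eq by (simp add: sin_of_real[symmetric] sin_exp_eq' mult_ac) (simp add: field_simps)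
  ultimately show ?thesis by simp
qed

lemma trig_poly_real_polynomial:
  assumes "real_polynomial_function p" "trig_poly A (\<lambda>z. complex_of_real (s z))"
  shows "trig_poly A (\<lambda>z. complex_of_real (p (s z)))"
  using assms(1)
proof induction
  case (linear f)
  have "f x = f 1 * x" for x :: real
    using bounded_linear.linear[OF linear] linear_scale[of f x 1] by simp
  hence "(\<lambda>z. complex_of_real (f (s z))) = (\<lambda>z. complex_of_real (f 1) * complex_of_real (s z))"
    by (metis of_real_mult)
  thus ?case using trig_poly_scale[OF assms(2)] by metis
qed (auto intro!: trig_poly_const trig_poly_add trig_poly_mult)

lemma (in prob_space) trig_poly_integrable:
  assumes "trig_poly A f" "\<And>a. a \<in> A \<Longrightarrow> \<zeta> a \<in> borel_measurable M"
  shows "integrable M (\<lambda>\<omega>. f (\<lambda>a. \<zeta> a \<omega>))"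
  using assms(1)
proof induction
  case (trig_poly_iexp u)
  have [measurable]: "\<And>a. a \<in> A \<Longrightarrow> \<zeta> a \<in> borel_measurable M" by fact
  show ?case by (intro integrable_iexp) auto
qed auto

lemma (in prob_space) trig_poly_flip:
  assumes "trig_poly A f" "unconditional M A \<zeta>"
  shows "(CLINT \<omega>|M. f (\<lambda>a. flip B a * \<zeta> a \<omega>)) = (CLINT \<omega>|M. f (\<lambda>a. \<zeta> a \<omega>))"
  using assms(1)
proof induction
  case (trig_poly_iexp u)
  show ?case using assms(2) by (simp add: unconditional_def)
next
  case (trig_poly_add f g)
  have [measurable]: "\<And>a. a \<in> A \<Longrightarrow> \<zeta> a \<in> borel_measurable M"
    using assms(2) by (simp add: unconditional_def)
  have "integrable M (\<lambda>\<omega>. h (\<lambda>a. flip B a * \<zeta> a \<omega>))" "integrable M (\<lambda>\<omega>. h (\<lambda>a. \<zeta> a \<omega>))"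
    if "trig_poly A h" for h
    by (rule trig_poly_integrable[OF that], measurable)+
  with trig_poly_add show ?case by simp
qed simp

section \<open>Self-normalised sums\<close>

lemma sum_squared_le: "(\<Sum>a\<in>A. x a)\<^sup>2 \<le> real (card A) * (\<Sum>a\<in>A. (x a)\<^sup>2)" for x :: "'a \<Rightarrow> real"
  using sum_squared_le_sum_of_squares[of x A] by (cases "finite A") (auto simp: mult.commute)

text \<open>Justifies the truncation \<open>L * sin (z / L)\<close>: it is bounded by
  \<open>L\<close>, odd and hence compatible with sign changes, a trigonometric polynomial in
  \<open>z\<close>, and it tends to \<open>z\<close> as \<open>L\<close> grows.\<close>

lemma scaled_sin_tendsto: "(\<lambda>n. real (Suc n) * sin (z / real (Suc n))) \<longlonglongrightarrow> z"
proof -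
  have "((\<lambda>x. sin (z * x)) has_field_derivative z) (at 0)"
    by (auto intro!: derivative_eq_intros)
  hence "((\<lambda>h. sin (z * h) / h) \<longlongrightarrow> z) (at 0)"
    by (simp add: DERIV_def)
  moreover have "filterlim (\<lambda>n. inverse (real (Suc n))) (at 0) sequentially"
    using LIMSEQ_inverse_real_of_nat by (auto simp: filterlim_at)
  ultimately have "(\<lambda>n. sin (z * inverse (real (Suc n))) / inverse (real (Suc n))) \<longlonglongrightarrow> z"
    by (rule filterlim_compose)
  thus ?thesis by (simp add: divide_inverse mult_ac)
qed

text \<open>The square function does not notice sign changes, so only the power of the linear sum is
  affected. For a polynomial \<open>h\<close> both sides are expectations of trigonometric
  polynomials; Weierstrass approximation on the bounded range of the truncated square function
  extends the identity to continuous \<open>h\<close>, such as the negative powers used for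
  self-normalisation.\<close>

lemma (in prob_space) self_normalized_moment_flip:
  fixes h :: "real \<Rightarrow> real"
  assumes A: "finite A" and un: "unconditional M A \<zeta>" and L: "L > 0"
    and h: "continuous_on {0..real (card A) * L\<^sup>2} h"
  defines "z \<equiv> (\<lambda>a \<omega>. L * sin (\<zeta> a \<omega> / L))"
  shows "(LINT \<omega>|M. (\<Sum>a\<in>A. flip B a * z a \<omega>) ^ k * h (\<Sum>a\<in>A. (z a \<omega>)\<^sup>2)) =
         (LINT \<omega>|M. (\<Sum>a\<in>A. z a \<omega>) ^ k * h (\<Sum>a\<in>A. (z a \<omega>)\<^sup>2))"
    and "integrable M (\<lambda>\<omega>. (\<Sum>a\<in>A. flip B a * z a \<omega>) ^ k * h (\<Sum>a\<in>A. (z a \<omega>)\<^sup>2))"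
proof -
  define K where "K = real (card A) * L\<^sup>2"
  define S where "S \<omega> = (\<Sum>a\<in>A. (z a \<omega>)\<^sup>2)" for \<omega>
  define Y where "Y B \<omega> = (\<Sum>a\<in>A. flip B a * z a \<omega>)" for B \<omega>
  have meas[measurable]: "\<And>a. a \<in> A \<Longrightarrow> \<zeta> a \<in> borel_measurable M"
    using un by (simp add: unconditional_def)
  have zmeas[measurable]: "\<And>a. a \<in> A \<Longrightarrow> z a \<in> borel_measurable M"
    unfolding z_def by measurable
  have Smeas[measurable]: "S \<in> borel_measurable M" and Ymeas[measurable]: "Y B \<in> borel_measurable M" for B
    unfolding S_def Y_def by measurable
  have zle: "\<bar>z a \<omega>\<bar> \<le> L" for a \<omega>
    using L abs_sin_le_one[of "\<zeta> a \<omega> / L"] by (simp add: z_def abs_mult mult_left_le)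
  have S: "S \<omega> \<in> {0..K}" for \<omega>
  proof -
    have "(z a \<omega>)\<^sup>2 \<le> L\<^sup>2" for a
      using zle[of a \<omega>] L by (simp add: abs_le_square_iff[symmetric])
    hence "S \<omega> \<le> (\<Sum>a\<in>A. L\<^sup>2)" unfolding S_def by (intro sum_mono) auto
    thus ?thesis by (auto simp: S_def K_def sum_nonneg)
  qed
  have Yle: "\<bar>Y B \<omega>\<bar> \<le> card A * L" for B \<omega>
  proof -
    have "\<bar>Y B \<omega>\<bar> \<le> (\<Sum>a\<in>A. \<bar>flip B a * z a \<omega>\<bar>)" unfolding Y_def by (rule sum_abs)
    also have "\<dots> \<le> (\<Sum>a\<in>A. L)" using zle by (intro sum_mono) (auto simp: abs_mult)
    finally show ?thesis by simp
  qed
  have Ypow: "\<bar>Y B \<omega> ^ k\<bar> \<le> (card A * L) ^ k" for B \<omega>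
    using power_mono[OF Yle, of B \<omega> k] by (simp add: power_abs)
  have hS[measurable]: "(\<lambda>\<omega>. h (S \<omega>)) \<in> borel_measurable M"
  proof -
    have "(\<lambda>x. if x \<in> {0..K} then h x else 0) \<in> borel_measurable borel"
      using h by (intro borel_measurable_continuous_on_if) (auto simp: K_def)
    from measurable_compose[OF Smeas this] show ?thesis using S by simp
  qed
  have "compact (h ` {0..K})"
    using h by (intro compact_continuous_image) (auto simp: K_def)
  then obtain b where b: "\<And>\<omega>. \<bar>h (S \<omega>)\<bar> \<le> b"
    using S by (metis bounded_iff compact_imp_bounded image_eqI real_norm_def)
  have int: "integrable M (\<lambda>\<omega>. Y B \<omega> ^ k * h (S \<omega>))" for B
  proof (rule integrable_const_bound[where B = "(card A * L) ^ k * b"])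
    show "AE \<omega> in M. norm (Y B \<omega> ^ k * h (S \<omega>)) \<le> (card A * L) ^ k * b"
      using b Ypow[of B] L by (auto simp: abs_mult intro!: mult_mono)
  qed measurable
  show "integrable M (\<lambda>\<omega>. (\<Sum>a\<in>A. flip B a * z a \<omega>) ^ k * h (\<Sum>a\<in>A. (z a \<omega>)\<^sup>2))"
    using int[of B] by (simp add: Y_def S_def)
  have main: "(LINT \<omega>|M. Y B \<omega> ^ k * p (S \<omega>)) = (LINT \<omega>|M. Y {} \<omega> ^ k * p (S \<omega>))
      \<and> integrable M (\<lambda>\<omega>. Y B \<omega> ^ k * p (S \<omega>))" if p: "real_polynomial_function p" for p B
  proof -
    define F :: "('b \<Rightarrow> real) \<Rightarrow> complex" where
      "F = (\<lambda>x. (\<Sum>a\<in>A. complex_of_real L * complex_of_real (sin (1 / L * x a))) ^ k *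
        complex_of_real (p (\<Sum>a\<in>A. (L * sin (1 / L * x a))\<^sup>2)))"
    have sq: "trig_poly A (\<lambda>x. complex_of_real (\<Sum>a\<in>A. (L * sin (1 / L * x a))\<^sup>2))"
      unfolding of_real_sum of_real_power of_real_mult
      by (rule trig_poly_sum[OF trig_poly_power[OF trig_poly_scale[OF trig_poly_sin]]]) (use A in auto)
    have F: "trig_poly A F"
      unfolding F_def
      by (rule trig_poly_mult[OF trig_poly_power[OF trig_poly_sum[OF trig_poly_scale[OF trig_poly_sin]]]
            trig_poly_real_polynomial[OF p sq]]) (use A in auto)
    have eq: "F (\<lambda>a. flip B a * \<zeta> a \<omega>) = complex_of_real (Y B \<omega> ^ k * p (S \<omega>))" for B \<omega>
    proof -
      have 1: "L * sin (1 / L * (flip B a * \<zeta> a \<omega>)) = flip B a * z a \<omega>" for a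
        by (auto simp: flip_def z_def)
      hence 2: "complex_of_real L * complex_of_real (sin (1 / L * (flip B a * \<zeta> a \<omega>))) =
          complex_of_real (flip B a * z a \<omega>)" for a
        by (metis of_real_mult)
      have 3: "(flip B a * z a \<omega>)\<^sup>2 = (z a \<omega>)\<^sup>2" for a
        by (auto simp: flip_def)
      show ?thesis
        unfolding F_def 1 2 3 of_real_sum[symmetric] Y_def S_def
        by (simp only: of_real_mult of_real_power)
    qed
    have eq0: "F (\<lambda>a. \<zeta> a \<omega>) = complex_of_real (Y {} \<omega> ^ k * p (S \<omega>))" for \<omega>
      using eq[of "{}" \<omega>] by (simp add: flip_def)
    have "(CLINT \<omega>|M. F (\<lambda>a. flip B a * \<zeta> a \<omega>)) = (CLINT \<omega>|M. F (\<lambda>a. \<zeta> a \<omega>))"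
      by (rule trig_poly_flip[OF F un])
    hence 1: "(LINT \<omega>|M. Y B \<omega> ^ k * p (S \<omega>)) = (LINT \<omega>|M. Y {} \<omega> ^ k * p (S \<omega>))"
      unfolding eq eq0 integral_complex_of_real by simp
    have "integrable M (\<lambda>\<omega>. F (\<lambda>a. flip B a * \<zeta> a \<omega>))"
      by (rule trig_poly_integrable[OF F]) measurable
    hence "integrable M (\<lambda>\<omega>. Y B \<omega> ^ k * p (S \<omega>))"
      unfolding eq complex_of_real_integrable_eq .
    with 1 show ?thesis by simp
  qed
  \<comment> \<open>The other factor is bounded by \<open>(card A * L) ^ k\<close>, so a uniform
    error \<open>e\<close> in \<open>h\<close> costs at most this multiple of \<open>e\<close> on
    either side.\<close>
  have approx: "\<bar>(LINT \<omega>|M. Y B \<omega> ^ k * h (S \<omega>)) - (LINT \<omega>|M. Y {} \<omega> ^ k * h (S \<omega>))\<bar> \<le>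
      2 * ((card A * L) ^ k * e)" if e: "e > 0" for e
  proof -
    obtain p where p: "real_polynomial_function p" "\<And>x. x \<in> {0..K} \<Longrightarrow> \<bar>h x - p x\<bar> < e"
      using Stone_Weierstrass_real_polynomial_function[of "{0..K}" h e] h e by (auto simp: K_def)
    have d: "\<bar>(LINT \<omega>|M. Y B \<omega> ^ k * h (S \<omega>)) - (LINT \<omega>|M. Y B \<omega> ^ k * p (S \<omega>))\<bar> \<le>
        (card A * L) ^ k * e" for B
    proof -
      have i2: "integrable M (\<lambda>\<omega>. Y B \<omega> ^ k * p (S \<omega>))"
        using main[OF p(1)] by blast
      have "\<bar>(LINT \<omega>|M. Y B \<omega> ^ k * h (S \<omega>)) - (LINT \<omega>|M. Y B \<omega> ^ k * p (S \<omega>))\<bar> =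
          \<bar>LINT \<omega>|M. Y B \<omega> ^ k * h (S \<omega>) - Y B \<omega> ^ k * p (S \<omega>)\<bar>"
        using int i2 by simp
      also have "\<dots> \<le> (LINT \<omega>|M. \<bar>Y B \<omega> ^ k * h (S \<omega>) - Y B \<omega> ^ k * p (S \<omega>)\<bar>)"
        by (rule integral_abs_bound)
      also have "\<dots> \<le> (LINT \<omega>|M. (card A * L) ^ k * e)"
      proof (rule integral_mono)
        fix \<omega>
        have "\<bar>Y B \<omega> ^ k * h (S \<omega>) - Y B \<omega> ^ k * p (S \<omega>)\<bar> = \<bar>Y B \<omega> ^ k\<bar> * \<bar>h (S \<omega>) - p (S \<omega>)\<bar>"
          by (simp add: abs_mult[symmetric] right_diff_distrib)
        also have "\<dots> \<le> (card A * L) ^ k * e"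
          using p(2)[OF S[of \<omega>]] Ypow[of B \<omega>] L by (intro mult_mono) auto
        finally show "\<bar>Y B \<omega> ^ k * h (S \<omega>) - Y B \<omega> ^ k * p (S \<omega>)\<bar> \<le> (card A * L) ^ k * e" .
      qed (use int i2 in auto)
      finally show ?thesis by (simp add: prob_space)
    qed
    show ?thesis
      using d[of B] d[of "{}"] main[OF p(1), of B] by linarith
  qed
  have "(LINT \<omega>|M. Y B \<omega> ^ k * h (S \<omega>)) = (LINT \<omega>|M. Y {} \<omega> ^ k * h (S \<omega>))"
  proof (rule ccontr)
    assume neq: "\<not> ?thesis"
    define r where "r = \<bar>(LINT \<omega>|M. Y B \<omega> ^ k * h (S \<omega>)) - (LINT \<omega>|M. Y {} \<omega> ^ k * h (S \<omega>))\<bar>"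
    define c where "c = 2 * (card A * L) ^ k"
    have r: "r > 0" using neq by (simp add: r_def)
    have c: "c \<ge> 0" using L by (simp add: c_def)
    \<comment> \<open>The \<open>c + 1\<close> in the denominator allows for
      \<open>c = 0\<close>.\<close>
    have "r \<le> c * (r / (2 * (c + 1)))"
      using approx[of "r / (2 * (c + 1))"] r c by (simp add: r_def c_def)
    also have "\<dots> < r"
      using r c by (simp add: field_simps add_nonneg_pos)
    finally show False by simp
  qed
  thus "(LINT \<omega>|M. (\<Sum>a\<in>A. flip B a * z a \<omega>) ^ k * h (\<Sum>a\<in>A. (z a \<omega>)\<^sup>2)) =
         (LINT \<omega>|M. (\<Sum>a\<in>A. z a \<omega>) ^ k * h (\<Sum>a\<in>A. (z a \<omega>)\<^sup>2))"
    by (simp add: Y_def S_def flip_def)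
qed

lemma power_over_one_plus_power_le_1: "(s::real) ^ m / (1 + s) ^ m \<le> 1" if "s \<ge> 0"
  using that by (simp add: divide_le_eq_1 power_mono)

text \<open>After truncation the expectation equals its average over all sign choices. For a fixed
  outcome Khinchine's inequality bounds that average, and the resulting power of the square function
  is absorbed by the denominator, where the 1 keeps the quotient continuous. The bound is
  independent of \<open>A\<close>, so arbitrarily fine partitions are allowed.\<close>

lemma (in prob_space) self_normalized_moment:
  assumes A: "finite A" and un: "unconditional M A \<zeta>"
  shows "(LINT \<omega>|M. (\<Sum>a\<in>A. \<zeta> a \<omega>) ^ (2*m) / (1 + (\<Sum>a\<in>A. (\<zeta> a \<omega>)\<^sup>2)) ^ m) \<le> 4 * fact (2*m)"
    and "integrable M (\<lambda>\<omega>. (\<Sum>a\<in>A. \<zeta> a \<omega>) ^ (2*m) / (1 + (\<Sum>a\<in>A. (\<zeta> a \<omega>)\<^sup>2)) ^ m)"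
proof -
  have meas[measurable]: "\<And>a. a \<in> A \<Longrightarrow> \<zeta> a \<in> borel_measurable M"
    using un by (simp add: unconditional_def)
  define z where "z n a \<omega> = real (Suc n) * sin (\<zeta> a \<omega> / real (Suc n))" for n a \<omega>
  have zmeas[measurable]: "\<And>a n. a \<in> A \<Longrightarrow> z n a \<in> borel_measurable M"
    unfolding z_def by measurable
  have trunc: "(LINT \<omega>|M. (\<Sum>a\<in>A. z n a \<omega>) ^ (2*m) / (1 + (\<Sum>a\<in>A. (z n a \<omega>)\<^sup>2)) ^ m) \<le> 4 * fact (2*m)" for n
  proof -
    define h where "h s = 1 / (1 + s) ^ m" for s :: real
    have h: "continuous_on {0..real (card A) * (real (Suc n))\<^sup>2} h"
      unfolding h_def by (intro continuous_intros) auto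
    define q where "q B \<omega> = (\<Sum>a\<in>A. flip B a * z n a \<omega>) ^ (2*m) * h (\<Sum>a\<in>A. (z n a \<omega>)\<^sup>2)" for B \<omega>
    have int: "integrable M (q B)" and eq: "(LINT \<omega>|M. q B \<omega>) =
      (LINT \<omega>|M. (\<Sum>a\<in>A. z n a \<omega>) ^ (2*m) * h (\<Sum>a\<in>A. (z n a \<omega>)\<^sup>2))" for B
      unfolding q_def z_def by (rule self_normalized_moment_flip[OF A un _ h]; simp)+
    have "2 ^ card A * (LINT \<omega>|M. (\<Sum>a\<in>A. z n a \<omega>) ^ (2*m) * h (\<Sum>a\<in>A. (z n a \<omega>)\<^sup>2)) =
        (\<Sum>B\<in>Pow A. LINT \<omega>|M. q B \<omega>)"
      unfolding eq using A by (simp add: card_Pow)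
    also have "\<dots> = (LINT \<omega>|M. (\<Sum>B\<in>Pow A. q B \<omega>))"
      using int by simp
    also have "\<dots> \<le> (LINT \<omega>|M. 2 ^ card A * (4 * fact (2*m)))"
    proof (rule integral_mono)
      fix \<omega>
      define S where "S = (\<Sum>a\<in>A. (z n a \<omega>)\<^sup>2)"
      have S: "S \<ge> 0" by (simp add: S_def sum_nonneg)
      have "(\<Sum>B\<in>Pow A. q B \<omega>) = (\<Sum>B\<in>Pow A. (\<Sum>a\<in>A. flip B a * z n a \<omega>) ^ (2*m)) * h S"
        by (simp add: q_def S_def sum_distrib_right)
      also have "\<dots> \<le> (2 ^ card A * (4 * fact (2*m)) * S ^ m) * h S"
        unfolding S_def by (intro mult_right_mono Khinchine A) (auto simp: h_def sum_nonneg)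
      also have "\<dots> = (2 ^ card A * (4 * fact (2*m))) * (S ^ m / (1 + S) ^ m)"
        by (simp add: h_def)
      also have "\<dots> \<le> (2 ^ card A * (4 * fact (2*m))) * 1"
        using S by (intro mult_left_mono power_over_one_plus_power_le_1) auto
      finally show "(\<Sum>B\<in>Pow A. q B \<omega>) \<le> 2 ^ card A * (4 * fact (2*m))" by simp
    qed (use int in auto)
    finally show ?thesis
      by (simp add: h_def prob_space)
  qed
  \<comment> \<open>Cauchy-Schwarz gives a bound that depends on \<open>A\<close>; it serves only as
    the dominating constant when the truncation is removed.\<close>
  have bound: "\<bar>(\<Sum>a\<in>A. x a) ^ (2*m) / (1 + (\<Sum>a\<in>A. (x a)\<^sup>2)) ^ m\<bar> \<le> real (card A) ^ m" for x :: "'b \<Rightarrow> real"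
  proof -
    define S where "S = (\<Sum>a\<in>A. (x a)\<^sup>2)"
    have S: "S \<ge> 0" by (simp add: S_def sum_nonneg)
    have "(\<Sum>a\<in>A. x a) ^ (2*m) / (1 + S) ^ m = ((\<Sum>a\<in>A. x a)\<^sup>2) ^ m / (1 + S) ^ m"
      by (simp add: power_mult)
    also have "\<dots> \<le> (real (card A) * S) ^ m / (1 + S) ^ m"
      using S sum_squared_le[of x A] by (intro divide_right_mono power_mono) (auto simp: S_def)
    also have "\<dots> = real (card A) ^ m * (S ^ m / (1 + S) ^ m)"
      by (simp add: power_mult_distrib)
    also have "\<dots> \<le> real (card A) ^ m * 1"
      using S by (intro mult_left_mono power_over_one_plus_power_le_1) auto
    finally show ?thesis using S by (simp add: S_def abs_mult power_mult)
  qed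
  have nz: "1 + (\<Sum>a\<in>A. (x a)\<^sup>2) \<noteq> 0" for x :: "'b \<Rightarrow> real"
    using sum_nonneg[of A "\<lambda>a. (x a)\<^sup>2"] by (smt (verit) zero_le_power2)
  have lim: "(\<lambda>n. (LINT \<omega>|M. (\<Sum>a\<in>A. z n a \<omega>) ^ (2*m) / (1 + (\<Sum>a\<in>A. (z n a \<omega>)\<^sup>2)) ^ m)) \<longlonglongrightarrow>
      (LINT \<omega>|M. (\<Sum>a\<in>A. \<zeta> a \<omega>) ^ (2*m) / (1 + (\<Sum>a\<in>A. (\<zeta> a \<omega>)\<^sup>2)) ^ m)"
    and int: "integrable M (\<lambda>\<omega>. (\<Sum>a\<in>A. \<zeta> a \<omega>) ^ (2*m) / (1 + (\<Sum>a\<in>A. (\<zeta> a \<omega>)\<^sup>2)) ^ m)"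
  proof -
    have AE: "AE \<omega> in M. (\<lambda>n. (\<Sum>a\<in>A. z n a \<omega>) ^ (2*m) / (1 + (\<Sum>a\<in>A. (z n a \<omega>)\<^sup>2)) ^ m) \<longlonglongrightarrow>
      (\<Sum>a\<in>A. \<zeta> a \<omega>) ^ (2*m) / (1 + (\<Sum>a\<in>A. (\<zeta> a \<omega>)\<^sup>2)) ^ m"
      using nz unfolding z_def by (intro AE_I2 tendsto_intros scaled_sin_tendsto) auto
    show "(\<lambda>n. (LINT \<omega>|M. (\<Sum>a\<in>A. z n a \<omega>) ^ (2*m) / (1 + (\<Sum>a\<in>A. (z n a \<omega>)\<^sup>2)) ^ m)) \<longlonglongrightarrow>
      (LINT \<omega>|M. (\<Sum>a\<in>A. \<zeta> a \<omega>) ^ (2*m) / (1 + (\<Sum>a\<in>A. (\<zeta> a \<omega>)\<^sup>2)) ^ m)"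
      using bound AE
      by (intro integral_dominated_convergence[where w = "\<lambda>_. real (card A) ^ m"]) auto
    show "integrable M (\<lambda>\<omega>. (\<Sum>a\<in>A. \<zeta> a \<omega>) ^ (2*m) / (1 + (\<Sum>a\<in>A. (\<zeta> a \<omega>)\<^sup>2)) ^ m)"
      using bound by (intro integrable_const_bound[where B = "real (card A) ^ m"]) auto
  qed
  show "(LINT \<omega>|M. (\<Sum>a\<in>A. \<zeta> a \<omega>) ^ (2*m) / (1 + (\<Sum>a\<in>A. (\<zeta> a \<omega>)\<^sup>2)) ^ m) \<le> 4 * fact (2*m)"
    using trunc by (intro LIMSEQ_le_const2[OF lim]) auto
  show "integrable M (\<lambda>\<omega>. (\<Sum>a\<in>A. \<zeta> a \<omega>) ^ (2*m) / (1 + (\<Sum>a\<in>A. (\<zeta> a \<omega>)\<^sup>2)) ^ m)" by fact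
qed

lemma unconditional_scale:
  assumes "unconditional P A \<zeta>"
  shows "unconditional P A (\<lambda>a \<omega>. d a * \<zeta> a \<omega>)"
proof -
  have "(CLINT \<omega>|P. iexp (\<Sum>a\<in>A. (u a * d a) * (flip B a * \<zeta> a \<omega>))) =
        (CLINT \<omega>|P. iexp (\<Sum>a\<in>A. (u a * d a) * \<zeta> a \<omega>))" for u B
    using conjunct2[OF assms[unfolded unconditional_def], THEN spec[of _ "\<lambda>a. u a * d a"]] by blast
  thus ?thesis
    using assms by (auto simp: unconditional_def mult_ac)
qed

text \<open>Markov's inequality for the self-normalised moment of order \<open>2 * m\<close>.
  Multipliers of modulus at most \<open>D\<close> enlarge the square function by at most
  \<open>D\<^sup>2\<close>, so one event for the unweighted square function serves every choice of
  \<open>d\<close>.\<close>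

lemma (in prob_space) self_normalized_tail:
  assumes A: "finite A" and un: "unconditional M A \<zeta>"
    and d: "\<And>a. a \<in> A \<Longrightarrow> \<bar>d a\<bar> \<le> D" and x: "x > 0" and y: "y \<ge> 0"
  shows "prob {\<omega>\<in>space M. \<bar>\<Sum>a\<in>A. d a * \<zeta> a \<omega>\<bar> > x \<and> (\<Sum>a\<in>A. (\<zeta> a \<omega>)\<^sup>2) \<le> y} \<le>
    4 * fact (2*m) * (1 + D\<^sup>2 * y) ^ m / x ^ (2*m)"
proof -
  have meas[measurable]: "\<And>a. a \<in> A \<Longrightarrow> \<zeta> a \<in> borel_measurable M"
    using un by (simp add: unconditional_def)
  define S where "S \<omega> = (\<Sum>a\<in>A. (d a * \<zeta> a \<omega>)\<^sup>2)" for \<omega>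
  define Y where "Y \<omega> = (\<Sum>a\<in>A. d a * \<zeta> a \<omega>)" for \<omega>
  define E where "E = {\<omega>\<in>space M. \<bar>Y \<omega>\<bar> > x \<and> (\<Sum>a\<in>A. (\<zeta> a \<omega>)\<^sup>2) \<le> y}"
  have E[measurable]: "E \<in> sets M" unfolding E_def Y_def by measurable
  have S0: "S \<omega> \<ge> 0" for \<omega> by (simp add: S_def sum_nonneg)
  define c where "c = x ^ (2*m) / (1 + D\<^sup>2 * y) ^ m"
  have pos: "1 + D\<^sup>2 * y > 0" using y by (simp add: add_pos_nonneg)
  have le: "c * indicator E \<omega> \<le> Y \<omega> ^ (2*m) / (1 + S \<omega>) ^ m" for \<omega>
  proof (cases "\<omega> \<in> E")
    case True
    have "S \<omega> \<le> (\<Sum>a\<in>A. D\<^sup>2 * (\<zeta> a \<omega>)\<^sup>2)"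
      unfolding S_def power_mult_distrib using d
      by (intro sum_mono mult_right_mono) (auto simp: abs_le_square_iff[symmetric] intro: order_trans[OF _ abs_ge_self])
    also have "\<dots> \<le> D\<^sup>2 * y" using True by (auto simp: E_def sum_distrib_left[symmetric] intro: mult_left_mono)
    finally have S: "S \<omega> \<le> D\<^sup>2 * y" .
    have "x ^ (2*m) \<le> \<bar>Y \<omega>\<bar> ^ (2*m)"
      using True x by (intro power_mono) (auto simp: E_def)
    hence Y: "x ^ (2*m) \<le> Y \<omega> ^ (2*m)" by (simp add: power_even_abs)
    have "x ^ (2*m) / (1 + D\<^sup>2 * y) ^ m \<le> Y \<omega> ^ (2*m) / (1 + S \<omega>) ^ m"
    proof (rule frac_le)
      show "0 \<le> Y \<omega> ^ (2*m)" by (simp add: power_mult)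
      show "0 < (1 + S \<omega>) ^ m" "(1 + S \<omega>) ^ m \<le> (1 + D\<^sup>2 * y) ^ m"
        using S S0[of \<omega>] by (auto intro!: zero_less_power power_mono)
    qed (fact Y)
    thus ?thesis using True by (simp add: c_def)
  qed (use S0[of \<omega>] in \<open>auto intro!: divide_nonneg_nonneg simp: power_mult\<close>)
  have int: "integrable M (\<lambda>\<omega>. Y \<omega> ^ (2*m) / (1 + S \<omega>) ^ m)"
    and bd: "(LINT \<omega>|M. Y \<omega> ^ (2*m) / (1 + S \<omega>) ^ m) \<le> 4 * fact (2*m)"
    unfolding Y_def S_def using self_normalized_moment[OF A unconditional_scale[OF un, of d], of m] by auto
  have "c * prob E = (LINT \<omega>|M. c * indicator E \<omega>)"
    by simp
  also have "\<dots> \<le> (LINT \<omega>|M. Y \<omega> ^ (2*m) / (1 + S \<omega>) ^ m)"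
    using int le by (intro integral_mono) (auto intro!: integrable_real_indicator simp: emeasure_eq_measure)
  also note bd
  finally have "prob E \<le> 4 * fact (2*m) / c"
    using x pos by (simp add: c_def field_simps)
  thus ?thesis using x pos unfolding E_def Y_def c_def by (simp add: field_simps)
qed

text \<open>All signed sums have the same law, and for every outcome at least a fraction 1/384 of
  them has a square of at least half the square function. Averaging bounds the tail of the square
  function by that of a single sum, which for cell integrals is again one stable integral.\<close>

lemma (in prob_space) square_function_tail:
  assumes A: "finite A" and un: "unconditional M A \<zeta>"
  shows "prob {\<omega>\<in>space M. (\<Sum>a\<in>A. (\<zeta> a \<omega>)\<^sup>2) > y} \<le>
    384 * prob {\<omega>\<in>space M. (\<Sum>a\<in>A. \<zeta> a \<omega>)\<^sup>2 \<ge> y / 2}"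
proof -
  have meas[measurable]: "\<And>a. a \<in> A \<Longrightarrow> \<zeta> a \<in> borel_measurable M"
    using un by (simp add: unconditional_def)
  define S where "S \<omega> = (\<Sum>a\<in>A. (\<zeta> a \<omega>)\<^sup>2)" for \<omega>
  define Y where "Y B \<omega> = (\<Sum>a\<in>A. flip B a * \<zeta> a \<omega>)" for B \<omega>
  have Sm[measurable]: "S \<in> borel_measurable M" and Ym[measurable]: "Y B \<in> borel_measurable M" for B
    unfolding S_def Y_def by measurable
  have law: "distr M borel (Y B) = distr M borel (Y {})" for B
  proof (rule Levy_uniqueness)
    show "char (distr M borel (Y B)) = char (distr M borel (Y {}))"
    proof
      fix t
      have "(CLINT \<omega>|M. iexp (\<Sum>a\<in>A. t * (flip B a * \<zeta> a \<omega>))) = (CLINT \<omega>|M. iexp (\<Sum>a\<in>A. t * \<zeta> a \<omega>))"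
        using conjunct2[OF un[unfolded unconditional_def], THEN spec[of _ "\<lambda>_. t"]] by blast
      thus "char (distr M borel (Y B)) t = char (distr M borel (Y {})) t"
        by (simp add: char_def integral_distr Y_def sum_distrib_left flip_def mult.assoc)
    qed
  qed (auto intro!: real_distribution_distr)
  define p where "p = prob {\<omega>\<in>space M. (Y {} \<omega>)\<^sup>2 \<ge> y / 2}"
  have eqp: "prob {\<omega>\<in>space M. (Y B \<omega>)\<^sup>2 \<ge> y / 2} = p" for B
  proof -
    have "prob {\<omega>\<in>space M. (Y B \<omega>)\<^sup>2 \<ge> y / 2} = measure (distr M borel (Y B)) {x. x\<^sup>2 \<ge> y / 2}" for B
      by (subst measure_distr) (auto intro!: arg_cong[where f=prob])
    thus ?thesis using law[of B] by (simp add: p_def)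
  qed
  have le: "2 ^ card A * indicator {\<omega>\<in>space M. S \<omega> > y} \<omega> \<le>
      384 * (\<Sum>B\<in>Pow A. indicator {\<omega>\<in>space M. (Y B \<omega>)\<^sup>2 \<ge> y / 2} \<omega> :: real)" if "\<omega> \<in> space M" for \<omega>
  proof (cases "S \<omega> > y")
    case True
    have "2 ^ card A \<le> 384 * real (card {B\<in>Pow A. S \<omega> / 2 \<le> (Y B \<omega>)\<^sup>2})"
      unfolding S_def Y_def by (rule sign_sum_large_often[OF A])
    also have "card {B\<in>Pow A. S \<omega> / 2 \<le> (Y B \<omega>)\<^sup>2} \<le> card {B\<in>Pow A. y / 2 \<le> (Y B \<omega>)\<^sup>2}"
      using True A by (intro card_mono) auto
    also have "real (card {B\<in>Pow A. y / 2 \<le> (Y B \<omega>)\<^sup>2}) = (\<Sum>B\<in>{B\<in>Pow A. y / 2 \<le> (Y B \<omega>)\<^sup>2}. 1)"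
      by simp
    also have "\<dots> = (\<Sum>B\<in>Pow A. if y / 2 \<le> (Y B \<omega>)\<^sup>2 then 1 else 0)"
      by (rule sum.inter_filter) (use A in simp)
    also have "\<dots> = (\<Sum>B\<in>Pow A. indicator {\<omega>\<in>space M. (Y B \<omega>)\<^sup>2 \<ge> y / 2} \<omega>)"
      using that by (intro sum.cong) (auto simp: indicator_def)
    finally show ?thesis using True that by simp
  qed (auto intro!: sum_nonneg)
  have "2 ^ card A * prob {\<omega>\<in>space M. S \<omega> > y} = (LINT \<omega>|M. 2 ^ card A * indicator {\<omega>\<in>space M. S \<omega> > y} \<omega>)"
    by simp
  also have "\<dots> \<le> (LINT \<omega>|M. 384 * (\<Sum>B\<in>Pow A. indicator {\<omega>\<in>space M. (Y B \<omega>)\<^sup>2 \<ge> y / 2} \<omega>))"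
    using le by (intro integral_mono) (auto simp: emeasure_eq_measure intro!: integrable_real_indicator)
  also have "\<dots> = 384 * (\<Sum>B\<in>Pow A. prob {\<omega>\<in>space M. (Y B \<omega>)\<^sup>2 \<ge> y / 2})"
    by (simp add: emeasure_eq_measure)
  also have "\<dots> = 2 ^ card A * (384 * p)"
    unfolding eqp using A by (simp add: card_Pow)
  finally show ?thesis
    by (simp add: p_def S_def Y_def flip_def)
qed

section \<open>A maximal inequality for stable integrals\<close>

lemma Lp_fun_bounded_by:
  assumes "f \<in> borel_measurable lborel" "g \<in> Lp_fun p" "\<And>x. norm (f x) \<le> C * norm (g x)" "p \<ge> 0" "C \<ge> 0"
  shows "f \<in> Lp_fun p"
proof -
  have "integrable lborel (\<lambda>x. norm (f x) powr p)"
  proof (rule Bochner_Integration.integrable_bound)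
    show "integrable lborel (\<lambda>x. C powr p * norm (g x) powr p)"
      using assms(2) by (auto simp: Lp_fun_def)
    show "(\<lambda>x. norm (f x) powr p) \<in> borel_measurable lborel"
      using assms(1) by measurable
    show "AE x in lborel. norm (norm (f x) powr p) \<le> norm (C powr p * norm (g x) powr p)"
      using assms by (intro AE_I2) (auto simp: powr_mult[symmetric] intro!: powr_mono2)
  qed
  with assms(1) show ?thesis by (auto simp: Lp_fun_def)
qed

lemma Lp_fun_cmult: "f \<in> Lp_fun p \<Longrightarrow> p \<ge> 0 \<Longrightarrow> (\<lambda>x. c * f x) \<in> Lp_fun p"
  by (rule Lp_fun_bounded_by[of _ f p "norm c"]) (auto simp: norm_mult Lp_fun_def)

text \<open>Comparing both terms with their maximum gives the factor \<open>2 powr p\<close> for all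
  nonnegative exponents alike, so \<open>p < 1\<close> is not a separate case.\<close>

lemma powr_add_le:
  fixes a b p :: real
  assumes "a \<ge> 0" "b \<ge> 0" "p \<ge> 0"
  shows "(a + b) powr p \<le> 2 powr p * (a powr p + b powr p)"
proof -
  have "(a + b) powr p \<le> (2 * max a b) powr p"
    using assms by (intro powr_mono2) auto
  also have "\<dots> = 2 powr p * max a b powr p"
    using assms by (simp add: powr_mult)
  also have "\<dots> \<le> 2 powr p * (a powr p + b powr p)"
    by (intro mult_left_mono) (auto simp: max_def)
  finally show ?thesis .
qed

lemma Lp_fun_add:
  assumes "f \<in> Lp_fun p" "g \<in> Lp_fun p" "p \<ge> 0"
  shows "(\<lambda>x. f x + g x) \<in> Lp_fun p"
proof -
  have [measurable]: "f \<in> borel_measurable lborel" "g \<in> borel_measurable lborel"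
    using assms by (auto simp: Lp_fun_def)
  have "integrable lborel (\<lambda>x. norm (f x + g x) powr p)"
  proof (rule Bochner_Integration.integrable_bound)
    show "integrable lborel (\<lambda>x. 2 powr p * (norm (f x) powr p + norm (g x) powr p))"
      using assms by (auto simp: Lp_fun_def)
    show "AE x in lborel. norm (norm (f x + g x) powr p) \<le>
        norm (2 powr p * (norm (f x) powr p + norm (g x) powr p))"
    proof (intro AE_I2)
      fix x
      have "norm (f x + g x) powr p \<le> (norm (f x) + norm (g x)) powr p"
        using assms by (intro powr_mono2 norm_triangle_ineq) auto
      also have "\<dots> \<le> 2 powr p * (norm (f x) powr p + norm (g x) powr p)"
        using assms by (intro powr_add_le) auto
      finally show "norm (norm (f x + g x) powr p) \<le>
        norm (2 powr p * (norm (f x) powr p + norm (g x) powr p))" by simp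
    qed
  qed measurable
  thus ?thesis by (auto simp: Lp_fun_def)
qed

lemma Lp_fun_sum:
  assumes "\<And>a. a \<in> A \<Longrightarrow> f a \<in> Lp_fun p" "p \<ge> 0"
  shows "(\<lambda>x. \<Sum>a\<in>A. c a * f a x) \<in> Lp_fun p"
  using assms(1)
proof (induction A rule: infinite_finite_induct)
  case (insert a A)
  thus ?case using Lp_fun_add[OF Lp_fun_cmult[of "f a" p "c a"] insert.IH] assms(2) by simp
qed (auto simp: Lp_fun_def)

text \<open>The p-th power of the quasi-norm, kept without a root because in this form it is the
  exponent of the characteristic function.\<close>

definition power_norm :: "real \<Rightarrow> ('a::euclidean_space \<Rightarrow> complex) \<Rightarrow> real" where
  "power_norm p f = (LINT x|lborel. norm (f x) powr p)"

lemma power_norm_nonneg [simp]: "power_norm p f \<ge> 0"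
  by (simp add: power_norm_def)

lemma power_norm_cmult: "power_norm p (\<lambda>x. c * f x) = norm c powr p * power_norm p f"
  by (simp add: power_norm_def norm_mult powr_mult)

lemma power_norm_mono:
  assumes "g \<in> Lp_fun p" "\<And>x. norm (f x) \<le> C * norm (g x)" "p \<ge> 0" "C \<ge> 0"
    "f \<in> borel_measurable lborel"
  shows "power_norm p f \<le> C powr p * power_norm p g"
proof -
  have "f \<in> Lp_fun p" by (rule Lp_fun_bounded_by[of _ g p C]) (use assms in auto)
  have "power_norm p f \<le> (LINT x|lborel. C powr p * norm (g x) powr p)"
    unfolding power_norm_def
  proof (rule integral_mono)
    show "norm (f x) powr p \<le> C powr p * norm (g x) powr p" for x
      using assms by (auto simp: powr_mult[symmetric] intro!: powr_mono2)
  qed (use assms \<open>f \<in> Lp_fun p\<close> in \<open>auto simp: Lp_fun_def\<close>)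
  thus ?thesis by (simp add: power_norm_def)
qed

locale stable_integral = prob_space P for P :: "'w measure" +
  fixes \<alpha> :: real and I :: "('a::euclidean_space \<Rightarrow> complex) \<Rightarrow> 'w \<Rightarrow> complex"
  assumes alpha_pos: "0 < \<alpha>" and stable: "stable_random_integral P \<alpha> I"
begin

lemma I_measurable: "f \<in> Lp_fun \<alpha> \<Longrightarrow> I f \<in> borel_measurable P"
  using stable by (simp add: stable_random_integral_def)

lemma I_linear:
  "f \<in> Lp_fun \<alpha> \<Longrightarrow> g \<in> Lp_fun \<alpha> \<Longrightarrow> AE \<omega> in P. I (\<lambda>x. a * f x + b * g x) \<omega> = a * I f \<omega> + b * I g \<omega>"
  using stable by (simp add: stable_random_integral_def)

lemma I_char:
  "f \<in> Lp_fun \<alpha> \<Longrightarrow> (CLINT \<omega>|P. iexp (Re (I f \<omega>))) = complex_of_real (exp (- power_norm \<alpha> f))"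
  using stable by (simp add: stable_random_integral_def power_norm_def)

lemma zero_in_Lp: "(\<lambda>x. 0) \<in> Lp_fun \<alpha>"
  by (simp add: Lp_fun_def)

lemma I_cmult: "f \<in> Lp_fun \<alpha> \<Longrightarrow> AE \<omega> in P. I (\<lambda>x. a * f x) \<omega> = a * I f \<omega>"
  using I_linear[of f f a 0] by simp

lemma I_diff: "f \<in> Lp_fun \<alpha> \<Longrightarrow> g \<in> Lp_fun \<alpha> \<Longrightarrow> AE \<omega> in P. I (\<lambda>x. f x - g x) \<omega> = I f \<omega> - I g \<omega>"
  using I_linear[of f g 1 "-1"] by simp

lemma I_sum:
  assumes "finite A" "\<And>a. a \<in> A \<Longrightarrow> f a \<in> Lp_fun \<alpha>"
  shows "AE \<omega> in P. I (\<lambda>x. \<Sum>a\<in>A. c a * f a x) \<omega> = (\<Sum>a\<in>A. c a * I (f a) \<omega>)"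
  using assms
proof (induction A)
  case empty
  show ?case using I_cmult[OF zero_in_Lp, of 0] by simp
next
  case (insert a A)
  have "AE \<omega> in P. I (\<lambda>x. c a * f a x + 1 * (\<Sum>a\<in>A. c a * f a x)) \<omega> =
      c a * I (f a) \<omega> + 1 * I (\<lambda>x. \<Sum>a\<in>A. c a * f a x) \<omega>"
    using insert alpha_pos by (intro I_linear Lp_fun_sum) auto
  with insert show ?case by auto
qed

lemma I_char_scaled:
  assumes f: "f \<in> Lp_fun \<alpha>"
  shows "(CLINT \<omega>|P. iexp (u * Re (I f \<omega>))) = complex_of_real (exp (- (\<bar>u\<bar> powr \<alpha> * power_norm \<alpha> f)))"
proof -
  have uf: "(\<lambda>x. complex_of_real u * f x) \<in> Lp_fun \<alpha>"
    using f alpha_pos by (intro Lp_fun_cmult) auto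
  note [measurable] = I_measurable[OF f] I_measurable[OF uf]
  have "(CLINT \<omega>|P. iexp (u * Re (I f \<omega>))) = (CLINT \<omega>|P. iexp (Re (I (\<lambda>x. complex_of_real u * f x) \<omega>)))"
  proof (rule integral_cong_AE)
    show "AE \<omega> in P. iexp (u * Re (I f \<omega>)) = iexp (Re (I (\<lambda>x. complex_of_real u * f x) \<omega>))"
      using I_cmult[OF f, of "complex_of_real u"] by eventually_elim simp
  qed measurable
  also have "\<dots> = complex_of_real (exp (- (\<bar>u\<bar> powr \<alpha> * power_norm \<alpha> f)))"
    by (subst I_char[OF uf]) (simp add: power_norm_cmult)
  finally show ?thesis .
qed

section \<open>The tail of a single stable integral\<close>

definition unit_fun :: "'a \<Rightarrow> complex" where
  "unit_fun = indicator (cbox 0 One)"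

lemma unit_fun: "unit_fun \<in> Lp_fun \<alpha>" "power_norm \<alpha> unit_fun = 1"
proof -
  have eq: "norm (unit_fun x) powr \<alpha> = indicator (cbox 0 One) x" for x
    using alpha_pos by (auto simp: unit_fun_def indicator_def)
  have fin: "emeasure lborel (cbox 0 One :: 'a set) = 1"
    by (simp add: emeasure_lborel_cbox_eq inner_Basis)
  hence "measure lborel (cbox 0 One :: 'a set) = 1" by (simp add: measure_def)
  thus "power_norm \<alpha> unit_fun = 1" by (simp add: power_norm_def eq)
  show "unit_fun \<in> Lp_fun \<alpha>"
    unfolding Lp_fun_def mem_Collect_eq eq using fin by (auto simp: unit_fun_def)
qed

definition tail :: "real \<Rightarrow> real" where
  "tail r = prob {\<omega>\<in>space P. r < \<bar>Re (I unit_fun \<omega>)\<bar>}"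

lemma prob_abs_gt_tendsto_0:
  assumes [measurable]: "X \<in> borel_measurable P"
  shows "((\<lambda>r. prob {\<omega>\<in>space P. r < \<bar>X \<omega> :: real\<bar>}) \<longlongrightarrow> 0) at_top"
proof -
  have "((\<lambda>r. LINT \<omega>|P. indicator {\<omega>\<in>space P. r < \<bar>X \<omega> :: real\<bar>} \<omega> :: real) \<longlongrightarrow> (LINT \<omega>|P. 0)) at_top"
  proof (rule integral_dominated_convergence_at_top[where w = "\<lambda>_. 1"])
    show "AE \<omega> in P. ((\<lambda>r. indicator {\<omega>\<in>space P. r < \<bar>X \<omega>\<bar>} \<omega> :: real) \<longlongrightarrow> 0) at_top"
    proof (intro AE_I2 tendsto_eventually)
      fix \<omega> show "\<forall>\<^sub>F r in at_top. indicator {\<omega>\<in>space P. r < \<bar>X \<omega>\<bar>} \<omega> = (0::real)"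
        using eventually_gt_at_top[of "\<bar>X \<omega>\<bar>"] by eventually_elim auto
    qed
  qed (auto simp: indicator_def)
  thus ?thesis by simp
qed

lemma tail_tendsto_0: "(tail \<longlongrightarrow> 0) at_top"
  unfolding tail_def using unit_fun(1) by (intro prob_abs_gt_tendsto_0) (auto dest: I_measurable)

text \<open>The law of \<open>Re (I f)\<close> depends on \<open>f\<close> only through
  \<open>power_norm\<close>, and is that of a multiple of the variable belonging to the unit cube.
  One function \<open>tail\<close> therefore bounds all remainders.\<close>

lemma prob_I_gt_le_tail:
  assumes f: "f \<in> Lp_fun \<alpha>" and c: "c > 0" and le: "power_norm \<alpha> f \<le> c powr \<alpha>" and r: "r \<ge> 0"
  shows "prob {\<omega>\<in>space P. r < \<bar>Re (I f \<omega>)\<bar>} \<le> tail (r / c)"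
proof -
  define d where "d = power_norm \<alpha> f powr (1 / \<alpha>)"
  have d: "d \<ge> 0" "d powr \<alpha> = power_norm \<alpha> f"
    using alpha_pos by (auto simp: d_def powr_powr)
  have "d \<le> (c powr \<alpha>) powr (1 / \<alpha>)"
    unfolding d_def using le alpha_pos by (intro powr_mono2) auto
  hence dc: "d \<le> c" using alpha_pos c by (simp add: powr_powr)
  note [measurable] = I_measurable[OF f] I_measurable[OF unit_fun(1)]
  have law: "distr P borel (\<lambda>\<omega>. Re (I f \<omega>)) = distr P borel (\<lambda>\<omega>. d * Re (I unit_fun \<omega>))"
  proof (rule Levy_uniqueness)
    show "char (distr P borel (\<lambda>\<omega>. Re (I f \<omega>))) = char (distr P borel (\<lambda>\<omega>. d * Re (I unit_fun \<omega>)))"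
    proof
      fix t
      have "(CLINT \<omega>|P. iexp (t * Re (I f \<omega>))) = (CLINT \<omega>|P. iexp (t * d * Re (I unit_fun \<omega>)))"
        unfolding I_char_scaled[OF f] I_char_scaled[OF unit_fun(1)] unit_fun(2)
        using d by (simp add: abs_mult powr_mult)
      thus "char (distr P borel (\<lambda>\<omega>. Re (I f \<omega>))) t = char (distr P borel (\<lambda>\<omega>. d * Re (I unit_fun \<omega>))) t"
        by (simp add: char_def integral_distr mult.assoc)
    qed
  qed (auto intro!: real_distribution_distr)
  have "prob {\<omega>\<in>space P. r < \<bar>Re (I f \<omega>)\<bar>} = measure (distr P borel (\<lambda>\<omega>. Re (I f \<omega>))) {x. r < \<bar>x\<bar>}"
    by (subst measure_distr) (auto intro!: arg_cong[where f=prob])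
  also have "\<dots> = prob {\<omega>\<in>space P. r < \<bar>d * Re (I unit_fun \<omega>)\<bar>}"
    unfolding law by (subst measure_distr) (auto intro!: arg_cong[where f=prob])
  also have "\<dots> \<le> tail (r / c)"
    unfolding tail_def
  proof (rule finite_measure_mono)
    show "{\<omega>\<in>space P. r < \<bar>d * Re (I unit_fun \<omega>)\<bar>} \<subseteq> {\<omega>\<in>space P. r / c < \<bar>Re (I unit_fun \<omega>)\<bar>}"
    proof safe
      fix \<omega> assume "r < \<bar>d * Re (I unit_fun \<omega>)\<bar>"
      also have "\<dots> \<le> c * \<bar>Re (I unit_fun \<omega>)\<bar>"
        using d dc by (simp add: abs_mult mult_right_mono)
      finally show "r / c < \<bar>Re (I unit_fun \<omega>)\<bar>"
        using c by (simp add: divide_less_eq mult.commute)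
    qed
  qed measurable
  finally show ?thesis .
qed

section \<open>Integrals over the cells of a partition\<close>

definition cell_coord :: "('a \<Rightarrow> 'k) \<Rightarrow> ('a \<Rightarrow> complex) \<Rightarrow> 'k \<times> bool \<Rightarrow> 'w \<Rightarrow> real" where
  "cell_coord \<kappa> g = (\<lambda>(c, b) \<omega>. let z = I (\<lambda>x. if \<kappa> x = c then g x else 0) \<omega> in if b then Re z else Im z)"

text \<open>\<open>\<kappa>\<close> labels the cells, and each cell carries two coordinates, the
  real and the imaginary part of its integral. The minus sign comes from Re((a - ib) z) = a Re z + b
  Im z: a real linear form in the coordinates is the real part of an integral of \<open>g\<close>
  times a multiplier that is constant on cells.\<close>

lemma sum_cell_coord:
  assumes R: "finite R" and cells: "\<And>c. c \<in> R \<Longrightarrow> {x. \<kappa> x = c} \<in> sets borel" and g: "g \<in> Lp_fun \<alpha>"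
    and range: "\<And>x. \<kappa> x \<in> R"
  shows "AE \<omega> in P. (\<Sum>a\<in>R \<times> UNIV. u a * cell_coord \<kappa> g a \<omega>) =
      Re (I (\<lambda>x. Complex (u (\<kappa> x, True)) (- u (\<kappa> x, False)) * g x) \<omega>)"
    and "(\<lambda>x. if \<kappa> x = c then g x else 0) \<in> Lp_fun \<alpha>"
    and "(\<lambda>x. w (\<kappa> x) * g x) \<in> Lp_fun \<alpha>"
proof -
  have cell: "(\<lambda>x. if \<kappa> x = c then g x else 0) \<in> Lp_fun \<alpha>" for c
  proof (cases "c \<in> R")
    case True
    have [measurable]: "{x. \<kappa> x = c} \<in> sets borel" "g \<in> borel_measurable borel"
      using cells True g by (auto simp: Lp_fun_def)
    have "(\<lambda>x. if x \<in> {x. \<kappa> x = c} then g x else 0) \<in> borel_measurable lborel"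
      by measurable
    with alpha_pos g show ?thesis
      by - (rule Lp_fun_bounded_by[of _ g \<alpha> 1], auto)
  next
    case False
    hence "\<kappa> x \<noteq> c" for x using range by auto
    thus ?thesis by (simp add: zero_in_Lp)
  qed
  show "(\<lambda>x. if \<kappa> x = c then g x else 0) \<in> Lp_fun \<alpha>" by (rule cell)
  have eq: "(\<Sum>c\<in>R. w c * (if \<kappa> x = c then g x else 0)) = w (\<kappa> x) * g x" for w x
  proof -
    have "(\<Sum>c\<in>R. w c * (if \<kappa> x = c then g x else 0)) = (\<Sum>c\<in>R. if \<kappa> x = c then w c * g x else 0)"
      by (intro sum.cong) auto
    thus ?thesis using R range by simp
  qed
  show "(\<lambda>x. w (\<kappa> x) * g x) \<in> Lp_fun \<alpha>"
    using Lp_fun_sum[of R "\<lambda>c x. if \<kappa> x = c then g x else 0" \<alpha> w] cell alpha_pos by (simp add: eq)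
  have "AE \<omega> in P. I (\<lambda>x. \<Sum>c\<in>R. Complex (u (c, True)) (- u (c, False)) * (if \<kappa> x = c then g x else 0)) \<omega> =
      (\<Sum>c\<in>R. Complex (u (c, True)) (- u (c, False)) * I (\<lambda>x. if \<kappa> x = c then g x else 0) \<omega>)"
    using R cell by (intro I_sum) auto
  thus "AE \<omega> in P. (\<Sum>a\<in>R \<times> UNIV. u a * cell_coord \<kappa> g a \<omega>) =
      Re (I (\<lambda>x. Complex (u (\<kappa> x, True)) (- u (\<kappa> x, False)) * g x) \<omega>)"
  proof eventually_elim
    case (elim \<omega>)
    have "(\<Sum>a\<in>R \<times> UNIV. u a * cell_coord \<kappa> g a \<omega>) =
        (\<Sum>c\<in>R. \<Sum>b\<in>UNIV. u (c, b) * cell_coord \<kappa> g (c, b) \<omega>)"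
      by (simp add: sum.cartesian_product)
    also have "\<dots> = Re (\<Sum>c\<in>R. Complex (u (c, True)) (- u (c, False)) * I (\<lambda>x. if \<kappa> x = c then g x else 0) \<omega>)"
      by (simp add: UNIV_bool cell_coord_def Let_def algebra_simps)
    finally show ?case unfolding elim[symmetric] by (simp only: eq)
  qed
qed

lemma cell_coord_measurable:
  assumes "(\<lambda>x. if \<kappa> x = fst a then g x else 0) \<in> Lp_fun \<alpha>"
  shows "cell_coord \<kappa> g a \<in> borel_measurable P"
  using I_measurable[OF assms] by (cases a) (auto simp: cell_coord_def Let_def)

text \<open>A sign change replaces the multiplier on each cell by a reflection of it in the axes,
  which has the same modulus. So \<open>power_norm\<close>, and with it the characteristic function,
  stays the same. Rotational invariance is what lets real and imaginary parts change sign
  separately.\<close>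

lemma unconditional_cell_coord:
  fixes \<kappa> :: "'a \<Rightarrow> 'k"
  assumes R: "finite R" and cells: "\<And>c. c \<in> R \<Longrightarrow> {x. \<kappa> x = c} \<in> sets borel" and g: "g \<in> Lp_fun \<alpha>"
    and range: "\<And>x. \<kappa> x \<in> R"
  shows "unconditional P (R \<times> UNIV) (cell_coord \<kappa> g)"
  unfolding unconditional_def
proof (intro conjI ballI allI)
  note cell = sum_cell_coord(2)[OF R cells g range]
  show meas: "cell_coord \<kappa> g a \<in> borel_measurable P" for a
    by (intro cell_coord_measurable cell) auto
  fix u :: "'k \<times> bool \<Rightarrow> real" and B
  have char: "(CLINT \<omega>|P. iexp (\<Sum>a\<in>R \<times> UNIV. v a * cell_coord \<kappa> g a \<omega>)) =
      exp (- power_norm \<alpha> (\<lambda>x. Complex (v (\<kappa> x, True)) (- v (\<kappa> x, False)) * g x))" for v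
  proof -
    have f: "(\<lambda>x. Complex (v (\<kappa> x, True)) (- v (\<kappa> x, False)) * g x) \<in> Lp_fun \<alpha>"
      by (rule sum_cell_coord(3)[OF R cells g range])
    note [measurable] = I_measurable[OF f] meas
    have AEv: "AE \<omega> in P. (\<Sum>a\<in>R \<times> UNIV. v a * cell_coord \<kappa> g a \<omega>) =
        Re (I (\<lambda>x. Complex (v (\<kappa> x, True)) (- v (\<kappa> x, False)) * g x) \<omega>)"
      by (rule sum_cell_coord(1)[OF R cells g range])
    have "(CLINT \<omega>|P. iexp (\<Sum>a\<in>R \<times> UNIV. v a * cell_coord \<kappa> g a \<omega>)) =
      (CLINT \<omega>|P. iexp (Re (I (\<lambda>x. Complex (v (\<kappa> x, True)) (- v (\<kappa> x, False)) * g x) \<omega>)))"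
    proof (rule integral_cong_AE)
      show "AE \<omega> in P. iexp (\<Sum>a\<in>R \<times> UNIV. v a * cell_coord \<kappa> g a \<omega>) =
        iexp (Re (I (\<lambda>x. Complex (v (\<kappa> x, True)) (- v (\<kappa> x, False)) * g x) \<omega>))"
        using AEv by eventually_elim simp
    qed measurable
    also note I_char[OF f]
    finally show ?thesis .
  qed
  have flips: "cmod (Complex (u a * flip B a) (- (u b * flip B b))) = cmod (Complex (u a) (- u b))" for a b
    by (simp add: cmod_def power_mult_distrib power2_eq_square[of "flip _ _"])
  have "(CLINT \<omega>|P. iexp (\<Sum>a\<in>R \<times> UNIV. u a * (flip B a * cell_coord \<kappa> g a \<omega>))) =
    (CLINT \<omega>|P. iexp (\<Sum>a\<in>R \<times> UNIV. (u a * flip B a) * cell_coord \<kappa> g a \<omega>))"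
    by (simp add: mult.assoc)
  also have "\<dots> = (CLINT \<omega>|P. iexp (\<Sum>a\<in>R \<times> UNIV. u a * cell_coord \<kappa> g a \<omega>))"
    unfolding char power_norm_def norm_mult flips ..
  finally show "(CLINT \<omega>|P. iexp (\<Sum>a\<in>R \<times> UNIV. u a * (flip B a * cell_coord \<kappa> g a \<omega>))) =
    (CLINT \<omega>|P. iexp (\<Sum>a\<in>R \<times> UNIV. u a * cell_coord \<kappa> g a \<omega>))" .
qed

text \<open>All integrands are linear forms in the same coordinates, so the square function is one
  random variable for all \<open>k\<close>: the event that it exceeds \<open>y\<close> is counted
  once, and on the complement each \<open>k\<close> contributes its self-normalised tail. The
  multiplier \<open>Complex 1 (-1)\<close> is the form with all coefficients 1, as
  \<open>square_function_tail\<close> requires.\<close>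

lemma simple_maximal_inequality:
  assumes R: "finite R" and cells: "\<And>c. c \<in> R \<Longrightarrow> {x. \<kappa> x = c} \<in> sets borel" and g: "g \<in> Lp_fun \<alpha>"
    and range: "\<And>x. \<kappa> x \<in> R" and F: "finite F"
    and s: "\<And>k c. k \<in> F \<Longrightarrow> c \<in> R \<Longrightarrow> norm (s k c) \<le> D" and w: "\<And>k. k \<in> F \<Longrightarrow> w k > 0" and y: "y \<ge> 0"
  shows "prob {\<omega>\<in>space P. \<exists>k\<in>F. w k < \<bar>Re (I (\<lambda>x. s k (\<kappa> x) * g x) \<omega>)\<bar>} \<le>
    384 * prob {\<omega>\<in>space P. (Re (I (\<lambda>x. Complex 1 (-1) * g x) \<omega>))\<^sup>2 \<ge> y / 2} +
    (\<Sum>k\<in>F. 4 * fact (2*m) * (1 + D\<^sup>2 * y) ^ m / w k ^ (2*m))"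
proof -
  define A where "A = R \<times> (UNIV :: bool set)"
  define \<zeta> where "\<zeta> = cell_coord \<kappa> g"
  have A: "finite A" using R by (auto simp: A_def)
  have un: "unconditional P A \<zeta>"
    unfolding A_def \<zeta>_def by (rule unconditional_cell_coord[OF R cells g range])
  have [measurable]: "\<And>a. a \<in> A \<Longrightarrow> \<zeta> a \<in> borel_measurable P"
    using un by (simp add: unconditional_def)
  have sf: "(\<lambda>x. s k (\<kappa> x) * g x) \<in> Lp_fun \<alpha>" "(\<lambda>x. Complex 1 (-1) * g x) \<in> Lp_fun \<alpha>" for k
    using alpha_pos by (auto intro: sum_cell_coord(3)[OF R cells g range] Lp_fun_cmult[OF g])
  note [measurable] = sf[THEN I_measurable]
  define d where "d k = (\<lambda>(c, b). if b then Re (s k c) else - Im (s k c))" for k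
  define Y where "Y k \<omega> = (\<Sum>a\<in>A. d k a * \<zeta> a \<omega>)" for k \<omega>
  define S where "S \<omega> = (\<Sum>a\<in>A. (\<zeta> a \<omega>)\<^sup>2)" for \<omega>
  have [measurable]: "Y k \<in> borel_measurable P" "S \<in> borel_measurable P" for k
    unfolding Y_def S_def by measurable
  have AE0: "AE \<omega> in P. (\<Sum>a\<in>A. u a * \<zeta> a \<omega>) = Re (I (\<lambda>x. Complex (u (\<kappa> x, True)) (- u (\<kappa> x, False)) * g x) \<omega>)" for u
    unfolding A_def \<zeta>_def by (rule sum_cell_coord(1)[OF R cells g range])
  have AEY: "AE \<omega> in P. \<forall>k\<in>F. Y k \<omega> = Re (I (\<lambda>x. s k (\<kappa> x) * g x) \<omega>)"
  proof -
    have "AE \<omega> in P. Y k \<omega> = Re (I (\<lambda>x. s k (\<kappa> x) * g x) \<omega>)" for k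
    proof -
      have "Complex (d k (\<kappa> x, True)) (- d k (\<kappa> x, False)) = s k (\<kappa> x)" for x
        by (simp add: d_def)
      thus ?thesis
        using AE0[of "d k"] by (simp add: Y_def)
    qed
    thus ?thesis using F by (simp add: AE_finite_all)
  qed
  have AE1: "AE \<omega> in P. (\<Sum>a\<in>A. \<zeta> a \<omega>) = Re (I (\<lambda>x. Complex 1 (-1) * g x) \<omega>)"
    using AE0[of "\<lambda>_. 1"] by simp
  have d: "\<bar>d k a\<bar> \<le> D" if "k \<in> F" "a \<in> A" for k a
    using s[OF that(1), of "fst a"] that(2) abs_Re_le_cmod[of "s k (fst a)"] abs_Im_le_cmod[of "s k (fst a)"]
    by (auto simp: d_def A_def split: prod.splits)
  have ev: "{\<omega>\<in>space P. S \<omega> > y} \<in> sets P" "(\<Union>k\<in>F. {\<omega>\<in>space P. \<bar>Y k \<omega>\<bar> > w k \<and> S \<omega> \<le> y}) \<in> sets P"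
    using F by (auto intro!: sets.finite_UN)
  have "prob {\<omega>\<in>space P. \<exists>k\<in>F. w k < \<bar>Re (I (\<lambda>x. s k (\<kappa> x) * g x) \<omega>)\<bar>} =
      prob {\<omega>\<in>space P. \<exists>k\<in>F. w k < \<bar>Y k \<omega>\<bar>}"
    using AEY F by (intro finite_measure_eq_AE) auto
  also have "\<dots> \<le> prob ({\<omega>\<in>space P. S \<omega> > y} \<union> (\<Union>k\<in>F. {\<omega>\<in>space P. \<bar>Y k \<omega>\<bar> > w k \<and> S \<omega> \<le> y}))"
    using F ev by (intro finite_measure_mono) auto
  also have "\<dots> \<le> prob {\<omega>\<in>space P. S \<omega> > y} + prob (\<Union>k\<in>F. {\<omega>\<in>space P. \<bar>Y k \<omega>\<bar> > w k \<and> S \<omega> \<le> y})"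
    using ev by (intro measure_Un_le) auto
  also have "prob (\<Union>k\<in>F. {\<omega>\<in>space P. \<bar>Y k \<omega>\<bar> > w k \<and> S \<omega> \<le> y}) \<le>
      (\<Sum>k\<in>F. prob {\<omega>\<in>space P. \<bar>Y k \<omega>\<bar> > w k \<and> S \<omega> \<le> y})"
    using F by (intro measure_UNION_le) auto
  also have "\<dots> \<le> (\<Sum>k\<in>F. 4 * fact (2*m) * (1 + D\<^sup>2 * y) ^ m / w k ^ (2*m))"
    unfolding Y_def S_def by (intro sum_mono self_normalized_tail[OF A un d _ y] w) auto
  also have "prob {\<omega>\<in>space P. S \<omega> > y} \<le> 384 * prob {\<omega>\<in>space P. (\<Sum>a\<in>A. \<zeta> a \<omega>)\<^sup>2 \<ge> y / 2}"
    unfolding S_def by (rule square_function_tail[OF A un])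
  also have "prob {\<omega>\<in>space P. (\<Sum>a\<in>A. \<zeta> a \<omega>)\<^sup>2 \<ge> y / 2} =
      prob {\<omega>\<in>space P. (Re (I (\<lambda>x. Complex 1 (-1) * g x) \<omega>))\<^sup>2 \<ge> y / 2}"
    using AE1 by (intro finite_measure_eq_AE) auto
  finally show ?thesis by simp
qed

lemma simple_maximal_inequality':
  assumes g: "g \<in> Lp_fun \<alpha>" and F: "finite F" and q: "\<And>k. k \<in> F \<Longrightarrow> q k \<in> borel_measurable borel"
    and Q: "finite Q" "\<And>k x. k \<in> F \<Longrightarrow> q k x \<in> Q" "\<And>z. z \<in> Q \<Longrightarrow> norm z \<le> D"
    and w: "\<And>k. k \<in> F \<Longrightarrow> w k > 0" and y: "y \<ge> 0"
  shows "prob {\<omega>\<in>space P. \<exists>k\<in>F. w k < \<bar>Re (I (\<lambda>x. q k x * g x) \<omega>)\<bar>} \<le>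
    384 * prob {\<omega>\<in>space P. (Re (I (\<lambda>x. Complex 1 (-1) * g x) \<omega>))\<^sup>2 \<ge> y / 2} +
    (\<Sum>k\<in>F. 4 * fact (2*m) * (1 + D\<^sup>2 * y) ^ m / w k ^ (2*m))"
proof -
  \<comment> \<open>The label of a point is the whole tuple of values there, so every
    \<open>q k\<close> is constant on cells; finiteness of \<open>Q\<close> and \<open>F\<close>
    leaves finitely many cells.\<close>
  define \<kappa> where "\<kappa> x = restrict (\<lambda>k. q k x) F" for x
  define R where "R = PiE F (\<lambda>_. Q)"
  have cells: "{x. \<kappa> x = c} \<in> sets borel" if "c \<in> R" for c
  proof -
    have "{x. \<kappa> x = c} = (if F = {} then UNIV else (\<Inter>k\<in>F. q k -` {c k} \<inter> space borel))"
      using that by (auto simp: \<kappa>_def R_def fun_eq_iff PiE_iff extensional_def)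
    also have "\<dots> \<in> sets borel"
      using F q by (auto intro!: sets.finite_INT measurable_sets[of _ borel borel, simplified])
    finally show ?thesis .
  qed
  have "prob {\<omega>\<in>space P. \<exists>k\<in>F. w k < \<bar>Re (I (\<lambda>x. \<kappa> x k * g x) \<omega>)\<bar>} \<le>
    384 * prob {\<omega>\<in>space P. (Re (I (\<lambda>x. Complex 1 (-1) * g x) \<omega>))\<^sup>2 \<ge> y / 2} +
    (\<Sum>k\<in>F. 4 * fact (2*m) * (1 + D\<^sup>2 * y) ^ m / w k ^ (2*m))"
  proof (rule simple_maximal_inequality[where R = R])
    show "finite R" using F Q by (auto simp: R_def intro!: finite_PiE)
    show "\<kappa> x \<in> R" for x using Q by (auto simp: \<kappa>_def R_def)
    show "norm (c k) \<le> D" if "k \<in> F" "c \<in> R" for k c using that Q by (auto simp: R_def)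
  qed (use cells g F w y in auto)
  also have "{\<omega>\<in>space P. \<exists>k\<in>F. w k < \<bar>Re (I (\<lambda>x. \<kappa> x k * g x) \<omega>)\<bar>} =
      {\<omega>\<in>space P. \<exists>k\<in>F. w k < \<bar>Re (I (\<lambda>x. q k x * g x) \<omega>)\<bar>}"
    by (auto simp: \<kappa>_def)
  finally show ?thesis .
qed

end

section \<open>Rounding to a finite grid\<close>

definition grid_round :: "nat \<Rightarrow> complex \<Rightarrow> complex" where
  "grid_round n z = Complex (\<lfloor>real (Suc n) * Re z\<rfloor> / real (Suc n)) (\<lfloor>real (Suc n) * Im z\<rfloor> / real (Suc n))"

lemma grid_round_error: "norm (z - grid_round n z) \<le> 2 / real (Suc n)"
proof -
  have *: "\<bar>t - \<lfloor>real (Suc n) * t\<rfloor> / real (Suc n)\<bar> \<le> 1 / real (Suc n)" for t :: real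
  proof -
    have "\<bar>real (Suc n) * t - \<lfloor>real (Suc n) * t\<rfloor>\<bar> \<le> 1" by linarith
    hence "\<bar>real (Suc n) * t - \<lfloor>real (Suc n) * t\<rfloor>\<bar> / real (Suc n) \<le> 1 / real (Suc n)"
      by (intro divide_right_mono) auto
    also have "\<bar>real (Suc n) * t - \<lfloor>real (Suc n) * t\<rfloor>\<bar> / real (Suc n) =
        \<bar>(real (Suc n) * t - \<lfloor>real (Suc n) * t\<rfloor>) / real (Suc n)\<bar>"
      by (simp del: of_nat_Suc)
    also have "(real (Suc n) * t - \<lfloor>real (Suc n) * t\<rfloor>) / real (Suc n) = t - \<lfloor>real (Suc n) * t\<rfloor> / real (Suc n)"
      by (simp add: diff_divide_distrib del: of_nat_Suc)
    finally show ?thesis .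
  qed
  have "norm (z - grid_round n z) \<le> \<bar>Re (z - grid_round n z)\<bar> + \<bar>Im (z - grid_round n z)\<bar>"
    by (rule cmod_le)
  also have "\<dots> \<le> 1 / real (Suc n) + 1 / real (Suc n)"
    using *[of "Re z"] *[of "Im z"] by (intro add_mono) (auto simp: grid_round_def)
  finally show ?thesis by simp
qed

lemma grid_round_measurable [measurable]: "grid_round n \<in> borel_measurable borel"
  unfolding borel_measurable_complex_iff grid_round_def by auto

lemma finite_grid_round: "finite (grid_round n ` cball 0 1)"
proof (rule finite_subset)
  let ?J = "{- int (Suc n)..int (Suc n)}"
  show "grid_round n ` cball 0 1 \<subseteq> (\<lambda>(a, b). Complex (a / real (Suc n)) (b / real (Suc n))) ` (?J \<times> ?J)"
  proof safe
    fix z :: complex assume z: "z \<in> cball 0 1"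
    have *: "\<lfloor>real (Suc n) * t\<rfloor> \<in> ?J" if "\<bar>t\<bar> \<le> 1" for t
    proof -
      have "\<bar>real (Suc n) * t\<bar> \<le> real (Suc n)" using that by (simp add: abs_mult mult_left_le)
      thus ?thesis by (auto simp: le_floor_iff floor_le_iff)
    qed
    show "grid_round n z \<in> (\<lambda>(a, b). Complex (a / real (Suc n)) (b / real (Suc n))) ` (?J \<times> ?J)"
      using *[of "Re z"] *[of "Im z"] z abs_Re_le_cmod[of z] abs_Im_le_cmod[of z]
      unfolding grid_round_def
      by (intro image_eqI[of _ _ "(\<lfloor>real (Suc n) * Re z\<rfloor>, \<lfloor>real (Suc n) * Im z\<rfloor>)"]) auto
  qed
qed auto

context stable_integral
begin

text \<open>The quotients \<open>f k / g\<close> lie in the unit disc; rounded to a grid they become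
  simple multipliers. Half of the threshold \<open>2 * w k\<close> goes to the simple part and half
  to the rounding error, whose tail vanishes as the grid is refined. Rounded quotients have modulus
  at most 3, whence 9 = 3^2.\<close>

lemma finite_maximal_inequality:
  assumes g: "g \<in> Lp_fun \<alpha>" and F: "finite F" and f: "\<And>k. k \<in> F \<Longrightarrow> f k \<in> borel_measurable borel"
    and fg: "\<And>k x. k \<in> F \<Longrightarrow> norm (f k x) \<le> norm (g x)"
    and w: "\<And>k. k \<in> F \<Longrightarrow> w k > 0" and y: "y \<ge> 0"
  shows "prob {\<omega>\<in>space P. \<exists>k\<in>F. 2 * w k < \<bar>Re (I (f k) \<omega>)\<bar>} \<le>
    384 * prob {\<omega>\<in>space P. (Re (I (\<lambda>x. Complex 1 (-1) * g x) \<omega>))\<^sup>2 \<ge> y / 2} +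
    (\<Sum>k\<in>F. 4 * fact (2*m) * (1 + 9 * y) ^ m / w k ^ (2*m))" (is "_ \<le> ?B")
proof -
  \<comment> \<open>Where \<open>g\<close> vanishes so does \<open>f k\<close>, and the quotient
    takes the default value 0.\<close>
  define q where "q n k x = grid_round n (f k x / g x)" for n k x
  have [measurable]: "g \<in> borel_measurable borel" "\<And>k. k \<in> F \<Longrightarrow> f k \<in> borel_measurable borel"
    using g f by (auto simp: Lp_fun_def)
  have qm[measurable]: "q n k \<in> borel_measurable borel" if "k \<in> F" for n k
    using that unfolding q_def by measurable
  have fLp: "f k \<in> Lp_fun \<alpha>" if "k \<in> F" for k
    by (rule Lp_fun_bounded_by[OF _ g, of _ 1]) (use that f fg alpha_pos in auto)
  have ball: "f k x / g x \<in> cball 0 1" if "k \<in> F" for k x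
    using fg[OF that, of x] by (simp add: norm_divide divide_le_eq_1)
  have dist: "norm (f k x - q n k x * g x) \<le> 2 / real (Suc n) * norm (g x)" if "k \<in> F" for n k x
  proof (cases "g x = 0")
    case True
    thus ?thesis using fg[OF that, of x] by simp
  next
    case False
    hence "f k x - q n k x * g x = (f k x / g x - q n k x) * g x" by (simp add: field_simps)
    hence "norm (f k x - q n k x * g x) = norm (f k x / g x - q n k x) * norm (g x)"
      by (simp only: norm_mult)
    also have "\<dots> \<le> 2 / real (Suc n) * norm (g x)"
      unfolding q_def by (intro mult_right_mono grid_round_error) auto
    finally show ?thesis .
  qed
  have qn: "norm (q n k x) \<le> 3" if "k \<in> F" for n k x
  proof -
    have "norm (q n k x) \<le> norm (f k x / g x) + norm (f k x / g x - q n k x)"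
      using norm_triangle_ineq4[of "f k x / g x" "f k x / g x - q n k x"] by simp
    also have "\<dots> \<le> 1 + 2 / real (Suc n)"
      using grid_round_error[of "f k x / g x" n] ball[OF that, of x] by (intro add_mono) (auto simp: q_def)
    also have "\<dots> \<le> 3" by (simp add: divide_le_eq)
    finally show ?thesis .
  qed
  have qLp: "(\<lambda>x. q n k x * g x) \<in> Lp_fun \<alpha>" if "k \<in> F" for n k
    by (rule Lp_fun_bounded_by[OF _ g, of _ 3])
       (use that qn alpha_pos in \<open>auto simp: norm_mult intro!: mult_right_mono\<close>)
  have dLp: "(\<lambda>x. f k x - q n k x * g x) \<in> Lp_fun \<alpha>" if "k \<in> F" for n k
    by (rule Lp_fun_bounded_by[OF _ g, of _ "2 / real (Suc n)"]) (use that dist alpha_pos in auto)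
  note meas[measurable] = fLp[THEN I_measurable] qLp[THEN I_measurable] dLp[THEN I_measurable]
  \<comment> \<open>The scale of the rounding error in the quasi-norm; the summand 1 keeps it
    positive when \<open>g\<close> is zero almost everywhere.\<close>
  define c where "c n = 2 / real (Suc n) * (power_norm \<alpha> g + 1) powr (1 / \<alpha>)" for n
  have p1: "power_norm \<alpha> g + 1 > 0" by (simp add: add_nonneg_pos)
  hence c0: "c n > 0" for n by (simp add: c_def)
  have step: "prob {\<omega>\<in>space P. \<exists>k\<in>F. 2 * w k < \<bar>Re (I (f k) \<omega>)\<bar>} \<le> ?B + (\<Sum>k\<in>F. tail (w k / c n))" for n
  proof -
    have ca: "(2 / real (Suc n)) powr \<alpha> * power_norm \<alpha> g \<le> c n powr \<alpha>"
      unfolding c_def using alpha_pos by (subst powr_mult) (auto simp: powr_powr add_nonneg_pos intro!: mult_left_mono)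
    define E1 where "E1 = {\<omega>\<in>space P. \<exists>k\<in>F. w k < \<bar>Re (I (\<lambda>x. q n k x * g x) \<omega>)\<bar>}"
    define E2 where "E2 k = {\<omega>\<in>space P. w k < \<bar>Re (I (\<lambda>x. f k x - q n k x * g x) \<omega>)\<bar>}" for k
    have [measurable]: "E1 \<in> sets P" "\<And>k. k \<in> F \<Longrightarrow> E2 k \<in> sets P"
      unfolding E1_def E2_def using F by measurable
    hence E2U [measurable]: "(\<Union>k\<in>F. E2 k) \<in> sets P"
      using F by (intro sets.finite_UN) auto
    have "AE \<omega> in P. \<forall>k\<in>F. I (\<lambda>x. f k x - q n k x * g x) \<omega> = I (f k) \<omega> - I (\<lambda>x. q n k x * g x) \<omega>"
      using F fLp qLp by (simp add: AE_finite_all I_diff)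
    hence "prob {\<omega>\<in>space P. \<exists>k\<in>F. 2 * w k < \<bar>Re (I (f k) \<omega>)\<bar>} \<le> prob (E1 \<union> (\<Union>k\<in>F. E2 k))"
    proof (intro finite_measure_mono_AE)
      assume "AE \<omega> in P. \<forall>k\<in>F. I (\<lambda>x. f k x - q n k x * g x) \<omega> = I (f k) \<omega> - I (\<lambda>x. q n k x * g x) \<omega>"
      thus "AE \<omega> in P. \<omega> \<in> {\<omega>\<in>space P. \<exists>k\<in>F. 2 * w k < \<bar>Re (I (f k) \<omega>)\<bar>} \<longrightarrow> \<omega> \<in> E1 \<union> (\<Union>k\<in>F. E2 k)"
      proof eventually_elim
        case (elim \<omega>)
        show ?case
        proof
          assume "\<omega> \<in> {\<omega>\<in>space P. \<exists>k\<in>F. 2 * w k < \<bar>Re (I (f k) \<omega>)\<bar>}"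
          then obtain k where k: "k \<in> F" "\<omega> \<in> space P" "2 * w k < \<bar>Re (I (f k) \<omega>)\<bar>" by auto
          have "Re (I (\<lambda>x. f k x - q n k x * g x) \<omega>) = Re (I (f k) \<omega>) - Re (I (\<lambda>x. q n k x * g x) \<omega>)"
            using elim k(1) by simp
          with k(3) have "w k < \<bar>Re (I (\<lambda>x. q n k x * g x) \<omega>)\<bar> \<or> w k < \<bar>Re (I (\<lambda>x. f k x - q n k x * g x) \<omega>)\<bar>"
            by linarith
          thus "\<omega> \<in> E1 \<union> (\<Union>k\<in>F. E2 k)"
            using k by (auto simp: E1_def E2_def)
        qed
      qed
    qed measurable
    also have "\<dots> \<le> prob E1 + prob (\<Union>k\<in>F. E2 k)"
      using F by (intro measure_Un_le) auto
    also have "prob E1 \<le> 384 * prob {\<omega>\<in>space P. (Re (I (\<lambda>x. Complex 1 (-1) * g x) \<omega>))\<^sup>2 \<ge> y / 2} +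
        (\<Sum>k\<in>F. 4 * fact (2*m) * (1 + 3\<^sup>2 * y) ^ m / w k ^ (2*m))"
      unfolding E1_def
    proof (rule simple_maximal_inequality'[OF g F qm finite_grid_round[of n] _ _ w y])
      show "q n k x \<in> grid_round n ` cball 0 1" if "k \<in> F" for k x
        unfolding q_def using ball[OF that] by blast
      fix z assume "z \<in> grid_round n ` cball 0 1"
      then obtain v where v: "z = grid_round n v" "norm v \<le> 1" by auto
      have "norm z \<le> norm v + norm (v - z)"
        using norm_triangle_ineq4[of v "v - z"] by simp
      also have "\<dots> \<le> 1 + 2 / real (Suc n)"
        using v grid_round_error[of v n] by (intro add_mono) auto
      also have "\<dots> \<le> 3" by (simp add: divide_le_eq)
      finally show "norm z \<le> 3" .
    qed
    also have "prob (\<Union>k\<in>F. E2 k) \<le> (\<Sum>k\<in>F. prob (E2 k))"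
      using F by (intro measure_UNION_le) auto
    also have "\<dots> \<le> (\<Sum>k\<in>F. tail (w k / c n))"
    proof (rule sum_mono)
      fix k assume k: "k \<in> F"
      have "power_norm \<alpha> (\<lambda>x. f k x - q n k x * g x) \<le> (2 / real (Suc n)) powr \<alpha> * power_norm \<alpha> g"
        by (rule power_norm_mono[OF g]) (use k dist alpha_pos in auto)
      also note ca
      finally show "prob (E2 k) \<le> tail (w k / c n)"
        unfolding E2_def using k w[OF k] c0 dLp by (intro prob_I_gt_le_tail) auto
    qed
    finally show ?thesis by simp
  qed
  have clim: "c \<longlonglongrightarrow> 0"
  proof -
    have "(\<lambda>n. 2 * (power_norm \<alpha> g + 1) powr (1 / \<alpha>) * inverse (real (Suc n))) \<longlonglongrightarrow> 2 * (power_norm \<alpha> g + 1) powr (1 / \<alpha>) * 0"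
      by (intro tendsto_intros LIMSEQ_inverse_real_of_nat)
    thus ?thesis by (simp add: c_def[abs_def] divide_inverse mult_ac)
  qed
  have "(\<lambda>n. tail (w k / c n)) \<longlonglongrightarrow> 0" if "k \<in> F" for k
  proof (rule filterlim_compose[OF tail_tendsto_0])
    have "filterlim c (at_right 0) sequentially"
      using clim c0 by (auto simp: filterlim_at intro!: always_eventually less_imp_neq[symmetric])
    thus "filterlim (\<lambda>n. w k / c n) at_top sequentially"
      using w[OF that] by (auto simp: divide_inverse intro!: filterlim_tendsto_pos_mult_at_top[of _ "w k"]
          filterlim_compose[OF filterlim_inverse_at_top_right])
  qed
  hence "(\<lambda>n. ?B + (\<Sum>k\<in>F. tail (w k / c n))) \<longlonglongrightarrow> ?B + (\<Sum>k\<in>F. 0)"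
    by (intro tendsto_intros) auto
  thus ?thesis
    using step by (intro LIMSEQ_le_const[of _ ?B]) auto
qed

text \<open>The order of the limits matters: first \<open>y\<close> is fixed so that the square
  function exceeds it with small probability, then the threshold \<open>x\<close> grows and kills
  the sum over the indices, which carries \<open>x ^ (2*m)\<close> in its denominator.\<close>

lemma stable_maximal_bound_Re:
  fixes f :: "'k::countable \<Rightarrow> 'a \<Rightarrow> complex"
  assumes g: "g \<in> Lp_fun \<alpha>" and f: "\<And>k. f k \<in> borel_measurable borel"
    and fg: "\<And>k x. norm (f k x) \<le> norm (g x)" and w: "\<And>k. w k > 0"
    and W: "\<And>F. finite F \<Longrightarrow> (\<Sum>k\<in>F. 1 / w k ^ (2*m)) \<le> W" and m: "m > 0"
  shows "AE \<omega> in P. \<exists>C. \<forall>k. \<bar>Re (I (f k) \<omega>)\<bar> \<le> C * w k"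
proof -
  define T where "T y = prob {\<omega>\<in>space P. (Re (I (\<lambda>x. Complex 1 (-1) * g x) \<omega>))\<^sup>2 \<ge> y / 2}" for y
  have fLp: "f k \<in> Lp_fun \<alpha>" for k
    by (rule Lp_fun_bounded_by[OF _ g, of _ 1]) (use f fg alpha_pos in auto)
  note [measurable] = fLp[THEN I_measurable]
  define E where "E x = {\<omega>\<in>space P. \<exists>k. 2 * (x * w k) < \<bar>Re (I (f k) \<omega>)\<bar>}" for x
  have [measurable]: "E x \<in> sets P" for x unfolding E_def by measurable
  have bound: "prob (E x) \<le> 384 * T y + 4 * fact (2*m) * (1 + 9 * y) ^ m * W / x ^ (2*m)" (is "_ \<le> ?B")
    if x: "x > 0" and y: "y \<ge> 0" for x y
  proof -
    \<comment> \<open>Finite stages in an enumeration of the indices; continuity of the measure from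
      below gives the union over all of them.\<close>
    define E' where "E' n = {\<omega>\<in>space P. \<exists>k\<in>{k. to_nat k < n}. 2 * (x * w k) < \<bar>Re (I (f k) \<omega>)\<bar>}" for n
    have fin: "finite {k::'k. to_nat k < n}" for n
      by (rule finite_imageD[of to_nat]) (auto intro: finite_subset[of _ "{..<n}"])
    have E'm: "E' n \<in> sets P" for n
      unfolding E'_def by measurable
    have le: "prob (E' n) \<le> ?B" for n
    proof -
      have "prob (E' n) \<le> 384 * T y + (\<Sum>k\<in>{k. to_nat k < n}. 4 * fact (2*m) * (1 + 9 * y) ^ m / (x * w k) ^ (2*m))"
        unfolding E'_def T_def by (rule finite_maximal_inequality[OF g fin f fg _ y]) (use w x in auto)
      also have "(\<Sum>k\<in>{k. to_nat k < n}. 4 * fact (2*m) * (1 + 9 * y) ^ m / (x * w k) ^ (2*m)) =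
          4 * fact (2*m) * (1 + 9 * y) ^ m / x ^ (2*m) * (\<Sum>k\<in>{k. to_nat k < n}. 1 / w k ^ (2*m))"
        by (simp add: sum_distrib_left power_mult_distrib)
      also have "\<dots> \<le> 4 * fact (2*m) * (1 + 9 * y) ^ m / x ^ (2*m) * W"
        using x y by (intro mult_left_mono W fin) auto
      finally show ?thesis by simp
    qed
    have "(\<Union>n. E' n) = E x"
    proof safe
      fix \<omega> assume "\<omega> \<in> E x"
      then obtain k where "\<omega> \<in> space P" "2 * (x * w k) < \<bar>Re (I (f k) \<omega>)\<bar>" by (auto simp: E_def)
      hence "\<omega> \<in> E' (Suc (to_nat k))" by (auto simp: E'_def)
      thus "\<omega> \<in> (\<Union>n. E' n)" by blast
    qed (auto simp: E_def E'_def)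
    moreover have "incseq E'"
      by (auto simp: incseq_def E'_def intro: less_le_trans)
    ultimately have "(\<lambda>n. prob (E' n)) \<longlonglongrightarrow> prob (E x)"
      using finite_Lim_measure_incseq[of E'] E'm by auto
    thus ?thesis using le by (intro LIMSEQ_le_const2) auto
  qed
  have gm: "(\<lambda>x. Complex 1 (-1) * g x) \<in> Lp_fun \<alpha>" using g alpha_pos by (intro Lp_fun_cmult) auto
  note [measurable] = I_measurable[OF gm]
  have Tlim: "(T \<longlongrightarrow> 0) at_top"
  proof -
    define X where "X \<omega> = (Re (I (\<lambda>x. Complex 1 (-1) * g x) \<omega>))\<^sup>2" for \<omega>
    have [measurable]: "X \<in> borel_measurable P" unfolding X_def by measurable
    \<comment> \<open>\<open>prob_abs_gt_tendsto_0\<close> has a strict inequality and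
      \<open>T\<close> a weak one; a quarter instead of a half bridges the difference for positive
      \<open>y\<close>.\<close>
    have lim: "((\<lambda>y. prob {\<omega>\<in>space P. y / 4 < \<bar>X \<omega>\<bar>}) \<longlongrightarrow> 0) at_top"
    proof (rule filterlim_compose[OF prob_abs_gt_tendsto_0[of X]])
      have "filterlim (\<lambda>y::real. (1/4) * y) at_top at_top"
        by (rule filterlim_tendsto_pos_mult_at_top[OF tendsto_const _ filterlim_ident]) simp
      thus "filterlim (\<lambda>y::real. y / 4) at_top at_top" by simp
    qed measurable
    have le: "\<forall>\<^sub>F y in at_top. T y \<le> prob {\<omega>\<in>space P. y / 4 < \<bar>X \<omega>\<bar>}"
      using eventually_gt_at_top[of 0]
    proof eventually_elim
      case (elim y)
      show ?case unfolding T_def X_def[symmetric] using elim by (intro finite_measure_mono) auto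
    qed
    have "\<forall>\<^sub>F y in at_top. 0 \<le> T y"
      by (simp add: T_def)
    from tendsto_sandwich[OF this le tendsto_const lim] show ?thesis .
  qed
  \<comment> \<open>The intersection is the event that no multiple of \<open>w\<close> bounds the
    real parts of the integrals.\<close>
  have small: "prob (\<Inter>n. E (real (Suc n))) \<le> \<epsilon>" if \<epsilon>: "\<epsilon> > 0" for \<epsilon>
  proof -
    have "\<forall>\<^sub>F y in at_top. T y < \<epsilon> / 768 \<and> y \<ge> 0"
      using order_tendstoD(2)[OF Tlim, of "\<epsilon> / 768"] \<epsilon>
      by (intro eventually_conj eventually_ge_at_top) auto
    then obtain y where y: "T y < \<epsilon> / 768" "y \<ge> 0"
      using eventually_happens'[OF trivial_limit_at_top_linorder] by blast
    have "(\<lambda>n. 384 * T y + 4 * fact (2*m) * (1 + 9 * y) ^ m * W * inverse (real (Suc n)) ^ (2*m)) \<longlonglongrightarrow>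
        384 * T y + 4 * fact (2*m) * (1 + 9 * y) ^ m * W * 0 ^ (2*m)"
      by (intro tendsto_intros LIMSEQ_inverse_real_of_nat)
    moreover have "384 * T y + 4 * fact (2*m) * (1 + 9 * y) ^ m * W * 0 ^ (2*m) < \<epsilon>"
      using y m \<epsilon> by (simp add: power_0_left)
    ultimately have "\<forall>\<^sub>F n in sequentially. 384 * T y + 4 * fact (2*m) * (1 + 9 * y) ^ m * W * inverse (real (Suc n)) ^ (2*m) < \<epsilon>"
      by (rule order_tendstoD)
    then obtain n where n: "384 * T y + 4 * fact (2*m) * (1 + 9 * y) ^ m * W * inverse (real (Suc n)) ^ (2*m) < \<epsilon>"
      using eventually_happens'[OF sequentially_bot] by blast
    have "prob (\<Inter>n. E (real (Suc n))) \<le> prob (E (real (Suc n)))"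
      by (intro finite_measure_mono) auto
    also have "\<dots> \<le> 384 * T y + 4 * fact (2*m) * (1 + 9 * y) ^ m * W / real (Suc n) ^ (2*m)"
      using y by (intro bound) auto
    also have "\<dots> < \<epsilon>" using n by (simp add: divide_inverse power_inverse)
    finally show ?thesis by simp
  qed
  have "prob (\<Inter>n. E (real (Suc n))) \<le> 0"
  proof (rule field_le_epsilon)
    fix \<epsilon> :: real assume "\<epsilon> > 0"
    from small[OF this] show "prob (\<Inter>n. E (real (Suc n))) \<le> 0 + \<epsilon>" by simp
  qed
  hence "prob (\<Inter>n. E (real (Suc n))) = 0"
    by (simp only: measure_le_0_iff)
  hence "AE \<omega> in P. \<omega> \<notin> (\<Inter>n. E (real (Suc n)))"
    by (intro AE_not_in) (auto simp: null_sets_def emeasure_eq_measure)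
  thus ?thesis
  proof (rule AE_mp, intro AE_I2 impI)
    fix \<omega> assume "\<omega> \<in> space P" "\<omega> \<notin> (\<Inter>n. E (real (Suc n)))"
    then obtain n where "\<And>k. \<bar>Re (I (f k) \<omega>)\<bar> \<le> 2 * (real (Suc n) * w k)"
      by (auto simp: E_def not_less)
    thus "\<exists>C. \<forall>k. \<bar>Re (I (f k) \<omega>)\<bar> \<le> C * w k"
      by (intro exI[of _ "2 * real (Suc n)"] allI) (simp only: mult.assoc)
  qed
qed

theorem stable_maximal_bound:
  fixes f :: "'k::countable \<Rightarrow> 'a \<Rightarrow> complex"
  assumes g: "g \<in> Lp_fun \<alpha>" and f: "\<And>k. f k \<in> borel_measurable borel"
    and fg: "\<And>k x. norm (f k x) \<le> norm (g x)" and w: "\<And>k. w k > 0"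
    and W: "\<And>F. finite F \<Longrightarrow> (\<Sum>k\<in>F. 1 / w k ^ (2*m)) \<le> W" and m: "m > 0"
  shows "AE \<omega> in P. \<exists>C. \<forall>k. norm (I (f k) \<omega>) \<le> C * w k"
proof -
  have fLp: "f k \<in> Lp_fun \<alpha>" for k
    by (rule Lp_fun_bounded_by[OF _ g, of _ 1]) (use f fg alpha_pos in auto)
  have 1: "AE \<omega> in P. \<exists>C. \<forall>k. \<bar>Re (I (f k) \<omega>)\<bar> \<le> C * w k"
    by (rule stable_maximal_bound_Re[OF g f fg w W m])
  \<comment> \<open>Since Im z = Re(-iz), the imaginary part is the real part of the integral of
    another function with the same modulus.\<close>
  have 2: "AE \<omega> in P. \<exists>C. \<forall>k. \<bar>Re (I (\<lambda>x. -\<i> * f k x) \<omega>)\<bar> \<le> C * w k"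
    by (rule stable_maximal_bound_Re[OF g _ _ w W m]) (use f fg in \<open>auto simp: norm_mult\<close>)
  have 3: "AE \<omega> in P. \<forall>k. I (\<lambda>x. -\<i> * f k x) \<omega> = -\<i> * I (f k) \<omega>"
    unfolding AE_all_countable using fLp I_cmult by blast
  show ?thesis using 1 2 3
  proof eventually_elim
    case (elim \<omega>)
    then obtain C C' where C: "\<And>k. \<bar>Re (I (f k) \<omega>)\<bar> \<le> C * w k" "\<And>k. \<bar>Im (I (f k) \<omega>)\<bar> \<le> C' * w k"
      by auto
    show ?case
    proof (intro exI[of _ "C + C'"] allI)
      fix k
      have "norm (I (f k) \<omega>) \<le> \<bar>Re (I (f k) \<omega>)\<bar> + \<bar>Im (I (f k) \<omega>)\<bar>" by (rule cmod_le)
      also have "\<dots> \<le> C * w k + C' * w k" by (intro add_mono C)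
      finally show "norm (I (f k) \<omega>) \<le> (C + C') * w k" by (simp add: algebra_simps)
    qed
  qed
qed

end

section \<open>Fourier integrals of twice differentiable functions\<close>

definition fint :: "(real \<Rightarrow> complex) \<Rightarrow> real \<Rightarrow> complex" where
  "fint f x = (CLINT s|lborel. iexp (x * s) * f s)"

lemma integrable_iexp_mult:
  assumes "integrable lborel f" "g \<in> borel_measurable borel"
  shows "integrable lborel (\<lambda>s. iexp (g s) * f s)"
proof (rule Bochner_Integration.integrable_bound[OF assms(1)])
  note [measurable] = assms(2) borel_measurable_integrable[OF assms(1)]
  show "(\<lambda>s. iexp (g s) * f s) \<in> borel_measurable lborel" by measurable
qed (auto simp: norm_mult)

lemma norm_fint_le: "norm (fint f x) \<le> (LINT s|lborel. norm (f s))"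
  unfolding fint_def using integral_norm_bound[of lborel "\<lambda>s. iexp (x * s) * f s"] by (simp add: norm_mult)

text \<open>The Taylor remainder of the exponential gives an explicit quadratic error whose constant
  is half the second absolute moment of \<open>f\<close>; hence the third integrability
  assumption.\<close>

lemma fint_has_vector_derivative:
  assumes f: "integrable lborel f" "integrable lborel (\<lambda>s. complex_of_real s * f s)"
    "integrable lborel (\<lambda>s. complex_of_real (s\<^sup>2) * f s)"
  shows "(fint f has_vector_derivative fint (\<lambda>s. \<i> * (complex_of_real s * f s)) x) (at x)"
  unfolding has_vector_derivative_def
proof (rule has_derivativeI_sandwich[where e = 1])
  let ?K = "LINT s|lborel. norm (complex_of_real (s\<^sup>2) * f s)"
  show "((\<lambda>y. ?K / 2 * \<bar>y - x\<bar>) \<longlongrightarrow> 0) (at x)"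
    by (auto intro!: tendsto_eq_intros)
  fix y :: real assume y: "y \<noteq> x"
  define h where "h = y - x"
  have i1: "integrable lborel (\<lambda>s. iexp (u * s) * f s)" for u
    by (intro integrable_iexp_mult f) auto
  have i2: "integrable lborel (\<lambda>s. iexp (x * s) * (\<i> * (complex_of_real s * f s)))"
    by (intro integrable_iexp_mult integrable_mult_right f) auto
  have "(fint f y - fint f x) - (y - x) *\<^sub>R fint (\<lambda>s. \<i> * (complex_of_real s * f s)) x =
      (CLINT s|lborel. iexp (y * s) * f s - iexp (x * s) * f s - h *\<^sub>R (iexp (x * s) * (\<i> * (complex_of_real s * f s))))"
    unfolding fint_def h_def using i1 i2 by simp
  also have "norm \<dots> \<le> (LINT s|lborel. h\<^sup>2 / 2 * norm (complex_of_real (s\<^sup>2) * f s))"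
  proof (rule order_trans[OF integral_norm_bound], rule integral_mono)
    show "integrable lborel (\<lambda>s. norm (iexp (y * s) * f s - iexp (x * s) * f s - h *\<^sub>R (iexp (x * s) * (\<i> * (complex_of_real s * f s)))))"
      using i1 i2 by (intro integrable_norm Bochner_Integration.integrable_diff integrable_scaleR_right) auto
    show "integrable lborel (\<lambda>s. h\<^sup>2 / 2 * norm (complex_of_real (s\<^sup>2) * f s))"
      using f(3) by (intro integrable_mult_right integrable_norm)
    fix s
    have "y * s = x * s + h * s" by (simp add: h_def algebra_simps)
    hence "iexp (y * s) * f s - iexp (x * s) * f s - h *\<^sub>R (iexp (x * s) * (\<i> * (complex_of_real s * f s))) =
        iexp (x * s) * (iexp (h * s) - (\<Sum>k\<le>1. (\<i> * complex_of_real (h * s)) ^ k / fact k)) * f s"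
      by (simp add: exp_add algebra_simps scaleR_conv_of_real)
    also have "norm \<dots> = norm (iexp (h * s) - (\<Sum>k\<le>1. (\<i> * complex_of_real (h * s)) ^ k / fact k)) * norm (f s)"
      by (simp add: norm_mult)
    also have "\<dots> \<le> \<bar>h * s\<bar> ^ Suc 1 / fact (Suc 1) * norm (f s)"
      by (intro mult_right_mono iexp_approx1) auto
    also have "\<dots> = h\<^sup>2 / 2 * norm (complex_of_real (s\<^sup>2) * f s)"
      by (simp add: norm_mult norm_power power_mult_distrib flip: power2_eq_square)
    finally show "norm (iexp (y * s) * f s - iexp (x * s) * f s - h *\<^sub>R (iexp (x * s) * (\<i> * (complex_of_real s * f s)))) \<le>
        h\<^sup>2 / 2 * norm (complex_of_real (s\<^sup>2) * f s)" .
  qed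
  also have "\<dots> = ?K / 2 * \<bar>y - x\<bar> * norm (y - x)"
    by (simp add: h_def power2_eq_square abs_mult_self_eq)
  finally show "norm ((fint f y - fint f x) - (y - x) *\<^sub>R fint (\<lambda>s. \<i> * (complex_of_real s * f s)) x) / norm (y - x)
      \<le> ?K / 2 * \<bar>y - x\<bar>"
    using y by (simp add: divide_le_eq)
qed (auto intro: bounded_linear_scaleR_left)

text \<open>Two continuous derivatives give decay like 1 / (1 + y^2), which is summable over the
  integers and integrable over the line, and the class is stable under products and
  dilations.\<close>

definition C2 :: "(real \<Rightarrow> complex) \<Rightarrow> bool" where
  "C2 h \<longleftrightarrow> (\<exists>h1 h2. (\<forall>x. (h has_vector_derivative h1 x) (at x)) \<and>
     (\<forall>x. (h1 has_vector_derivative h2 x) (at x)) \<and> continuous_on UNIV h2)"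

lemma C2I:
  assumes "\<And>x. (h has_vector_derivative h1 x) (at x)" "\<And>x. (h1 has_vector_derivative h2 x) (at x)"
    "continuous_on UNIV h2"
  shows "C2 h"
  using assms unfolding C2_def by blast

lemma has_vector_derivative_UNIV_continuous:
  "(\<And>x. (h has_vector_derivative h1 x) (at x)) \<Longrightarrow> continuous_on UNIV h"
  by (meson continuous_at_imp_continuous_on has_vector_derivative_continuous)

lemma C2_continuous: "C2 h \<Longrightarrow> continuous_on UNIV h"
  unfolding C2_def using has_vector_derivative_UNIV_continuous by blast

lemma C2_mult:
  assumes "C2 f" "C2 g"
  shows "C2 (\<lambda>x. f x * g x)"
proof -
  obtain f1 f2 where f: "\<And>x. (f has_vector_derivative f1 x) (at x)"
    "\<And>x. (f1 has_vector_derivative f2 x) (at x)" "continuous_on UNIV f2"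
    using assms(1) unfolding C2_def by blast
  obtain g1 g2 where g: "\<And>x. (g has_vector_derivative g1 x) (at x)"
    "\<And>x. (g1 has_vector_derivative g2 x) (at x)" "continuous_on UNIV g2"
    using assms(2) unfolding C2_def by blast
  note cont = has_vector_derivative_UNIV_continuous[of f, OF f(1)] has_vector_derivative_UNIV_continuous[of f1, OF f(2)]
    has_vector_derivative_UNIV_continuous[of g, OF g(1)] has_vector_derivative_UNIV_continuous[of g1, OF g(2)]
  show ?thesis
  proof (rule C2I[of _ "\<lambda>x. f x * g1 x + f1 x * g x"
      "\<lambda>x. (f x * g2 x + f1 x * g1 x) + (f1 x * g1 x + f2 x * g x)"])
    show "continuous_on UNIV (\<lambda>x. f x * g2 x + f1 x * g1 x + (f1 x * g1 x + f2 x * g x))"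
      using f(3) g(3) cont by (intro continuous_intros)
  qed (intro has_vector_derivative_mult has_vector_derivative_add f g)+
qed

lemma C2_of_real:
  assumes "\<And>x. (f has_real_derivative f1 x) (at x)" "\<And>x. (f1 has_real_derivative f2 x) (at x)"
    "continuous_on UNIV f2"
  shows "C2 (\<lambda>x. complex_of_real (f x))"
proof -
  have *: "((\<lambda>x. complex_of_real (g x)) has_vector_derivative complex_of_real d) (at x)"
    if "(g has_real_derivative d) (at x)" for g d x
    using that unfolding has_real_derivative_iff_has_vector_derivative
    by (rule bounded_linear.has_vector_derivative[OF bounded_linear_of_real])
  show ?thesis
    by (rule C2I[OF * * continuous_on_of_real]) (rule assms)+
qed

lemma C2_const: "C2 (\<lambda>x. c)"
  by (rule C2I[of _ "\<lambda>_. 0" "\<lambda>_. 0"]) auto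

lemma C2_ident: "C2 (\<lambda>x. complex_of_real x)"
  by (rule C2_of_real[of _ "\<lambda>_. 1" "\<lambda>_. 0"]) auto

lemma C2_cnj:
  assumes "C2 f"
  shows "C2 (\<lambda>x. cnj (f x))"
proof -
  obtain f1 f2 where f: "\<And>x. (f has_vector_derivative f1 x) (at x)"
    "\<And>x. (f1 has_vector_derivative f2 x) (at x)" "continuous_on UNIV f2"
    using assms unfolding C2_def by blast
  show ?thesis
    by (rule C2I; (rule bounded_linear.has_vector_derivative[OF bounded_linear_cnj] f continuous_on_cnj)+)
qed

lemma C2_dilate:
  assumes "C2 f"
  shows "C2 (\<lambda>x. f (c * x))"
proof -
  obtain f1 f2 where f: "\<And>x. (f has_vector_derivative f1 x) (at x)"
    "\<And>x. (f1 has_vector_derivative f2 x) (at x)" "continuous_on UNIV f2"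
    using assms unfolding C2_def by blast
  have *: "((\<lambda>x. g (c * x)) has_vector_derivative c *\<^sub>R g1 (c * x)) (at x)"
    if "\<And>x. (g has_vector_derivative g1 x) (at x)" for g g1 and x :: real
  proof -
    have "((*) c has_vector_derivative c) (at x)"
      by (auto intro!: derivative_eq_intros simp: has_real_derivative_iff_has_vector_derivative[symmetric])
    from vector_diff_chain_at[OF this that] show ?thesis by (simp add: o_def)
  qed
  show ?thesis
  proof (rule C2I[of _ "\<lambda>x. c *\<^sub>R f1 (c * x)" "\<lambda>x. c *\<^sub>R (c *\<^sub>R f2 (c * x))"])
    show "((\<lambda>x. f (c * x)) has_vector_derivative c *\<^sub>R f1 (c * x)) (at x)" for x by (rule *) (rule f)
    show "((\<lambda>x. c *\<^sub>R f1 (c * x)) has_vector_derivative c *\<^sub>R (c *\<^sub>R f2 (c * x))) (at x)" for x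
      by (rule bounded_linear.has_vector_derivative[OF bounded_linear_scaleR_right], rule *, rule f)
    show "continuous_on UNIV (\<lambda>x. c *\<^sub>R c *\<^sub>R f2 (c * x))"
      by (intro continuous_intros continuous_on_compose2[OF f(3)]) auto
  qed
qed

lemma integrable_compact_support:
  fixes h :: "real \<Rightarrow> complex"
  assumes "continuous_on UNIV h" "\<And>x. \<bar>x\<bar> > R \<Longrightarrow> h x = 0"
  shows "integrable lborel h"
proof -
  have "integrable lborel (\<lambda>x. indicator {-R..R} x *\<^sub>R h x)"
    by (intro borel_integrable_compact continuous_on_subset[OF assms(1)]) auto
  moreover have "indicator {-R..R} x *\<^sub>R h x = h x" for x
    using assms(2)[of x] by (auto simp: indicator_def)
  ultimately show ?thesis by simp
qed

lemma fint_decay: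
  assumes "C2 h" and supp: "\<And>x. \<bar>x\<bar> > R \<Longrightarrow> h x = 0"
  obtains C where "C \<ge> 0" "\<And>y. norm (fint h y) \<le> C / (1 + y\<^sup>2)"
proof -
  obtain h1 h2 where h: "\<And>x. (h has_vector_derivative h1 x) (at x)"
    "\<And>x. (h1 has_vector_derivative h2 x) (at x)" "continuous_on UNIV h2"
    using assms(1) unfolding C2_def by blast
  have zero: "f1 x = 0" if "\<And>x. (f has_vector_derivative f1 x) (at x)" "\<And>x. \<bar>x\<bar> > R \<Longrightarrow> f x = 0" "\<bar>x\<bar> > R"
    for f f1 :: "real \<Rightarrow> complex" and x
  proof -
    have "open {x. \<bar>x\<bar> > R}"
      by (intro open_Collect_less continuous_intros)
    moreover have "((\<lambda>x. 0) has_vector_derivative (0::complex)) (at x)" by simp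
    ultimately have "(f has_vector_derivative 0) (at x)"
      using has_vector_derivative_transform_within_open[of "\<lambda>x. 0" 0 x "{x. \<bar>x\<bar> > R}" f] that by simp
    thus ?thesis using that(1)[of x] vector_derivative_unique_at by blast
  qed
  have h1: "h1 x = 0" if "\<bar>x\<bar> > R" for x
    using zero[of h h1, OF h(1) supp that] by blast
  have h2: "h2 x = 0" if "\<bar>x\<bar> > R" for x
    using zero[of h1 h2, OF h(2) h1 that] by blast
  note cont = has_vector_derivative_UNIV_continuous[of h, OF h(1)] has_vector_derivative_UNIV_continuous[of h1, OF h(2)]
  have int: "integrable lborel h" "integrable lborel h2"
    using integrable_compact_support[OF cont(1) supp] integrable_compact_support[OF h(3) h2] by auto
  have parts: "complex_of_real (y\<^sup>2) * fint h y = - fint h2 y" for y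
  proof -
    define S where "S = \<bar>R\<bar> + 1"
    \<comment> \<open>Two integrations by parts in one: \<open>F\<close> is an antiderivative of
      iexp(yx) (h'' + y^2 h), and it vanishes at both ends of the interval.\<close>
    define F where "F x = iexp (y * x) * (h1 x - \<i> * complex_of_real y * h x)" for x
    define f where "f x = iexp (y * x) * (h2 x + complex_of_real (y\<^sup>2) * h x)" for x
    have dF: "(F has_vector_derivative f x) (at x)" for x
    proof -
      have "((*) y has_vector_derivative y) (at x)"
        by (auto intro!: derivative_eq_intros simp: has_real_derivative_iff_has_vector_derivative[symmetric])
      from vector_diff_chain_at[OF this has_vector_derivative_iexp]
      have e: "((\<lambda>x. iexp (y * x)) has_vector_derivative y *\<^sub>R (\<i> * iexp (y * x))) (at x)"
        by (simp add: o_def)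
      have i: "((\<lambda>x. \<i> * complex_of_real y * h x) has_vector_derivative \<i> * complex_of_real y * h1 x) (at x)"
        by (intro bounded_linear.has_vector_derivative[OF bounded_linear_mult_right] h)
      have "(F has_vector_derivative iexp (y * x) * (h2 x - \<i> * complex_of_real y * h1 x) +
          (y *\<^sub>R (\<i> * iexp (y * x))) * (h1 x - \<i> * complex_of_real y * h x)) (at x)"
        unfolding F_def by (intro has_vector_derivative_mult e has_vector_derivative_diff i h)
      also have "iexp (y * x) * (h2 x - \<i> * complex_of_real y * h1 x) +
          (y *\<^sub>R (\<i> * iexp (y * x))) * (h1 x - \<i> * complex_of_real y * h x) = f x"
        by (simp add: f_def scaleR_conv_of_real algebra_simps power2_eq_square)
      finally show ?thesis .
    qed
    have "(CLINT x|lborel. indicator {-S..S} x *\<^sub>R f x) = F S - F (-S)"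
    proof (rule integral_FTC_Icc)
      show "continuous_on {-S..S} f"
        unfolding f_def by (intro continuous_intros continuous_on_subset[OF h(3)] continuous_on_subset[OF cont(1)]) auto
    qed (auto simp: S_def intro: has_vector_derivative_at_within dF)
    also have "F S - F (-S) = 0"
      using supp[of S] supp[of "-S"] h1[of S] h1[of "-S"] by (simp add: F_def S_def)
    also have "(\<lambda>x. indicator {-S..S} x *\<^sub>R f x) = f"
      using supp h2 by (auto simp: fun_eq_iff indicator_def f_def S_def)
    finally have "0 = (CLINT x|lborel. iexp (y * x) * h2 x + complex_of_real (y\<^sup>2) * (iexp (y * x) * h x))"
      by (simp add: f_def algebra_simps)
    also have "\<dots> = fint h2 y + complex_of_real (y\<^sup>2) * fint h y"
    proof -
      have i: "integrable lborel (\<lambda>x. iexp (y * x) * h x)" "integrable lborel (\<lambda>x. iexp (y * x) * h2 x)"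
        by (intro integrable_iexp_mult int; measurable)+
      show ?thesis
        unfolding fint_def Bochner_Integration.integral_add[OF i(2) integrable_mult_right[OF i(1)]] by simp
    qed
    finally show ?thesis by (simp add: eq_neg_iff_add_eq_0 add.commute)
  qed
  define C where "C = (LINT s|lborel. norm (h s)) + (LINT s|lborel. norm (h2 s))"
  show ?thesis
  proof (rule that[of C])
    show "C \<ge> 0" by (auto simp: C_def)
    fix y
    have "(1 + y\<^sup>2) * norm (fint h y) = norm (fint h y) + norm (complex_of_real (y\<^sup>2) * fint h y)"
      by (simp add: norm_mult norm_power algebra_simps)
    also have "\<dots> \<le> C"
      unfolding parts C_def norm_minus_cancel by (intro add_mono norm_fint_le)
    finally show "norm (fint h y) \<le> C / (1 + y\<^sup>2)"
      by (simp add: le_divide_eq mult.commute add_pos_nonneg)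
  qed
qed

section \<open>Twice differentiable building blocks\<close>

lemma DERIV_max_0_power:
  "((\<lambda>y. max 0 y ^ Suc (Suc n)) has_real_derivative real (Suc (Suc n)) * max 0 y ^ Suc n) (at y)"
proof -
  consider "y < 0" | "y = 0" | "y > 0" by linarith
  thus ?thesis
  proof cases
    case 1
    have "((\<lambda>y. 0) has_real_derivative 0) (at y)" by simp
    hence "((\<lambda>y. max 0 y ^ Suc (Suc n)) has_real_derivative 0) (at y)"
      by (rule has_field_derivative_transform_within_open[of _ _ _ "{..<0}"]) (use 1 in auto)
    thus ?thesis using 1 by simp
  next
    case 3
    have "((\<lambda>y. y ^ Suc (Suc n)) has_real_derivative real (Suc (Suc n)) * y ^ Suc n) (at y)"
      using DERIV_pow[of "Suc (Suc n)" y] by simp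
    hence "((\<lambda>y. max 0 y ^ Suc (Suc n)) has_real_derivative real (Suc (Suc n)) * y ^ Suc n) (at y)"
      by (rule has_field_derivative_transform_within_open[of _ _ _ "{0<..}"]) (use 3 in auto)
    thus ?thesis using 3 by simp
  next
    case 2
    have "((\<lambda>h. max 0 h ^ Suc (Suc n) / h) \<longlongrightarrow> (0::real)) (at 0)"
    proof (rule Lim_null_comparison)
      show "\<forall>\<^sub>F h in at 0. norm (max 0 h ^ Suc (Suc n) / h) \<le> \<bar>h\<bar> ^ Suc n" for h :: real
      proof (rule always_eventually, rule allI)
        fix h :: real
        show "norm (max 0 h ^ Suc (Suc n) / h) \<le> \<bar>h\<bar> ^ Suc n"
        proof (cases "h > 0")
          case False
          hence "max 0 h = 0" by simp
          hence "norm (max 0 h ^ Suc (Suc n) / h) = 0" by simp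
          also have "0 \<le> \<bar>h\<bar> ^ Suc n" by (rule zero_le_power) simp
          finally show ?thesis .
        qed simp
      qed
      show "((\<lambda>h::real. \<bar>h\<bar> ^ Suc n) \<longlongrightarrow> 0) (at 0)"
        by (auto intro!: tendsto_eq_intros)
    qed
    thus ?thesis using 2 by (simp add: DERIV_def)
  qed
qed

text \<open>The third is the least integer power for which the positive part has two continuous
  derivatives. Products of two such functions are the bumps used for testing.\<close>

definition pos3 :: "real \<Rightarrow> real" where "pos3 y = max 0 y ^ 3"

lemma pos3_DERIV: "(pos3 has_real_derivative 3 * max 0 y ^ 2) (at y)"
  using DERIV_max_0_power[of 1 y] by (simp add: pos3_def[abs_def] numeral_3_eq_3 numeral_2_eq_2)

lemma max_sq_DERIV: "((\<lambda>y. 3 * max 0 y ^ 2) has_real_derivative 6 * max 0 y) (at y)"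
  using DERIV_cmult[OF DERIV_max_0_power[of 0 y], of 3] by (simp add: numeral_2_eq_2)

lemma C2_pos3_affine: "C2 (\<lambda>x. complex_of_real (pos3 (a + b * x)))"
proof (rule C2_of_real[of _ "\<lambda>x. (3 * max 0 (a + b * x) ^ 2) * b" "\<lambda>x. ((6 * max 0 (a + b * x)) * b) * b"])
  fix x
  have d: "((\<lambda>x. a + b * x) has_real_derivative b) (at x)" by (auto intro!: derivative_eq_intros)
  show "((\<lambda>x. pos3 (a + b * x)) has_real_derivative 3 * (max 0 (a + b * x))\<^sup>2 * b) (at x)"
    by (rule DERIV_chain'[OF d pos3_DERIV])
  show "((\<lambda>x. 3 * (max 0 (a + b * x))\<^sup>2 * b) has_real_derivative 6 * max 0 (a + b * x) * b * b) (at x)"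
    by (rule DERIV_cmult_right[OF DERIV_chain'[OF d max_sq_DERIV]])
qed (intro continuous_intros)

text \<open>Agrees with \<open>\<bar>\<eta>\<bar> powr p\<close> for \<open>\<bar>\<eta>\<bar> \<ge> 1\<close>, but without the singularity at the origin.\<close>

definition smooth_powr :: "real \<Rightarrow> real \<Rightarrow> real" where
  "smooth_powr p \<eta> = (\<eta>\<^sup>2 + pos3 (1 - \<eta>\<^sup>2)) powr (p / 2)"

lemma smooth_powr_eq: "\<bar>\<eta>\<bar> \<ge> 1 \<Longrightarrow> smooth_powr p \<eta> = \<bar>\<eta>\<bar> powr p"
proof -
  assume a: "\<bar>\<eta>\<bar> \<ge> 1"
  hence "\<eta>\<^sup>2 \<ge> 1" using abs_le_square_iff[of 1 \<eta>] by simp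
  hence "smooth_powr p \<eta> = \<eta>\<^sup>2 powr (p / 2)" by (simp add: smooth_powr_def pos3_def)
  also have "\<eta>\<^sup>2 = \<bar>\<eta>\<bar> powr 2" using a by (simp add: powr_numeral)
  also have "(\<bar>\<eta>\<bar> powr 2) powr (p / 2) = \<bar>\<eta>\<bar> powr p" by (simp only: powr_powr) simp
  finally show ?thesis .
qed

text \<open>The base of the power is strictly positive everywhere, with value 1 at the origin, so
  all its real powers are as smooth as the base.\<close>

lemma C2_smooth_powr: "C2 (\<lambda>x. complex_of_real (smooth_powr p x))"
proof -
  define b where "b x = x\<^sup>2 + pos3 (1 - x\<^sup>2)" for x
  define b1 where "b1 x = 2 * x + 3 * max 0 (1 - x\<^sup>2) ^ 2 * (- (2 * x))" for x :: real
  define b2 where "b2 x = 2 + (3 * max 0 (1 - x\<^sup>2) ^ 2 * (- 2) + 6 * max 0 (1 - x\<^sup>2) * (- (2 * x)) * (- (2 * x)))" for x :: real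
  have b: "b x > 0" for x
    by (cases "x\<^sup>2 < 1") (auto simp: b_def pos3_def add_nonneg_pos add_pos_nonneg)
  have d: "((\<lambda>x. 1 - x\<^sup>2) has_real_derivative - (2 * x)) (at x)" for x :: real
    by (auto intro!: derivative_eq_intros)
  have d1: "(b has_real_derivative b1 x) (at x)" for x
    unfolding b_def b1_def
    by (intro DERIV_add DERIV_chain'[OF d pos3_DERIV]) (auto intro!: derivative_eq_intros)
  have d2: "(b1 has_real_derivative b2 x) (at x)" for x
    unfolding b1_def b2_def
    by (intro DERIV_add DERIV_mult' DERIV_chain'[OF d max_sq_DERIV]) (auto intro!: derivative_eq_intros)
  have cont: "continuous_on UNIV b" "continuous_on UNIV b1" "continuous_on UNIV b2"
    unfolding b_def b1_def b2_def pos3_def by (intro continuous_intros)+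
  have pw: "((\<lambda>x. b x powr q) has_real_derivative q * b x powr (q - 1) * b1 x) (at x)" for x q
    by (rule DERIV_chain2[OF has_real_derivative_powr[OF b] d1])
  show ?thesis
    unfolding smooth_powr_def b_def[symmetric]
  proof (rule C2_of_real[of _ "\<lambda>x. (p/2) * b x powr (p/2 - 1) * b1 x"
        "\<lambda>x. ((p/2) * b x powr (p/2 - 1)) * b2 x + ((p/2) * ((p/2 - 1) * b x powr (p/2 - 1 - 1) * b1 x)) * b1 x"])
    show "((\<lambda>x. b x powr (p/2)) has_real_derivative (p/2) * b x powr (p/2 - 1) * b1 x) (at x)" for x by (rule pw)
    show "((\<lambda>x. (p/2) * b x powr (p/2 - 1) * b1 x) has_real_derivative
        ((p/2) * b x powr (p/2 - 1)) * b2 x + ((p/2) * ((p/2 - 1) * b x powr (p/2 - 1 - 1) * b1 x)) * b1 x) (at x)" for x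
      by (intro DERIV_mult' DERIV_cmult pw d2)
    have "b x \<noteq> 0" for x using b[of x] by simp
    thus "continuous_on UNIV (\<lambda>x. ((p/2) * b x powr (p/2 - 1)) * b2 x + ((p/2) * ((p/2 - 1) * b x powr (p/2 - 1 - 1) * b1 x)) * b1 x)"
      using cont by (intro continuous_intros) auto
  qed
qed

section \<open>Fourier inversion\<close>

lemma fint_multiplication_formula:
  assumes A: "integrable lborel A" and B: "integrable lborel B"
  shows "(CLINT x|lborel. A x * fint B x) = (CLINT y|lborel. B y * fint A y)"
    and "integrable lborel (\<lambda>x. A x * fint B x)"
proof -
  note [measurable] = borel_measurable_integrable[OF A] borel_measurable_integrable[OF B]
  have prod: "integrable (lborel \<Otimes>\<^sub>M lborel) (\<lambda>(x, y). A x * (iexp (x * y) * B y))"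
  proof (rule lborel_pair.Fubini_integrable)
    show "(\<lambda>(x, y). A x * (iexp (x * y) * B y)) \<in> borel_measurable (lborel \<Otimes>\<^sub>M lborel)"
      by measurable
    have "(\<lambda>x. \<integral>y. norm (case (x, y) of (x, y) \<Rightarrow> A x * (iexp (x * y) * B y)) \<partial>lborel) =
        (\<lambda>x. norm (A x) * (LINT y|lborel. norm (B y)))"
      by (simp add: norm_mult)
    thus "integrable lborel (\<lambda>x. \<integral>y. norm (case (x, y) of (x, y) \<Rightarrow> A x * (iexp (x * y) * B y)) \<partial>lborel)"
      using A by simp
    show "AE x in lborel. integrable lborel (\<lambda>y. case (x, y) of (x, y) \<Rightarrow> A x * (iexp (x * y) * B y))"
      unfolding split by (intro AE_I2 integrable_mult_right integrable_iexp_mult[OF B]) measurable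
  qed
  have 0: "(\<integral>y. \<integral>x. A x * (iexp (x * y) * B y) \<partial>lborel \<partial>lborel) =
      (\<integral>x. \<integral>y. A x * (iexp (x * y) * B y) \<partial>lborel \<partial>lborel)"
    using lborel_pair.Fubini_integral[of "\<lambda>x y. A x * (iexp (x * y) * B y)"] prod by simp
  have 2: "(\<integral>x. A x * (iexp (x * y) * B y) \<partial>lborel) = B y * fint A y" for y
  proof -
    have "(\<integral>x. A x * (iexp (x * y) * B y) \<partial>lborel) = (\<integral>x. B y * (iexp (y * x) * A x) \<partial>lborel)"
      by (simp add: mult_ac)
    thus ?thesis by (simp add: fint_def)
  qed
  have 1: "(\<integral>y. A x * (iexp (x * y) * B y) \<partial>lborel) = A x * fint B x" for x
    by (simp add: fint_def)
  show "(CLINT x|lborel. A x * fint B x) = (CLINT y|lborel. B y * fint A y)"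
    using 0 unfolding 1 2 by (rule sym)
  show "integrable lborel (\<lambda>x. A x * fint B x)"
    using lborel_pair.integrable_fst[OF prod] unfolding split 1 .
qed

lemma fint_gaussian:
  assumes e: "e > 0"
  shows "fint (\<lambda>x. complex_of_real (std_normal_density (e * x))) y = complex_of_real (1 / e * exp (- ((y / e)\<^sup>2) / 2))"
    and "integrable lborel (\<lambda>x. complex_of_real (std_normal_density (e * x)))"
proof -
  have int: "integrable lborel (\<lambda>x. complex_of_real (std_normal_density x))"
    using integrable_std_normal_moment[of 0] by (intro integrable_of_real) simp
  from lborel_integrable_real_affine[OF this, of e 0] e
  show "integrable lborel (\<lambda>x. complex_of_real (std_normal_density (e * x)))" by simp
  have "complex_of_real (exp (- (t\<^sup>2) / 2)) = (CLINT x|std_normal_distribution. iexp (t * x))" for t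
    using char_std_normal_distribution by (simp add: char_def fun_eq_iff)
  also have "\<dots> t = (CLINT x|lborel. iexp (t * x) * complex_of_real (std_normal_density x))" for t
    by (subst integral_density) (auto simp: scaleR_conv_of_real mult.commute)
  finally have g: "(CLINT x|lborel. iexp (t * x) * complex_of_real (std_normal_density x)) = complex_of_real (exp (- (t\<^sup>2) / 2))" for t
    by simp
  have "complex_of_real (exp (- ((y / e)\<^sup>2) / 2)) = (CLINT x|lborel. iexp ((y / e) * x) * complex_of_real (std_normal_density x))"
    by (rule g[symmetric])
  also have "\<dots> = \<bar>e\<bar> *\<^sub>R (CLINT x|lborel. iexp ((y / e) * (0 + e * x)) * complex_of_real (std_normal_density (0 + e * x)))"
    using e by (intro lborel_integral_real_affine) auto
  also have "\<dots> = complex_of_real e * fint (\<lambda>x. complex_of_real (std_normal_density (e * x))) y"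
    using e by (simp add: fint_def scaleR_conv_of_real)
  finally show "fint (\<lambda>x. complex_of_real (std_normal_density (e * x))) y = complex_of_real (1 / e * exp (- ((y / e)\<^sup>2) / 2))"
    using e by (simp add: field_simps)
qed

text \<open>Gaussian regularisation: the transform of the modulated Gaussian \<open>A n\<close> is
  an approximate identity concentrated at \<open>\<eta>\<close>. The multiplication formula moves
  the transform from \<open>V\<close> to the Gaussian, and both sides have limits by dominated
  convergence.\<close>

lemma fint_inversion:
  assumes V: "continuous_on UNIV V" "integrable lborel V" "\<And>x. norm (V x) \<le> B"
    and v: "integrable lborel (fint V)"
  shows "fint (fint V) (- \<eta>) = 2 * complex_of_real pi * V \<eta>"
proof -
  define e where "e n = inverse (real (Suc n))" for n
  have e0: "e n > 0" for n by (simp add: e_def)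
  have elim: "e \<longlonglongrightarrow> 0" unfolding e_def by (rule LIMSEQ_inverse_real_of_nat)
  note [measurable] = borel_measurable_integrable[OF v] borel_measurable_integrable[OF V(2)]
  define A where "A n x = iexp (- (x * \<eta>)) * complex_of_real (std_normal_density (e n * x))" for n x
  have A: "integrable lborel (A n)" for n
    unfolding A_def by (intro integrable_iexp_mult fint_gaussian e0) measurable
  have fA: "fint (A n) y = complex_of_real (1 / e n * exp (- (((y - \<eta>) / e n)\<^sup>2) / 2))" for n y
  proof -
    have "fint (A n) y = fint (\<lambda>x. complex_of_real (std_normal_density (e n * x))) (y - \<eta>)"
      unfolding fint_def A_def
    proof (intro Bochner_Integration.integral_cong refl)
      fix s
      have "iexp (y * s) * iexp (- (s * \<eta>)) = iexp (y * s + - (s * \<eta>))"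
        by (simp only: exp_add[symmetric] distrib_left of_real_add)
      also have "y * s + - (s * \<eta>) = (y - \<eta>) * s" by (simp add: algebra_simps)
      finally show "iexp (y * s) * (iexp (- (s * \<eta>)) * complex_of_real (std_normal_density (e n * s))) =
          iexp ((y - \<eta>) * s) * complex_of_real (std_normal_density (e n * s))"
        by (simp only: mult.assoc[symmetric])
    qed
    thus ?thesis by (simp add: fint_gaussian[OF e0])
  qed
  have eq: "(CLINT x|lborel. A n x * fint V x) =
      (CLINT s|lborel. V (\<eta> + e n * s) * complex_of_real (exp (- s\<^sup>2 / 2)))" for n
  proof -
    have "(CLINT x|lborel. A n x * fint V x) = (CLINT y|lborel. V y * fint (A n) y)"
      by (rule fint_multiplication_formula[OF A V(2)])
    also have "\<dots> = \<bar>e n\<bar> *\<^sub>R (CLINT s|lborel. V (\<eta> + e n * s) * fint (A n) (\<eta> + e n * s))"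
      using e0[of n] by (intro lborel_integral_real_affine) auto
    also have "(\<lambda>s. V (\<eta> + e n * s) * fint (A n) (\<eta> + e n * s)) =
        (\<lambda>s. complex_of_real (1 / e n) * (V (\<eta> + e n * s) * complex_of_real (exp (- s\<^sup>2 / 2))))"
      using e0[of n] by (auto simp: fA)
    finally show ?thesis
      using e0[of n] by (simp add: scaleR_conv_of_real)
  qed
  have sd: "std_normal_density x \<le> 1 / sqrt (2 * pi)" "std_normal_density x \<ge> 0" for x
    by (auto simp: std_normal_density_def divide_le_cancel)
  have gi: "integrable lborel (\<lambda>s. exp (- s\<^sup>2 / 2) :: real)"
    using integrable_mult_right[OF integrable_std_normal_moment[of 0], of "sqrt (2 * pi)"] by (simp add: std_normal_density_def)
  have gv: "(LINT s|lborel. exp (- s\<^sup>2 / 2)) = sqrt (2 * pi)"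
  proof -
    have "(LINT s|lborel. sqrt (2 * pi) * std_normal_density s) = sqrt (2 * pi)"
      using integral_std_normal_moment_even[of 0] by simp
    thus ?thesis by (simp add: std_normal_density_def)
  qed
  have lim1: "(\<lambda>n. CLINT x|lborel. A n x * fint V x) \<longlonglongrightarrow>
      (CLINT x|lborel. iexp (- (x * \<eta>)) * complex_of_real (1 / sqrt (2 * pi)) * fint V x)"
  proof (rule integral_dominated_convergence[where w = "\<lambda>x. norm (fint V x)"])
    show "AE x in lborel. (\<lambda>n. A n x * fint V x) \<longlonglongrightarrow> iexp (- (x * \<eta>)) * complex_of_real (1 / sqrt (2 * pi)) * fint V x"
    proof (rule AE_I2)
      fix x
      have "(\<lambda>n. 1 / sqrt (2 * pi) * exp (- (e n * x)\<^sup>2 / 2)) \<longlonglongrightarrow> 1 / sqrt (2 * pi) * exp (- (0 * x)\<^sup>2 / 2)"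
        by (intro tendsto_intros elim) auto
      thus "(\<lambda>n. A n x * fint V x) \<longlonglongrightarrow> iexp (- (x * \<eta>)) * complex_of_real (1 / sqrt (2 * pi)) * fint V x"
        unfolding A_def std_normal_density_def by (intro tendsto_intros) simp
    qed
    show "AE x in lborel. norm (A n x * fint V x) \<le> norm (fint V x)" for n
    proof (rule AE_I2)
      fix x
      have "1 / sqrt (2 * pi) \<le> 1" using pi_ge_two by (simp add: divide_le_eq real_le_rsqrt)
      hence "std_normal_density (e n * x) \<le> 1" by (rule order_trans[OF sd(1)])
      thus "norm (A n x * fint V x) \<le> norm (fint V x)"
        using sd(2)[of "e n * x"] by (simp add: A_def norm_mult mult_left_le_one_le)
    qed
  qed (use v in \<open>auto simp: A_def\<close>)
  have lim2: "(\<lambda>n. CLINT s|lborel. V (\<eta> + e n * s) * complex_of_real (exp (- s\<^sup>2 / 2))) \<longlonglongrightarrow>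
      (CLINT s|lborel. V \<eta> * complex_of_real (exp (- s\<^sup>2 / 2)))"
  proof (rule integral_dominated_convergence[where w = "\<lambda>s. B * exp (- s\<^sup>2 / 2)"])
    show "AE s in lborel. (\<lambda>n. V (\<eta> + e n * s) * complex_of_real (exp (- s\<^sup>2 / 2))) \<longlonglongrightarrow>
        V \<eta> * complex_of_real (exp (- s\<^sup>2 / 2))"
    proof (rule AE_I2)
      fix s
      have "(\<lambda>n. \<eta> + e n * s) \<longlonglongrightarrow> \<eta> + 0 * s" by (intro tendsto_intros elim)
      moreover have "isCont V \<eta>" using V(1) by (simp add: continuous_on_eq_continuous_at)
      ultimately have "(\<lambda>n. V (\<eta> + e n * s)) \<longlonglongrightarrow> V \<eta>"
        using isCont_tendsto_compose by fastforce
      thus "(\<lambda>n. V (\<eta> + e n * s) * complex_of_real (exp (- s\<^sup>2 / 2))) \<longlonglongrightarrow>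
        V \<eta> * complex_of_real (exp (- s\<^sup>2 / 2))" by (intro tendsto_intros)
    qed
    show "AE s in lborel. norm (V (\<eta> + e n * s) * complex_of_real (exp (- s\<^sup>2 / 2))) \<le> B * exp (- s\<^sup>2 / 2)" for n
      using V(3) by (intro AE_I2) (auto simp: norm_mult)
  qed (use gi in auto)
  have "(CLINT s|lborel. V \<eta> * complex_of_real (exp (- s\<^sup>2 / 2))) = V \<eta> * complex_of_real (sqrt (2 * pi))"
    using gv by (simp only: integral_mult_right_zero integral_complex_of_real)
  moreover have "(CLINT x|lborel. iexp (- (x * \<eta>)) * complex_of_real (1 / sqrt (2 * pi)) * fint V x) =
      complex_of_real (1 / sqrt (2 * pi)) * fint (fint V) (- \<eta>)"
    by (simp add: fint_def[of "fint V"] mult_ac)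
  ultimately have "complex_of_real (1 / sqrt (2 * pi)) * fint (fint V) (- \<eta>) = V \<eta> * complex_of_real (sqrt (2 * pi))"
    using LIMSEQ_unique[OF lim1 lim2[folded eq]] by simp
  moreover have "complex_of_real (sqrt (2 * pi)) * complex_of_real (sqrt (2 * pi)) = 2 * complex_of_real pi"
    unfolding of_real_mult[symmetric] real_sqrt_mult_self by simp
  ultimately show ?thesis
    by (simp add: field_simps)
qed

section \<open>Sums over dyadic indices\<close>

lemma sum_int_nat_abs_le:
  fixes g :: "nat \<Rightarrow> real"
  assumes g: "summable g" "\<And>i. g i \<ge> 0" and F: "finite F"
  shows "(\<Sum>m\<in>F. g (nat \<bar>m\<bar>)) \<le> 2 * suminf g"
proof -
  define N where "N = Max (insert 0 ((\<lambda>m. nat \<bar>m\<bar>) ` F))"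
  have N: "nat \<bar>m\<bar> \<le> N" if "m \<in> F" for m
    unfolding N_def using F that by (intro Max_ge) auto
  have sub: "F \<subseteq> int ` {..N} \<union> (\<lambda>i. - int i) ` {..N}"
  proof
    fix m assume m: "m \<in> F"
    show "m \<in> int ` {..N} \<union> (\<lambda>i. - int i) ` {..N}"
    proof (cases "m \<ge> 0")
      case True
      thus ?thesis using N[OF m] by (intro UnI1 image_eqI[of _ _ "nat \<bar>m\<bar>"]) auto
    next
      case False
      thus ?thesis using N[OF m] by (intro UnI2 image_eqI[of _ _ "nat \<bar>m\<bar>"]) auto
    qed
  qed
  have "(\<Sum>m\<in>F. g (nat \<bar>m\<bar>)) \<le> (\<Sum>m\<in>int ` {..N} \<union> (\<lambda>i. - int i) ` {..N}. g (nat \<bar>m\<bar>))"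
    using sub g by (intro sum_mono2) auto
  also have "\<dots> \<le> (\<Sum>m\<in>int ` {..N}. g (nat \<bar>m\<bar>)) + (\<Sum>m\<in>(\<lambda>i. - int i) ` {..N}. g (nat \<bar>m\<bar>))"
    using g sum.union_inter[of "int ` {..N}" "(\<lambda>i. - int i) ` {..N}" "\<lambda>m. g (nat \<bar>m\<bar>)"]
      sum_nonneg[of "int ` {..N} \<inter> (\<lambda>i. - int i) ` {..N}" "\<lambda>m. g (nat \<bar>m\<bar>)"] by simp
  also have "\<dots> = (\<Sum>i\<le>N. g i) + (\<Sum>i\<le>N. g i)"
    by (subst (1 2) sum.reindex) (auto simp: inj_on_def)
  also have "\<dots> \<le> suminf g + suminf g"
    using g by (intro add_mono sum_le_suminf) auto
  finally show ?thesis by simp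
qed

lemma sum_int_powr_bounded:
  assumes "p > 1"
  obtains K where "K \<ge> 0" "\<And>F. finite F \<Longrightarrow> (\<Sum>k\<in>F. (1 + \<bar>real_of_int k\<bar>) powr (- p)) \<le> K"
proof -
  define g where "g i = (1 + real i) powr (- p)" for i
  have "summable (\<lambda>n. real n powr (- p))" using assms by (subst summable_real_powr_iff) auto
  hence "summable (\<lambda>n. real (n + 1) powr (- p))" by (subst summable_iff_shift)
  hence g: "summable g" "\<And>i. g i \<ge> 0" by (auto simp: g_def[abs_def] add.commute)
  show ?thesis
  proof (rule that[of "2 * suminf g"])
    show "2 * suminf g \<ge> 0" using g by (auto intro: suminf_nonneg)
    fix F :: "int set" assume "finite F"
    have eq: "(1 + \<bar>real_of_int k\<bar>) powr (- p) = g (nat \<bar>k\<bar>)" for k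
      by (simp add: g_def)
    from sum_int_nat_abs_le[OF g \<open>finite F\<close>] show "(\<Sum>k\<in>F. (1 + \<bar>real_of_int k\<bar>) powr (- p)) \<le> 2 * suminf g"
      unfolding eq .
  qed
qed

lemma sum_int_geometric_bounded:
  assumes "p > 0"
  obtains K where "K \<ge> 0" "\<And>F. finite F \<Longrightarrow> (\<Sum>j\<in>F. 2 powr (- p * \<bar>real_of_int j\<bar>)) \<le> K"
proof -
  define g where "g i = (2 powr (- p)) ^ i" for i :: nat
  have g: "summable g" "\<And>i. g i \<ge> 0"
    unfolding g_def using assms by (auto intro!: summable_geometric simp: powr_less_one)
  have eq: "2 powr (- p * \<bar>real_of_int j\<bar>) = g (nat \<bar>j\<bar>)" for j
    by (simp add: g_def powr_realpow[symmetric] powr_powr)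
  show ?thesis
  proof (rule that[of "2 * suminf g"])
    show "2 * suminf g \<ge> 0" using g by (auto intro: suminf_nonneg)
    fix F :: "int set" assume "finite F"
    from sum_int_nat_abs_le[OF g this] show "(\<Sum>j\<in>F. 2 powr (- p * \<bar>real_of_int j\<bar>)) \<le> 2 * suminf g"
      unfolding eq .
  qed
qed

text \<open>Uniformity in the real shift \<open>y\<close> is the point: passing to the floor of
  \<open>y\<close> costs a factor of at most 2 in 1 + |y - k|, and the remaining integer shift is a
  reindexing.\<close>

lemma sum_shifted_powr_bounded:
  assumes "p > 1"
  obtains K where "K \<ge> 0" "\<And>F y. finite F \<Longrightarrow> (\<Sum>k\<in>F. (1 + \<bar>y - real_of_int k\<bar>) powr (- p)) \<le> K"
proof -
  obtain K where K: "K \<ge> 0" "\<And>F. finite F \<Longrightarrow> (\<Sum>k\<in>F. (1 + \<bar>real_of_int k\<bar>) powr (- p)) \<le> K"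
    using sum_int_powr_bounded[OF assms] by blast
  show ?thesis
  proof (rule that[of "2 powr p * K"])
    show "2 powr p * K \<ge> 0" using K by simp
    fix F y assume F: "finite (F :: int set)"
    have "(1 + \<bar>y - real_of_int k\<bar>) powr (- p) \<le> 2 powr p * (1 + \<bar>real_of_int (k - \<lfloor>y\<rfloor>)\<bar>) powr (- p)" for k
    proof -
      have le: "(1 + \<bar>real_of_int (k - \<lfloor>y\<rfloor>)\<bar>) / 2 \<le> 1 + \<bar>y - real_of_int k\<bar>"
      proof -
        have "(1 + \<bar>a - r\<bar>) / 2 \<le> 1 + \<bar>y - a\<bar>" if "r \<le> y" "y < r + 1" for a r :: real
        proof -
          have "\<bar>a - r\<bar> \<le> \<bar>y - a\<bar> + \<bar>y - r\<bar>"
            using abs_triangle_ineq[of "a - y" "y - r"] by (simp add: abs_minus_commute)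
          moreover have "\<bar>y - r\<bar> \<le> 1" "\<bar>y - a\<bar> \<ge> 0" using that by (auto simp: abs_if)
          moreover have "p \<le> q + s \<Longrightarrow> s \<le> 1 \<Longrightarrow> 0 \<le> q \<Longrightarrow> (1 + p) / 2 \<le> 1 + q" for p q s :: real
            by simp
          ultimately show ?thesis by blast
        qed
        from this[of "real_of_int \<lfloor>y\<rfloor>" "real_of_int k"] show ?thesis
          using floor_correct[of y] by simp
      qed
      have "(1 + \<bar>y - real_of_int k\<bar>) powr (- p) \<le> ((1 + \<bar>real_of_int (k - \<lfloor>y\<rfloor>)\<bar>) / 2) powr (- p)"
        using assms le by (intro powr_mono2') auto
      also have "\<dots> = 2 powr p * (1 + \<bar>real_of_int (k - \<lfloor>y\<rfloor>)\<bar>) powr (- p)"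
        by (simp add: powr_divide powr_minus_divide)
      finally show ?thesis .
    qed
    hence "(\<Sum>k\<in>F. (1 + \<bar>y - real_of_int k\<bar>) powr (- p)) \<le>
        (\<Sum>k\<in>F. 2 powr p * (1 + \<bar>real_of_int (k - \<lfloor>y\<rfloor>)\<bar>) powr (- p))"
      by (intro sum_mono)
    also have "\<dots> = 2 powr p * (\<Sum>k\<in>(\<lambda>k. k - \<lfloor>y\<rfloor>) ` F. (1 + \<bar>real_of_int k\<bar>) powr (- p))"
      by (subst sum.reindex) (auto simp: inj_on_def sum_distrib_left)
    also have "\<dots> \<le> 2 powr p * K"
      using F by (intro mult_left_mono K) auto
    finally show "(\<Sum>k\<in>F. (1 + \<bar>y - real_of_int k\<bar>) powr (- p)) \<le> 2 powr p * K" .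
  qed
qed

lemma inverse_square_le_powr: "1 / (1 + z\<^sup>2) \<le> 2 * (1 + \<bar>z\<bar>) powr (- 2)" for z :: real
proof -
  have "(1 + \<bar>z\<bar>)\<^sup>2 \<le> 2 * (1 + z\<^sup>2)"
    using sum_squares_bound[of 1 "\<bar>z\<bar>"] by (simp add: power2_sum)
  hence "1 / (1 + z\<^sup>2) \<le> 2 / (1 + \<bar>z\<bar>)\<^sup>2"
    by (simp add: field_simps add_pos_nonneg)
  also have "\<dots> = 2 * (1 + \<bar>z\<bar>) powr (- 2)"
    by (simp add: powr_minus_divide powr_numeral)
  finally show ?thesis .
qed

lemma sum_shifted_inverse_square_bounded:
  obtains K where "K \<ge> 0" "\<And>F y. finite F \<Longrightarrow> (\<Sum>k\<in>F. 1 / (1 + (y - real_of_int k)\<^sup>2)) \<le> K"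
proof -
  obtain K where K: "K \<ge> 0" "\<And>F y. finite F \<Longrightarrow> (\<Sum>k\<in>F. (1 + \<bar>y - real_of_int k\<bar>) powr (- 2)) \<le> K"
    using sum_shifted_powr_bounded[of 2] by auto
  show ?thesis
  proof (rule that[of "2 * K"])
    fix F :: "int set" and y assume F: "finite F"
    have "(\<Sum>k\<in>F. 1 / (1 + (y - real_of_int k)\<^sup>2)) \<le> (\<Sum>k\<in>F. 2 * (1 + \<bar>y - real_of_int k\<bar>) powr (- 2))"
      by (intro sum_mono inverse_square_le_powr)
    also have "\<dots> \<le> 2 * K" using K(2)[OF F, of y] by (simp add: sum_distrib_left[symmetric])
    finally show "(\<Sum>k\<in>F. 1 / (1 + (y - real_of_int k)\<^sup>2)) \<le> 2 * K" .
  qed (use K in simp)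
qed

text \<open>A discrete convolution of two inverse square profiles decays like one of them, because 1
  + y^2 is at most twice the sum of the two denominators.\<close>

lemma sum_convolution_inverse_square_bounded:
  obtains K where "K \<ge> 0"
    "\<And>F y. finite F \<Longrightarrow> (\<Sum>k\<in>F. 1 / (1 + (real_of_int k)\<^sup>2) * (1 / (1 + (y - real_of_int k)\<^sup>2))) \<le> K / (1 + y\<^sup>2)"
proof -
  obtain K where K: "K \<ge> 0" "\<And>F y. finite F \<Longrightarrow> (\<Sum>k\<in>F. 1 / (1 + (y - real_of_int k)\<^sup>2)) \<le> K"
    using sum_shifted_inverse_square_bounded by blast
  show ?thesis
  proof (rule that[of "4 * K"])
    fix F :: "int set" and y :: real assume F: "finite F"
    have le: "1 / (1 + k\<^sup>2) * (1 / (1 + (y - k)\<^sup>2)) \<le> 2 / (1 + y\<^sup>2) * (1 / (1 + (y - k)\<^sup>2) + 1 / (1 + (0 - k)\<^sup>2))" for k :: real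
    proof -
      have p: "1 + k\<^sup>2 > 0" "1 + (y - k)\<^sup>2 > 0" "1 + y\<^sup>2 > 0" by (simp_all add: add_pos_nonneg)
      have "0 \<le> (y - 2 * k)\<^sup>2" by simp
      hence "1 + y\<^sup>2 \<le> 2 * ((1 + k\<^sup>2) + (1 + (y - k)\<^sup>2))" by (simp add: power2_eq_square algebra_simps)
      have *: "1 / a * (1 / b) \<le> 2 / c * (1 / b + 1 / a)" if "a > 0" "b > 0" "c > 0" "c \<le> 2 * (a + b)" for a b c :: real
      proof -
        have "1 / a * (1 / b) = c * (1 / (a * b * c))" using that by simp
        also have "\<dots> \<le> 2 * (a + b) * (1 / (a * b * c))" using that by (intro mult_right_mono) auto
        also have "\<dots> = 2 / c * (1 / b + 1 / a)" using that by (simp add: field_simps)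
        finally show ?thesis .
      qed
      from *[OF p(1) p(2) p(3)] \<open>1 + y\<^sup>2 \<le> 2 * ((1 + k\<^sup>2) + (1 + (y - k)\<^sup>2))\<close> show ?thesis by simp
    qed
    have "(\<Sum>k\<in>F. 1 / (1 + (real_of_int k)\<^sup>2) * (1 / (1 + (y - real_of_int k)\<^sup>2))) \<le>
        (\<Sum>k\<in>F. 2 / (1 + y\<^sup>2) * (1 / (1 + (y - real_of_int k)\<^sup>2) + 1 / (1 + (0 - real_of_int k)\<^sup>2)))"
      by (intro sum_mono le)
    also have "\<dots> = 2 / (1 + y\<^sup>2) * ((\<Sum>k\<in>F. 1 / (1 + (y - real_of_int k)\<^sup>2)) + (\<Sum>k\<in>F. 1 / (1 + (0 - real_of_int k)\<^sup>2)))"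
      by (simp only: sum_distrib_left[symmetric] sum.distrib)
    also have "\<dots> \<le> 2 / (1 + y\<^sup>2) * (K + K)"
      using F by (intro mult_left_mono add_mono K) auto
    finally show "(\<Sum>k\<in>F. 1 / (1 + (real_of_int k)\<^sup>2) * (1 / (1 + (y - real_of_int k)\<^sup>2))) \<le> 4 * K / (1 + y\<^sup>2)"
      by simp
  qed (use K in simp)
qed

lemma sum_int_pairs_le:
  fixes f :: "int \<times> int \<Rightarrow> real"
  assumes F: "finite F" and f: "\<And>j k. f (j, k) \<ge> 0"
    and b: "\<And>j F. finite F \<Longrightarrow> (\<Sum>k\<in>F. f (j, k)) \<le> b j"
  shows "(\<Sum>p\<in>F. f p) \<le> (\<Sum>j\<in>fst ` F. b j)"
proof -
  have "(\<Sum>p\<in>F. f p) \<le> (\<Sum>p\<in>fst ` F \<times> snd ` F. f p)"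
  proof (rule sum_mono2)
    show "F \<subseteq> fst ` F \<times> snd ` F" by force
    show "0 \<le> f p" for p using f by (cases p) auto
  qed (use F in auto)
  also have "\<dots> = (\<Sum>j\<in>fst ` F. \<Sum>k\<in>snd ` F. f (j, k))"
    by (simp add: sum.cartesian_product)
  also have "\<dots> \<le> (\<Sum>j\<in>fst ` F. b j)"
    using F by (intro sum_mono b) auto
  finally show ?thesis .
qed

lemma finite_D_index: "finite (D_index n M)"
proof (rule finite_subset)
  show "D_index n M \<subseteq> {- int n..int n} \<times> {- \<lceil>M * 2 ^ (n + 1)\<rceil>..\<lceil>M * 2 ^ (n + 1)\<rceil>}"
  proof
    fix p assume p: "p \<in> D_index n M"
    obtain j k where jk: "p = (j, k)" by (cases p)
    have "real_of_int \<bar>k\<bar> \<le> M * 2 ^ (n + 1)" "\<bar>j\<bar> \<le> int n" using p jk by (auto simp: D_index_def)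
    moreover from this(1) have "\<bar>k\<bar> \<le> \<lceil>M * 2 ^ (n + 1)\<rceil>" by (simp add: le_ceiling_iff)
    ultimately show "p \<in> {- int n..int n} \<times> {- \<lceil>M * 2 ^ (n + 1)\<rceil>..\<lceil>M * 2 ^ (n + 1)\<rceil>}"
      unfolding jk by (simp add: abs_le_iff)
  qed
qed auto

lemma D_index_mono: "m \<le> n \<Longrightarrow> M \<ge> 0 \<Longrightarrow> D_index m M \<subseteq> D_index n M"
proof -
  assume a: "m \<le> n" "M \<ge> 0"
  hence "M * 2 ^ (m + 1) \<le> M * 2 ^ (n + 1)" by (intro mult_left_mono power_increasing) auto
  thus ?thesis using a unfolding D_index_def by auto
qed

text \<open>The index sets exhaust all pairs, so an absolutely summable family can be summed along
  them; positivity of \<open>M\<close> makes the range of \<open>k\<close> grow.\<close>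

lemma filterlim_D_index:
  assumes M: "M > 0"
  shows "filterlim (\<lambda>n. D_index n M) (finite_subsets_at_top UNIV) sequentially"
  unfolding filterlim_finite_subsets_at_top
proof safe
  fix X :: "(int \<times> int) set" assume X: "finite X"
  have "\<exists>n. p \<in> D_index n M" for p
  proof (cases p)
    case (Pair j k)
    obtain n0 where "real_of_int \<bar>k\<bar> / M < 2 ^ n0"
      using real_arch_pow[of 2 "real_of_int \<bar>k\<bar> / M"] by auto
    also have "(2::real) ^ n0 \<le> 2 ^ (max n0 (nat \<bar>j\<bar>) + 1)"
      by (intro power_increasing) auto
    finally have "real_of_int \<bar>k\<bar> \<le> M * 2 ^ (max n0 (nat \<bar>j\<bar>) + 1)"
      using M by (simp add: divide_less_eq mult.commute)
    thus ?thesis using Pair by (intro exI[of _ "max n0 (nat \<bar>j\<bar>)"]) (auto simp: D_index_def)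
  qed
  then obtain n where n: "\<And>p. p \<in> D_index (n p) M" by metis
  define N where "N = Max (insert 0 (n ` X))"
  show "eventually (\<lambda>n. finite (D_index n M) \<and> X \<subseteq> D_index n M \<and> D_index n M \<subseteq> UNIV) sequentially"
    unfolding eventually_sequentially
  proof (intro exI[of _ N] allI impI conjI finite_D_index)
    fix m assume m: "N \<le> m"
    show "X \<subseteq> D_index m M"
    proof
      fix p assume p: "p \<in> X"
      have "n p \<le> N" unfolding N_def using X p by (intro Max_ge) auto
      thus "p \<in> D_index m M" using n[of p] D_index_mono[of "n p" m M] m M by auto
    qed
  qed auto
qed

section \<open>Quadratic decay and square integrable functions\<close>

lemma integrable_inverse_square: "integrable lborel (\<lambda>x::real. 1 / (1 + x\<^sup>2))"
  using integrable_inverse_1_plus_square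
  by (simp add: set_integrable_def einterval_def inverse_eq_divide)

lemma integrable_quadratic_decay:
  fixes f :: "real \<Rightarrow> 'b::{banach, second_countable_topology}"
  assumes "f \<in> borel_measurable borel" "\<And>x. norm (f x) \<le> C / (1 + x\<^sup>2)"
  shows "integrable lborel f"
proof (rule Bochner_Integration.integrable_bound)
  show "integrable lborel (\<lambda>x. C * (1 / (1 + x\<^sup>2)))"
    by (intro integrable_mult_right integrable_inverse_square)
  show "AE x in lborel. norm (f x) \<le> norm (C * (1 / (1 + x\<^sup>2)))"
  proof (intro AE_I2)
    fix x
    show "norm (f x) \<le> norm (C * (1 / (1 + x\<^sup>2)))"
      using assms(2)[of x] abs_ge_self[of "C * (1 / (1 + x\<^sup>2))"] by simp
  qed
qed (use assms in simp)

lemma cnj_measurable [measurable]: "cnj \<in> borel_measurable borel"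
  by (intro borel_measurable_continuous_onI continuous_intros)

lemma Lp_fun_2_mult_integrable:
  assumes "f \<in> Lp_fun 2" "g \<in> Lp_fun 2"
  shows "integrable lborel (\<lambda>x. f x * cnj (g x))"
proof (rule Bochner_Integration.integrable_bound)
  have i: "integrable lborel (\<lambda>x. (norm (h x))\<^sup>2)" if "h \<in> Lp_fun 2" for h
    using that by (simp add: Lp_fun_def powr_numeral)
  show "integrable lborel (\<lambda>x. (norm (f x))\<^sup>2 + (norm (g x))\<^sup>2)"
    using assms by (intro Bochner_Integration.integrable_add i)
  show "AE x in lborel. norm (f x * cnj (g x)) \<le> norm ((norm (f x))\<^sup>2 + (norm (g x))\<^sup>2)"
  proof (intro AE_I2)
    fix x
    have "2 * norm (f x) * norm (g x) \<le> (norm (f x))\<^sup>2 + (norm (g x))\<^sup>2"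
      by (rule sum_squares_bound)
    moreover have "0 \<le> norm (f x) * norm (g x)" by simp
    ultimately have "norm (f x) * norm (g x) \<le> (norm (f x))\<^sup>2 + (norm (g x))\<^sup>2" by linarith
    thus "norm (f x * cnj (g x)) \<le> norm ((norm (f x))\<^sup>2 + (norm (g x))\<^sup>2)"
      by (simp add: norm_mult)
  qed
qed (use assms in \<open>auto simp: Lp_fun_def\<close>)

text \<open>If \<open>D\<close> is orthogonal to every basis vector, subtracting a combination of basis vectors only
  increases its norm.\<close>

lemma orthonormal_basis_complete:
  assumes e: "orthonormal_basis_L2 e" and D: "D \<in> Lp_fun 2"
    and orth: "\<And>i. (LINT x|lborel. D x * cnj (e i x)) = 0"
  shows "AE x in lborel. D x = 0"
proof -
  have eL: "e i \<in> Lp_fun 2" for i using e by (simp add: orthonormal_basis_L2_def)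
  have sq: "integrable lborel (\<lambda>x. (norm (h x))\<^sup>2)" if "h \<in> Lp_fun 2" for h
    using that by (simp add: Lp_fun_def powr_numeral)
  have "(LINT x|lborel. (norm (D x))\<^sup>2) \<le> \<epsilon>" if \<epsilon>: "\<epsilon> > 0" for \<epsilon>
  proof -
    obtain F c where F: "finite F" "(LINT x|lborel. (norm (D x - (\<Sum>i\<in>F. c i * e i x)))\<^sup>2) < \<epsilon>"
      using e D \<epsilon> unfolding orthonormal_basis_L2_def by blast
    define S where "S x = (\<Sum>i\<in>F. c i * e i x)" for x
    have prods: "integrable lborel (\<lambda>x. D x * cnj (e i x))" "integrable lborel (\<lambda>x. e i x * cnj (e k x))" for i k
      using Lp_fun_2_mult_integrable eL D by blast+
    have DS_eq: "D x * cnj (S x) = (\<Sum>i\<in>F. cnj (c i) * (D x * cnj (e i x)))" for x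
      by (simp add: S_def sum_distrib_left mult_ac)
    have DS: "integrable lborel (\<lambda>x. D x * cnj (S x))" "(CLINT x|lborel. D x * cnj (S x)) = 0"
      unfolding DS_eq using prods orth by (auto simp: Bochner_Integration.integral_sum)
    have SS_eq: "S x * cnj (S x) = (\<Sum>i\<in>F. \<Sum>k\<in>F. c i * cnj (c k) * (e i x * cnj (e k x)))" for x
      by (simp add: S_def sum_product mult_ac)
    have "integrable lborel (\<lambda>x. S x * cnj (S x))"
      unfolding SS_eq using prods by auto
    hence S2: "integrable lborel (\<lambda>x. (norm (S x))\<^sup>2)"
      by (simp add: complex_norm_square[symmetric] complex_of_real_integrable_eq del: of_real_power)
    define r where "r x = Re (D x * cnj (S x))" for x
    have r: "integrable lborel r" "integral\<^sup>L lborel r = Re (CLINT x|lborel. D x * cnj (S x))"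
      unfolding r_def[abs_def] by (rule integrable_Re[OF DS(1)], rule integral_Re[OF DS(1)])
    have pw: "(norm (D x - S x))\<^sup>2 = (norm (D x))\<^sup>2 + (norm (S x))\<^sup>2 - 2 * r x" for x
      by (simp add: r_def cmod_power2 power2_diff algebra_simps)
    have "(LINT x|lborel. (norm (D x - S x))\<^sup>2) =
        (LINT x|lborel. (norm (D x))\<^sup>2) + (LINT x|lborel. (norm (S x))\<^sup>2) - 2 * Re (CLINT x|lborel. D x * cnj (S x))"
      unfolding pw r(2)[symmetric] using sq[OF D] S2 r(1) by simp
    moreover have "(LINT x|lborel. (norm (S x))\<^sup>2) \<ge> 0" by (intro integral_nonneg_AE) auto
    moreover have lt: "(LINT x|lborel. (norm (D x - S x))\<^sup>2) < \<epsilon>" using F(2) by (simp only: S_def)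
    ultimately show ?thesis unfolding DS(2) zero_complex.sel by linarith
  qed
  hence "(LINT x|lborel. (norm (D x))\<^sup>2) \<le> 0"
    by (rule field_le_epsilon) auto
  hence "(LINT x|lborel. (norm (D x))\<^sup>2) = 0"
    by (intro antisym integral_nonneg_AE) auto
  hence "AE x in lborel. (norm (D x))\<^sup>2 = 0"
    using sq[OF D] by (subst (asm) integral_nonneg_eq_0_iff_AE) auto
  thus ?thesis by eventually_elim simp
qed

lemma abs_summable_D_index_limit:
  fixes f :: "int \<times> int \<Rightarrow> complex"
  assumes M: "M > 0" and b: "\<And>F. finite F \<Longrightarrow> (\<Sum>p\<in>F. norm (f p)) \<le> B"
  shows "(\<lambda>n. \<Sum>p\<in>D_index n M. f p) \<longlonglongrightarrow> infsum f UNIV"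
proof -
  have "(\<lambda>p. norm (f p)) summable_on UNIV"
    using b by (intro nonneg_bdd_above_summable_on) (auto simp: bdd_above_def)
  hence "f summable_on UNIV" by (rule abs_summable_summable)
  hence "(f has_sum infsum f UNIV) UNIV" by (rule has_sum_infsum)
  thus ?thesis
    unfolding has_sum_def by (rule filterlim_compose[OF _ filterlim_D_index[OF M]])
qed

section \<open>Wavelets\<close>

locale wavelet =
  fixes \<psi> :: "real \<Rightarrow> real"
  assumes lm: "lemarie_meyer_wavelet \<psi>"
begin

abbreviation "\<phi> \<equiv> fourier \<psi>"

section \<open>Regularity and support of the wavelet\<close>

lemma psi_moment_bounded: obtains C where "\<And>x. \<bar>x ^ i * \<psi> x\<bar> \<le> C / (1 + x\<^sup>2)"
proof -
  have "bounded (range (\<lambda>x. x ^ m * (deriv ^^ 0) \<psi> x))" for m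
    using lm unfolding lemarie_meyer_wavelet_def schwartz_def by blast
  hence "\<exists>C. \<forall>x. \<bar>x ^ m * \<psi> x\<bar> \<le> C" for m by (auto simp: bounded_iff)
  then obtain C where C: "\<And>m x. \<bar>x ^ m * \<psi> x\<bar> \<le> C m" by metis
  show ?thesis
  proof (rule that[of "C i + C (i + 2)"])
    fix x
    have "\<bar>x ^ i * \<psi> x\<bar> * (1 + x\<^sup>2) = \<bar>x ^ i * \<psi> x\<bar> + \<bar>x ^ (i + 2) * \<psi> x\<bar>"
      by (simp add: abs_mult power_add algebra_simps power2_eq_square)
    also have "\<dots> \<le> C i + C (i + 2)" by (intro add_mono C)
    finally show "\<bar>x ^ i * \<psi> x\<bar> \<le> (C i + C (i + 2)) / (1 + x\<^sup>2)"
      by (simp add: le_divide_eq add_pos_nonneg)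
  qed
qed

lemma psi_continuous: "continuous_on UNIV \<psi>"
proof -
  have "(deriv ^^ 0) \<psi> differentiable (at x)" for x
    using lm unfolding lemarie_meyer_wavelet_def schwartz_def by blast
  thus ?thesis
    by (auto simp: continuous_on_eq_continuous_within intro: differentiable_imp_continuous_within)
qed

lemma psi_measurable [measurable]: "\<psi> \<in> borel_measurable borel"
  using psi_continuous by (rule borel_measurable_continuous_onI)

lemma psi_moment_integrable: "integrable lborel (\<lambda>s. complex_of_real (s ^ i * \<psi> s))"
proof -
  obtain C where "\<And>x. \<bar>x ^ i * \<psi> x\<bar> \<le> C / (1 + x\<^sup>2)" using psi_moment_bounded[of i] by blast
  thus ?thesis by (intro integrable_quadratic_decay[of _ C]) (auto simp: norm_mult abs_mult norm_power power_abs)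
qed

lemma fourier_eq_fint: "\<phi> \<xi> = complex_of_real (1 / sqrt (2 * pi)) * fint (\<lambda>s. complex_of_real (\<psi> s)) (- \<xi>)"
  by (simp add: fourier_def fint_def mult_ac)

lemma C2_fint_psi: "C2 (fint (\<lambda>s. complex_of_real (\<psi> s)))"
proof -
  \<comment> \<open>The k-th derivative of the integrand in the frequency, without the exponential
    factor; the moments of the wavelet make each of these integrable.\<close>
  define f where "f k s = \<i> ^ k * complex_of_real (s ^ k * \<psi> s)" for k s
  have i: "integrable lborel (\<lambda>s. complex_of_real (s ^ l) * f k s)" for k l
  proof -
    have "integrable lborel (\<lambda>s. \<i> ^ k * complex_of_real (s ^ (l + k) * \<psi> s))"
      by (intro integrable_mult_right psi_moment_integrable)
    thus ?thesis by (simp add: f_def power_add mult_ac)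
  qed
  have d: "(fint (f k) has_vector_derivative fint (f (Suc k)) x) (at x)" for k x
  proof -
    have "(\<lambda>s. \<i> * (complex_of_real s * f k s)) = f (Suc k)"
      by (auto simp: f_def mult_ac)
    thus ?thesis
      using fint_has_vector_derivative[of "f k" x] i[of 0 k] i[of 1 k] i[of 2 k] by simp
  qed
  have "C2 (fint (f 0))"
    by (rule C2I[OF d d has_vector_derivative_UNIV_continuous[OF d]])
  moreover have "f 0 = (\<lambda>s. complex_of_real (\<psi> s))" by (auto simp: f_def)
  ultimately show ?thesis by simp
qed

lemma C2_fourier: "C2 \<phi>"
proof -
  have "C2 (\<lambda>\<xi>. complex_of_real (1 / sqrt (2 * pi)) * fint (\<lambda>s. complex_of_real (\<psi> s)) (-1 * \<xi>))"
    by (rule C2_mult[OF C2_const C2_dilate[OF C2_fint_psi]])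
  thus ?thesis by (simp add: fourier_eq_fint[abs_def])
qed

lemma fourier_measurable [measurable]: "\<phi> \<in> borel_measurable borel"
  using C2_continuous[OF C2_fourier] by (rule borel_measurable_continuous_onI)

text \<open>2 and 11 are integer substitutes for \<open>2 * pi / 3\<close> and
  \<open>8 * pi / 3\<close>, by 3 < pi < 4.\<close>

lemma fourier_support:
  assumes "\<bar>\<xi>\<bar> < 2 \<or> \<bar>\<xi>\<bar> > 11"
  shows "\<phi> \<xi> = 0"
proof (rule ccontr)
  assume "\<phi> \<xi> \<noteq> 0"
  hence "\<xi> \<in> closure {\<xi>. \<phi> \<xi> \<noteq> 0}" by (intro subsetD[OF closure_subset]) simp
  hence "\<xi> \<in> {\<xi>. 2 * pi / 3 \<le> \<bar>\<xi>\<bar> \<and> \<bar>\<xi>\<bar> \<le> 8 * pi / 3}"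
    using lm unfolding lemarie_meyer_wavelet_def by blast
  hence "2 * pi / 3 \<le> \<bar>\<xi>\<bar>" "\<bar>\<xi>\<bar> \<le> 8 * pi / 3" by auto
  moreover have "pi < 4" "pi > 3" using pi_less_4 pi_gt3 by auto
  ultimately have "2 < \<bar>\<xi>\<bar>" "\<bar>\<xi>\<bar> < 11" by (auto simp: field_simps)
  thus False using assms by auto
qed

lemma fourier_bounded: obtains B where "B > 0" "\<And>\<xi>. norm (\<phi> \<xi>) \<le> B"
proof
  define B where "B = norm (complex_of_real (1 / sqrt (2 * pi))) * (LINT s|lborel. norm (complex_of_real (\<psi> s))) + 1"
  show "B > 0" unfolding B_def by (intro add_nonneg_pos mult_nonneg_nonneg integral_nonneg_AE) auto
  fix \<xi>
  have "norm (\<phi> \<xi>) \<le> norm (complex_of_real (1 / sqrt (2 * pi))) * (LINT s|lborel. norm (complex_of_real (\<psi> s)))"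
    unfolding fourier_eq_fint norm_mult by (intro mult_left_mono norm_fint_le) auto
  thus "norm (\<phi> \<xi>) \<le> B" by (simp add: B_def)
qed

section \<open>The wavelet basis and its Fourier transform\<close>

definition E :: "int \<Rightarrow> int \<Rightarrow> real \<Rightarrow> real" where
  "E j k x = 2 powr (real_of_int j / 2) * \<psi> (2 powr real_of_int j * x - real_of_int k)"

text \<open>The unitary Fourier transform of \<open>E j k\<close>; \<open>psi_hat\<close> is the
  same function with the \<open>L\<^sup>2\<close> normalisation replaced by the
  \<open>L\<^sup>\<alpha>\<close> one.\<close>

definition Eh :: "int \<Rightarrow> int \<Rightarrow> real \<Rightarrow> complex" where
  "Eh j k \<xi> = complex_of_real (2 powr (- real_of_int j / 2)) *
     iexp (- (real_of_int k * 2 powr (- real_of_int j) * \<xi>)) * \<phi> (2 powr (- real_of_int j) * \<xi>)"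

lemma E_measurable [measurable]: "E j k \<in> borel_measurable borel"
  unfolding E_def by measurable

lemma Eh_measurable [measurable]: "Eh j k \<in> borel_measurable borel"
  unfolding Eh_def by measurable

lemma E_integrable: "integrable lborel (\<lambda>x. complex_of_real (E j k x))"
proof -
  have "integrable lborel (\<lambda>x. complex_of_real (\<psi> x))" using psi_moment_integrable[of 0] by simp
  from lborel_integrable_real_affine[OF this, of "2 powr real_of_int j" "- real_of_int k"]
  have "integrable lborel (\<lambda>x. complex_of_real (\<psi> (2 powr real_of_int j * x - real_of_int k)))"
    by (simp add: add.commute)
  from integrable_mult_right[OF this, of "complex_of_real (2 powr (real_of_int j / 2))"] show ?thesis
    by (simp add: E_def)
qed

lemma fint_E: "fint (\<lambda>x. complex_of_real (E j k x)) (- \<xi>) = complex_of_real (sqrt (2 * pi)) * Eh j k \<xi>"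
proof -
  define c where "c = 2 powr real_of_int j"
  define \<eta> where "\<eta> = 2 powr (- real_of_int j) * \<xi>"
  define f where "f s = iexp (- (\<eta> * s)) * complex_of_real (\<psi> s)" for s
  have c: "c > 0" by (simp add: c_def)
  have c\<eta>: "c * \<eta> = \<xi>" by (simp add: c_def \<eta>_def powr_minus)
  have h: "2 powr (real_of_int j / 2) = c * 2 powr (- real_of_int j / 2)"
    unfolding c_def by (simp flip: powr_add)
  have "(CLINT s|lborel. f s) = \<bar>c\<bar> *\<^sub>R (CLINT x|lborel. f (- real_of_int k + c * x))"
    using c by (intro lborel_integral_real_affine) auto
  also have "(\<lambda>x. f (- real_of_int k + c * x)) = (\<lambda>x. iexp (\<eta> * k) * (iexp (- \<xi> * x) * complex_of_real (\<psi> (c * x - real_of_int k))))"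
  proof
    fix x
    have "- (\<eta> * (- real_of_int k + c * x)) = \<eta> * k + - \<xi> * x"
      unfolding c\<eta>[symmetric] by (simp add: algebra_simps)
    hence "iexp (- (\<eta> * (- real_of_int k + c * x))) = iexp (\<eta> * k) * iexp (- \<xi> * x)"
      by (simp only: of_real_add distrib_left exp_add)
    thus "f (- real_of_int k + c * x) = iexp (\<eta> * k) * (iexp (- \<xi> * x) * complex_of_real (\<psi> (c * x - real_of_int k)))"
      by (simp add: f_def mult.assoc add.commute)
  qed
  finally have 1: "(CLINT s|lborel. f s) =
      c * (iexp (\<eta> * k) * (CLINT x|lborel. iexp (- \<xi> * x) * complex_of_real (\<psi> (c * x - real_of_int k))))"
    using c by (simp add: scaleR_conv_of_real)
  have 2: "(CLINT s|lborel. f s) = complex_of_real (sqrt (2 * pi)) * \<phi> \<eta>"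
    by (simp add: fourier_def f_def mult_ac)
  have 3: "iexp (- (\<eta> * k)) * iexp (\<eta> * k) = 1"
    by (simp flip: exp_add)
  have "fint (\<lambda>x. complex_of_real (E j k x)) (- \<xi>) = complex_of_real (2 powr (- real_of_int j / 2)) *
      (c * (CLINT x|lborel. iexp (- \<xi> * x) * complex_of_real (\<psi> (c * x - real_of_int k))))"
  proof -
    have "iexp (- \<xi> * x) * complex_of_real (E j k x) = complex_of_real (2 powr (- real_of_int j / 2)) * complex_of_real c *
        (iexp (- \<xi> * x) * complex_of_real (\<psi> (c * x - real_of_int k)))" for x
      unfolding E_def h c_def[symmetric] by (simp add: mult_ac)
    hence "fint (\<lambda>x. complex_of_real (E j k x)) (- \<xi>) =
        (CLINT x|lborel. complex_of_real (2 powr (- real_of_int j / 2)) * complex_of_real c *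
        (iexp (- \<xi> * x) * complex_of_real (\<psi> (c * x - real_of_int k))))"
      by (simp only: fint_def)
    thus ?thesis by (simp only: integral_mult_right_zero mult.assoc)
  qed
  also have "\<dots> = complex_of_real (2 powr (- real_of_int j / 2)) * (iexp (- (\<eta> * k)) * (CLINT s|lborel. f s))"
    unfolding 1 using 3 by (simp add: mult.assoc[symmetric] mult.commute[of _ "complex_of_real c"])
  also have "\<dots> = complex_of_real (sqrt (2 * pi)) * Eh j k \<xi>"
    unfolding 2 Eh_def \<eta>_def by (simp add: mult_ac)
  finally show ?thesis .
qed

lemma fint_E': "fint (\<lambda>x. complex_of_real (E j k x)) \<xi> = complex_of_real (sqrt (2 * pi)) * cnj (Eh j k \<xi>)"
proof -
  have "fint (\<lambda>x. complex_of_real (E j k x)) \<xi> = cnj (fint (\<lambda>x. complex_of_real (E j k x)) (- \<xi>))"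
    unfolding fint_def
    by (subst Bochner_Integration.integral_cnj[symmetric], intro Bochner_Integration.integral_cong) (simp_all add: exp_cnj)
  thus ?thesis by (simp add: fint_E)
qed

lemma basis_E: "orthonormal_basis_L2 (\<lambda>(j, k) x. complex_of_real (E j k x))"
  using lm unfolding lemarie_meyer_wavelet_def E_def by simp

text \<open>The singular weight meets the transform of the wavelet only where |\<eta>| >= 2, and
  there it coincides with its smooth replacement.\<close>

lemma psi_frac_eq_fint:
  "psi_frac \<psi> \<alpha> v = fint (\<lambda>\<eta>. \<phi> \<eta> * complex_of_real (smooth_powr (- (v + 1 / \<alpha>)) \<eta>))"
proof
  fix y
  have "\<phi> \<eta> / complex_of_real (\<bar>\<eta>\<bar> powr (v + 1 / \<alpha>)) = \<phi> \<eta> * complex_of_real (smooth_powr (- (v + 1 / \<alpha>)) \<eta>)" for \<eta>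
  proof (cases "\<bar>\<eta>\<bar> < 2")
    case True
    thus ?thesis using fourier_support[of \<eta>] by simp
  next
    case False
    hence "smooth_powr (- (v + 1 / \<alpha>)) \<eta> = \<bar>\<eta>\<bar> powr (- (v + 1 / \<alpha>))"
      by (intro smooth_powr_eq) auto
    also have "\<dots> = 1 / \<bar>\<eta>\<bar> powr (v + 1 / \<alpha>)" by (rule powr_minus_divide)
    finally show ?thesis by simp
  qed
  thus "psi_frac \<psi> \<alpha> v y = fint (\<lambda>\<eta>. \<phi> \<eta> * complex_of_real (smooth_powr (- (v + 1 / \<alpha>)) \<eta>)) y"
    by (simp add: psi_frac_def fint_def)
qed

text \<open>The later size estimates for increments of \<open>psi_frac\<close> rest on just this:
  quadratic decay of the function and of its derivative.\<close>

lemma psi_frac_regular: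
  obtains C \<theta> where "C \<ge> 0" "\<And>y. (psi_frac \<psi> \<alpha> v has_vector_derivative \<theta> y) (at y)"
    "\<And>y. norm (psi_frac \<psi> \<alpha> v y) \<le> C / (1 + y\<^sup>2)" "\<And>y. norm (\<theta> y) \<le> C / (1 + y\<^sup>2)"
proof -
  define h where "h \<eta> = \<phi> \<eta> * complex_of_real (smooth_powr (- (v + 1 / \<alpha>)) \<eta>)" for \<eta>
  define g where "g \<eta> = \<i> * (complex_of_real \<eta> * h \<eta>)" for \<eta>
  have eq: "psi_frac \<psi> \<alpha> v = fint h" unfolding psi_frac_eq_fint h_def ..
  have C2h: "C2 h" unfolding h_def by (rule C2_mult[OF C2_fourier C2_smooth_powr])
  have C2h1: "C2 (\<lambda>\<eta>. complex_of_real \<eta> * h \<eta>)" by (rule C2_mult[OF C2_ident C2h])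
  have C2h2: "C2 (\<lambda>\<eta>. complex_of_real (\<eta>\<^sup>2) * h \<eta>)"
    using C2_mult[OF C2_ident C2h1] by (simp add: power2_eq_square mult.assoc)
  have C2g: "C2 g" unfolding g_def by (rule C2_mult[OF C2_const C2h1])
  have supp: "\<And>x. \<bar>x\<bar> > 11 \<Longrightarrow> h x = 0" by (simp add: h_def fourier_support)
  note int = integrable_compact_support[OF C2_continuous[OF C2h] supp]
    integrable_compact_support[OF C2_continuous[OF C2h1], of 11]
    integrable_compact_support[OF C2_continuous[OF C2h2], of 11]
  obtain C1 where C1: "C1 \<ge> 0" "\<And>y. norm (fint h y) \<le> C1 / (1 + y\<^sup>2)"
    using fint_decay[OF C2h supp] by blast
  obtain C2 where C2: "C2 \<ge> 0" "\<And>y. norm (fint g y) \<le> C2 / (1 + y\<^sup>2)"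
    using fint_decay[OF C2g, of 11] supp by (auto simp: g_def)
  show ?thesis
  proof (rule that[of "C1 + C2" "fint g"])
    show "(psi_frac \<psi> \<alpha> v has_vector_derivative fint g y) (at y)" for y
      unfolding eq g_def by (rule fint_has_vector_derivative) (use int supp in auto)
    show "norm (psi_frac \<psi> \<alpha> v y) \<le> (C1 + C2) / (1 + y\<^sup>2)" for y
      unfolding eq by (rule order_trans[OF C1(2)]) (use C2(1) in \<open>auto intro!: divide_right_mono\<close>)
    show "norm (fint g y) \<le> (C1 + C2) / (1 + y\<^sup>2)" for y
      by (rule order_trans[OF C2(2)]) (use C1(1) in \<open>auto intro!: divide_right_mono\<close>)
  qed (use C1 C2 in auto)
qed

section \<open>Wavelet expansion of smooth bumps\<close>

definition coef :: "(real \<Rightarrow> complex) \<Rightarrow> int \<Rightarrow> int \<Rightarrow> complex" where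
  "coef V j k = (CLINT \<xi>|lborel. V \<xi> * cnj (Eh j k \<xi>))"

text \<open>The support of \<open>V\<close> is bounded and stays away from the origin, so it meets
  only finitely many of the dyadic annuli that carry the functions \<open>Eh j k\<close>. Within one
  scale the coefficients are samples of a Fourier integral and decay quadratically in
  \<open>k\<close>.\<close>

lemma coef_bound:
  assumes V: "C2 V" "a > 0" "\<And>x. \<bar>x\<bar> < a \<or> \<bar>x\<bar> > b \<Longrightarrow> V x = 0"
  obtains C j0 where "C \<ge> 0" "\<And>j k. norm (coef V j k) \<le> C / (1 + (real_of_int k)\<^sup>2)"
    "\<And>j k. \<bar>j\<bar> > int j0 \<Longrightarrow> coef V j k = 0"
proof -
  obtain j1 where j1: "max b 1 < 2 ^ j1" using real_arch_pow[of 2 "max b 1"] by auto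
  obtain j2 where j2: "11 / a < 2 ^ j2" using real_arch_pow[of 2 "11 / a"] by auto
  define j0 where "j0 = max j1 j2"
  \<comment> \<open>With this \<open>j0\<close>, scales above \<open>j0\<close> push the annulus
    beyond \<open>b\<close>, and scales below \<open>- j0\<close> push it inside
    \<open>a\<close>.\<close>
  have p: "b < 2 ^ j0" "11 / a < 2 ^ j0"
    using j1 j2 power_increasing[of j1 j0 "2::real"] power_increasing[of j2 j0 "2::real"]
    by (auto simp: j0_def intro: less_le_trans)
  have zero: "V \<xi> * cnj (Eh j k \<xi>) = 0" if j: "\<bar>j\<bar> > int j0" for j k \<xi>
  proof (rule ccontr)
    assume nz: "V \<xi> * cnj (Eh j k \<xi>) \<noteq> 0"
    hence "V \<xi> \<noteq> 0" "\<phi> (2 powr (- real_of_int j) * \<xi>) \<noteq> 0" by (auto simp: Eh_def)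
    hence "\<not> (\<bar>\<xi>\<bar> < a \<or> \<bar>\<xi>\<bar> > b)"
      "\<not> (\<bar>2 powr (- real_of_int j) * \<xi>\<bar> < 2 \<or> \<bar>2 powr (- real_of_int j) * \<xi>\<bar> > 11)"
      using V(3)[of \<xi>] fourier_support[of "2 powr (- real_of_int j) * \<xi>"] by blast+
    hence 1: "a \<le> \<bar>\<xi>\<bar>" "\<bar>\<xi>\<bar> \<le> b" "2 \<le> 2 powr (- real_of_int j) * \<bar>\<xi>\<bar>" "2 powr (- real_of_int j) * \<bar>\<xi>\<bar> \<le> 11"
      by (simp_all add: not_less abs_mult)
    show False
    proof (cases "j > 0")
      case True
      have "2 powr (- real_of_int j) \<le> 2 powr (- real j0)" using j True by (intro powr_mono) auto
      also have "\<dots> = 1 / 2 ^ j0" by (simp add: powr_minus_divide powr_realpow)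
      finally have "2 powr (- real_of_int j) * \<bar>\<xi>\<bar> \<le> 1 / 2 ^ j0 * b"
        using 1 by (intro mult_mono) auto
      also have "\<dots> < 1" using p by (simp add: divide_less_eq)
      finally show False using 1 by simp
    next
      case False
      have "11 < 2 ^ j0 * a" using p(2) V(2) by (simp add: divide_less_eq)
      also have "2 ^ j0 * a \<le> 2 powr (- real_of_int j) * \<bar>\<xi>\<bar>"
      proof (intro mult_mono)
        have "(2::real) ^ j0 = 2 powr (real j0)" by (simp add: powr_realpow)
        also have "\<dots> \<le> 2 powr (- real_of_int j)" using j False by (intro powr_mono) auto
        finally show "(2::real) ^ j0 \<le> 2 powr (- real_of_int j)" .
      qed (use 1 V in auto)
      finally show False using 1 by simp
    qed
  qed
  have "\<exists>C\<ge>0. \<forall>k. norm (coef V j k) \<le> C / (1 + (real_of_int k)\<^sup>2)" for j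
  proof -
    define c where "c = 2 powr (- real_of_int j)"
    have c: "c > 0" by (simp add: c_def)
    define W where "W \<xi> = V \<xi> * cnj (\<phi> (c * \<xi>))" for \<xi>
    have "C2 W" unfolding W_def by (intro C2_mult V C2_cnj C2_dilate C2_fourier)
    moreover have "\<And>x. \<bar>x\<bar> > b \<Longrightarrow> W x = 0" using V(3) by (simp add: W_def)
    ultimately obtain C where C: "C \<ge> 0" "\<And>y. norm (fint W y) \<le> C / (1 + y\<^sup>2)"
      using fint_decay by blast
    have eq: "coef V j k = complex_of_real (2 powr (- real_of_int j / 2)) * fint W (real_of_int k * c)" for k
    proof -
      have "V \<xi> * cnj (Eh j k \<xi>) = complex_of_real (2 powr (- real_of_int j / 2)) * (iexp (real_of_int k * c * \<xi>) * W \<xi>)" for \<xi>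
        unfolding Eh_def W_def c_def by (simp add: exp_cnj mult_ac)
      thus ?thesis by (simp only: coef_def fint_def integral_mult_right_zero)
    qed
    show ?thesis
    proof (intro exI[of _ "2 powr (- real_of_int j / 2) * (C * (1 + 1 / c\<^sup>2))"] conjI allI)
      fix k
      have "(1 + 1 / c\<^sup>2) * (1 + (real_of_int k * c)\<^sup>2) = 1 + (real_of_int k)\<^sup>2 + (1 / c\<^sup>2 + (real_of_int k * c)\<^sup>2)"
        using c by (simp add: field_simps power_mult_distrib)
      hence le: "1 + (real_of_int k)\<^sup>2 \<le> (1 + 1 / c\<^sup>2) * (1 + (real_of_int k * c)\<^sup>2)"
        by simp
      have "norm (coef V j k) \<le> 2 powr (- real_of_int j / 2) * (C / (1 + (real_of_int k * c)\<^sup>2))"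
        using mult_left_mono[OF C(2)[of "real_of_int k * c"], of "2 powr (- real_of_int j / 2)"]
        by (simp add: eq norm_mult)
      also have "C / (1 + (real_of_int k * c)\<^sup>2) \<le> C * (1 + 1 / c\<^sup>2) / (1 + (real_of_int k)\<^sup>2)"
        using mult_left_mono[OF le C(1)] by (simp add: divide_le_eq le_divide_eq add_pos_nonneg)
      finally show "norm (coef V j k) \<le> 2 powr (- real_of_int j / 2) * (C * (1 + 1 / c\<^sup>2)) / (1 + (real_of_int k)\<^sup>2)"
        by (simp add: mult_left_mono)
    qed (use C c in auto)
  qed
  then obtain C where C: "\<And>j. C j \<ge> 0" "\<And>j k. norm (coef V j k) \<le> C j / (1 + (real_of_int k)\<^sup>2)"
    by metis
  have z: "coef V j k = 0" if "\<bar>j\<bar> > int j0" for j k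
    unfolding coef_def by (simp add: zero[OF that])
  show ?thesis
  proof (rule that[of "\<Sum>j\<in>{- int j0..int j0}. C j" j0])
    show "norm (coef V j k) \<le> (\<Sum>j\<in>{- int j0..int j0}. C j) / (1 + (real_of_int k)\<^sup>2)" for j k
    proof (cases "j \<in> {- int j0..int j0}")
      case True
      have "C j \<le> (\<Sum>j\<in>{- int j0..int j0}. C j)"
        using True C by (intro member_le_sum) auto
      thus ?thesis by (intro order_trans[OF C(2)] divide_right_mono) auto
    next
      case False
      hence "coef V j k = 0" by (intro z) auto
      thus ?thesis using C by (auto intro!: divide_nonneg_nonneg sum_nonneg)
    qed
  qed (use C z in \<open>auto intro: sum_nonneg\<close>)
qed

text \<open>The bound is independent of the finite index set and belongs to both
  \<open>L\<^sup>1\<close> and \<open>L\<^sup>2\<close>: it dominates the partial sums in the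
  original variable and puts their limit into both spaces.\<close>

lemma E_partial_sums_bound:
  assumes V: "C2 V" "a > 0" "\<And>x. \<bar>x\<bar> < a \<or> \<bar>x\<bar> > b \<Longrightarrow> V x = 0"
  obtains L where "L \<ge> 0"
    "\<And>F x. finite F \<Longrightarrow> (\<Sum>(j, k)\<in>F. norm (coef V j k * complex_of_real (E j k x))) \<le> L / (1 + x\<^sup>2)"
proof -
  obtain C j0 where C: "C \<ge> 0" "\<And>j k. norm (coef V j k) \<le> C / (1 + (real_of_int k)\<^sup>2)"
    "\<And>j k. \<bar>j\<bar> > int j0 \<Longrightarrow> coef V j k = 0"
    using coef_bound[OF V] by blast
  obtain c where c: "\<And>x. \<bar>x ^ 0 * \<psi> x\<bar> \<le> c / (1 + x\<^sup>2)" using psi_moment_bounded[of 0] by blast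
  have c0: "c \<ge> 0" using c[of 0] by simp
  obtain K where K: "K \<ge> 0"
    "\<And>F y. finite F \<Longrightarrow> (\<Sum>k\<in>F. 1 / (1 + (real_of_int k)\<^sup>2) * (1 / (1 + (y - real_of_int k)\<^sup>2))) \<le> K / (1 + y\<^sup>2)"
    using sum_convolution_inverse_square_bounded by blast
  define B where "B j = C * (2 powr (real_of_int j / 2) * c) * (K * (1 + 1 / (2 powr real_of_int j)\<^sup>2))" for j :: int
  have B0: "B j \<ge> 0" for j using C c0 K by (simp add: B_def)
  show ?thesis
  proof (rule that[of "\<Sum>j\<in>{- int j0..int j0}. B j"])
    show "(\<Sum>j\<in>{- int j0..int j0}. B j) \<ge> 0" using B0 by (intro sum_nonneg)
    fix F :: "(int \<times> int) set" and x :: real assume F: "finite F"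
    have "(\<Sum>p\<in>F. case p of (j, k) \<Rightarrow> norm (coef V j k * complex_of_real (E j k x))) \<le>
        (\<Sum>j\<in>fst ` F. if j \<in> {- int j0..int j0} then B j / (1 + x\<^sup>2) else 0)"
    proof (rule sum_int_pairs_le[OF F])
      fix j and G :: "int set" assume G: "finite G"
      show "(\<Sum>k\<in>G. case (j, k) of (j, k) \<Rightarrow> norm (coef V j k * complex_of_real (E j k x))) \<le>
          (if j \<in> {- int j0..int j0} then B j / (1 + x\<^sup>2) else 0)"
      proof (cases "j \<in> {- int j0..int j0}")
        case False
        hence "coef V j k = 0" for k by (intro C) auto
        thus ?thesis using False by (simp del: atLeastAtMost_iff)
      next
        case True
        define d where "d = 2 powr real_of_int j"
        have d: "d > 0" by (simp add: d_def)
        have "(\<Sum>k\<in>G. norm (coef V j k * complex_of_real (E j k x))) \<le>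
          (\<Sum>k\<in>G. (C * (2 powr (real_of_int j / 2) * c)) * (1 / (1 + (real_of_int k)\<^sup>2) * (1 / (1 + (d * x - real_of_int k)\<^sup>2))))"
        proof (rule sum_mono)
          fix k
          have "norm (coef V j k * complex_of_real (E j k x)) =
              norm (coef V j k) * (2 powr (real_of_int j / 2) * \<bar>\<psi> (d * x - real_of_int k)\<bar>)"
            by (simp add: norm_mult E_def abs_mult d_def)
          also have "\<dots> \<le> C / (1 + (real_of_int k)\<^sup>2) * (2 powr (real_of_int j / 2) * (c / (1 + (d * x - real_of_int k)\<^sup>2)))"
            using c[of "d * x - real_of_int k"] C c0 by (intro mult_mono C) auto
          finally show "norm (coef V j k * complex_of_real (E j k x)) \<le>
            (C * (2 powr (real_of_int j / 2) * c)) * (1 / (1 + (real_of_int k)\<^sup>2) * (1 / (1 + (d * x - real_of_int k)\<^sup>2)))"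
            by simp
        qed
        also have "\<dots> \<le> (C * (2 powr (real_of_int j / 2) * c)) * (K / (1 + (d * x)\<^sup>2))"
          unfolding sum_distrib_left[symmetric] using C c0 G by (intro mult_left_mono K) auto
        also have "\<dots> \<le> (C * (2 powr (real_of_int j / 2) * c)) * ((K * (1 + 1 / d\<^sup>2)) / (1 + x\<^sup>2))"
        proof (intro mult_left_mono)
          have "(1 + 1 / d\<^sup>2) * (1 + (d * x)\<^sup>2) = 1 + x\<^sup>2 + (1 / d\<^sup>2 + (d * x)\<^sup>2)"
            using d by (simp add: field_simps power_mult_distrib)
          hence le: "1 + x\<^sup>2 \<le> (1 + 1 / d\<^sup>2) * (1 + (d * x)\<^sup>2)" by simp
          show "K / (1 + (d * x)\<^sup>2) \<le> (K * (1 + 1 / d\<^sup>2)) / (1 + x\<^sup>2)"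
            using mult_left_mono[OF le K(1)] by (simp add: divide_le_eq le_divide_eq add_pos_nonneg)
        qed (use C c0 in auto)
        finally show ?thesis using True by (simp add: B_def d_def)
      qed
    qed auto
    also have "\<dots> = (\<Sum>j\<in>fst ` F \<inter> {- int j0..int j0}. B j / (1 + x\<^sup>2))"
      using F by (subst sum.inter_restrict) auto
    also have "\<dots> \<le> (\<Sum>j\<in>{- int j0..int j0}. B j / (1 + x\<^sup>2))"
      using B0 by (intro sum_mono2) auto
    finally show "(\<Sum>(j, k)\<in>F. norm (coef V j k * complex_of_real (E j k x))) \<le> (\<Sum>j\<in>{- int j0..int j0}. B j) / (1 + x\<^sup>2)"
      by (simp add: sum_divide_distrib)
  qed
qed

lemma E_bounded: obtains B where "\<And>x. \<bar>E j k x\<bar> \<le> B"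
proof -
  obtain c where c: "\<And>x. \<bar>x ^ 0 * \<psi> x\<bar> \<le> c / (1 + x\<^sup>2)" using psi_moment_bounded[of 0] by blast
  have c0: "c \<ge> 0" using c[of 0] by simp
  have c1: "\<bar>\<psi> x\<bar> \<le> c" for x
  proof -
    have "\<bar>\<psi> x\<bar> \<le> c / (1 + x\<^sup>2)" using c[of x] by simp
    also have "\<dots> \<le> c / 1" using c0 by (intro divide_left_mono) (auto intro: add_pos_nonneg)
    finally show ?thesis by simp
  qed
  show ?thesis
    by (rule that[of "2 powr (real_of_int j / 2) * c"]) (auto simp: E_def abs_mult intro!: mult_left_mono c1)
qed

text \<open>An orthonormal basis by itself yields convergence in mean. Here the partial sums in the
  original variable converge absolutely at every point; up to a constant, their limit has the same
  inner products with the basis as the transform of \<open>V\<close>, so by completeness the two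
  agree almost everywhere. Inverting the transform gives convergence at every
  \<open>\<eta>\<close>.\<close>

theorem wavelet_expansion:
  assumes V: "C2 V" "a > 0" "\<And>x. \<bar>x\<bar> < a \<or> \<bar>x\<bar> > b \<Longrightarrow> V x = 0" and M: "M > 0"
  shows "(\<lambda>n. \<Sum>(j, k)\<in>D_index n M. coef V j k * Eh j k \<eta>) \<longlonglongrightarrow> V \<eta>"
proof -
  obtain L where L: "L \<ge> 0"
    "\<And>F x. finite F \<Longrightarrow> (\<Sum>(j, k)\<in>F. norm (coef V j k * complex_of_real (E j k x))) \<le> L / (1 + x\<^sup>2)"
    using E_partial_sums_bound[OF V] by blast
  have Vsupp: "\<And>x. \<bar>x\<bar> > b \<Longrightarrow> V x = 0" using V by auto
  obtain CV where CV: "CV \<ge> 0" "\<And>y. norm (fint V y) \<le> CV / (1 + y\<^sup>2)"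
    using fint_decay[OF V(1) Vsupp] by blast
  have Vc: "continuous_on UNIV V" by (rule C2_continuous[OF V(1)])
  have Vi: "integrable lborel V" by (rule integrable_compact_support[OF Vc Vsupp])
  note [measurable] = borel_measurable_integrable[OF Vi]
  have fVm[measurable]: "fint V \<in> borel_measurable borel"
    unfolding fint_def by measurable
  have fVi: "integrable lborel (fint V)" by (rule integrable_quadratic_decay[OF fVm CV(2)])
  \<comment> \<open>\<open>fint\<close> is not unitary; \<open>s\<close> is the factor by which it
    differs from a unitary transform.\<close>
  define s where "s = complex_of_real (sqrt (2 * pi))"
  have ss: "s * s = 2 * complex_of_real pi" unfolding s_def of_real_mult[symmetric] real_sqrt_mult_self by simp
  have s0: "s \<noteq> 0" by (simp add: s_def)
  define f where "f x = (\<lambda>(j, k). coef V j k * complex_of_real (E j k x))" for x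
  have fb: "(\<Sum>p\<in>F. norm (f x p)) \<le> L / (1 + x\<^sup>2)" if "finite F" for F x
    using L(2)[OF that, of x] by (simp add: f_def case_prod_unfold)
  define v where "v n x = (\<Sum>p\<in>D_index n M. f x p)" for n x
  define vt where "vt x = infsum (f x) UNIV" for x
  have lim: "(\<lambda>n. v n x) \<longlonglongrightarrow> vt x" for x
    unfolding v_def vt_def by (rule abs_summable_D_index_limit[OF M fb])
  have vb: "norm (v n x) \<le> L / (1 + x\<^sup>2)" for n x
    unfolding v_def by (rule order_trans[OF norm_sum fb[OF finite_D_index]])
  have vtb: "norm (vt x) \<le> L / (1 + x\<^sup>2)" for x
    by (rule LIMSEQ_le_const2[OF tendsto_norm[OF lim]]) (use vb in auto)
  have vm[measurable]: "v n \<in> borel_measurable borel" for n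
    unfolding v_def f_def case_prod_unfold by measurable
  have vtm[measurable]: "vt \<in> borel_measurable borel"
    by (rule borel_measurable_LIMSEQ_metric[OF vm lim])
  define i2 where "i2 = (\<lambda>x::real. L * (1 / (1 + x\<^sup>2)))"
  have i2: "integrable lborel i2" unfolding i2_def by (intro integrable_mult_right integrable_inverse_square)
  have conv: "(\<lambda>n. CLINT x|lborel. v n x * g x) \<longlonglongrightarrow> (CLINT x|lborel. vt x * g x)"
    if g: "g \<in> borel_measurable borel" "\<And>x. norm (g x) \<le> B" for g B
  proof (rule integral_dominated_convergence[where w = "\<lambda>x. B * i2 x"])
    note [measurable] = g(1)
    have B0: "B \<ge> 0" using g(2)[of 0] norm_ge_zero order_trans by blast
    show "AE x in lborel. (\<lambda>n. v n x * g x) \<longlonglongrightarrow> vt x * g x"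
      by (intro AE_I2 tendsto_intros lim)
    show "AE x in lborel. norm (v n x * g x) \<le> B * i2 x" for n
    proof (intro AE_I2)
      fix x
      have "norm (v n x * g x) \<le> (L / (1 + x\<^sup>2)) * B"
        unfolding norm_mult using vb[of n x] g(2)[of x] B0 L(1) by (intro mult_mono) auto
      thus "norm (v n x * g x) \<le> B * i2 x" by (simp add: i2_def mult.commute)
    qed
  qed (use g(1) i2 in auto)
  have vtE: "(CLINT x|lborel. vt x * complex_of_real (E j k x)) = coef V j k" for j k
  proof -
    obtain B where B: "\<And>x. \<bar>E j k x\<bar> \<le> B" using E_bounded by blast
    have inn: "(CLINT x|lborel. complex_of_real (E j' k' x) * complex_of_real (E j k x)) = (if (j', k') = (j, k) then 1 else 0)"
      and inni: "integrable lborel (\<lambda>x. complex_of_real (E j' k' x) * complex_of_real (E j k x))" for j' k'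
    proof -
      note ob = basis_E[unfolded orthonormal_basis_L2_def]
      show "(CLINT x|lborel. complex_of_real (E j' k' x) * complex_of_real (E j k x)) = (if (j', k') = (j, k) then 1 else 0)"
        using conjunct1[OF conjunct2[OF ob], rule_format, of "(j', k')" "(j, k)"] by simp
      show "integrable lborel (\<lambda>x. complex_of_real (E j' k' x) * complex_of_real (E j k x))"
        using Lp_fun_2_mult_integrable[OF conjunct1[OF ob, rule_format, of "(j', k')"] conjunct1[OF ob, rule_format, of "(j, k)"]] by simp
    qed
    have fin: "(CLINT x|lborel. v n x * complex_of_real (E j k x)) = (if (j, k) \<in> D_index n M then coef V j k else 0)" for n
    proof -
      have "(CLINT x|lborel. v n x * complex_of_real (E j k x)) =
          (CLINT x|lborel. (\<Sum>p\<in>D_index n M. coef V (fst p) (snd p) * (complex_of_real (E (fst p) (snd p) x) * complex_of_real (E j k x))))"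
        by (simp only: v_def f_def case_prod_unfold sum_distrib_right mult.assoc)
      also have "\<dots> = (\<Sum>p\<in>D_index n M. coef V (fst p) (snd p) * (if p = (j, k) then 1 else 0))"
        by (subst Bochner_Integration.integral_sum) (auto simp: inni inn)
      also have "\<dots> = (\<Sum>p\<in>D_index n M. if p = (j, k) then coef V j k else 0)"
        by (intro sum.cong) auto
      also have "\<dots> = (if (j, k) \<in> D_index n M then coef V j k else 0)"
        by (simp add: finite_D_index)
      finally show ?thesis .
    qed
    \<comment> \<open>Each index belongs to the exhausting sets from some stage on, so the inner
      product of its basis function with the partial sums is eventually constant.\<close>
    have "eventually (\<lambda>n. (j, k) \<in> D_index n M) sequentially"
    proof -
      have "eventually (\<lambda>n. finite (D_index n M) \<and> {(j, k)} \<subseteq> D_index n M \<and> D_index n M \<subseteq> UNIV) sequentially"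
        using filterlim_D_index[OF M, unfolded filterlim_finite_subsets_at_top, rule_format, of "{(j, k)}"] by simp
      thus ?thesis by eventually_elim auto
    qed
    hence "eventually (\<lambda>n. (CLINT x|lborel. v n x * complex_of_real (E j k x)) = coef V j k) sequentially"
      by eventually_elim (simp add: fin)
    hence "(\<lambda>n. CLINT x|lborel. v n x * complex_of_real (E j k x)) \<longlonglongrightarrow> coef V j k"
      by (rule tendsto_eventually)
    moreover have "(\<lambda>n. CLINT x|lborel. v n x * complex_of_real (E j k x)) \<longlonglongrightarrow> (CLINT x|lborel. vt x * complex_of_real (E j k x))"
      by (rule conv[of _ B]) (use B in auto)
    ultimately show ?thesis using LIMSEQ_unique by blast
  qed
  have fVE: "(CLINT x|lborel. fint V x * complex_of_real (E j k x)) = s * coef V j k" for j k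
  proof -
    have "(CLINT x|lborel. fint V x * complex_of_real (E j k x)) = (CLINT x|lborel. complex_of_real (E j k x) * fint V x)"
      by (simp add: mult.commute)
    also have "\<dots> = (CLINT y|lborel. V y * fint (\<lambda>x. complex_of_real (E j k x)) y)"
      by (rule fint_multiplication_formula[OF E_integrable Vi])
    also have "\<dots> = (CLINT y|lborel. s * (V y * cnj (Eh j k y)))"
      by (simp add: fint_E' s_def mult_ac)
    finally show ?thesis by (simp only: coef_def integral_mult_right_zero)
  qed
  \<comment> \<open>The transform of \<open>V\<close> minus the rescaled sum of the series; all its
    inner products with the basis vanish.\<close>
  define D where "D x = fint V x - s * vt x" for x
  have [measurable]: "D \<in> borel_measurable borel" unfolding D_def by measurable
  have Db: "norm (D x) \<le> (CV + norm s * L) / (1 + x\<^sup>2)" for x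
  proof -
    have "norm (D x) \<le> norm (fint V x) + norm s * norm (vt x)"
      unfolding D_def using norm_triangle_ineq4[of "fint V x" "s * vt x"] by (simp add: norm_mult)
    also have "\<dots> \<le> CV / (1 + x\<^sup>2) + norm s * (L / (1 + x\<^sup>2))"
      by (intro add_mono CV mult_left_mono vtb) auto
    finally show ?thesis by (simp add: add_divide_distrib)
  qed
  have DL: "D \<in> Lp_fun 2"
  proof -
    define c where "c = CV + norm s * L"
    have c: "c \<ge> 0" using CV L by (simp add: c_def)
    have "(norm (D x))\<^sup>2 \<le> c\<^sup>2 / (1 + x\<^sup>2)" for x
    proof -
      have "(norm (D x))\<^sup>2 \<le> (c / (1 + x\<^sup>2))\<^sup>2"
        using Db[of x] by (intro power_mono) (auto simp: c_def)
      also have "\<dots> = c\<^sup>2 / ((1 + x\<^sup>2) * (1 + x\<^sup>2))" by (simp add: power2_eq_square)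
      also have "\<dots> \<le> c\<^sup>2 / ((1 + x\<^sup>2) * 1)"
        by (intro divide_left_mono mult_left_mono mult_pos_pos) (auto intro: add_pos_nonneg)
      finally show ?thesis by simp
    qed
    hence "integrable lborel (\<lambda>x. (norm (D x))\<^sup>2)"
      by (intro integrable_quadratic_decay[of _ "c\<^sup>2"]) auto
    thus ?thesis by (simp add: Lp_fun_def powr_numeral)
  qed
  have "AE x in lborel. D x = 0"
  proof (rule orthonormal_basis_complete[OF basis_E DL])
    fix i :: "int \<times> int"
    obtain j k where i: "i = (j, k)" by (cases i)
    obtain B where B: "\<And>x. \<bar>E j k x\<bar> \<le> B" using E_bounded by blast
    have prod: "integrable lborel (\<lambda>x. h x * complex_of_real (E j k x))" if "integrable lborel h" for h
    proof (rule Bochner_Integration.integrable_bound[OF integrable_mult_right[OF that, of "complex_of_real B"]])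
      note [measurable] = borel_measurable_integrable[OF that]
      show "(\<lambda>x. h x * complex_of_real (E j k x)) \<in> borel_measurable lborel" by measurable
      have "B \<ge> 0" using B[of 0] by (meson abs_ge_zero order_trans)
      thus "AE x in lborel. norm (h x * complex_of_real (E j k x)) \<le> norm (complex_of_real B * h x)"
        using B by (intro AE_I2) (auto simp: norm_mult mult.commute[of B] intro!: mult_left_mono)
    qed
    have vti: "integrable lborel vt" by (rule integrable_quadratic_decay[OF vtm vtb])
    have "(CLINT x|lborel. D x * complex_of_real (E j k x)) =
        (CLINT x|lborel. fint V x * complex_of_real (E j k x) - s * (vt x * complex_of_real (E j k x)))"
      by (simp add: D_def algebra_simps)
    also have "\<dots> = (CLINT x|lborel. fint V x * complex_of_real (E j k x)) - s * (CLINT x|lborel. vt x * complex_of_real (E j k x))"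
      using prod[OF fVi] prod[OF vti] by (subst Bochner_Integration.integral_diff) auto
    also have "\<dots> = 0" by (simp add: fVE vtE)
    finally show "(LINT x|lborel. D x * cnj ((case i of (j, k) \<Rightarrow> \<lambda>x. complex_of_real (E j k x)) x)) = 0"
      by (simp add: i)
  qed
  hence AE: "AE x in lborel. iexp (- \<eta> * x) * fint V x = s * (vt x * iexp (- \<eta> * x))"
    by eventually_elim (simp add: D_def mult_ac)
  have "compact (V ` {-b..b})" by (intro compact_continuous_image continuous_on_subset[OF Vc]) auto
  hence "bounded (V ` {-b..b})" by (rule compact_imp_bounded)
  then obtain B where "\<forall>y\<in>V ` {-b..b}. norm y \<le> B"
    unfolding bounded_iff by (rule exE)
  hence B: "norm (V x) \<le> B" if "x \<in> {-b..b}" for x using that by simp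
  have VB: "norm (V x) \<le> \<bar>B\<bar>" for x
    using B[of x] Vsupp[of x] by (cases "\<bar>x\<bar> \<le> b") (auto simp: abs_le_iff intro: order_trans)
  have "2 * complex_of_real pi * V \<eta> = fint (fint V) (- \<eta>)"
    by (rule fint_inversion[OF Vc Vi VB fVi, symmetric])
  also have "\<dots> = (CLINT x|lborel. s * (vt x * iexp (- \<eta> * x)))"
    unfolding fint_def[of "fint V"] by (rule integral_cong_AE) (use AE in auto)
  also have "\<dots> = s * (CLINT x|lborel. vt x * iexp (- \<eta> * x))" by simp
  finally have 1: "s * (s * V \<eta>) = s * (CLINT x|lborel. vt x * iexp (- \<eta> * x))"
    by (simp only: ss mult.assoc[symmetric])
  hence 2: "(CLINT x|lborel. vt x * iexp (- \<eta> * x)) = s * V \<eta>" using s0 by simp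
  have 3: "(CLINT x|lborel. v n x * iexp (- \<eta> * x)) = s * (\<Sum>(j, k)\<in>D_index n M. coef V j k * Eh j k \<eta>)" for n
  proof -
    have "(CLINT x|lborel. v n x * iexp (- \<eta> * x)) =
        (CLINT x|lborel. (\<Sum>p\<in>D_index n M. coef V (fst p) (snd p) * (iexp (- \<eta> * x) * complex_of_real (E (fst p) (snd p) x))))"
    proof (intro Bochner_Integration.integral_cong refl)
      fix x
      show "v n x * iexp (- \<eta> * x) =
          (\<Sum>p\<in>D_index n M. coef V (fst p) (snd p) * (iexp (- \<eta> * x) * complex_of_real (E (fst p) (snd p) x)))"
        unfolding v_def f_def case_prod_unfold sum_distrib_right by (intro sum.cong refl) (simp only: mult_ac)
    qed
    also have "\<dots> = (\<Sum>p\<in>D_index n M. coef V (fst p) (snd p) * fint (\<lambda>x. complex_of_real (E (fst p) (snd p) x)) (- \<eta>))"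
    proof -
      have i: "integrable lborel (\<lambda>x. coef V j k * (iexp (- \<eta> * x) * complex_of_real (E j k x)))" for j k
        by (intro integrable_mult_right integrable_iexp_mult E_integrable) measurable
      show ?thesis
        unfolding fint_def Bochner_Integration.integral_sum[OF i] by (simp only: integral_mult_right_zero)
    qed
    also have "\<dots> = s * (\<Sum>(j, k)\<in>D_index n M. coef V j k * Eh j k \<eta>)"
      by (simp add: fint_E s_def case_prod_unfold sum_distrib_left mult_ac)
    finally show ?thesis .
  qed
  have "(\<lambda>n. CLINT x|lborel. v n x * iexp (- \<eta> * x)) \<longlonglongrightarrow> (CLINT x|lborel. vt x * iexp (- \<eta> * x))"
    by (rule conv[of _ 1]) auto
  hence "(\<lambda>n. s * (\<Sum>(j, k)\<in>D_index n M. coef V j k * Eh j k \<eta>)) \<longlonglongrightarrow> s * V \<eta>"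
    unfolding 2 3 .
  from tendsto_mult_left[OF this, of "inverse s"] show ?thesis
    using s0 by (simp add: mult.assoc[symmetric])
qed

end

section \<open>Hoelder bounds for weighted dyadic sums\<close>

text \<open>The constant is the same for all exponents \<open>\<beta>\<close>, so that the exponent
  may later depend on the scale. For distant points the power of the distance is at least 1 and the
  decay suffices. For close points the mean value theorem applies, with 8 = 2 * 4: 2 from comparing
  two forms of quadratic decay, 4 from moving the centre by at most 1.\<close>

lemma increment_bound:
  fixes f :: "real \<Rightarrow> complex"
  assumes C: "C \<ge> 0" and f: "\<And>y. norm (f y) \<le> C / (1 + y\<^sup>2)"
    and f': "\<And>y. (f has_vector_derivative \<theta> y) (at y)" "\<And>y. norm (\<theta> y) \<le> C / (1 + y\<^sup>2)"
    and b: "0 < \<beta>" "\<beta> \<le> 1"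
  shows "norm (f y - f z) \<le> 8 * C * \<bar>y - z\<bar> powr \<beta> * ((1 + \<bar>y\<bar>) powr (-2) + (1 + \<bar>z\<bar>) powr (-2))"
proof (cases "\<bar>y - z\<bar> \<le> 1")
  case False
  hence x: "1 \<le> \<bar>y - z\<bar> powr \<beta>" using b by (simp add: ge_one_powr_ge_zero)
  have le: "C / (1 + u\<^sup>2) \<le> 2 * C * (1 + \<bar>u\<bar>) powr (-2)" for u
    using mult_left_mono[OF inverse_square_le_powr[of u] C] by simp
  have "norm (f y - f z) \<le> norm (f y) + norm (f z)" by (rule norm_triangle_ineq4)
  also have "\<dots> \<le> 2 * C * (1 + \<bar>y\<bar>) powr (-2) + 2 * C * (1 + \<bar>z\<bar>) powr (-2)"
    by (intro add_mono order_trans[OF f le])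
  also have "\<dots> = 2 * C * 1 * ((1 + \<bar>y\<bar>) powr (-2) + (1 + \<bar>z\<bar>) powr (-2))" by (simp add: algebra_simps)
  also have "\<dots> \<le> 8 * C * \<bar>y - z\<bar> powr \<beta> * ((1 + \<bar>y\<bar>) powr (-2) + (1 + \<bar>z\<bar>) powr (-2))"
    using C x by (intro mult_right_mono mult_mono) auto
  finally show ?thesis .
next
  case True
  define B where "B = 8 * C * (1 + \<bar>y\<bar>) powr (-2)"
  have der: "norm (\<theta> u) \<le> B" if "u \<in> {min y z..max y z}" for u
  proof -
    have "\<bar>y - u\<bar> \<le> 1" using that True by (auto simp: min_def max_def split: if_splits)
    moreover have "\<bar>y\<bar> \<le> \<bar>u\<bar> + \<bar>y - u\<bar>" using abs_triangle_ineq[of u "y - u"] by simp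
    ultimately have "(1 + \<bar>y\<bar>) / 2 \<le> 1 + \<bar>u\<bar>" by simp
    hence "(1 + \<bar>u\<bar>) powr (-2) \<le> ((1 + \<bar>y\<bar>) / 2) powr (-2)" by (intro powr_mono2') auto
    also have "\<dots> = 4 * (1 + \<bar>y\<bar>) powr (-2)" by (simp add: powr_divide powr_minus_divide powr_numeral)
    finally have u: "(1 + \<bar>u\<bar>) powr (-2) \<le> 4 * (1 + \<bar>y\<bar>) powr (-2)" .
    have "norm (\<theta> u) \<le> C * (1 / (1 + u\<^sup>2))" using f'(2)[of u] by simp
    also have "\<dots> \<le> C * (2 * (1 + \<bar>u\<bar>) powr (-2))" by (intro mult_left_mono inverse_square_le_powr C)
    also have "\<dots> \<le> C * (2 * (4 * (1 + \<bar>y\<bar>) powr (-2)))" using C u by (intro mult_left_mono) auto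
    finally show ?thesis by (simp add: B_def)
  qed
  have "norm (f y - f z) \<le> B * norm (y - z)"
  proof (rule differentiable_bound[of "{min y z..max y z}" f "\<lambda>u h. h *\<^sub>R \<theta> u"])
    fix u assume u: "u \<in> {min y z..max y z}"
    show "(f has_derivative (\<lambda>h. h *\<^sub>R \<theta> u)) (at u within {min y z..max y z})"
      using f'(1)[of u] unfolding has_vector_derivative_def by (rule has_derivative_at_withinI)
    show "onorm (\<lambda>h. h *\<^sub>R \<theta> u) \<le> B"
      using der[OF u] by (intro onorm_le) (simp add: mult.commute[of _ "norm (\<theta> u)"] mult_right_mono)
  qed auto
  also have "\<dots> = 8 * C * \<bar>y - z\<bar> * (1 + \<bar>y\<bar>) powr (-2)" by (simp add: B_def)
  also have "\<dots> \<le> 8 * C * \<bar>y - z\<bar> powr \<beta> * ((1 + \<bar>y\<bar>) powr (-2) + (1 + \<bar>z\<bar>) powr (-2))"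
  proof (intro mult_mono mult_left_mono)
    show "\<bar>y - z\<bar> \<le> \<bar>y - z\<bar> powr \<beta>"
    proof (cases "y = z")
      case False
      thus ?thesis using powr_mono'[of \<beta> 1 "\<bar>y - z\<bar>"] True b by simp
    qed simp
  qed (use C in auto)
  finally show ?thesis .
qed

text \<open>The weights to the power -2 are summable over all indices, small positive powers absorb
  the growth of the random coefficients, and outside \<open>D_index n M\<close> the weight is at
  least of order \<open>2 ^ n\<close>, so that a spare power yields a geometric rate.\<close>

definition wt :: "int \<times> int \<Rightarrow> real" where
  "wt = (\<lambda>(j, k). 2 powr \<bar>real_of_int j\<bar> * (1 + \<bar>real_of_int k\<bar>))"

lemma wt_ge_1: "wt p \<ge> 1"
proof -
  have "1 * 1 \<le> 2 powr \<bar>real_of_int j\<bar> * (1 + \<bar>real_of_int k\<bar>)" for j k :: int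
    by (intro mult_mono) (auto intro: ge_one_powr_ge_zero)
  thus ?thesis by (auto simp: wt_def split: prod.splits)
qed

text \<open>For j >= 0 the gain 2^(-jH) must beat 2^(j \<gamma>) from the Hoelder bound and 2^(2j
  \<delta>) from the weight, which enters through |j| and again through |k|, of size up to 2^j where
  the terms are large. For j < 0 the loss 2^(|j| H), with one weight factor 2^(|j| \<delta>), is
  beaten by 2^(-|j|) from the Lipschitz bound. These are the two inequalities on
  \<open>H\<close>.\<close>

lemma weighted_increment_sum:
  fixes f :: "real \<Rightarrow> complex"
  assumes inc: "\<And>\<beta> y z. 0 < \<beta> \<Longrightarrow> \<beta> \<le> 1 \<Longrightarrow>
      norm (f y - f z) \<le> C * \<bar>y - z\<bar> powr \<beta> * ((1 + \<bar>y\<bar>) powr (-2) + (1 + \<bar>z\<bar>) powr (-2))"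
    and C: "C \<ge> 0" and \<gamma>: "0 < \<gamma>" "\<gamma> < 1" and \<delta>: "0 < \<delta>" "\<delta> \<le> 1/2" "\<gamma> + 2 * \<delta> < H" "H + \<delta> < 1" and M: "M > 0"
  obtains B where "B \<ge> 0" "\<And>F s t. finite F \<Longrightarrow> \<bar>s\<bar> \<le> M \<Longrightarrow> \<bar>t\<bar> \<le> M \<Longrightarrow>
    (\<Sum>(j, k)\<in>F. 2 powr (- real_of_int j * H) * wt (j, k) powr \<delta> *
       norm (f (2 powr real_of_int j * t - real_of_int k) - f (2 powr real_of_int j * s - real_of_int k))) \<le> B * \<bar>t - s\<bar> powr \<gamma>"
proof -
  obtain K where K: "K \<ge> 0" "\<And>F y. finite F \<Longrightarrow> (\<Sum>k\<in>F. (1 + \<bar>y - real_of_int k\<bar>) powr (- (3/2))) \<le> K"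
    using sum_shifted_powr_bounded[of "3/2"] by auto
  define \<epsilon> where "\<epsilon> = min (H - 2 * \<delta> - \<gamma>) (1 - H - \<delta>)"
  have \<epsilon>: "\<epsilon> > 0" using \<delta> by (simp add: \<epsilon>_def)
  obtain G where G: "G \<ge> 0" "\<And>F. finite F \<Longrightarrow> (\<Sum>j\<in>F. 2 powr (- \<epsilon> * \<bar>real_of_int j\<bar>)) \<le> G"
    using sum_int_geometric_bounded[OF \<epsilon>] by blast
  define A where "A = 2 * K * C * (1 + M) * (1 + 2 * M)"
  have A0: "A \<ge> 0" using K C M by (simp add: A_def)
  \<comment> \<open>The weight in \<open>k\<close> is traded for a weight in the centre
    \<open>y\<close>, at the cost of some decay: the remaining exponent 2 - \<delta> is at least
    3/2, still above the threshold 1 of summability.\<close>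
  have shift: "(1 + \<bar>real_of_int k\<bar>) powr \<delta> * (1 + \<bar>y - real_of_int k\<bar>) powr (-2) \<le> (1 + \<bar>y\<bar>) powr \<delta> * (1 + \<bar>y - real_of_int k\<bar>) powr (- (3/2))" for y k
  proof -
    have "1 + \<bar>real_of_int k\<bar> \<le> 1 + (\<bar>y\<bar> + \<bar>y - real_of_int k\<bar>)"
      using abs_triangle_ineq4[of y "y - real_of_int k"] by simp
    also have "\<dots> \<le> (1 + \<bar>y\<bar>) * (1 + \<bar>y - real_of_int k\<bar>)" by (simp add: algebra_simps)
    finally have "(1 + \<bar>real_of_int k\<bar>) powr \<delta> \<le> ((1 + \<bar>y\<bar>) * (1 + \<bar>y - real_of_int k\<bar>)) powr \<delta>"
      using \<delta> by (intro powr_mono2) auto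
    hence "(1 + \<bar>real_of_int k\<bar>) powr \<delta> * (1 + \<bar>y - real_of_int k\<bar>) powr (-2) \<le>
        (1 + \<bar>y\<bar>) powr \<delta> * ((1 + \<bar>y - real_of_int k\<bar>) powr \<delta> * (1 + \<bar>y - real_of_int k\<bar>) powr (-2))"
      by (simp add: powr_mult mult_right_mono mult.assoc[symmetric])
    also have "(1 + \<bar>y - real_of_int k\<bar>) powr \<delta> * (1 + \<bar>y - real_of_int k\<bar>) powr (-2) = (1 + \<bar>y - real_of_int k\<bar>) powr (\<delta> - 2)"
      by (simp add: powr_add[symmetric])
    also have "(1 + \<bar>y\<bar>) powr \<delta> * (1 + \<bar>y - real_of_int k\<bar>) powr (\<delta> - 2) \<le> (1 + \<bar>y\<bar>) powr \<delta> * (1 + \<bar>y - real_of_int k\<bar>) powr (- (3/2))"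
      using \<delta> by (intro mult_left_mono powr_mono) auto
    finally show ?thesis .
  qed
  show ?thesis
  proof (rule that[of "A * G"])
    show "A * G \<ge> 0" using A0 G by simp
    fix F :: "(int \<times> int) set" and s t :: real assume F: "finite F" and st: "\<bar>s\<bar> \<le> M" "\<bar>t\<bar> \<le> M"
    define \<tau> where "\<tau> = \<bar>t - s\<bar>"
    have \<tau>: "0 \<le> \<tau>" "\<tau> \<le> 2 * M" using st abs_triangle_ineq4[of t s] by (auto simp: \<tau>_def)
    \<comment> \<open>On a bounded interval a Lipschitz bound implies a Hoelder bound of order
      \<open>\<gamma>\<close>.\<close>
    have \<tau>1: "\<tau> \<le> (1 + 2 * M) * \<tau> powr \<gamma>"
    proof (cases "\<tau> = 0")
      case False
      hence "\<tau> = \<tau> powr (1 - \<gamma>) * \<tau> powr \<gamma>" using \<tau> by (simp add: powr_add[symmetric])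
      also have "\<dots> \<le> (1 + 2 * M) powr (1 - \<gamma>) * \<tau> powr \<gamma>"
        using \<tau> \<gamma> by (intro mult_right_mono powr_mono2) auto
      also have "(1 + 2 * M) powr (1 - \<gamma>) \<le> (1 + 2 * M) powr 1"
        using M \<gamma> by (intro powr_mono) auto
      finally show ?thesis using M by (simp add: mult_right_mono)
    qed simp
    have "(\<Sum>p\<in>F. case p of (j, k) \<Rightarrow> 2 powr (- real_of_int j * H) * wt (j, k) powr \<delta> *
       norm (f (2 powr real_of_int j * t - real_of_int k) - f (2 powr real_of_int j * s - real_of_int k))) \<le>
      (\<Sum>j\<in>fst ` F. A * \<tau> powr \<gamma> * 2 powr (- \<epsilon> * \<bar>real_of_int j\<bar>))"
    proof (rule sum_int_pairs_le[OF F])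
      fix j and X :: "int set" assume X: "finite X"
      define d where "d = 2 powr real_of_int j"
      \<comment> \<open>Hoelder exponent at fine scales, Lipschitz exponent at coarse ones.\<close>
      define \<beta> where "\<beta> = (if j \<ge> 0 then \<gamma> else 1)"
      define m where "m = max 0 (real_of_int j)"
      have \<beta>: "0 < \<beta>" "\<beta> \<le> 1" using \<gamma> by (auto simp: \<beta>_def)
      have d: "d > 0" by (simp add: d_def)
      define c where "c = 2 powr (- real_of_int j * H) * 2 powr (\<bar>real_of_int j\<bar> * \<delta>) * C * (d * \<tau>) powr \<beta>"
      have c0: "c \<ge> 0" using C by (simp add: c_def)
      have summand: "2 powr (- real_of_int j * H) * wt (j, k) powr \<delta> * norm (f (d * t - real_of_int k) - f (d * s - real_of_int k)) \<le>
        c * ((1 + M) * 2 powr (m * \<delta>)) * ((1 + \<bar>d * t - real_of_int k\<bar>) powr (- (3/2)) + (1 + \<bar>d * s - real_of_int k\<bar>) powr (- (3/2)))" for k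
      proof -
        have yb: "(1 + \<bar>d * u\<bar>) powr \<delta> \<le> (1 + M) * 2 powr (m * \<delta>)" if u: "\<bar>u\<bar> \<le> M" for u
        proof -
          have dm: "d \<le> 2 powr m" "1 \<le> 2 powr m" unfolding d_def m_def by (auto intro: powr_mono ge_one_powr_ge_zero)
          have "\<bar>d * u\<bar> \<le> 2 powr m * M" using d u dm by (simp add: abs_mult mult_mono)
          hence "1 + \<bar>d * u\<bar> \<le> (1 + M) * 2 powr m" using dm by (simp add: algebra_simps)
          hence "(1 + \<bar>d * u\<bar>) powr \<delta> \<le> ((1 + M) * 2 powr m) powr \<delta>" using \<delta> by (intro powr_mono2) auto
          also have "\<dots> = (1 + M) powr \<delta> * 2 powr (m * \<delta>)" using M by (simp add: powr_mult powr_powr)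
          also have "(1 + M) powr \<delta> \<le> (1 + M) powr 1" using M \<delta> by (intro powr_mono) auto
          finally show ?thesis using M by (simp add: mult_right_mono)
        qed
        have sh: "(1 + \<bar>real_of_int k\<bar>) powr \<delta> * (1 + \<bar>d * u - real_of_int k\<bar>) powr (-2) \<le>
            (1 + M) * 2 powr (m * \<delta>) * (1 + \<bar>d * u - real_of_int k\<bar>) powr (- (3/2))" if u: "\<bar>u\<bar> \<le> M" for u
          by (rule order_trans[OF shift]) (intro mult_right_mono yb u, auto)
        have "norm (f (d * t - real_of_int k) - f (d * s - real_of_int k)) \<le>
           C * (d * \<tau>) powr \<beta> * ((1 + \<bar>d * t - real_of_int k\<bar>) powr (-2) + (1 + \<bar>d * s - real_of_int k\<bar>) powr (-2))"
        proof -
          have "\<bar>(d * t - real_of_int k) - (d * s - real_of_int k)\<bar> = d * \<tau>"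
            using d by (simp add: \<tau>_def abs_mult flip: right_diff_distrib)
          thus ?thesis using inc[OF \<beta>, of "d * t - real_of_int k" "d * s - real_of_int k"] by simp
        qed
        moreover have "wt (j, k) powr \<delta> = 2 powr (\<bar>real_of_int j\<bar> * \<delta>) * (1 + \<bar>real_of_int k\<bar>) powr \<delta>"
          by (simp add: wt_def powr_mult powr_powr)
        ultimately have "2 powr (- real_of_int j * H) * wt (j, k) powr \<delta> * norm (f (d * t - real_of_int k) - f (d * s - real_of_int k)) \<le>
            2 powr (- real_of_int j * H) * (2 powr (\<bar>real_of_int j\<bar> * \<delta>) * (1 + \<bar>real_of_int k\<bar>) powr \<delta>) *
            (C * (d * \<tau>) powr \<beta> * ((1 + \<bar>d * t - real_of_int k\<bar>) powr (-2) + (1 + \<bar>d * s - real_of_int k\<bar>) powr (-2)))"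
          by (intro mult_mono) auto
        also have "\<dots> = c * ((1 + \<bar>real_of_int k\<bar>) powr \<delta> * (1 + \<bar>d * t - real_of_int k\<bar>) powr (-2) +
            (1 + \<bar>real_of_int k\<bar>) powr \<delta> * (1 + \<bar>d * s - real_of_int k\<bar>) powr (-2))"
          by (simp add: c_def algebra_simps)
        also have "\<dots> \<le> c * ((1 + M) * 2 powr (m * \<delta>) * (1 + \<bar>d * t - real_of_int k\<bar>) powr (- (3/2)) +
            (1 + M) * 2 powr (m * \<delta>) * (1 + \<bar>d * s - real_of_int k\<bar>) powr (- (3/2)))"
          by (intro mult_left_mono add_mono sh st c0)
        finally show ?thesis by (simp add: algebra_simps)
      qed
      have "(\<Sum>k\<in>X. 2 powr (- real_of_int j * H) * wt (j, k) powr \<delta> * norm (f (d * t - real_of_int k) - f (d * s - real_of_int k))) \<le>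
          (\<Sum>k\<in>X. c * ((1 + M) * 2 powr (m * \<delta>)) * ((1 + \<bar>d * t - real_of_int k\<bar>) powr (- (3/2)) + (1 + \<bar>d * s - real_of_int k\<bar>) powr (- (3/2))))"
        by (intro sum_mono summand)
      also have "\<dots> \<le> c * ((1 + M) * 2 powr (m * \<delta>)) * (K + K)"
        unfolding sum_distrib_left[symmetric] sum.distrib
        using c0 M X by (intro mult_left_mono add_mono K) auto
      also have "\<dots> = 2 * K * C * (1 + M) * (2 powr (- real_of_int j * H) * 2 powr (\<bar>real_of_int j\<bar> * \<delta>) * 2 powr (m * \<delta>) * (d * \<tau>) powr \<beta>)"
        by (simp add: c_def)
      also have "\<dots> \<le> 2 * K * C * (1 + M) * ((1 + 2 * M) * \<tau> powr \<gamma> * 2 powr (- \<epsilon> * \<bar>real_of_int j\<bar>))"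
      proof (intro mult_left_mono)
        have dt: "(d * \<tau>) powr \<beta> = 2 powr (real_of_int j * \<beta>) * \<tau> powr \<beta>"
          using d \<tau> by (simp add: powr_mult d_def powr_powr)
        have "2 powr (- real_of_int j * H) * 2 powr (\<bar>real_of_int j\<bar> * \<delta>) * 2 powr (m * \<delta>) * 2 powr (real_of_int j * \<beta>) =
            2 powr (- real_of_int j * H + \<bar>real_of_int j\<bar> * \<delta> + m * \<delta> + real_of_int j * \<beta>)"
          by (simp only: powr_add)
        also have "\<dots> \<le> 2 powr (- \<epsilon> * \<bar>real_of_int j\<bar>)"
        proof (rule powr_mono)
          show "- real_of_int j * H + \<bar>real_of_int j\<bar> * \<delta> + m * \<delta> + real_of_int j * \<beta> \<le> - \<epsilon> * \<bar>real_of_int j\<bar>"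
          proof (cases "j \<ge> 0")
            case True
            have "real_of_int j * \<epsilon> \<le> real_of_int j * (H - 2 * \<delta> - \<gamma>)"
              using True by (intro mult_left_mono) (auto simp: \<epsilon>_def)
            thus ?thesis using True by (simp add: m_def \<beta>_def algebra_simps)
          next
            case False
            have "real_of_int (- j) * \<epsilon> \<le> real_of_int (- j) * (1 - H - \<delta>)"
              using False by (intro mult_left_mono) (auto simp: \<epsilon>_def)
            thus ?thesis using False by (simp add: m_def \<beta>_def algebra_simps)
          qed
        qed simp
        finally have 1: "2 powr (- real_of_int j * H) * 2 powr (\<bar>real_of_int j\<bar> * \<delta>) * 2 powr (m * \<delta>) * 2 powr (real_of_int j * \<beta>) \<le>
            2 powr (- \<epsilon> * \<bar>real_of_int j\<bar>)" .
        have 2: "\<tau> powr \<beta> \<le> (1 + 2 * M) * \<tau> powr \<gamma>"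
        proof (cases "j \<ge> 0")
          case True
          have "1 * \<tau> powr \<gamma> \<le> (1 + 2 * M) * \<tau> powr \<gamma>" using M by (intro mult_right_mono) auto
          thus ?thesis using True by (simp add: \<beta>_def)
        next
          case False
          thus ?thesis using \<tau>1 \<tau> by (simp add: \<beta>_def)
        qed
        have "2 powr (- real_of_int j * H) * 2 powr (\<bar>real_of_int j\<bar> * \<delta>) * 2 powr (m * \<delta>) * (d * \<tau>) powr \<beta> =
            (2 powr (- real_of_int j * H) * 2 powr (\<bar>real_of_int j\<bar> * \<delta>) * 2 powr (m * \<delta>) * 2 powr (real_of_int j * \<beta>)) * \<tau> powr \<beta>"
          unfolding dt by (simp only: mult.assoc)
        also have "\<dots> \<le> 2 powr (- \<epsilon> * \<bar>real_of_int j\<bar>) * ((1 + 2 * M) * \<tau> powr \<gamma>)"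
          using 1 2 by (intro mult_mono) auto
        finally show "2 powr (- real_of_int j * H) * 2 powr (\<bar>real_of_int j\<bar> * \<delta>) * 2 powr (m * \<delta>) * (d * \<tau>) powr \<beta> \<le>
            (1 + 2 * M) * \<tau> powr \<gamma> * 2 powr (- \<epsilon> * \<bar>real_of_int j\<bar>)"
          by (simp only: mult_ac)
      qed (use K C M in auto)
      finally show "(\<Sum>k\<in>X. case (j, k) of (j, k) \<Rightarrow> 2 powr (- real_of_int j * H) * wt (j, k) powr \<delta> *
         norm (f (2 powr real_of_int j * t - real_of_int k) - f (2 powr real_of_int j * s - real_of_int k))) \<le>
         A * \<tau> powr \<gamma> * 2 powr (- \<epsilon> * \<bar>real_of_int j\<bar>)"
        by (simp add: d_def A_def mult_ac)
    qed auto
    also have "\<dots> \<le> A * \<tau> powr \<gamma> * G"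
      unfolding sum_distrib_left[symmetric] using A0 F by (intro mult_left_mono G) auto
    finally show "(\<Sum>(j, k)\<in>F. 2 powr (- real_of_int j * H) * wt (j, k) powr \<delta> *
       norm (f (2 powr real_of_int j * t - real_of_int k) - f (2 powr real_of_int j * s - real_of_int k))) \<le> A * G * \<bar>t - s\<bar> powr \<gamma>"
      by (simp add: \<tau>_def mult_ac)
  qed
qed

text \<open>An index is left out because its scale or its position is large, and either makes the
  weight large. This converts spare weight into a rate for the tails.\<close>

lemma wt_off_D_index:
  assumes "p \<notin> D_index n M" "M > 0"
  shows "min 1 M * 2 ^ n \<le> wt p"
proof -
  obtain j k where p: "p = (j, k)" by (cases p)
  have "\<bar>j\<bar> > int n \<or> M * 2 ^ (n + 1) < real_of_int \<bar>k\<bar>"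
    using assms by (auto simp: p D_index_def not_le)
  thus ?thesis
  proof
    assume j: "\<bar>j\<bar> > int n"
    have "min 1 M * 2 ^ n \<le> 1 * (2::real) ^ n" by (intro mult_right_mono) auto
    also have "\<dots> = 2 powr real n" by (simp add: powr_realpow)
    also have "\<dots> \<le> 2 powr \<bar>real_of_int j\<bar>" using j by (intro powr_mono) auto
    also have "\<dots> * 1 \<le> 2 powr \<bar>real_of_int j\<bar> * (1 + \<bar>real_of_int k\<bar>)" by (intro mult_left_mono) auto
    finally show ?thesis by (simp add: p wt_def)
  next
    assume k: "M * 2 ^ (n + 1) < real_of_int \<bar>k\<bar>"
    have "min 1 M * 2 ^ n \<le> M * 2 ^ (n + 1)" using assms by (intro mult_mono power_increasing) auto
    also have "\<dots> \<le> 1 * (1 + \<bar>real_of_int k\<bar>)" using k by simp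
    also have "\<dots> \<le> 2 powr \<bar>real_of_int j\<bar> * (1 + \<bar>real_of_int k\<bar>)"
      by (intro mult_right_mono) (auto intro: ge_one_powr_ge_zero)
    finally show ?thesis by (simp add: p wt_def)
  qed
qed

section \<open>An envelope for the normalised wavelets\<close>

definition envelope :: "real \<Rightarrow> real \<Rightarrow> real \<Rightarrow> real" where
  "envelope \<alpha> \<delta> \<xi> = \<bar>\<xi>\<bar> powr (- (1 / \<alpha>)) * min (\<bar>\<xi>\<bar> powr \<delta>) (\<bar>\<xi>\<bar> powr (- \<delta>))"

lemma envelope_nonneg [simp]: "envelope \<alpha> \<delta> \<xi> \<ge> 0"
  by (simp add: envelope_def)

lemma envelope_measurable [measurable]: "envelope \<alpha> \<delta> \<in> borel_measurable borel"
  unfolding envelope_def by measurable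

text \<open>The function |\<xi>|^(-1/\<alpha>) just fails to be in \<open>L\<^sup>\<alpha>\<close>,
  at the origin as well as at infinity. The minimum improves it at both ends and leaves the
  exponents \<open>d - 1\<close> and \<open>- d - 1\<close>.\<close>

lemma envelope_integrable:
  assumes \<alpha>: "\<alpha> > 0" and \<delta>: "\<delta> > 0"
  shows "integrable lborel (\<lambda>\<xi>. envelope \<alpha> \<delta> \<xi> powr \<alpha>)"
proof -
  define d where "d = \<alpha> * \<delta>"
  have d: "d > 0" using assms by (simp add: d_def)
  define h1 where "h1 \<xi> = (if \<xi> \<in> {0..1} then \<xi> powr (d - 1) else 0)" for \<xi> :: real
  define h2 where "h2 \<xi> = (if \<xi> \<in> {1..} then \<xi> powr (- d - 1) else 0)" for \<xi> :: real
  have [measurable]: "h1 \<in> borel_measurable borel" "h2 \<in> borel_measurable borel"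
    unfolding h1_def[abs_def] h2_def[abs_def] by measurable
  have i1: "integrable lborel h1"
  proof (rule integrableI_nonneg)
    have "((\<lambda>\<xi>. \<xi> powr (d - 1)) has_integral (1 powr ((d - 1) + 1) / ((d - 1) + 1))) {0..1}"
      using d by (intro has_integral_powr_from_0) auto
    hence "(h1 has_integral (1 powr ((d - 1) + 1) / ((d - 1) + 1))) UNIV"
      unfolding h1_def has_integral_restrict_UNIV .
    hence "(\<integral>\<^sup>+\<xi>. ennreal (h1 \<xi>) \<partial>lborel) = ennreal (1 powr ((d - 1) + 1) / ((d - 1) + 1))"
      by (rule nn_integral_has_integral_lborel[rotated 2]) (measurable, auto simp: h1_def)
    thus "(\<integral>\<^sup>+\<xi>. ennreal (h1 \<xi>) \<partial>lborel) < \<infinity>" by simp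
  qed (measurable, auto simp: h1_def)
  have i2: "integrable lborel h2"
  proof (rule integrableI_nonneg)
    have "((\<lambda>\<xi>. \<xi> powr (- d - 1)) has_integral - (1 powr ((- d - 1) + 1)) / ((- d - 1) + 1)) {1..}"
      using d by (intro has_integral_powr_to_inf) auto
    hence "(h2 has_integral - (1 powr ((- d - 1) + 1)) / ((- d - 1) + 1)) UNIV"
      unfolding h2_def has_integral_restrict_UNIV .
    hence "(\<integral>\<^sup>+\<xi>. ennreal (h2 \<xi>) \<partial>lborel) = ennreal (- (1 powr ((- d - 1) + 1)) / ((- d - 1) + 1))"
      by (rule nn_integral_has_integral_lborel[rotated 2]) (measurable, auto simp: h2_def)
    thus "(\<integral>\<^sup>+\<xi>. ennreal (h2 \<xi>) \<partial>lborel) < \<infinity>" by simp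
  qed (measurable, auto simp: h2_def)
  define h where "h \<xi> = h1 \<xi> + h2 \<xi>" for \<xi>
  have i: "integrable lborel h" unfolding h_def using i1 i2 by simp
  have i': "integrable lborel (\<lambda>\<xi>. h (- \<xi>))"
    using lborel_integrable_real_affine[OF i, of "-1" 0] by simp
  have pos: "envelope \<alpha> \<delta> \<xi> powr \<alpha> \<le> h \<xi>" if "\<xi> > 0" for \<xi>
  proof (cases "\<xi> \<le> 1")
    case True
    have "envelope \<alpha> \<delta> \<xi> powr \<alpha> \<le> (\<xi> powr (- (1 / \<alpha>)) * \<xi> powr \<delta>) powr \<alpha>"
      unfolding envelope_def using \<alpha> that by (intro powr_mono2 mult_left_mono) auto
    also have "\<dots> = \<xi> powr ((- (1 / \<alpha>) + \<delta>) * \<alpha>)" by (simp add: powr_add[symmetric] powr_powr)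
    also have "(- (1 / \<alpha>) + \<delta>) * \<alpha> = d - 1" using \<alpha> by (simp add: d_def field_simps)
    also have "\<xi> powr (d - 1) \<le> h \<xi>" using True that by (simp add: h_def h1_def h2_def)
    finally show ?thesis .
  next
    case False
    have "envelope \<alpha> \<delta> \<xi> powr \<alpha> \<le> (\<xi> powr (- (1 / \<alpha>)) * \<xi> powr (- \<delta>)) powr \<alpha>"
      unfolding envelope_def using \<alpha> that by (intro powr_mono2 mult_left_mono) auto
    also have "\<dots> = \<xi> powr ((- (1 / \<alpha>) + - \<delta>) * \<alpha>)" by (simp add: powr_add[symmetric] powr_powr)
    also have "(- (1 / \<alpha>) + - \<delta>) * \<alpha> = - d - 1" using \<alpha> by (simp add: d_def field_simps)
    finally show ?thesis using False that by (simp add: h_def h1_def h2_def)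
  qed
  have h0: "h \<xi> \<ge> 0" for \<xi> by (simp add: h_def h1_def h2_def)
  have le: "envelope \<alpha> \<delta> \<xi> powr \<alpha> \<le> h \<xi> + h (- \<xi>)" for \<xi>
  proof -
    consider "\<xi> > 0" | "\<xi> < 0" | "\<xi> = 0" by linarith
    thus ?thesis
    proof cases
      case 1
      thus ?thesis using pos[OF 1] h0[of "-\<xi>"] by simp
    next
      case 2
      have "envelope \<alpha> \<delta> \<xi> = envelope \<alpha> \<delta> (- \<xi>)" by (simp add: envelope_def)
      thus ?thesis using pos[of "-\<xi>"] 2 h0[of \<xi>] by simp
    next
      case 3
      thus ?thesis using h0 by (simp add: envelope_def add_nonneg_nonneg)
    qed
  qed
  show ?thesis
  proof (rule Bochner_Integration.integrable_bound)
    show "integrable lborel (\<lambda>\<xi>. h \<xi> + h (- \<xi>))" using i i' by simp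
    show "AE \<xi> in lborel. norm (envelope \<alpha> \<delta> \<xi> powr \<alpha>) \<le> norm (h \<xi> + h (- \<xi>))"
      using le by (intro AE_I2) (auto intro: order_trans[OF _ abs_ge_self])
  qed measurable
qed

context wavelet
begin

text \<open>Where the wavelet is nonzero, 2^(-j) |\<xi>| lies between 2 and 11. So 2^(-j/\<alpha>)
  is comparable to |\<xi>|^(-1/\<alpha>), and |\<xi>| to 2^j, whence the growth factor in
  \<open>j\<close> makes up for the minimum in the envelope. As \<open>k\<close> enters through a
  phase, the bound does not depend on it.\<close>

lemma psi_hat_le_envelope:
  assumes \<alpha>: "\<alpha> > 0" and \<delta>: "\<delta> > 0"
  obtains B where "B > 0" "\<And>j k \<xi>. norm (psi_hat \<psi> \<alpha> j k \<xi>) \<le> 2 powr (\<delta> * \<bar>real_of_int j\<bar>) * (B * envelope \<alpha> \<delta> \<xi>)"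
proof -
  obtain b where b: "b > 0" "\<And>\<xi>. norm (\<phi> \<xi>) \<le> b" using fourier_bounded by blast
  show ?thesis
  proof (rule that[of "b * 11 powr (1 / \<alpha>) * 11 powr \<delta>"])
    fix j k \<xi>
    define c where "c = 2 powr (- real_of_int j)"
    have c: "c > 0" by (simp add: c_def)
    show "norm (psi_hat \<psi> \<alpha> j k \<xi>) \<le> 2 powr (\<delta> * \<bar>real_of_int j\<bar>) * (b * 11 powr (1 / \<alpha>) * 11 powr \<delta> * envelope \<alpha> \<delta> \<xi>)"
    proof (cases "\<phi> (c * \<xi>) = 0")
      case True
      thus ?thesis using b by (simp add: psi_hat_def c_def)
    next
      case False
      hence "\<not> (\<bar>c * \<xi>\<bar> < 2 \<or> \<bar>c * \<xi>\<bar> > 11)" using fourier_support by blast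
      hence r: "2 \<le> c * \<bar>\<xi>\<bar>" "c * \<bar>\<xi>\<bar> \<le> 11" using c by (simp_all add: abs_mult not_less)
      hence x0: "\<bar>\<xi>\<bar> > 0" using c by (cases "\<xi> = 0") auto
      have 1: "2 powr (- real_of_int j / \<alpha>) \<le> 11 powr (1 / \<alpha>) * \<bar>\<xi>\<bar> powr (- (1 / \<alpha>))"
      proof -
        have "2 powr (- real_of_int j / \<alpha>) = c powr (1 / \<alpha>)" by (simp add: c_def powr_powr)
        also have "\<dots> \<le> (11 / \<bar>\<xi>\<bar>) powr (1 / \<alpha>)"
          using r x0 c \<alpha> by (intro powr_mono2) (auto simp: le_divide_eq)
        also have "\<dots> = 11 powr (1 / \<alpha>) * \<bar>\<xi>\<bar> powr (- (1 / \<alpha>))"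
          using x0 by (simp add: powr_divide powr_minus_divide)
        finally show ?thesis .
      qed
      have e: "(1::real) \<le> 11 powr \<delta>" using \<delta> by (simp add: ge_one_powr_ge_zero)
      have 2: "1 \<le> 2 powr (\<delta> * \<bar>real_of_int j\<bar>) * (11 powr \<delta> * min (\<bar>\<xi>\<bar> powr \<delta>) (\<bar>\<xi>\<bar> powr (- \<delta>)))"
      proof -
        define J where "J = 2 powr \<bar>real_of_int j\<bar>"
        have J: "J > 0" "J powr \<delta> = 2 powr (\<delta> * \<bar>real_of_int j\<bar>)" by (auto simp: J_def powr_powr mult.commute)
        have "1 / c = 2 powr real_of_int j" by (simp add: c_def powr_minus_divide)
        hence cJ: "c \<le> J" "1 / c \<le> J" by (auto simp: c_def J_def intro!: powr_mono)
        have "1 \<le> J * \<bar>\<xi>\<bar>" using r(1) mult_right_mono[OF cJ(1), of "\<bar>\<xi>\<bar>"] by simp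
        hence "1 powr \<delta> \<le> (J * \<bar>\<xi>\<bar>) powr \<delta>" using \<delta> by (intro powr_mono2) auto
        hence a1: "1 \<le> J powr \<delta> * \<bar>\<xi>\<bar> powr \<delta>" using J by (simp add: powr_mult)
        have "\<bar>\<xi>\<bar> \<le> 11 * (1 / c)" using r(2) c by (simp add: le_divide_eq mult.commute)
        also have "\<dots> \<le> 11 * J" using cJ by simp
        finally have "\<bar>\<xi>\<bar> powr \<delta> \<le> (11 * J) powr \<delta>" using \<delta> by (intro powr_mono2) auto
        hence "\<bar>\<xi>\<bar> powr \<delta> \<le> 11 powr \<delta> * J powr \<delta>" using J by (simp add: powr_mult)
        hence a2: "1 \<le> J powr \<delta> * (11 powr \<delta> * \<bar>\<xi>\<bar> powr (- \<delta>))"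
          using x0 by (simp add: powr_minus_divide le_divide_eq mult_ac)
        have "1 \<le> J powr \<delta> * (11 powr \<delta> * \<bar>\<xi>\<bar> powr \<delta>)"
          using mult_mono[OF e a1] by (simp add: mult_ac)
        with a2 show ?thesis unfolding J(2)[symmetric] by (auto simp: min_def)
      qed
      have "norm (psi_hat \<psi> \<alpha> j k \<xi>) = 2 powr (- real_of_int j / \<alpha>) * norm (\<phi> (c * \<xi>))"
        by (simp add: psi_hat_def norm_mult c_def)
      also have "\<dots> \<le> 11 powr (1 / \<alpha>) * \<bar>\<xi>\<bar> powr (- (1 / \<alpha>)) * b"
        using 1 b by (intro mult_mono) auto
      also have "\<dots> = 11 powr (1 / \<alpha>) * \<bar>\<xi>\<bar> powr (- (1 / \<alpha>)) * b * 1" by simp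
      also have "\<dots> \<le> 11 powr (1 / \<alpha>) * \<bar>\<xi>\<bar> powr (- (1 / \<alpha>)) * b *
          (2 powr (\<delta> * \<bar>real_of_int j\<bar>) * (11 powr \<delta> * min (\<bar>\<xi>\<bar> powr \<delta>) (\<bar>\<xi>\<bar> powr (- \<delta>))))"
        using 2 b by (intro mult_left_mono) auto
      also have "\<dots> = 2 powr (\<delta> * \<bar>real_of_int j\<bar>) * (b * 11 powr (1 / \<alpha>) * 11 powr \<delta> * envelope \<alpha> \<delta> \<xi>)"
        by (simp add: envelope_def mult_ac)
      finally show ?thesis .
    qed
  qed (use b in auto)
qed

end

section \<open>Testing against smooth bumps\<close>

lemma pos3_nonneg [simp]: "pos3 y \<ge> 0" and pos3_pos_iff [simp]: "pos3 y > 0 \<longleftrightarrow> y > 0"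
  by (auto simp: pos3_def max_def)

lemma pos3_eq_0 [simp]: "y \<le> 0 \<Longrightarrow> pos3 y = 0"
  by (simp add: pos3_def max_def)

text \<open>The fundamental lemma of the calculus of variations for functions continuous off the
  origin, with twice differentiable bumps supported on one side of it.\<close>

lemma continuous_eq_0_if_orthogonal_to_bumps:
  fixes d :: "real \<Rightarrow> complex"
  assumes cont: "continuous_on (- {0}) d" and x0: "x0 \<noteq> 0"
    and orth: "\<And>p q. p < q \<Longrightarrow> 0 < p \<or> q < 0 \<Longrightarrow>
      (CLINT x|lborel. complex_of_real (pos3 (x - p) * pos3 (q - x)) * d x) = 0"
  shows "d x0 = 0"
proof (rule ccontr)
  assume nz: "d x0 \<noteq> 0"
  \<comment> \<open>The conjugate of \<open>d x0\<close> rotates the value at \<open>x0\<close> to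
    the positive axis, so the real part is positive near \<open>x0\<close> and its integral against
    a bump there cannot vanish.\<close>
  define r where "r x = Re (cnj (d x0) * d x)" for x
  have r0: "r x0 > 0"
  proof -
    have "r x0 = (norm (d x0))\<^sup>2" by (simp only: cmod_power2) (simp add: r_def power2_eq_square)
    thus ?thesis using nz by simp
  qed
  have "continuous_on (- {0}) r" unfolding r_def by (intro continuous_intros cont)
  moreover have "open (- {0::real})" by (intro open_Compl closed_singleton)
  ultimately have "open (r -` {0<..} \<inter> - {0})"
    using continuous_open_preimage[of "- {0}" r "{0<..}"] by (simp add: Int_commute)
  moreover have "x0 \<in> r -` {0<..} \<inter> - {0}" using r0 x0 by simp
  ultimately obtain e where e: "e > 0" "cball x0 e \<subseteq> r -` {0<..} \<inter> - {0}"
    by (meson open_contains_cball)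
  define p where "p = x0 - e"
  define q where "q = x0 + e"
  have pq: "p < q" using e by (simp add: p_def q_def)
  have cb: "cball x0 e = {p..q}" by (simp add: p_def q_def cball_eq_atLeastAtMost)
  have "0 \<notin> {p..q}" using e(2) cb by auto
  hence sgn: "0 < p \<or> q < 0" using pq by auto
  have rpos: "r x > 0" if "x \<in> {p..q}" for x using e(2) that cb by auto
  define V where "V x = pos3 (x - p) * pos3 (q - x)" for x
  have V0: "V x = 0" if "x \<notin> {p..q}" for x using that by (auto simp: V_def not_le)
  have Vc: "continuous_on UNIV V"
    unfolding V_def pos3_def by (intro continuous_intros)
  have c: "continuous_on {p..q} (\<lambda>x. complex_of_real (V x) * d x)"
    using cont \<open>0 \<notin> {p..q}\<close> by (intro continuous_intros continuous_on_subset[OF Vc] continuous_on_subset[OF cont]) auto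
  have "integrable lborel (\<lambda>x. indicator {p..q} x *\<^sub>R (complex_of_real (V x) * d x))"
    by (intro borel_integrable_compact c) auto
  moreover have "indicator {p..q} x *\<^sub>R (complex_of_real (V x) * d x) = complex_of_real (V x) * d x" for x
    using V0[of x] by (auto simp: indicator_def)
  ultimately have i: "integrable lborel (\<lambda>x. complex_of_real (V x) * d x)" by simp
  have i': "integrable lborel (\<lambda>x. cnj (d x0) * (complex_of_real (V x) * d x))" using i by (rule integrable_mult_right)
  have eq: "V x * r x = Re (cnj (d x0) * (complex_of_real (V x) * d x))" for x
    by (simp add: r_def algebra_simps)
  have int: "integrable lborel (\<lambda>x. V x * r x)" unfolding eq by (rule integrable_Re[OF i'])
  have "(LINT x|lborel. V x * r x) = Re (cnj (d x0) * (CLINT x|lborel. complex_of_real (V x) * d x))"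
    unfolding eq integral_Re[OF i'] by simp
  also have "(CLINT x|lborel. complex_of_real (V x) * d x) = 0"
    unfolding V_def by (rule orth[OF pq sgn])
  finally have z: "(LINT x|lborel. V x * r x) = 0" by simp
  have nn: "V x * r x \<ge> 0" for x
  proof (cases "x \<in> {p..q}")
    case True
    thus ?thesis using rpos[of x] by (simp add: V_def)
  qed (simp add: V0)
  have "AE x in lborel. V x * r x = 0"
    using z int nn by (subst (asm) integral_nonneg_eq_0_iff_AE) auto
  hence "AE x in lborel. x \<notin> {p<..<q}"
  proof eventually_elim
    case (elim x)
    show ?case
    proof
      assume x: "x \<in> {p<..<q}"
      hence "V x > 0" "r x > 0" using rpos[of x] by (auto simp: V_def)
      thus False using elim by simp
    qed
  qed
  hence "{p<..<q} \<in> null_sets lborel" by (subst AE_iff_null_sets) auto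
  hence "emeasure lborel {p<..<q} = 0" by (rule null_setsD1)
  thus False using pq by simp
qed

context wavelet
begin

text \<open>Supplies domination on the Fourier side: besides the uniform bound, all terms vanish
  outside one annulus, which keeps the singularity of the kernel at the origin out of the
  integrals.\<close>

lemma coef_Eh_sums_bounded:
  assumes V: "C2 V" "a > 0" "\<And>x. \<bar>x\<bar> < a \<or> \<bar>x\<bar> > b \<Longrightarrow> V x = 0"
  obtains B r R where "B \<ge> 0" "r > 0"
    "\<And>F \<eta>. finite F \<Longrightarrow> (\<Sum>(j, k)\<in>F. norm (coef V j k * Eh j k \<eta>)) \<le> B"
    "\<And>j k \<eta>. \<bar>\<eta>\<bar> < r \<or> \<bar>\<eta>\<bar> > R \<Longrightarrow> coef V j k * Eh j k \<eta> = 0"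
proof -
  obtain C j0 where C: "C \<ge> 0" "\<And>j k. norm (coef V j k) \<le> C / (1 + (real_of_int k)\<^sup>2)"
    "\<And>j k. \<bar>j\<bar> > int j0 \<Longrightarrow> coef V j k = 0"
    using coef_bound[OF V] by blast
  obtain b where b: "b > 0" "\<And>\<xi>. norm (\<phi> \<xi>) \<le> b" using fourier_bounded by blast
  obtain K where K: "K \<ge> 0" "\<And>F y. finite F \<Longrightarrow> (\<Sum>k\<in>F. 1 / (1 + (y - real_of_int k)\<^sup>2)) \<le> K"
    using sum_shifted_inverse_square_bounded by blast
  define D where "D j = C * (2 powr (- real_of_int j / 2) * b) * K" for j :: int
  have D0: "D j \<ge> 0" for j using C b K by (simp add: D_def)
  show ?thesis
  proof (rule that[of "\<Sum>j\<in>{- int j0..int j0}. D j" "2 powr (- real j0)" "11 * 2 powr real j0"])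
    show "(\<Sum>j\<in>{- int j0..int j0}. D j) \<ge> 0" using D0 by (intro sum_nonneg)
    fix F :: "(int \<times> int) set" and \<eta> :: real assume F: "finite F"
    have "(\<Sum>p\<in>F. case p of (j, k) \<Rightarrow> norm (coef V j k * Eh j k \<eta>)) \<le>
        (\<Sum>j\<in>fst ` F. if j \<in> {- int j0..int j0} then D j else 0)"
    proof (rule sum_int_pairs_le[OF F])
      fix j and G :: "int set" assume G: "finite G"
      show "(\<Sum>k\<in>G. case (j, k) of (j, k) \<Rightarrow> norm (coef V j k * Eh j k \<eta>)) \<le> (if j \<in> {- int j0..int j0} then D j else 0)"
      proof (cases "j \<in> {- int j0..int j0}")
        case False
        hence "coef V j k = 0" for k by (intro C) auto
        thus ?thesis using False by (simp del: atLeastAtMost_iff)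
      next
        case True
        have "(\<Sum>k\<in>G. norm (coef V j k * Eh j k \<eta>)) \<le>
          (\<Sum>k\<in>G. (C * (2 powr (- real_of_int j / 2) * b)) * (1 / (1 + (0 - real_of_int k)\<^sup>2)))"
        proof (rule sum_mono)
          fix k
          have "norm (coef V j k * Eh j k \<eta>) = norm (coef V j k) * (2 powr (- real_of_int j / 2) * norm (\<phi> (2 powr (- real_of_int j) * \<eta>)))"
            by (simp add: norm_mult Eh_def)
          also have "\<dots> \<le> C / (1 + (real_of_int k)\<^sup>2) * (2 powr (- real_of_int j / 2) * b)"
            using C b by (intro mult_mono mult_left_mono C) auto
          finally show "norm (coef V j k * Eh j k \<eta>) \<le> (C * (2 powr (- real_of_int j / 2) * b)) * (1 / (1 + (0 - real_of_int k)\<^sup>2))"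
            by simp
        qed
        also have "\<dots> \<le> (C * (2 powr (- real_of_int j / 2) * b)) * K"
          unfolding sum_distrib_left[symmetric] using C b G by (intro mult_left_mono K) auto
        finally show ?thesis using True by (simp add: D_def)
      qed
    qed auto
    also have "\<dots> = (\<Sum>j\<in>fst ` F \<inter> {- int j0..int j0}. D j)"
      using F by (subst sum.inter_restrict) auto
    also have "\<dots> \<le> (\<Sum>j\<in>{- int j0..int j0}. D j)"
      using D0 by (intro sum_mono2) auto
    finally show "(\<Sum>(j, k)\<in>F. norm (coef V j k * Eh j k \<eta>)) \<le> (\<Sum>j\<in>{- int j0..int j0}. D j)" .
  next
    fix j k :: int and \<eta> :: real assume \<eta>: "\<bar>\<eta>\<bar> < 2 powr (- real j0) \<or> \<bar>\<eta>\<bar> > 11 * 2 powr real j0"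
    show "coef V j k * Eh j k \<eta> = 0"
    proof (rule ccontr)
      assume nz: "coef V j k * Eh j k \<eta> \<noteq> 0"
      hence j: "\<bar>j\<bar> \<le> int j0" using C(3)[of j k] by (cases "\<bar>j\<bar> > int j0") auto
      define c where "c = 2 powr (- real_of_int j)"
      have c: "c > 0" "c \<le> 2 powr real j0" "1 / c \<le> 2 powr real j0"
      proof -
        have "1 / c = 2 powr real_of_int j" by (simp add: c_def powr_minus_divide)
        thus "c > 0" "c \<le> 2 powr real j0" "1 / c \<le> 2 powr real j0" using j by (auto simp: c_def intro!: powr_mono)
      qed
      have "\<phi> (c * \<eta>) \<noteq> 0" using nz by (auto simp: Eh_def c_def)
      hence "\<not> (\<bar>c * \<eta>\<bar> < 2 \<or> \<bar>c * \<eta>\<bar> > 11)" using fourier_support by blast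
      hence r: "2 \<le> c * \<bar>\<eta>\<bar>" "c * \<bar>\<eta>\<bar> \<le> 11" using c by (simp_all add: abs_mult not_less)
      have "\<bar>\<eta>\<bar> \<le> 11 * (1 / c)" using r c by (simp add: le_divide_eq mult.commute)
      also have "\<dots> \<le> 11 * 2 powr real j0" using c by simp
      finally have 1: "\<bar>\<eta>\<bar> \<le> 11 * 2 powr real j0" .
      have "2 \<le> 2 powr real j0 * \<bar>\<eta>\<bar>" using r(1) mult_right_mono[OF c(2), of "\<bar>\<eta>\<bar>"] by simp
      hence "2 powr (- real j0) \<le> \<bar>\<eta>\<bar>" by (simp add: powr_minus_divide divide_le_eq mult.commute)
      thus False using \<eta> 1 by auto
    qed
  qed simp
qed

section \<open>Expansion of the one-dimensional kernel\<close>

definition kernel1 :: "real \<Rightarrow> real \<Rightarrow> real \<Rightarrow> real \<Rightarrow> complex" where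
  "kernel1 \<alpha> h t \<xi> = (iexp (t * \<xi>) - 1) / complex_of_real (\<bar>\<xi>\<bar> powr (h + 1 / \<alpha>))"

text \<open>One factor of the coefficient in \<open>U_star\<close>, its power of two included; up to
  normalisation it is also the wavelet coefficient of \<open>kernel1\<close>, by
  \<open>integral_kernel1_Eh\<close>.\<close>

definition dcoef :: "real \<Rightarrow> real \<Rightarrow> real \<Rightarrow> int \<Rightarrow> int \<Rightarrow> complex" where
  "dcoef \<alpha> h t j k = complex_of_real (2 powr (- real_of_int j * h)) *
     (psi_frac \<psi> \<alpha> h (2 powr real_of_int j * t - real_of_int k) - psi_frac \<psi> \<alpha> h (- real_of_int k))"

lemma kernel1_measurable [measurable]: "kernel1 \<alpha> h t \<in> borel_measurable borel"
  unfolding kernel1_def by measurable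

lemma psi_hat_eq_Eh: "psi_hat \<psi> \<alpha> j k \<xi> = complex_of_real (2 powr (real_of_int j / 2 - real_of_int j / \<alpha>)) * Eh j k \<xi>"
proof -
  have "2 powr (- real_of_int j / \<alpha>) = 2 powr (real_of_int j / 2 - real_of_int j / \<alpha>) * 2 powr (- real_of_int j / 2)"
    by (simp flip: powr_add)
  thus ?thesis by (simp add: psi_hat_def Eh_def mult_ac)
qed

text \<open>The \<open>L\<^sup>2\<close> pairing of the kernel with a wavelet, after the substitution \<open>\<xi> = 2\<^sup>j \<eta>\<close>.\<close>

lemma integral_kernel1_Eh:
  "(CLINT \<xi>|lborel. kernel1 \<alpha> h t \<xi> * Eh j k \<xi>) = complex_of_real (2 powr (real_of_int j / 2 - real_of_int j / \<alpha>)) * dcoef \<alpha> h t j k"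
proof -
  define c where "c = 2 powr real_of_int j"
  have c: "c > 0" by (simp add: c_def)
  define p where "p = h + 1 / \<alpha>"
  define g where "g \<eta> = \<phi> \<eta> / complex_of_real (\<bar>\<eta>\<bar> powr p)" for \<eta>
  have g: "integrable lborel g"
  proof -
    have "g \<eta> = \<phi> \<eta> * complex_of_real (smooth_powr (- p) \<eta>)" for \<eta>
    proof (cases "\<bar>\<eta>\<bar> < 2")
      case True
      thus ?thesis using fourier_support[of \<eta>] by (simp add: g_def)
    next
      case False
      hence "smooth_powr (- p) \<eta> = \<bar>\<eta>\<bar> powr (- p)" by (intro smooth_powr_eq) auto
      thus ?thesis by (simp add: g_def powr_minus_divide)
    qed
    hence ge: "g = (\<lambda>\<eta>. \<phi> \<eta> * complex_of_real (smooth_powr (- p) \<eta>))" by auto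
    show ?thesis
      unfolding ge by (rule integrable_compact_support[of _ 11])
        (auto intro!: C2_continuous C2_mult C2_fourier C2_smooth_powr simp: fourier_support)
  qed
  have pf: "psi_frac \<psi> \<alpha> h y = (CLINT \<eta>|lborel. iexp (y * \<eta>) * g \<eta>)" for y
    by (simp add: psi_frac_def g_def p_def)
  have pt: "kernel1 \<alpha> h t (c * \<eta>) * Eh j k (c * \<eta>) =
      complex_of_real (2 powr (- real_of_int j / 2) * c powr (- p)) *
      (iexp ((c * t - real_of_int k) * \<eta>) * g \<eta> - iexp (- real_of_int k * \<eta>) * g \<eta>)" for \<eta>
  proof -
    have cc: "2 powr (- real_of_int j) * (c * \<eta>) = \<eta>" by (simp add: c_def mult.assoc[symmetric] flip: powr_add)
    have c1: "real_of_int k * 2 powr (- real_of_int j) * (c * \<eta>) = real_of_int k * \<eta>"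
      using cc by (metis mult.assoc)
    have "\<bar>c * \<eta>\<bar> powr p = c powr p * \<bar>\<eta>\<bar> powr p" using c by (simp add: abs_mult powr_mult)
    hence k: "kernel1 \<alpha> h t (c * \<eta>) = complex_of_real (c powr (- p)) * ((iexp (c * t * \<eta>) - 1) / complex_of_real (\<bar>\<eta>\<bar> powr p))"
      unfolding kernel1_def p_def[symmetric] by (simp add: powr_minus_divide mult_ac)
    have "iexp ((c * t - real_of_int k) * \<eta>) = iexp (c * t * \<eta>) * iexp (- (real_of_int k * \<eta>))"
      by (simp add: algebra_simps flip: exp_add)
    thus ?thesis
      unfolding k Eh_def cc c1 g_def by (simp add: algebra_simps diff_divide_distrib)
  qed
  have "(CLINT \<xi>|lborel. kernel1 \<alpha> h t \<xi> * Eh j k \<xi>) = \<bar>c\<bar> *\<^sub>R (CLINT \<eta>|lborel. kernel1 \<alpha> h t (0 + c * \<eta>) * Eh j k (0 + c * \<eta>))"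
    using c by (intro lborel_integral_real_affine) auto
  also have "\<dots> = complex_of_real c * (complex_of_real (2 powr (- real_of_int j / 2) * c powr (- p)) *
      (CLINT \<eta>|lborel. iexp ((c * t - real_of_int k) * \<eta>) * g \<eta> - iexp (- real_of_int k * \<eta>) * g \<eta>))"
    using c by (simp only: add_0 pt integral_mult_right_zero) (simp add: scaleR_conv_of_real)
  also have "(CLINT \<eta>|lborel. iexp ((c * t - real_of_int k) * \<eta>) * g \<eta> - iexp (- real_of_int k * \<eta>) * g \<eta>) =
      psi_frac \<psi> \<alpha> h (c * t - real_of_int k) - psi_frac \<psi> \<alpha> h (- real_of_int k)"
    unfolding pf by (intro Bochner_Integration.integral_diff integrable_iexp_mult g) measurable
  also have "complex_of_real c * (complex_of_real (2 powr (- real_of_int j / 2) * c powr (- p)) *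
      (psi_frac \<psi> \<alpha> h (c * t - real_of_int k) - psi_frac \<psi> \<alpha> h (- real_of_int k))) =
      complex_of_real (c * (2 powr (- real_of_int j / 2) * c powr (- p))) *
      (psi_frac \<psi> \<alpha> h (c * t - real_of_int k) - psi_frac \<psi> \<alpha> h (- real_of_int k))"
    by simp
  also have "c * (2 powr (- real_of_int j / 2) * c powr (- p)) =
      2 powr (real_of_int j / 2 - real_of_int j / \<alpha>) * 2 powr (- real_of_int j * h)"
  proof -
    have "c * (2 powr (- real_of_int j / 2) * c powr (- p)) = 2 powr (real_of_int j + (- real_of_int j / 2 + real_of_int j * (- p)))"
      unfolding c_def powr_powr by (simp only: powr_add)
    also have "real_of_int j + (- real_of_int j / 2 + real_of_int j * (- p)) =
        (real_of_int j / 2 - real_of_int j / \<alpha>) + (- real_of_int j * h)"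
      by (simp add: p_def algebra_simps)
    finally show ?thesis by (simp only: powr_add)
  qed
  finally show ?thesis by (simp add: dcoef_def c_def mult.assoc)
qed

lemma dcoef_increment_sum:
  assumes h: "0 < h" "h < 1" and \<gamma>: "0 < \<gamma>" and \<delta>: "0 < \<delta>" "\<delta> \<le> 1/2" "\<gamma> + 2 * \<delta> < h" "h + \<delta> < 1" and M: "M > 0"
  obtains B where "B \<ge> 0"
    "\<And>F s t. finite F \<Longrightarrow> \<bar>s\<bar> \<le> M \<Longrightarrow> \<bar>t\<bar> \<le> M \<Longrightarrow>
      (\<Sum>(j, k)\<in>F. wt (j, k) powr \<delta> * norm (dcoef \<alpha> h t j k - dcoef \<alpha> h s j k)) \<le> B * \<bar>t - s\<bar> powr \<gamma>"
proof -
  obtain C \<theta> where C: "C \<ge> 0" "\<And>y. (psi_frac \<psi> \<alpha> h has_vector_derivative \<theta> y) (at y)"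
    "\<And>y. norm (psi_frac \<psi> \<alpha> h y) \<le> C / (1 + y\<^sup>2)" "\<And>y. norm (\<theta> y) \<le> C / (1 + y\<^sup>2)"
    using psi_frac_regular by blast
  obtain B where B: "B \<ge> 0" "\<And>F s t. finite F \<Longrightarrow> \<bar>s\<bar> \<le> M \<Longrightarrow> \<bar>t\<bar> \<le> M \<Longrightarrow>
    (\<Sum>(j, k)\<in>F. 2 powr (- real_of_int j * h) * wt (j, k) powr \<delta> *
       norm (psi_frac \<psi> \<alpha> h (2 powr real_of_int j * t - real_of_int k) - psi_frac \<psi> \<alpha> h (2 powr real_of_int j * s - real_of_int k))) \<le> B * \<bar>t - s\<bar> powr \<gamma>"
    using weighted_increment_sum[of "psi_frac \<psi> \<alpha> h" "8 * C" \<gamma> \<delta> h M,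
      OF increment_bound[OF C(1) C(3) C(2) C(4)]] C(1) \<gamma> \<delta> h M by auto
  have eq: "wt (j, k) powr \<delta> * norm (dcoef \<alpha> h t j k - dcoef \<alpha> h s j k) =
      2 powr (- real_of_int j * h) * wt (j, k) powr \<delta> *
       norm (psi_frac \<psi> \<alpha> h (2 powr real_of_int j * t - real_of_int k) - psi_frac \<psi> \<alpha> h (2 powr real_of_int j * s - real_of_int k))" for s t j k
  proof -
    have "dcoef \<alpha> h t j k - dcoef \<alpha> h s j k = complex_of_real (2 powr (- real_of_int j * h)) *
        (psi_frac \<psi> \<alpha> h (2 powr real_of_int j * t - real_of_int k) - psi_frac \<psi> \<alpha> h (2 powr real_of_int j * s - real_of_int k))"
      by (simp add: dcoef_def algebra_simps)
    thus ?thesis by (simp add: norm_mult)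
  qed
  show ?thesis
    by (rule that[OF B(1)]) (unfold eq, rule B(2))
qed

lemma dcoef_0 [simp]: "dcoef \<alpha> h 0 j k = 0"
  by (simp add: dcoef_def)

definition partial_kernel :: "real \<Rightarrow> real \<Rightarrow> real \<Rightarrow> real \<Rightarrow> nat \<Rightarrow> real \<Rightarrow> complex" where
  "partial_kernel \<alpha> h M t n \<xi> = (\<Sum>(j, k)\<in>D_index n M. dcoef \<alpha> h t j k * cnj (psi_hat \<psi> \<alpha> j k \<xi>))"

lemma partial_kernel_measurable [measurable]: "partial_kernel \<alpha> h M t n \<in> borel_measurable borel"
  unfolding partial_kernel_def case_prod_unfold psi_hat_eq_Eh by measurable

text \<open>One half of the weight exponent \<open>d\<close> pays for the growth of the normalised
  wavelets in |j|, and the other half stays in the sum as spare weight. Since \<open>dcoef\<close>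
  vanishes at time 0, the bound on increments from 0 is a bound on the coefficients
  themselves.\<close>

lemma dcoef_psi_hat_sum:
  assumes \<alpha>: "\<alpha> > 0" and h: "0 < h" "h < 1" and M: "M > 0" and t: "\<bar>t\<bar> \<le> M"
  obtains \<delta> B where "\<delta> > 0" "B \<ge> 0"
    "\<And>F \<xi>. finite F \<Longrightarrow> (\<Sum>(j, k)\<in>F. wt (j, k) powr \<delta> * norm (dcoef \<alpha> h t j k * cnj (psi_hat \<psi> \<alpha> j k \<xi>))) \<le> B * envelope \<alpha> \<delta> \<xi>"
proof -
  \<comment> \<open>These choices of \<open>\<gamma>\<close> and \<open>d\<close> satisfy the strict
    inequalities of \<open>dcoef_increment_sum\<close> for every \<open>h\<close> between 0 and
    1.\<close>
  define \<gamma> where "\<gamma> = h / 4"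
  define d where "d = min (1/2) (min (h / 4) ((1 - h) / 2))"
  define \<delta> where "\<delta> = d / 2"
  have \<gamma>: "0 < \<gamma>" using h by (simp add: \<gamma>_def)
  have d: "0 < d" "d \<le> 1/2" "\<gamma> + 2 * d < h" "h + d < 1"
  proof -
    show "0 < d" "d \<le> 1/2" using h by (auto simp: d_def)
    have "d \<le> h / 4" "d \<le> (1 - h) / 2"
      unfolding d_def by (rule min.coboundedI2[OF min.cobounded1], rule min.coboundedI2[OF min.cobounded2])
    thus "\<gamma> + 2 * d < h" "h + d < 1" using h by (simp_all add: \<gamma>_def)
  qed
  have \<delta>: "\<delta> > 0" using d by (simp add: \<delta>_def)
  obtain B where B: "B \<ge> 0" "\<And>F s t. finite F \<Longrightarrow> \<bar>s\<bar> \<le> M \<Longrightarrow> \<bar>t\<bar> \<le> M \<Longrightarrow>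
      (\<Sum>(j, k)\<in>F. wt (j, k) powr d * norm (dcoef \<alpha> h t j k - dcoef \<alpha> h s j k)) \<le> B * \<bar>t - s\<bar> powr \<gamma>"
    using dcoef_increment_sum[OF h \<gamma> d M] by blast
  obtain A where A: "A > 0" "\<And>j k \<xi>. norm (psi_hat \<psi> \<alpha> j k \<xi>) \<le> 2 powr (\<delta> * \<bar>real_of_int j\<bar>) * (A * envelope \<alpha> \<delta> \<xi>)"
    using psi_hat_le_envelope[OF \<alpha> \<delta>] by blast
  show ?thesis
  proof (rule that[of \<delta> "B * M powr \<gamma> * A"])
    fix F :: "(int \<times> int) set" and \<xi> assume F: "finite F"
    have "(\<Sum>(j, k)\<in>F. wt (j, k) powr \<delta> * norm (dcoef \<alpha> h t j k * cnj (psi_hat \<psi> \<alpha> j k \<xi>))) \<le>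
        (\<Sum>(j, k)\<in>F. wt (j, k) powr d * norm (dcoef \<alpha> h t j k - dcoef \<alpha> h 0 j k) * (A * envelope \<alpha> \<delta> \<xi>))"
    proof (rule sum_mono, clarify)
      fix j k
      have w: "2 powr (\<delta> * \<bar>real_of_int j\<bar>) \<le> wt (j, k) powr \<delta>"
      proof -
        have "2 powr \<bar>real_of_int j\<bar> * 1 \<le> wt (j, k)" unfolding wt_def split by (intro mult_left_mono) auto
        hence "(2 powr \<bar>real_of_int j\<bar>) powr \<delta> \<le> wt (j, k) powr \<delta>" using \<delta> by (intro powr_mono2) auto
        thus ?thesis by (simp add: powr_powr mult.commute)
      qed
      have "wt (j, k) powr \<delta> * norm (dcoef \<alpha> h t j k * cnj (psi_hat \<psi> \<alpha> j k \<xi>)) \<le>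
          wt (j, k) powr \<delta> * (norm (dcoef \<alpha> h t j k) * (wt (j, k) powr \<delta> * (A * envelope \<alpha> \<delta> \<xi>)))"
        unfolding norm_mult complex_mod_cnj
        using A by (intro mult_left_mono order_trans[OF A(2)] mult_right_mono w) auto
      also have "\<dots> = wt (j, k) powr d * norm (dcoef \<alpha> h t j k - dcoef \<alpha> h 0 j k) * (A * envelope \<alpha> \<delta> \<xi>)"
      proof -
        have "wt (j, k) powr d = wt (j, k) powr \<delta> * wt (j, k) powr \<delta>" by (simp add: \<delta>_def flip: powr_add)
        thus ?thesis by (simp add: mult_ac)
      qed
      finally show "wt (j, k) powr \<delta> * norm (dcoef \<alpha> h t j k * cnj (psi_hat \<psi> \<alpha> j k \<xi>)) \<le>
          wt (j, k) powr d * norm (dcoef \<alpha> h t j k - dcoef \<alpha> h 0 j k) * (A * envelope \<alpha> \<delta> \<xi>)" .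
    qed
    also have "\<dots> = (\<Sum>(j, k)\<in>F. wt (j, k) powr d * norm (dcoef \<alpha> h t j k - dcoef \<alpha> h 0 j k)) * (A * envelope \<alpha> \<delta> \<xi>)"
      by (simp add: sum_distrib_right case_prod_unfold)
    also have "\<dots> \<le> (B * \<bar>t - 0\<bar> powr \<gamma>) * (A * envelope \<alpha> \<delta> \<xi>)"
      using M t A F by (intro mult_right_mono B) auto
    also have "\<dots> \<le> (B * M powr \<gamma>) * (A * envelope \<alpha> \<delta> \<xi>)"
      using t A B \<gamma> by (intro mult_right_mono mult_left_mono powr_mono2) auto
    finally show "(\<Sum>(j, k)\<in>F. wt (j, k) powr \<delta> * norm (dcoef \<alpha> h t j k * cnj (psi_hat \<psi> \<alpha> j k \<xi>))) \<le> B * M powr \<gamma> * A * envelope \<alpha> \<delta> \<xi>"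
      by (simp add: mult_ac)
  qed (use \<delta> A B in auto)
qed

lemma Eh_continuous: "continuous_on UNIV (Eh j k)"
  unfolding Eh_def
  by (intro continuous_intros continuous_on_compose2[OF C2_continuous[OF C2_fourier]]) auto

lemma kernel1_mult_bound:
  assumes "norm (g \<xi>) \<le> B" "\<bar>\<xi>\<bar> < r \<or> \<bar>\<xi>\<bar> > R \<Longrightarrow> g \<xi> = 0" "r > 0" "h + 1 / \<alpha> > 0"
  shows "norm (kernel1 \<alpha> h t \<xi> * g \<xi>) \<le> 2 * r powr (- (h + 1 / \<alpha>)) * B * indicator {-R..R} \<xi>"
proof (cases "\<bar>\<xi>\<bar> < r \<or> \<bar>\<xi>\<bar> > R")
  case True
  have "B \<ge> 0" using assms(1) norm_ge_zero order_trans by blast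
  thus ?thesis using assms(2)[OF True] by simp
next
  case False
  have "norm (iexp (t * \<xi>) - 1) \<le> norm (iexp (t * \<xi>)) + norm (1::complex)" by (rule norm_triangle_ineq4)
  hence "norm (kernel1 \<alpha> h t \<xi>) \<le> 2 / \<bar>\<xi>\<bar> powr (h + 1 / \<alpha>)"
    by (simp add: kernel1_def norm_divide divide_right_mono)
  also have "\<dots> \<le> 2 / r powr (h + 1 / \<alpha>)"
    using False assms(3,4) by (intro divide_left_mono powr_mono2) auto
  finally have "norm (kernel1 \<alpha> h t \<xi>) \<le> 2 * r powr (- (h + 1 / \<alpha>))"
    unfolding powr_minus_divide by simp
  hence "norm (kernel1 \<alpha> h t \<xi> * g \<xi>) \<le> (2 * r powr (- (h + 1 / \<alpha>))) * B"
    unfolding norm_mult using assms(1) by (intro mult_mono) auto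
  moreover have "\<xi> \<in> {-R..R}" using False by (auto simp: not_less abs_le_iff)
  ultimately show ?thesis by simp
qed

lemma kernel1_mult_integrable:
  assumes [measurable]: "g \<in> borel_measurable borel" and "\<And>\<xi>. norm (g \<xi>) \<le> B"
    "\<And>\<xi>. \<bar>\<xi>\<bar> < r \<or> \<bar>\<xi>\<bar> > R \<Longrightarrow> g \<xi> = 0" "r > 0" "h + 1 / \<alpha> > 0"
  shows "integrable lborel (\<lambda>\<xi>. kernel1 \<alpha> h t \<xi> * g \<xi>)"
proof (rule Bochner_Integration.integrable_bound)
  show "integrable lborel (\<lambda>\<xi>. 2 * r powr (- (h + 1 / \<alpha>)) * B * indicator {-R..R} \<xi> :: real)"
    by (intro integrable_mult_right integrable_real_indicator) (auto simp: emeasure_lborel_Icc_eq)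
  show "AE \<xi> in lborel. norm (kernel1 \<alpha> h t \<xi> * g \<xi>) \<le> norm (2 * r powr (- (h + 1 / \<alpha>)) * B * indicator {-R..R} \<xi> :: real)"
  proof (intro AE_I2)
    fix \<xi>
    show "norm (kernel1 \<alpha> h t \<xi> * g \<xi>) \<le> norm (2 * r powr (- (h + 1 / \<alpha>)) * B * indicator {-R..R} \<xi> :: real)"
      using kernel1_mult_bound[of g \<xi> B r R h \<alpha> t] assms by (auto intro: order_trans[OF _ abs_ge_self])
  qed
qed measurable

lemma kernel1_Eh_integrable:
  assumes p: "h + 1 / \<alpha> > 0"
  shows "integrable lborel (\<lambda>\<xi>. kernel1 \<alpha> h t \<xi> * Eh j k \<xi>)"
proof -
  obtain b where b: "b > 0" "\<And>\<xi>. norm (\<phi> \<xi>) \<le> b" using fourier_bounded by blast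
  define c where "c = 2 powr (- real_of_int j)"
  have c: "c > 0" by (simp add: c_def)
  show ?thesis
  proof (rule kernel1_mult_integrable[where B = "2 powr (- real_of_int j / 2) * b" and r = "2 / c" and R = "11 / c"])
    show "norm (Eh j k \<xi>) \<le> 2 powr (- real_of_int j / 2) * b" for \<xi>
      using b by (simp add: Eh_def norm_mult mult_left_mono)
    show "Eh j k \<xi> = 0" if "\<bar>\<xi>\<bar> < 2 / c \<or> 11 / c < \<bar>\<xi>\<bar>" for \<xi>
    proof -
      have "\<bar>c * \<xi>\<bar> < 2 \<or> \<bar>c * \<xi>\<bar> > 11" using that c by (auto simp: abs_mult field_simps)
      thus ?thesis using fourier_support by (auto simp: Eh_def c_def)
    qed
  qed (use c p in auto)
qed

text \<open>The series converges absolutely at each point, and uniformly away from the origin, to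
  some \<open>f\<close> that is continuous there. To identify \<open>f\<close> with the kernel, both
  are integrated against a bump \<open>V\<close>: for partial sums the pairing exchanges
  coefficients of the kernel with coefficients of \<open>V\<close>, and the expansion of
  \<open>V\<close> is already known.\<close>

theorem partial_kernel_tendsto:
  assumes \<alpha>: "\<alpha> > 0" and h: "0 < h" "h < 1" and M: "M > 0" and t: "\<bar>t\<bar> \<le> M"
  shows "(\<lambda>n. partial_kernel \<alpha> h M t n \<xi>) \<longlonglongrightarrow> kernel1 \<alpha> h t \<xi>"
proof -
  have p0: "h + 1 / \<alpha> > 0" using h \<alpha> by (simp add: add_pos_pos)
  obtain \<delta> B where \<delta>: "\<delta> > 0" and B: "B \<ge> 0"
    "\<And>F \<xi>. finite F \<Longrightarrow> (\<Sum>(j, k)\<in>F. wt (j, k) powr \<delta> * norm (dcoef \<alpha> h t j k * cnj (psi_hat \<psi> \<alpha> j k \<xi>))) \<le> B * envelope \<alpha> \<delta> \<xi>"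
    using dcoef_psi_hat_sum[OF assms] by blast
  define F where "F \<xi> = (\<lambda>(j, k). dcoef \<alpha> h t j k * cnj (psi_hat \<psi> \<alpha> j k \<xi>))" for \<xi>
  define pk where "pk n \<xi> = partial_kernel \<alpha> h M t n \<xi>" for n \<xi>
  have pkF: "pk n \<xi> = (\<Sum>p\<in>D_index n M. F \<xi> p)" for n \<xi>
    by (simp add: pk_def partial_kernel_def F_def)
  have Bw: "(\<Sum>p\<in>X. wt p powr \<delta> * norm (F \<xi> p)) \<le> B * envelope \<alpha> \<delta> \<xi>" if "finite X" for X \<xi>
    using B(2)[OF that, of \<xi>] by (simp add: F_def case_prod_unfold)
  have B1: "(\<Sum>p\<in>X. norm (F \<xi> p)) \<le> B * envelope \<alpha> \<delta> \<xi>" if "finite X" for X \<xi>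
  proof (rule order_trans[OF sum_mono Bw[OF that]])
    fix p show "norm (F \<xi> p) \<le> wt p powr \<delta> * norm (F \<xi> p)"
      using mult_right_mono[OF ge_one_powr_ge_zero[OF wt_ge_1[of p], of \<delta>], of "norm (F \<xi> p)"] \<delta> by simp
  qed
  define f where "f \<xi> = infsum (F \<xi>) UNIV" for \<xi>
  have lim: "(\<lambda>n. pk n \<xi>) \<longlonglongrightarrow> f \<xi>" for \<xi>
    unfolding pkF f_def by (rule abs_summable_D_index_limit[OF M B1])
  have pkb: "norm (pk n \<xi>) \<le> B * envelope \<alpha> \<delta> \<xi>" for n \<xi>
    unfolding pkF by (rule order_trans[OF norm_sum B1[OF finite_D_index]])
  \<comment> \<open>The geometric rate that the spare weight yields outside
    \<open>D_index n M\<close>.\<close>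
  define \<rho> where "\<rho> n = (min 1 M * 2 ^ n) powr (- \<delta>)" for n :: nat
  have mM: "min 1 M > 0" using M by simp
  have \<rho>0: "\<rho> n \<ge> 0" for n by (simp add: \<rho>_def)
  have \<rho>lim: "\<rho> \<longlonglongrightarrow> 0"
  proof -
    have eq: "\<rho> = (\<lambda>n. min 1 M powr (- \<delta>) * (2 powr (- \<delta>)) ^ n)"
      using mM by (auto simp: \<rho>_def powr_mult powr_powr mult.commute simp flip: powr_realpow)
    have "(\<lambda>n. (2 powr (- \<delta>)) ^ n) \<longlonglongrightarrow> 0"
      using \<delta> by (intro LIMSEQ_realpow_zero powr_less_one) auto
    from tendsto_mult_right_zero[OF this] show ?thesis unfolding eq .
  qed
  have tail: "norm (pk m \<xi> - pk n \<xi>) \<le> \<rho> n * (B * envelope \<alpha> \<delta> \<xi>)" if mn: "m \<ge> n" for m n \<xi>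
  proof -
    have "pk m \<xi> - pk n \<xi> = (\<Sum>p\<in>D_index m M - D_index n M. F \<xi> p)"
      unfolding pkF using D_index_mono[OF mn] M finite_D_index by (subst sum_diff) auto
    also have "norm \<dots> \<le> (\<Sum>p\<in>D_index m M - D_index n M. norm (F \<xi> p))" by (rule norm_sum)
    also have "\<dots> \<le> (\<Sum>p\<in>D_index m M - D_index n M. \<rho> n * (wt p powr \<delta> * norm (F \<xi> p)))"
    proof (rule sum_mono)
      fix p assume "p \<in> D_index m M - D_index n M"
      hence w: "min 1 M * 2 ^ n \<le> wt p" using wt_off_D_index M by blast
      have "1 = \<rho> n * (min 1 M * 2 ^ n) powr \<delta>"
        using mM by (simp add: \<rho>_def powr_minus field_simps)
      also have "\<dots> \<le> \<rho> n * wt p powr \<delta>"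
        using w \<delta> mM by (intro mult_left_mono \<rho>0 powr_mono2) auto
      finally have "1 * norm (F \<xi> p) \<le> \<rho> n * wt p powr \<delta> * norm (F \<xi> p)" by (intro mult_right_mono) auto
      thus "norm (F \<xi> p) \<le> \<rho> n * (wt p powr \<delta> * norm (F \<xi> p))" by (simp add: mult.assoc)
    qed
    also have "\<dots> \<le> \<rho> n * (B * envelope \<alpha> \<delta> \<xi>)"
      unfolding sum_distrib_left[symmetric] using finite_D_index by (intro mult_left_mono Bw \<rho>0) auto
    finally show ?thesis .
  qed
  have ftail: "norm (f \<xi> - pk n \<xi>) \<le> \<rho> n * (B * envelope \<alpha> \<delta> \<xi>)" for n \<xi>
  proof (rule LIMSEQ_le_const2)
    show "(\<lambda>m. norm (pk m \<xi> - pk n \<xi>)) \<longlonglongrightarrow> norm (f \<xi> - pk n \<xi>)"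
      by (intro tendsto_intros lim)
  qed (use tail in auto)
  \<comment> \<open>Away from the origin the envelope is bounded, which turns the rate into uniform
    convergence.\<close>
  have domb: "envelope \<alpha> \<delta> \<xi> \<le> a powr (- (1 / \<alpha>))" if "a > 0" "\<bar>\<xi>\<bar> \<ge> a" for a \<xi>
  proof -
    have "min (\<bar>\<xi>\<bar> powr \<delta>) (\<bar>\<xi>\<bar> powr (- \<delta>)) \<le> 1"
    proof (cases "\<bar>\<xi>\<bar> \<le> 1")
      case True
      hence "\<bar>\<xi>\<bar> powr \<delta> \<le> 1 powr \<delta>" using \<delta> by (intro powr_mono2) auto
      thus ?thesis by simp
    next
      case False
      hence "\<bar>\<xi>\<bar> powr (- \<delta>) \<le> 1 powr (- \<delta>)" using \<delta> by (intro powr_mono2') auto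
      thus ?thesis by simp
    qed
    moreover have "\<bar>\<xi>\<bar> powr (- (1 / \<alpha>)) \<le> a powr (- (1 / \<alpha>))" using that \<alpha> by (intro powr_mono2') auto
    ultimately have "envelope \<alpha> \<delta> \<xi> \<le> a powr (- (1 / \<alpha>)) * 1"
      unfolding envelope_def by (intro mult_mono) auto
    thus ?thesis by simp
  qed
  have pkc: "continuous_on S (pk n)" for n S
    unfolding pk_def[abs_def] partial_kernel_def case_prod_unfold psi_hat_eq_Eh
    by (intro continuous_intros continuous_on_subset[OF Eh_continuous]) auto
  have fc: "continuous_on {\<xi>. a < \<bar>\<xi>\<bar>} f" if a: "a > 0" for a
  proof (rule uniform_limit_theorem)
    show "\<forall>\<^sub>F n in sequentially. continuous_on {\<xi>. a < \<bar>\<xi>\<bar>} (pk n)" by (intro always_eventually allI pkc)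
    show "uniform_limit {\<xi>. a < \<bar>\<xi>\<bar>} pk f sequentially"
    proof (rule uniform_limitI)
      fix e :: real assume e: "e > 0"
      define K where "K = B * a powr (- (1 / \<alpha>))"
      have "(\<lambda>n. \<rho> n * K) \<longlonglongrightarrow> 0" using \<rho>lim by (rule tendsto_mult_left_zero)
      hence "\<forall>\<^sub>F n in sequentially. \<rho> n * K < e" using e by (rule order_tendstoD)
      thus "\<forall>\<^sub>F n in sequentially. \<forall>\<xi>\<in>{\<xi>. a < \<bar>\<xi>\<bar>}. dist (pk n \<xi>) (f \<xi>) < e"
      proof eventually_elim
        case (elim n)
        show ?case
        proof
          fix \<xi> assume "\<xi> \<in> {\<xi>. a < \<bar>\<xi>\<bar>}"
          hence "\<rho> n * (B * envelope \<alpha> \<delta> \<xi>) \<le> \<rho> n * K"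
            unfolding K_def using a by (intro mult_left_mono \<rho>0 domb B) auto
          thus "dist (pk n \<xi>) (f \<xi>) < e" using ftail[of \<xi> n] elim by (simp add: dist_norm norm_minus_commute)
        qed
      qed
    qed
  qed auto
  have fcont: "continuous_on (- {0}) f"
  proof (subst continuous_on_eq_continuous_at)
    show "\<forall>x\<in>- {0}. isCont f x"
    proof
      fix x :: real assume "x \<in> - {0}"
      hence x: "\<bar>x\<bar> / 2 > 0" "x \<in> {\<xi>. \<bar>x\<bar> / 2 < \<bar>\<xi>\<bar>}" by auto
      have "open {\<xi>::real. \<bar>x\<bar> / 2 < \<bar>\<xi>\<bar>}" by (intro open_Collect_less continuous_intros)
      thus "isCont f x" using fc[OF x(1)] x(2) by (simp add: continuous_on_eq_continuous_at)
    qed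
  qed (intro open_Compl closed_singleton)
  have kcont: "continuous_on (- {0}) (kernel1 \<alpha> h t)"
    unfolding kernel1_def by (intro continuous_intros) auto
  have fm[measurable]: "f \<in> borel_measurable borel"
    by (rule borel_measurable_LIMSEQ_metric[of pk]) (use lim in \<open>auto simp: pk_def[abs_def]\<close>)
  have weak: "(CLINT x|lborel. complex_of_real (pos3 (x - p) * pos3 (q - x)) * (f x - kernel1 \<alpha> h t x)) = 0"
    if pq: "p < q" "0 < p \<or> q < 0" for p q
  proof -
    define V where "V x = complex_of_real (pos3 (x - p) * pos3 (q - x))" for x
    define a where "a = min \<bar>p\<bar> \<bar>q\<bar>"
    define b where "b = max \<bar>p\<bar> \<bar>q\<bar>"
    have a: "a > 0" using pq by (auto simp: a_def)
    have V2: "C2 V"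
    proof -
      have "C2 (\<lambda>x. complex_of_real (pos3 (- p + 1 * x)) * complex_of_real (pos3 (q + (-1) * x)))"
        by (rule C2_mult[OF C2_pos3_affine C2_pos3_affine])
      thus ?thesis by (simp add: V_def[abs_def])
    qed
    have Vs: "V x = 0" if "\<bar>x\<bar> < a \<or> \<bar>x\<bar> > b" for x
    proof -
      have "x \<le> p \<or> q \<le> x" using that pq by (auto simp: a_def b_def min_def max_def abs_if split: if_splits)
      thus ?thesis by (auto simp: V_def)
    qed
    note Vc = C2_continuous[OF V2]
    have Vi: "integrable lborel V" by (rule integrable_compact_support[OF Vc, of b]) (use Vs in auto)
    note [measurable] = borel_measurable_integrable[OF Vi]
    obtain L r R where L: "L \<ge> 0" "r > 0"
      "\<And>F \<eta>. finite F \<Longrightarrow> (\<Sum>(j, k)\<in>F. norm (coef V j k * Eh j k \<eta>)) \<le> L"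
      "\<And>j k \<eta>. \<bar>\<eta>\<bar> < r \<or> \<bar>\<eta>\<bar> > R \<Longrightarrow> coef V j k * Eh j k \<eta> = 0"
      using coef_Eh_sums_bounded[OF V2 a Vs] by blast
    define \<Lambda> where "\<Lambda> n \<eta> = (\<Sum>(j, k)\<in>D_index n M. coef V j k * Eh j k \<eta>)" for n \<eta>
    have \<Lambda>m[measurable]: "\<Lambda> n \<in> borel_measurable borel" for n
      unfolding \<Lambda>_def case_prod_unfold by measurable
    have \<Lambda>b: "norm (\<Lambda> n \<eta>) \<le> L" for n \<eta>
      unfolding \<Lambda>_def by (rule order_trans[OF norm_sum order_trans[OF _ L(3)[OF finite_D_index, of \<eta> n M]]])
        (auto simp: case_prod_unfold)
    have \<Lambda>s: "\<Lambda> n \<eta> = 0" if "\<bar>\<eta>\<bar> < r \<or> \<bar>\<eta>\<bar> > R" for n \<eta>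
      unfolding \<Lambda>_def by (intro sum.neutral) (use L(4)[OF that] in auto)
    have \<Lambda>lim: "(\<lambda>n. \<Lambda> n \<eta>) \<longlonglongrightarrow> V \<eta>" for \<eta>
      unfolding \<Lambda>_def by (rule wavelet_expansion[OF V2 a Vs M])
    have Vb: "norm (V \<eta>) \<le> L" for \<eta>
      by (rule LIMSEQ_le_const2[OF tendsto_norm[OF \<Lambda>lim]]) (use \<Lambda>b in auto)
    have VEi: "integrable lborel (\<lambda>x. V x * cnj (Eh j k x))" for j k
      by (rule integrable_compact_support[of _ b])
         (auto intro!: continuous_intros Vc Eh_continuous simp: Vs)
    define s where "s j = complex_of_real (2 powr (real_of_int j / 2 - real_of_int j / \<alpha>))" for j
    \<comment> \<open>Duality: a finite sum of products of coefficients of the kernel and of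
      \<open>V\<close> is read once as \<open>V\<close> against the partial kernel, and once as the
      kernel against the partial expansion of \<open>V\<close>.\<close>
    have eq: "(CLINT x|lborel. V x * pk n x) = (CLINT x|lborel. kernel1 \<alpha> h t x * \<Lambda> n x)" for n
    proof -
      have "(CLINT x|lborel. V x * pk n x) =
          (CLINT x|lborel. (\<Sum>p\<in>D_index n M. dcoef \<alpha> h t (fst p) (snd p) * s (fst p) * (V x * cnj (Eh (fst p) (snd p) x))))"
      proof (intro Bochner_Integration.integral_cong refl)
        fix x
        show "V x * pk n x = (\<Sum>p\<in>D_index n M. dcoef \<alpha> h t (fst p) (snd p) * s (fst p) * (V x * cnj (Eh (fst p) (snd p) x)))"
          unfolding pkF F_def case_prod_unfold sum_distrib_left psi_hat_eq_Eh s_def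
          by (intro sum.cong refl) (simp add: mult_ac)
      qed
      also have "\<dots> = (\<Sum>p\<in>D_index n M. dcoef \<alpha> h t (fst p) (snd p) * s (fst p) * coef V (fst p) (snd p))"
        unfolding Bochner_Integration.integral_sum[OF integrable_mult_right[OF VEi]]
        by (simp only: integral_mult_right_zero coef_def)
      also have "\<dots> = (\<Sum>p\<in>D_index n M. coef V (fst p) (snd p) * (CLINT x|lborel. kernel1 \<alpha> h t x * Eh (fst p) (snd p) x))"
        unfolding integral_kernel1_Eh s_def by (intro sum.cong refl) (simp add: mult_ac)
      also have "\<dots> = (CLINT x|lborel. (\<Sum>p\<in>D_index n M. coef V (fst p) (snd p) * (kernel1 \<alpha> h t x * Eh (fst p) (snd p) x)))"
        unfolding Bochner_Integration.integral_sum[OF integrable_mult_right[OF kernel1_Eh_integrable[OF p0]]]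
        by (simp only: integral_mult_right_zero)
      also have "\<dots> = (CLINT x|lborel. kernel1 \<alpha> h t x * \<Lambda> n x)"
      proof (intro Bochner_Integration.integral_cong refl)
        fix x
        show "(\<Sum>p\<in>D_index n M. coef V (fst p) (snd p) * (kernel1 \<alpha> h t x * Eh (fst p) (snd p) x)) = kernel1 \<alpha> h t x * \<Lambda> n x"
          unfolding \<Lambda>_def case_prod_unfold sum_distrib_left by (intro sum.cong refl) (simp add: mult_ac)
      qed
      finally show ?thesis .
    qed
    have kV: "integrable lborel (\<lambda>x. kernel1 \<alpha> h t x * V x)"
      by (rule kernel1_mult_integrable[of V L a b]) (use Vb Vs a p0 in auto)
    have lim1: "(\<lambda>n. CLINT x|lborel. kernel1 \<alpha> h t x * \<Lambda> n x) \<longlonglongrightarrow> (CLINT x|lborel. kernel1 \<alpha> h t x * V x)"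
    proof (rule integral_dominated_convergence[where w = "\<lambda>\<xi>. 2 * r powr (- (h + 1 / \<alpha>)) * L * indicator {-R..R} \<xi>"])
      show "integrable lborel (\<lambda>\<xi>. 2 * r powr (- (h + 1 / \<alpha>)) * L * indicator {-R..R} \<xi> :: real)"
        by (intro integrable_mult_right integrable_real_indicator) (auto simp: emeasure_lborel_Icc_eq)
      show "AE x in lborel. (\<lambda>n. kernel1 \<alpha> h t x * \<Lambda> n x) \<longlonglongrightarrow> kernel1 \<alpha> h t x * V x"
        by (intro AE_I2 tendsto_intros \<Lambda>lim)
      show "AE x in lborel. norm (kernel1 \<alpha> h t x * \<Lambda> n x) \<le> 2 * r powr (- (h + 1 / \<alpha>)) * L * indicator {-R..R} x" for n
        by (intro AE_I2 kernel1_mult_bound) (use \<Lambda>b \<Lambda>s L p0 in auto)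
    qed measurable
    define w where "w x = norm (V x) * (B * a powr (- (1 / \<alpha>)))" for x
    have wi: "integrable lborel w" unfolding w_def by (intro integrable_mult_left integrable_norm Vi)
    have wb: "norm (V x * z) \<le> w x" if "norm z \<le> B * envelope \<alpha> \<delta> x" for x z
    proof (cases "\<bar>x\<bar> < a")
      case True
      thus ?thesis using Vs[of x] by (simp add: w_def)
    next
      case False
      hence "norm z \<le> B * a powr (- (1 / \<alpha>))"
        using that a B by (intro order_trans[OF that] mult_left_mono domb) auto
      thus ?thesis by (simp add: w_def norm_mult mult_left_mono)
    qed
    have fb: "norm (f x) \<le> B * envelope \<alpha> \<delta> x" for x
      by (rule LIMSEQ_le_const2[OF tendsto_norm[OF lim]]) (use pkb in auto)
    have lim2: "(\<lambda>n. CLINT x|lborel. V x * pk n x) \<longlonglongrightarrow> (CLINT x|lborel. V x * f x)"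
    proof (rule integral_dominated_convergence[where w = w])
      show "AE x in lborel. (\<lambda>n. V x * pk n x) \<longlonglongrightarrow> V x * f x" by (intro AE_I2 tendsto_intros lim)
      show "AE x in lborel. norm (V x * pk n x) \<le> w x" for n by (intro AE_I2 wb pkb)
    qed (use wi in \<open>auto simp: pk_def[abs_def]\<close>)
    have Vf: "integrable lborel (\<lambda>x. V x * f x)"
    proof (rule Bochner_Integration.integrable_bound[OF wi])
      show "AE x in lborel. norm (V x * f x) \<le> norm (w x)"
        using wb[OF fb] by (intro AE_I2) (auto intro: order_trans[OF _ abs_ge_self])
    qed measurable
    have "(CLINT x|lborel. V x * f x) = (CLINT x|lborel. kernel1 \<alpha> h t x * V x)"
      using LIMSEQ_unique[OF lim2 lim1[folded eq]] .
    moreover have "(CLINT x|lborel. V x * (f x - kernel1 \<alpha> h t x)) =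
        (CLINT x|lborel. V x * f x) - (CLINT x|lborel. kernel1 \<alpha> h t x * V x)"
      using Vf kV by (subst Bochner_Integration.integral_diff[symmetric]) (auto simp: algebra_simps)
    ultimately show ?thesis by (simp add: V_def)
  qed
  have "f \<xi> = kernel1 \<alpha> h t \<xi>"
  proof (cases "\<xi> = 0")
    case False
    have "f \<xi> - kernel1 \<alpha> h t \<xi> = 0"
      by (rule continuous_eq_0_if_orthogonal_to_bumps[of "\<lambda>x. f x - kernel1 \<alpha> h t x", OF _ False weak])
         (auto intro!: continuous_intros fcont kcont)
    thus ?thesis by simp
  next
    case True
    \<comment> \<open>At the origin every wavelet term vanishes by the support condition, and the
      kernel has the default value 0 there.\<close>
    have "F 0 p = 0" for p by (cases p) (simp add: F_def psi_hat_def fourier_support)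
    hence "f 0 = 0" unfolding f_def by (intro infsum_0) simp
    thus ?thesis using True by (simp add: kernel1_def)
  qed
  thus ?thesis using lim[of \<xi>] by (simp add: pk_def)
qed

text \<open>The kernel inherits the bound of its partial sums in the limit; this is how it comes to
  lie in \<open>L\<^sup>\<alpha>\<close>.\<close>

lemma partial_kernel_dominated:
  assumes \<alpha>: "\<alpha> > 0" and h: "0 < h" "h < 1" and M: "M > 0" and t: "\<bar>t\<bar> \<le> M"
  obtains \<delta> B where "\<delta> > 0" "B \<ge> 0" "\<And>n \<xi>. norm (partial_kernel \<alpha> h M t n \<xi>) \<le> B * envelope \<alpha> \<delta> \<xi>"
    "\<And>\<xi>. norm (kernel1 \<alpha> h t \<xi>) \<le> B * envelope \<alpha> \<delta> \<xi>"
proof -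
  obtain \<delta> B where \<delta>: "\<delta> > 0" and B: "B \<ge> 0"
    "\<And>F \<xi>. finite F \<Longrightarrow> (\<Sum>(j, k)\<in>F. wt (j, k) powr \<delta> * norm (dcoef \<alpha> h t j k * cnj (psi_hat \<psi> \<alpha> j k \<xi>))) \<le> B * envelope \<alpha> \<delta> \<xi>"
    using dcoef_psi_hat_sum[OF assms] by blast
  have b: "norm (partial_kernel \<alpha> h M t n \<xi>) \<le> B * envelope \<alpha> \<delta> \<xi>" for n \<xi>
  proof -
    have "norm (partial_kernel \<alpha> h M t n \<xi>) \<le> (\<Sum>(j, k)\<in>D_index n M. norm (dcoef \<alpha> h t j k * cnj (psi_hat \<psi> \<alpha> j k \<xi>)))"
      unfolding partial_kernel_def case_prod_unfold by (rule norm_sum)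
    also have "\<dots> \<le> (\<Sum>(j, k)\<in>D_index n M. wt (j, k) powr \<delta> * norm (dcoef \<alpha> h t j k * cnj (psi_hat \<psi> \<alpha> j k \<xi>)))"
    proof (rule sum_mono, clarify)
      fix j k
      show "norm (dcoef \<alpha> h t j k * cnj (psi_hat \<psi> \<alpha> j k \<xi>)) \<le> wt (j, k) powr \<delta> * norm (dcoef \<alpha> h t j k * cnj (psi_hat \<psi> \<alpha> j k \<xi>))"
        using mult_right_mono[OF ge_one_powr_ge_zero[OF wt_ge_1[of "(j, k)"], of \<delta>]
          norm_ge_zero[of "dcoef \<alpha> h t j k * cnj (psi_hat \<psi> \<alpha> j k \<xi>)"]] \<delta> by simp
    qed
    also have "\<dots> \<le> B * envelope \<alpha> \<delta> \<xi>" by (rule B(2)[OF finite_D_index])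
    finally show ?thesis .
  qed
  have "norm (kernel1 \<alpha> h t \<xi>) \<le> B * envelope \<alpha> \<delta> \<xi>" for \<xi>
    by (rule LIMSEQ_le_const2[OF tendsto_norm[OF partial_kernel_tendsto[OF assms]]]) (use b in auto)
  thus ?thesis using that \<delta> B b by blast
qed

end

section \<open>Tensor products and Hoelder norms\<close>

lemma vec_nth_measurable [measurable]: "(\<lambda>x::real^'n. x $ l) \<in> borel_measurable borel"
  by (intro borel_measurable_continuous_onI continuous_intros)

lemma nn_integral_lborel_vec_prod:
  fixes f :: "'n::finite \<Rightarrow> real \<Rightarrow> real"
  assumes "\<And>l. f l \<in> borel_measurable borel" "\<And>l x. 0 \<le> f l x"
  shows "(\<integral>\<^sup>+x. ennreal (\<Prod>l\<in>UNIV. f l ((x::real^'n) $ l)) \<partial>lborel) = (\<Prod>l\<in>UNIV. (\<integral>\<^sup>+x. ennreal (f l x) \<partial>lborel))"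
proof -
  \<comment> \<open>Recovers the coordinate from a standard basis vector, since the product formula
    for the integral runs over \<open>Basis\<close>.\<close>
  define ix where "ix b = (THE l. b = axis l (1::real))" for b :: "real^'n"
  have ix: "ix (axis l 1) = l" for l
    unfolding ix_def by (rule the_equality) (auto simp: axis_eq_axis)
  have Basis: "(Basis :: (real^'n) set) = (\<lambda>l. axis l 1) ` UNIV"
    by (auto simp: Basis_vec_def)
  have inj: "inj (\<lambda>l. axis l (1::real) :: real^'n)" by (auto simp: inj_on_def axis_eq_axis)
  have "(\<integral>\<^sup>+x. ennreal (\<Prod>l\<in>UNIV. f l ((x::real^'n) $ l)) \<partial>lborel) =
      (\<integral>\<^sup>+x. (\<Prod>b\<in>Basis. ennreal (f (ix b) ((x::real^'n) \<bullet> b))) \<partial>lborel)"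
    unfolding Basis using assms(2) by (simp add: prod.reindex[OF inj] ix inner_axis prod_ennreal)
  also have "\<dots> = (\<Prod>b\<in>(Basis :: (real^'n) set). (\<integral>\<^sup>+x. ennreal (f (ix b) x) \<partial>lborel))"
    using assms(1) by (intro nn_integral_lborel_prod) auto
  also have "\<dots> = (\<Prod>l\<in>UNIV. (\<integral>\<^sup>+x. ennreal (f l x) \<partial>lborel))"
    unfolding Basis by (simp add: prod.reindex[OF inj] ix)
  finally show ?thesis .
qed

lemma prod_in_Lp_fun:
  fixes G :: "'n::finite \<Rightarrow> real \<Rightarrow> real"
  assumes m: "\<And>l. G l \<in> borel_measurable borel" and nn: "\<And>l x. 0 \<le> G l x"
    and i: "\<And>l. integrable lborel (\<lambda>x. G l x powr p)"
  shows "(\<lambda>x::real^'n. complex_of_real (\<Prod>l\<in>UNIV. G l (x $ l))) \<in> Lp_fun p"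
proof -
  note [measurable] = m
  have eq: "norm (complex_of_real (\<Prod>l\<in>UNIV. G l (x $ l))) powr p = (\<Prod>l\<in>UNIV. G l (x $ l) powr p)" for x :: "real^'n"
    unfolding norm_of_real using nn by (simp add: abs_of_nonneg prod_nonneg prod_powr_distrib)
  have "integrable lborel (\<lambda>x::real^'n. \<Prod>l\<in>UNIV. G l (x $ l) powr p)"
  proof (rule integrableI_nonneg)
    have "(\<integral>\<^sup>+x. ennreal (\<Prod>l\<in>UNIV. G l ((x::real^'n) $ l) powr p) \<partial>lborel) =
        (\<Prod>l\<in>UNIV. (\<integral>\<^sup>+x. ennreal (G l x powr p) \<partial>lborel))"
      by (rule nn_integral_lborel_vec_prod) auto
    also have "\<dots> < \<infinity>"
      using i by (auto simp: less_top[symmetric] ennreal_prod_eq_top nn_integral_eq_integral)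
    finally show "(\<integral>\<^sup>+x. ennreal (\<Prod>l\<in>UNIV. G l ((x::real^'n) $ l) powr p) \<partial>lborel) < \<infinity>" .
  qed (auto simp: prod_nonneg)
  thus ?thesis unfolding Lp_fun_def mem_Collect_eq eq by auto
qed

text \<open>An index of the field is a pair of vectors, while multiplying out a product of sums
  produces vectors of pairs; \<open>pairs\<close> mediates between the two.\<close>

definition pairs :: "(int \<times> int) set \<Rightarrow> ((int^'n) \<times> (int^'n)) set" where
  "pairs D = {(J, K). \<forall>l. (J $ l, K $ l) \<in> D}"

lemma D_index_prod_eq_pairs: "D_index_prod n M = pairs (D_index n M)"
  by (simp add: D_index_prod_def pairs_def)

lemma sum_pairs_prod:
  fixes f :: "'n::finite \<Rightarrow> int \<times> int \<Rightarrow> 'b::comm_semiring_1"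
  assumes D: "finite D"
  shows "(\<Sum>(J, K)\<in>pairs D. \<Prod>l\<in>UNIV. f l (J $ l, K $ l)) = (\<Prod>l\<in>UNIV. \<Sum>p\<in>D. f l p)"
proof -
  have "(\<Prod>l\<in>UNIV. \<Sum>p\<in>D. f l p) = (\<Sum>g\<in>PiE UNIV (\<lambda>_. D). \<Prod>l\<in>UNIV. f l (g l))"
    using D by (intro prod_sum_PiE) auto
  also have "\<dots> = (\<Sum>(J, K)\<in>pairs D. \<Prod>l\<in>UNIV. f l (J $ l, K $ l))"
    by (rule sum.reindex_bij_witness[where i = "\<lambda>(J, K) l. (J $ l, K $ l)" and
          j = "\<lambda>g. (\<chi> l. fst (g l), \<chi> l. snd (g l))"]) (auto simp: pairs_def vec_eq_iff)
  finally show ?thesis by simp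
qed

lemma finite_pairs:
  assumes D: "finite D"
  shows "finite (pairs D :: ((int^'n) \<times> (int^'n)) set)"
proof -
  have sub: "pairs D \<subseteq> (\<lambda>g. (\<chi> l. fst (g l), \<chi> l. snd (g l))) ` PiE (UNIV :: 'n set) (\<lambda>_. D)"
  proof
    fix q :: "(int^'n) \<times> (int^'n)" assume q: "q \<in> pairs D"
    obtain J K where JK: "q = (J, K)" by (cases q)
    show "q \<in> (\<lambda>g. (\<chi> l. fst (g l), \<chi> l. snd (g l))) ` PiE (UNIV :: 'n set) (\<lambda>_. D)"
      by (rule image_eqI[of _ _ "\<lambda>l. (J $ l, K $ l)"]) (use q in \<open>auto simp: JK pairs_def vec_eq_iff\<close>)
  qed
  show ?thesis by (rule finite_subset[OF sub]) (use D in \<open>auto intro!: finite_imageI finite_PiE\<close>)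
qed

lemma subset_pairs:
  fixes X :: "((int^'n) \<times> (int^'n)) set"
  assumes "finite X"
  obtains D where "finite D" "X \<subseteq> pairs D"
proof (rule that)
  show "finite (\<Union>(J, K)\<in>X. (\<lambda>l. (J $ l, K $ l)) ` UNIV)" using assms by auto
  show "X \<subseteq> pairs (\<Union>(J, K)\<in>X. (\<lambda>l. (J $ l, K $ l)) ` UNIV)" by (auto simp: pairs_def)
qed

text \<open>Telescoping over the factors. The remaining factors are bounded by
  \<open>norm (a i) + norm (b i)\<close> rather than by mixed products, so that every summand is
  again a product over the coordinates and sums over multi-indices factorise.\<close>

lemma norm_prod_diff_le:
  fixes a b :: "'i \<Rightarrow> complex"
  assumes "finite A"
  shows "norm ((\<Prod>i\<in>A. a i) - (\<Prod>i\<in>A. b i)) \<le>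
    (\<Sum>l\<in>A. \<Prod>i\<in>A. if i = l then norm (a i - b i) else norm (a i) + norm (b i))"
  using assms
proof (induction A)
  case (insert c A)
  have "(\<Prod>i\<in>insert c A. a i) - (\<Prod>i\<in>insert c A. b i) =
      (a c - b c) * (\<Prod>i\<in>A. a i) + b c * ((\<Prod>i\<in>A. a i) - (\<Prod>i\<in>A. b i))"
    using insert.hyps by (simp add: algebra_simps)
  hence "norm ((\<Prod>i\<in>insert c A. a i) - (\<Prod>i\<in>insert c A. b i)) \<le>
      norm (a c - b c) * norm (\<Prod>i\<in>A. a i) + norm (b c) * norm ((\<Prod>i\<in>A. a i) - (\<Prod>i\<in>A. b i))"
    by (metis norm_mult norm_triangle_ineq)
  also have "\<dots> \<le> norm (a c - b c) * (\<Prod>i\<in>A. norm (a i) + norm (b i)) +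
      (norm (a c) + norm (b c)) * (\<Sum>l\<in>A. \<Prod>i\<in>A. if i = l then norm (a i - b i) else norm (a i) + norm (b i))"
    unfolding prod_norm[symmetric]
    by (intro add_mono mult_left_mono mult_mono prod_mono insert.IH[unfolded prod_norm[symmetric]] conjI) auto
  also have "\<dots> = (\<Sum>l\<in>insert c A. \<Prod>i\<in>insert c A. if i = l then norm (a i - b i) else norm (a i) + norm (b i))"
  proof -
    have 1: "(\<Prod>i\<in>insert c A. if i = c then norm (a i - b i) else norm (a i) + norm (b i)) =
        norm (a c - b c) * (\<Prod>i\<in>A. norm (a i) + norm (b i))"
    proof -
      have "(\<Prod>i\<in>A. if i = c then norm (a i - b i) else norm (a i) + norm (b i)) = (\<Prod>i\<in>A. norm (a i) + norm (b i))"
        using insert.hyps by (intro prod.cong) auto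
      thus ?thesis unfolding prod.insert[OF insert.hyps] by (simp only: simp_thms if_True)
    qed
    have 2: "(\<Prod>i\<in>insert c A. if i = l then norm (a i - b i) else norm (a i) + norm (b i)) =
        (norm (a c) + norm (b c)) * (\<Prod>i\<in>A. if i = l then norm (a i - b i) else norm (a i) + norm (b i))" if "l \<in> A" for l
    proof -
      have cl: "(c = l) = False" using insert.hyps that by auto
      show ?thesis unfolding prod.insert[OF insert.hyps] cl if_False ..
    qed
    have "(\<Sum>l\<in>A. \<Prod>i\<in>insert c A. if i = l then norm (a i - b i) else norm (a i) + norm (b i)) =
        (\<Sum>l\<in>A. (norm (a c) + norm (b c)) * (\<Prod>i\<in>A. if i = l then norm (a i - b i) else norm (a i) + norm (b i)))"
      by (intro sum.cong refl 2)
    thus ?thesis unfolding sum.insert[OF insert.hyps] 1 sum_distrib_left by (simp only:)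
  qed
  finally show ?case .
qed simp

section \<open>Hoelder norms from increments\<close>

lemma holder_norm_bound:
  fixes f :: "'a::real_normed_vector \<Rightarrow> real"
  assumes S: "s0 \<in> S" "t0 \<in> S" "s0 \<noteq> t0" and f0: "f s0 = 0" and R: "\<And>t. t \<in> S \<Longrightarrow> norm (t - s0) \<le> R"
    and \<gamma>: "\<gamma> > 0" and A: "A \<ge> 0" and inc: "\<And>s t. s \<in> S \<Longrightarrow> t \<in> S \<Longrightarrow> \<bar>f t - f s\<bar> \<le> A * norm (t - s) powr \<gamma>"
  shows "f \<in> holder_space \<gamma> S" "holder_norm \<gamma> S f \<le> A * (R powr \<gamma> + 1)" "0 \<le> holder_norm \<gamma> S f"
proof -
  \<comment> \<open>The zero at \<open>s0\<close> turns the bound on increments into a bound on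
    values.\<close>
  have b: "\<bar>f t\<bar> \<le> A * R powr \<gamma>" if t: "t \<in> S" for t
  proof -
    have "\<bar>f t\<bar> \<le> A * norm (t - s0) powr \<gamma>" using inc[OF S(1) t] f0 by simp
    also have "\<dots> \<le> A * R powr \<gamma>" using R[OF t] A \<gamma> by (intro mult_left_mono powr_mono2) auto
    finally show ?thesis .
  qed
  have q: "x \<le> A \<and> 0 \<le> x" if "x \<in> holder_quotients \<gamma> S f" for x
  proof -
    obtain s t where st: "x = \<bar>f s - f t\<bar> / norm (s - t) powr \<gamma>" "s \<in> S" "t \<in> S" "s \<noteq> t"
      using \<open>x \<in> holder_quotients \<gamma> S f\<close> unfolding holder_quotients_def by blast
    have "norm (s - t) powr \<gamma> > 0" using st by simp
    thus ?thesis using inc[OF st(3) st(2)] st(1) by (simp add: divide_le_eq)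
  qed
  have bd: "bdd_above ((\<lambda>t. \<bar>f t\<bar>) ` S)" "bdd_above (holder_quotients \<gamma> S f)"
    using b q by (auto simp: bdd_above_def)
  thus "f \<in> holder_space \<gamma> S" by (simp add: holder_space_def)
  have ne: "S \<noteq> {}" using S by auto
  \<comment> \<open>Two distinct points in \<open>S\<close> make the set of quotients nonempty; the
    supremum of an empty set would be an unspecified number.\<close>
  have qin: "\<bar>f s0 - f t0\<bar> / norm (s0 - t0) powr \<gamma> \<in> holder_quotients \<gamma> S f"
    using S unfolding holder_quotients_def by blast
  hence ne2: "holder_quotients \<gamma> S f \<noteq> {}" by auto
  have "(SUP t\<in>S. \<bar>f t\<bar>) \<le> A * R powr \<gamma>" using b by (intro cSUP_least ne) auto
  moreover have "Sup (holder_quotients \<gamma> S f) \<le> A" using q by (intro cSup_least ne2) auto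
  ultimately show "holder_norm \<gamma> S f \<le> A * (R powr \<gamma> + 1)" by (simp add: holder_norm_def algebra_simps)
  have "0 \<le> (SUP t\<in>S. \<bar>f t\<bar>)" using cSUP_upper2[OF bd(1) S(1), of 0] by simp
  moreover have "0 \<le> Sup (holder_quotients \<gamma> S f)" using cSup_upper2[OF qin _ bd(2)] q[OF qin] by auto
  ultimately show "0 \<le> holder_norm \<gamma> S f" by (simp add: holder_norm_def)
qed

text \<open>Fields vanishing at a common point are controlled by their increments alone. The bounds
  pass to the pointwise limit as \<open>m\<close> tends to infinity, so the limit is the same
  function for every \<open>\<gamma>\<close>.\<close>

lemma holder_Cauchy_limit:
  fixes u :: "nat \<Rightarrow> 'a::real_normed_vector \<Rightarrow> real"
  assumes S: "s0 \<in> S" "t0 \<in> S" "s0 \<noteq> t0" and u0: "\<And>n. u n s0 = 0" and R: "\<And>t. t \<in> S \<Longrightarrow> norm (t - s0) \<le> R"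
    and \<gamma>: "\<gamma> > 0" and A: "A \<ge> 0" and \<rho>: "\<rho> \<longlonglongrightarrow> 0" "\<And>n. \<rho> n \<ge> 0"
    and inc: "\<And>n s t. s \<in> S \<Longrightarrow> t \<in> S \<Longrightarrow> \<bar>u n t - u n s\<bar> \<le> A * norm (t - s) powr \<gamma>"
    and dif: "\<And>m n s t. n \<le> m \<Longrightarrow> s \<in> S \<Longrightarrow> t \<in> S \<Longrightarrow>
      \<bar>(u m t - u n t) - (u m s - u n s)\<bar> \<le> A * \<rho> n * norm (t - s) powr \<gamma>"
  shows "holder_Cauchy \<gamma> S u" "\<And>t. t \<in> S \<Longrightarrow> convergent (\<lambda>n. u n t)"
    "holder_limit \<gamma> S u (\<lambda>t. lim (\<lambda>n. u n t))"
proof -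
  define B where "B = A * (R powr \<gamma> + 1)"
  have B: "B \<ge> 0" using A by (simp add: B_def add_nonneg_nonneg)
  have hn: "holder_norm \<gamma> S (\<lambda>t. u m t - u n t) \<le> \<rho> n * B \<and> (\<forall>t\<in>S. \<bar>u m t - u n t\<bar> \<le> \<rho> n * B)" if mn: "n \<le> m" for m n
  proof -
    have i: "\<bar>(u m t - u n t) - (u m s - u n s)\<bar> \<le> (A * \<rho> n) * norm (t - s) powr \<gamma>" if "s \<in> S" "t \<in> S" for s t
      using dif[OF mn that] by simp
    have h: "holder_norm \<gamma> S (\<lambda>t. u m t - u n t) \<le> (A * \<rho> n) * (R powr \<gamma> + 1)"
      by (rule holder_norm_bound(2)[OF S _ R \<gamma> _ i]) (use u0 A \<rho> in auto)
    moreover have "\<bar>u m t - u n t\<bar> \<le> (A * \<rho> n) * (R powr \<gamma> + 1)" if t: "t \<in> S" for t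
    proof -
      have "\<bar>u m t - u n t\<bar> \<le> (A * \<rho> n) * norm (t - s0) powr \<gamma>" using i[OF S(1) t] u0 by simp
      also have "\<dots> \<le> (A * \<rho> n) * (R powr \<gamma> + 1)"
        using R[OF t] A \<rho>(2)[of n] \<gamma> by (intro mult_left_mono) (auto intro!: powr_mono2 add_increasing2)
      finally show ?thesis .
    qed
    ultimately show ?thesis by (simp add: B_def mult_ac)
  qed
  \<comment> \<open>\<open>dif\<close> covers the order \<open>n \<le> m\<close>; symmetry supplies
    the other one.\<close>
  have hsym: "holder_norm \<gamma> S (\<lambda>t. u m t - u n t) = holder_norm \<gamma> S (\<lambda>t. u n t - u m t)" for m n
  proof -
    have "\<bar>u m t - u n t\<bar> = \<bar>u n t - u m t\<bar>" for t by (rule abs_minus_commute)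
    moreover have "\<bar>u m s - u n s - (u m t - u n t)\<bar> = \<bar>u n s - u m s - (u n t - u m t)\<bar>" for s t
      by (subst abs_minus_commute) (simp add: algebra_simps)
    ultimately show ?thesis by (simp only: holder_norm_def holder_quotients_def)
  qed
  have lim0: "(\<lambda>n. \<rho> n * B) \<longlonglongrightarrow> 0" using \<rho>(1) by (rule tendsto_mult_left_zero)
  have sp: "u n \<in> holder_space \<gamma> S" for n
    by (rule holder_norm_bound(1)[OF S u0 R \<gamma> A inc])
  show "holder_Cauchy \<gamma> S u"
    unfolding holder_Cauchy_def
  proof (intro conjI allI impI)
    fix e :: real assume "e > 0"
    with lim0 have "\<forall>\<^sub>F n in sequentially. \<rho> n * B < e" by (rule order_tendstoD)
    then obtain n0 where n0: "\<And>n. n \<ge> n0 \<Longrightarrow> \<rho> n * B < e" by (auto simp: eventually_sequentially)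
    show "\<exists>n0. \<forall>m\<ge>n0. \<forall>n\<ge>n0. holder_norm \<gamma> S (\<lambda>t. u m t - u n t) < e"
    proof (intro exI[of _ n0] allI impI)
      fix m n assume mn: "m \<ge> n0" "n \<ge> n0"
      show "holder_norm \<gamma> S (\<lambda>t. u m t - u n t) < e"
      proof (cases "n \<le> m")
        case True
        thus ?thesis using hn[OF True] n0[OF mn(2)] by simp
      next
        case False
        thus ?thesis using hn[of m n] n0[OF mn(1)] hsym[of m n] by simp
      qed
    qed
  qed (rule sp)
  show conv: "convergent (\<lambda>n. u n t)" if t: "t \<in> S" for t
  proof (rule Cauchy_convergent, rule metric_CauchyI)
    fix e :: real assume "e > 0"
    with lim0 have "\<forall>\<^sub>F n in sequentially. \<rho> n * B < e" by (rule order_tendstoD)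
    then obtain n0 where n0: "\<And>n. n \<ge> n0 \<Longrightarrow> \<rho> n * B < e" by (auto simp: eventually_sequentially)
    have "\<bar>u m t - u n t\<bar> < e" if mn: "m \<ge> n0" "n \<ge> n0" for m n
    proof (cases "n \<le> m")
      case True
      thus ?thesis using hn[OF True] n0[OF mn(2)] t by force
    next
      case False
      thus ?thesis using hn[of m n] n0[OF mn(1)] t abs_minus_commute[of "u m t" "u n t"] by force
    qed
    thus "\<exists>M. \<forall>m\<ge>M. \<forall>n\<ge>M. dist (u m t) (u n t) < e" by (auto simp: dist_real_def)
  qed
  define U where "U t = lim (\<lambda>n. u n t)" for t
  have U: "(\<lambda>n. u n t) \<longlonglongrightarrow> U t" if "t \<in> S" for t
    unfolding U_def using conv[OF that] by (simp add: convergent_LIMSEQ_iff)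
  have U0: "U s0 = 0" using LIMSEQ_unique[OF U[OF S(1)]] u0 by simp
  have Uinc: "\<bar>U t - U s\<bar> \<le> A * norm (t - s) powr \<gamma>" if "s \<in> S" "t \<in> S" for s t
    by (rule LIMSEQ_le_const2[OF tendsto_rabs[OF tendsto_diff[OF U[OF that(2)] U[OF that(1)]]]]) (use inc that in auto)
  have Udif: "\<bar>(u n t - U t) - (u n s - U s)\<bar> \<le> (A * \<rho> n) * norm (t - s) powr \<gamma>" if st: "s \<in> S" "t \<in> S" for n s t
  proof (rule LIMSEQ_le_const2)
    show "(\<lambda>m. \<bar>(u n t - u m t) - (u n s - u m s)\<bar>) \<longlonglongrightarrow> \<bar>(u n t - U t) - (u n s - U s)\<bar>"
      using st by (intro tendsto_intros U)
    have "\<bar>(u n t - u m t) - (u n s - u m s)\<bar> \<le> A * \<rho> n * norm (t - s) powr \<gamma>" if "m \<ge> n" for m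
    proof -
      have "\<bar>(u n t - u m t) - (u n s - u m s)\<bar> = \<bar>(u m t - u n t) - (u m s - u n s)\<bar>"
        by (subst abs_minus_commute) (simp add: algebra_simps)
      thus ?thesis using dif[OF that st] by simp
    qed
    thus "\<exists>N. \<forall>m\<ge>N. \<bar>(u n t - u m t) - (u n s - u m s)\<bar> \<le> A * \<rho> n * norm (t - s) powr \<gamma>" by blast
  qed
  have hU: "holder_norm \<gamma> S (\<lambda>t. u n t - U t) \<le> \<rho> n * B" "0 \<le> holder_norm \<gamma> S (\<lambda>t. u n t - U t)" for n
  proof -
    have "holder_norm \<gamma> S (\<lambda>t. u n t - U t) \<le> (A * \<rho> n) * (R powr \<gamma> + 1)"
      by (rule holder_norm_bound(2)[OF S _ R \<gamma> _ Udif]) (use u0 U0 A \<rho> in auto)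
    thus "holder_norm \<gamma> S (\<lambda>t. u n t - U t) \<le> \<rho> n * B" by (simp add: B_def mult_ac)
    show "0 \<le> holder_norm \<gamma> S (\<lambda>t. u n t - U t)"
      by (rule holder_norm_bound(3)[OF S _ R \<gamma> _ Udif]) (use u0 U0 A \<rho> in auto)
  qed
  have "holder_limit \<gamma> S u U"
    unfolding holder_limit_def
  proof
    show "U \<in> holder_space \<gamma> S" by (rule holder_norm_bound(1)[OF S U0 R \<gamma> A Uinc])
    show "(\<lambda>n. holder_norm \<gamma> S (\<lambda>t. u n t - U t)) \<longlonglongrightarrow> 0"
      by (rule tendsto_sandwich[OF _ _ tendsto_const lim0]) (use hU in auto)
  qed
  thus "holder_limit \<gamma> S u (\<lambda>t. lim (\<lambda>n. u n t))" by (simp add: U_def[abs_def])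
qed

context wavelet
begin

section \<open>Coefficients and weights of the random field\<close>

definition field_coef :: "real \<Rightarrow> real^'n \<Rightarrow> real^'n \<Rightarrow> int^'n \<Rightarrow> int^'n \<Rightarrow> complex" where
  "field_coef \<alpha> H t J K = (\<Prod>l\<in>UNIV. dcoef \<alpha> (H $ l) (t $ l) (J $ l) (K $ l))"

lemma field_coef_eq:
  "field_coef \<alpha> H t J K = complex_of_real (2 powr (- (\<Sum>l\<in>UNIV. real_of_int (J $ l) * H $ l))) *
     (\<Prod>l\<in>UNIV. psi_frac \<psi> \<alpha> (H $ l) (2 powr real_of_int (J $ l) * t $ l - real_of_int (K $ l)) -
          psi_frac \<psi> \<alpha> (H $ l) (- real_of_int (K $ l)))"
  by (simp add: field_coef_def dcoef_def prod.distrib powr_sum sum_negf[symmetric])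

lemma U_star_eq:
  "U_star \<psi> \<alpha> H I M n t \<omega> = Re (\<Sum>(J, K)\<in>D_index_prod n M. field_coef \<alpha> H t J K * wavelet_coeff \<psi> \<alpha> I J K \<omega>)"
  unfolding U_star_def field_coef_eq by (intro arg_cong[where f = Re] sum.cong refl) (auto simp: mult_ac)

definition wtN :: "int^'n \<Rightarrow> int^'n \<Rightarrow> real" where
  "wtN J K = (\<Prod>l\<in>UNIV. wt (J $ l, K $ l))"

lemma wtN_ge_1: "wtN J K \<ge> 1"
  unfolding wtN_def by (intro prod_ge_1) (rule wt_ge_1)

lemma wtN_powr: "wtN J K powr p = (\<Prod>l\<in>UNIV. wt (J $ l, K $ l) powr p)"
  unfolding wtN_def by (rule prod_powr_distrib)

lemma wtN_off_D_index:
  assumes "(J, K) \<notin> D_index_prod n M" "M > 0"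
  shows "min 1 M * 2 ^ n \<le> wtN J K"
proof -
  obtain l where l: "(J $ l, K $ l) \<notin> D_index n M" using assms by (auto simp: D_index_prod_def)
  have "min 1 M * 2 ^ n \<le> wt (J $ l, K $ l)" by (rule wt_off_D_index[OF l assms(2)])
  also have "\<dots> * 1 \<le> wt (J $ l, K $ l) * (\<Prod>i\<in>UNIV - {l}. wt (J $ i, K $ i))"
    using wt_ge_1 by (intro mult_left_mono prod_ge_1) (auto intro: order_trans[OF zero_le_one])
  also have "\<dots> = wtN J K" unfolding wtN_def by (rule prod.remove[symmetric]) auto
  finally show ?thesis by simp
qed

lemma cube_component: "t \<in> cube M \<Longrightarrow> \<bar>t $ l\<bar> \<le> M"
  by (auto simp: cube_def abs_le_iff minus_le_iff)

text \<open>In a difference of products one coordinate contributes its increment and the others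
  their sizes, after which the sum over multi-indices factorises into one-dimensional sums. Sizes
  are increments from 0 and hence bounded on the cube.\<close>

lemma field_coef_increment_sum:
  fixes H :: "real^'n"
  assumes H: "\<And>l. 0 < H $ l \<and> H $ l < 1" and \<gamma>: "0 < \<gamma>"
    and \<delta>: "0 < \<delta>" "\<delta> \<le> 1/2" "\<And>l. \<gamma> + 2 * \<delta> < H $ l" "\<And>l. H $ l + \<delta> < 1" and M: "M > 0"
  obtains A where "A \<ge> 0"
    "\<And>X s t. finite X \<Longrightarrow> s \<in> cube M \<Longrightarrow> t \<in> cube M \<Longrightarrow>
      (\<Sum>(J, K)\<in>X. wtN J K powr \<delta> * norm (field_coef \<alpha> H t J K - field_coef \<alpha> H s J K)) \<le> A * norm (t - s) powr \<gamma>"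
proof -
  define Q where "Q l B \<longleftrightarrow> B \<ge> 0 \<and> (\<forall>F s t. finite F \<longrightarrow> \<bar>s\<bar> \<le> M \<longrightarrow> \<bar>t\<bar> \<le> M \<longrightarrow>
      (\<Sum>(j, k)\<in>F. wt (j, k) powr \<delta> * norm (dcoef \<alpha> (H $ l) t j k - dcoef \<alpha> (H $ l) s j k)) \<le> B * \<bar>t - s\<bar> powr \<gamma>)" for l B
  have "\<exists>B. Q l B" for l
  proof -
    have h: "0 < H $ l" "H $ l < 1" using H by auto
    obtain B where "B \<ge> 0" "\<And>F s t. finite F \<Longrightarrow> \<bar>s\<bar> \<le> M \<Longrightarrow> \<bar>t\<bar> \<le> M \<Longrightarrow>
      (\<Sum>(j, k)\<in>F. wt (j, k) powr \<delta> * norm (dcoef \<alpha> (H $ l) t j k - dcoef \<alpha> (H $ l) s j k)) \<le> B * \<bar>t - s\<bar> powr \<gamma>"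
      using dcoef_increment_sum[where \<alpha> = \<alpha>, OF h \<gamma> \<delta>(1,2) \<delta>(3) \<delta>(4) M] by blast
    thus ?thesis unfolding Q_def by blast
  qed
  then obtain B0 where "\<And>l. Q l (B0 l)" by metis
  hence B0: "\<And>l. B0 l \<ge> 0" "\<And>l F s t. finite F \<Longrightarrow> \<bar>s\<bar> \<le> M \<Longrightarrow> \<bar>t\<bar> \<le> M \<Longrightarrow>
      (\<Sum>(j, k)\<in>F. wt (j, k) powr \<delta> * norm (dcoef \<alpha> (H $ l) t j k - dcoef \<alpha> (H $ l) s j k)) \<le> B0 l * \<bar>t - s\<bar> powr \<gamma>"
    unfolding Q_def by blast+
  \<comment> \<open>Large enough for both roles of a coordinate: \<open>B0 l\<close> for an
    increment, and twice \<open>B0 l * M powr \<gamma>\<close> for the sizes at \<open>s\<close> and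
    \<open>t\<close>.\<close>
  define B where "B l = B0 l * (1 + 2 * M powr \<gamma>)" for l
  have B: "B l \<ge> 0" "B0 l \<le> B l" for l using B0(1)[of l] by (auto simp: B_def mult_left_le algebra_simps)
  define A where "A = real CARD('n) * (\<Prod>l\<in>UNIV. B l)"
  have A0: "A \<ge> 0" using B by (auto simp: A_def intro!: mult_nonneg_nonneg prod_nonneg)
  show ?thesis
  proof (rule that[OF A0])
    fix X :: "((int^'n) \<times> (int^'n)) set" and s t :: "real^'n"
    assume X: "finite X" and st: "s \<in> cube M" "t \<in> cube M"
    \<comment> \<open>An arbitrary finite index set is enlarged to a product set, over which the
      sums factorise; the summands are nonnegative.\<close>
    obtain D where D: "finite D" "X \<subseteq> pairs D" using subset_pairs[OF X] by blast
    define q where "q m l p = wt p powr \<delta> * (if l = m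
        then norm (dcoef \<alpha> (H $ l) (t $ l) (fst p) (snd p) - dcoef \<alpha> (H $ l) (s $ l) (fst p) (snd p))
        else norm (dcoef \<alpha> (H $ l) (t $ l) (fst p) (snd p)) + norm (dcoef \<alpha> (H $ l) (s $ l) (fst p) (snd p)))" for m l p
    have q0: "q m l p \<ge> 0" for m l p by (simp add: q_def)
    have pw: "wtN J K powr \<delta> * norm (field_coef \<alpha> H t J K - field_coef \<alpha> H s J K) \<le> (\<Sum>m\<in>UNIV. \<Prod>l\<in>UNIV. q m l (J $ l, K $ l))" for J K
    proof -
      have "wtN J K powr \<delta> * norm (field_coef \<alpha> H t J K - field_coef \<alpha> H s J K) \<le>
          (\<Prod>l\<in>UNIV. wt (J $ l, K $ l) powr \<delta>) * (\<Sum>m\<in>UNIV. \<Prod>l\<in>UNIV. if l = m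
            then norm (dcoef \<alpha> (H $ l) (t $ l) (J $ l) (K $ l) - dcoef \<alpha> (H $ l) (s $ l) (J $ l) (K $ l))
            else norm (dcoef \<alpha> (H $ l) (t $ l) (J $ l) (K $ l)) + norm (dcoef \<alpha> (H $ l) (s $ l) (J $ l) (K $ l)))"
        unfolding wtN_powr field_coef_def by (intro mult_left_mono norm_prod_diff_le prod_nonneg) auto
      also have "\<dots> = (\<Sum>m\<in>UNIV. \<Prod>l\<in>UNIV. q m l (J $ l, K $ l))"
        unfolding q_def sum_distrib_left prod.distrib fst_conv snd_conv ..
      finally show ?thesis .
    qed
    have cs: "\<bar>s $ l\<bar> \<le> M" "\<bar>t $ l\<bar> \<le> M" for l using st by (auto intro: cube_component)
    have single: "(\<Sum>p\<in>D. wt p powr \<delta> * norm (dcoef \<alpha> (H $ l) u (fst p) (snd p))) \<le> B0 l * M powr \<gamma>" if u: "\<bar>u\<bar> \<le> M" for l u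
    proof -
      have "(\<Sum>p\<in>D. wt p powr \<delta> * norm (dcoef \<alpha> (H $ l) u (fst p) (snd p))) \<le> B0 l * \<bar>u - 0\<bar> powr \<gamma>"
        using B0(2)[OF D(1), of 0 u l] u M by (simp add: case_prod_unfold)
      also have "\<dots> \<le> B0 l * M powr \<gamma>" using u \<gamma> B0 by (intro mult_left_mono powr_mono2) auto
      finally show ?thesis .
    qed
    have factor: "(\<Sum>p\<in>D. q m l p) \<le> B l * (if l = m then norm (t - s) powr \<gamma> else 1)" for m l
    proof (cases "l = m")
      case True
      have "(\<Sum>p\<in>D. q m l p) \<le> B0 l * \<bar>t $ l - s $ l\<bar> powr \<gamma>"
        using B0(2)[OF D(1) cs(1) cs(2), of l l l] True by (simp add: q_def case_prod_unfold)
      also have "\<dots> \<le> B l * norm (t - s) powr \<gamma>"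
        using B \<gamma> component_le_norm_cart[of "t - s" l] B0(1) by (intro mult_mono powr_mono2) auto
      finally show ?thesis using True by simp
    next
      case False
      have "(\<Sum>p\<in>D. q m l p) = (\<Sum>p\<in>D. wt p powr \<delta> * norm (dcoef \<alpha> (H $ l) (t $ l) (fst p) (snd p))) +
          (\<Sum>p\<in>D. wt p powr \<delta> * norm (dcoef \<alpha> (H $ l) (s $ l) (fst p) (snd p)))"
        using False by (simp add: q_def distrib_left sum.distrib)
      also have "\<dots> \<le> B0 l * M powr \<gamma> + B0 l * M powr \<gamma>" by (intro add_mono single cs)
      also have "\<dots> \<le> B l" using B0(1)[of l] by (simp add: B_def algebra_simps)
      finally show ?thesis using False by simp
    qed
    have "(\<Sum>(J, K)\<in>X. wtN J K powr \<delta> * norm (field_coef \<alpha> H t J K - field_coef \<alpha> H s J K)) \<le>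
        (\<Sum>(J, K)\<in>X. \<Sum>m\<in>UNIV. \<Prod>l\<in>UNIV. q m l (J $ l, K $ l))"
      by (intro sum_mono) (use pw in auto)
    also have "\<dots> \<le> (\<Sum>(J, K)\<in>pairs D. \<Sum>m\<in>UNIV. \<Prod>l\<in>UNIV. q m l (J $ l, K $ l))"
      using D finite_pairs[OF D(1)] q0 by (intro sum_mono2) (auto intro!: sum_nonneg prod_nonneg)
    also have "\<dots> = (\<Sum>m\<in>UNIV. \<Sum>(J, K)\<in>pairs D. \<Prod>l\<in>UNIV. q m l (J $ l, K $ l))"
      unfolding case_prod_unfold by (rule sum.swap)
    also have "\<dots> = (\<Sum>m\<in>UNIV. \<Prod>l\<in>UNIV. \<Sum>p\<in>D. q m l p)"
      by (simp only: sum_pairs_prod[OF D(1)])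
    also have "\<dots> \<le> (\<Sum>m\<in>(UNIV::'n set). \<Prod>l\<in>UNIV. B l * (if l = m then norm (t - s) powr \<gamma> else 1))"
      by (intro sum_mono prod_mono conjI factor sum_nonneg q0)
    also have "\<dots> = A * norm (t - s) powr \<gamma>"
      by (simp add: prod.distrib A_def)
    finally show "(\<Sum>(J, K)\<in>X. wtN J K powr \<delta> * norm (field_coef \<alpha> H t J K - field_coef \<alpha> H s J K)) \<le> A * norm (t - s) powr \<gamma>" .
  qed
qed

end

text \<open>Almost sure convergence makes the characteristic functions converge, so that of
  \<open>Y\<close> is 1 and cos(uY) = 1 almost surely for each u. Countably many u suffice: for u =
  1 / (k + 1) with k > |Y| the angle has modulus below 1, where the cosine equals 1 at 0
  only.\<close>

lemma (in prob_space) AE_eq_0_if_char_tendsto_1: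
  assumes X: "\<And>n. X n \<in> borel_measurable M" "Y \<in> borel_measurable M"
    and lim: "AE \<omega> in M. (\<lambda>n. X n \<omega>) \<longlonglongrightarrow> (Y \<omega> :: real)"
    and char: "\<And>u. (\<lambda>n. CLINT \<omega>|M. iexp (u * X n \<omega>)) \<longlonglongrightarrow> 1"
  shows "AE \<omega> in M. Y \<omega> = 0"
proof -
  note [measurable] = X
  have cos1: "AE \<omega> in M. cos (u * Y \<omega>) = 1" for u
  proof -
    have "(\<lambda>n. CLINT \<omega>|M. iexp (u * X n \<omega>)) \<longlonglongrightarrow> (CLINT \<omega>|M. iexp (u * Y \<omega>))"
    proof (rule integral_dominated_convergence[where w = "\<lambda>_. 1"])
      show "AE \<omega> in M. (\<lambda>n. iexp (u * X n \<omega>)) \<longlonglongrightarrow> iexp (u * Y \<omega>)"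
        using lim by eventually_elim (intro tendsto_intros)
    qed auto
    hence 1: "(CLINT \<omega>|M. iexp (u * Y \<omega>)) = 1" using char LIMSEQ_unique by blast
    have i: "integrable M (\<lambda>\<omega>. iexp (u * Y \<omega>))" by (rule integrable_iexp) auto
    have "(LINT \<omega>|M. Re (iexp (u * Y \<omega>))) = 1" using 1 integral_Re[OF i] by simp
    hence "(LINT \<omega>|M. 1 - cos (u * Y \<omega>)) = 0"
      using integrable_Re[OF i] by (simp add: Re_exp prob_space)
    moreover have "integrable M (\<lambda>\<omega>. 1 - cos (u * Y \<omega>))"
      by (rule integrable_const_bound[where B = 2]) (auto intro!: AE_I2 order_trans[OF abs_triangle_ineq4] simp: add_mono[of _ 1 _ 1, simplified])
    ultimately have "AE \<omega> in M. 1 - cos (u * Y \<omega>) = 0"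
      by (subst (asm) integral_nonneg_eq_0_iff_AE) auto
    thus ?thesis by eventually_elim simp
  qed
  have "AE \<omega> in M. \<forall>k::nat. cos (1 / real (Suc k) * Y \<omega>) = 1"
    unfolding AE_all_countable using cos1 by blast
  thus ?thesis
  proof eventually_elim
    case (elim \<omega>)
    obtain k :: nat where k: "\<bar>Y \<omega>\<bar> < real k" using reals_Archimedean2 by blast
    define y where "y = 1 / real (Suc k) * Y \<omega>"
    have y1: "\<bar>y\<bar> < 1" using k by (simp add: y_def abs_mult divide_less_eq)
    have "cos y = 1" unfolding y_def by (rule elim[rule_format])
    hence c: "cos \<bar>y\<bar> = 1" by (auto simp: abs_if)
    have "\<bar>y\<bar> = 0"
    proof (rule ccontr)
      assume "\<bar>y\<bar> \<noteq> 0"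
      hence "cos \<bar>y\<bar> < cos 0" using y1 pi_gt3 by (intro cos_monotone_0_pi) auto
      thus False using c by simp
    qed
    thus "Y \<omega> = 0" by (simp add: y_def)
  qed
qed

context wavelet
begin

lemma psi_hat_measurable [measurable]: "psi_hat \<psi> \<alpha> j k \<in> borel_measurable borel"
  unfolding psi_hat_eq_Eh by measurable

lemma Psi_hat_measurable [measurable]: "(\<lambda>x. Psi_hat \<psi> \<alpha> J K (x :: real^'n)) \<in> borel_measurable borel"
  unfolding Psi_hat_def by measurable

lemma wt_powr_sum_bounded:
  obtains S where "S \<ge> 0" "\<And>D. finite D \<Longrightarrow> (\<Sum>p\<in>D. wt p powr (- 2)) \<le> S"
proof -
  obtain K where K: "K \<ge> 0" "\<And>F. finite F \<Longrightarrow> (\<Sum>k\<in>F. (1 + \<bar>real_of_int k\<bar>) powr (- 2)) \<le> K"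
    using sum_int_powr_bounded[of 2] by auto
  obtain G where G: "G \<ge> 0" "\<And>F. finite F \<Longrightarrow> (\<Sum>j\<in>F. 2 powr (- 2 * \<bar>real_of_int j\<bar>)) \<le> G"
    using sum_int_geometric_bounded[of 2] by auto
  show ?thesis
  proof (rule that[of "G * K"])
    fix D :: "(int \<times> int) set" assume D: "finite D"
    have "(\<Sum>p\<in>D. wt p powr (- 2)) \<le> (\<Sum>j\<in>fst ` D. 2 powr (- 2 * \<bar>real_of_int j\<bar>) * K)"
    proof (rule sum_int_pairs_le[OF D])
      fix j and F :: "int set" assume F: "finite F"
      have "(\<Sum>k\<in>F. wt (j, k) powr (- 2)) = 2 powr (- 2 * \<bar>real_of_int j\<bar>) * (\<Sum>k\<in>F. (1 + \<bar>real_of_int k\<bar>) powr (- 2))"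
        by (simp add: wt_def powr_mult powr_powr sum_distrib_left mult.commute)
      also have "\<dots> \<le> 2 powr (- 2 * \<bar>real_of_int j\<bar>) * K" using F by (intro mult_left_mono K) auto
      finally show "(\<Sum>k\<in>F. wt (j, k) powr (- 2)) \<le> 2 powr (- 2 * \<bar>real_of_int j\<bar>) * K" .
    qed auto
    also have "\<dots> \<le> G * K"
      unfolding sum_distrib_right[symmetric] using D K by (intro mult_right_mono G) auto
    finally show "(\<Sum>p\<in>D. wt p powr (- 2)) \<le> G * K" .
  qed (use G K in auto)
qed

lemma envelope_prod_in_Lp_fun:
  fixes B \<delta> :: "'n::finite \<Rightarrow> real"
  assumes \<alpha>: "\<alpha> > 0" and "\<And>l. \<delta> l > 0" "\<And>l. B l \<ge> 0"
  shows "(\<lambda>x::real^'n. complex_of_real (\<Prod>l\<in>UNIV. B l * envelope \<alpha> (\<delta> l) (x $ l))) \<in> Lp_fun \<alpha>"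
proof (rule prod_in_Lp_fun)
  show "integrable lborel (\<lambda>x. (B l * envelope \<alpha> (\<delta> l) x) powr \<alpha>)" for l
    unfolding powr_mult by (intro integrable_mult_right envelope_integrable assms)
qed (use assms in auto)

end

section \<open>The harmonizable sheet\<close>

locale stable_sheet = stable_integral P \<alpha> I + wavelet \<psi>
  for P :: "'w measure" and \<alpha> :: real and I :: "(real^'n::finite \<Rightarrow> complex) \<Rightarrow> 'w \<Rightarrow> complex" and \<psi> +
  fixes H :: "real^'n" and M :: real
  assumes H: "\<And>l. 0 < H $ l \<and> H $ l < 1" and M: "M > 0"
begin

lemma Psi_hat_bound:
  assumes "\<delta> > 0"
  obtains B where "B > 0" "\<And>J K x. norm (Psi_hat \<psi> \<alpha> J K (x::real^'n)) \<le>
    (\<Prod>l\<in>UNIV. 2 powr (\<delta> * \<bar>real_of_int (J $ l)\<bar>)) * (\<Prod>l\<in>UNIV. B * envelope \<alpha> \<delta> (x $ l))"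
proof -
  obtain B where B: "B > 0" "\<And>j k \<xi>. norm (psi_hat \<psi> \<alpha> j k \<xi>) \<le> 2 powr (\<delta> * \<bar>real_of_int j\<bar>) * (B * envelope \<alpha> \<delta> \<xi>)"
    using psi_hat_le_envelope[OF alpha_pos assms] by blast
  show ?thesis
  proof (rule that[OF B(1)])
    fix J K :: "int^'n" and x :: "real^'n"
    have "norm (Psi_hat \<psi> \<alpha> J K x) \<le> (\<Prod>l\<in>UNIV. 2 powr (\<delta> * \<bar>real_of_int (J $ l)\<bar>) * (B * envelope \<alpha> \<delta> (x $ l)))"
      unfolding Psi_hat_def prod_norm[symmetric] by (intro prod_mono conjI B) auto
    thus "norm (Psi_hat \<psi> \<alpha> J K x) \<le> (\<Prod>l\<in>UNIV. 2 powr (\<delta> * \<bar>real_of_int (J $ l)\<bar>)) * (\<Prod>l\<in>UNIV. B * envelope \<alpha> \<delta> (x $ l))"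
      by (simp only: prod.distrib)
  qed
qed

lemma cnj_Psi_hat_in_Lp_fun: "(\<lambda>x. cnj (Psi_hat \<psi> \<alpha> J K (x::real^'n))) \<in> Lp_fun \<alpha>"
proof -
  obtain B where B: "B > 0" "\<And>J K x. norm (Psi_hat \<psi> \<alpha> J K (x::real^'n)) \<le>
    (\<Prod>l\<in>UNIV. 2 powr (1 * \<bar>real_of_int (J $ l)\<bar>)) * (\<Prod>l\<in>UNIV. B * envelope \<alpha> 1 (x $ l))"
    using Psi_hat_bound[of 1] by auto
  show ?thesis
  proof (rule Lp_fun_bounded_by[OF _ envelope_prod_in_Lp_fun[OF alpha_pos, of "\<lambda>_. 1" "\<lambda>_. B"]])
    show "(\<lambda>x. cnj (Psi_hat \<psi> \<alpha> J K (x::real^'n))) \<in> borel_measurable lborel" by measurable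
    show "norm (cnj (Psi_hat \<psi> \<alpha> J K x)) \<le>
        (\<Prod>l\<in>UNIV. 2 powr (1 * \<bar>real_of_int (J $ l)\<bar>)) * norm (complex_of_real (\<Prod>l\<in>UNIV. B * envelope \<alpha> 1 (x $ l)))" for x
      unfolding complex_mod_cnj norm_of_real using B(2)[of J K x] B(1) by (simp add: abs_of_nonneg prod_nonneg)
  qed (use alpha_pos B in \<open>auto intro: prod_nonneg\<close>)
qed

lemma wavelet_coeff_measurable: "wavelet_coeff \<psi> \<alpha> I J K \<in> borel_measurable P"
  using I_measurable[OF cnj_Psi_hat_in_Lp_fun] by (simp add: wavelet_coeff_def[abs_def])

lemma U_star_measurable: "U_star \<psi> \<alpha> H I M n t \<in> borel_measurable P"
proof -
  note [measurable] = wavelet_coeff_measurable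
  show ?thesis unfolding U_star_eq[abs_def] case_prod_unfold by measurable
qed

text \<open>The exponent \<open>\<delta>\<close> is split into two halves \<open>e\<close>. One
  normalises the wavelets so that all of them lie below a single function in
  \<open>L\<^sup>\<alpha>\<close>; the other is the weight in the maximal inequality. A moment of
  order \<open>2 * m\<close> with \<open>m\<close> at least \<open>1 / e\<close> makes the weights
  summable, the sum over multi-indices being bounded by a power of a one-dimensional sum.\<close>

lemma wavelet_coeff_bound:
  assumes \<delta>: "\<delta> > 0"
  shows "AE \<omega> in P. \<exists>C. \<forall>J K. norm (wavelet_coeff \<psi> \<alpha> I J K \<omega>) \<le> C * wtN J K powr \<delta>"
proof -
  define e where "e = \<delta> / 2"
  have e: "e > 0" using \<delta> by (simp add: e_def)
  obtain B where B: "B > 0" "\<And>J K x. norm (Psi_hat \<psi> \<alpha> J K (x::real^'n)) \<le>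
    (\<Prod>l\<in>UNIV. 2 powr (e * \<bar>real_of_int (J $ l)\<bar>)) * (\<Prod>l\<in>UNIV. B * envelope \<alpha> e (x $ l))"
    using Psi_hat_bound[OF e] by blast
  define g where "g x = complex_of_real (\<Prod>l\<in>UNIV. B * envelope \<alpha> e (x $ l))" for x :: "real^'n"
  have g: "g \<in> Lp_fun \<alpha>"
    unfolding g_def using envelope_prod_in_Lp_fun[OF alpha_pos, of "\<lambda>_. e" "\<lambda>_. B"] e B by auto
  define a where "a J = (\<Prod>l\<in>UNIV. 2 powr (e * \<bar>real_of_int (J $ l)\<bar>))" for J :: "int^'n"
  have a: "a J > 0" for J unfolding a_def by (intro prod_pos) auto
  define f where "f q x = complex_of_real (inverse (a (fst q))) * cnj (Psi_hat \<psi> \<alpha> (fst q) (snd q) x)"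
    for q :: "(int^'n) \<times> (int^'n)" and x :: "real^'n"
  define w where "w q = wtN (fst q) (snd q) powr e" for q :: "(int^'n) \<times> (int^'n)"
  define m where "m = nat \<lceil>1 / e\<rceil>"
  have m: "m > 0" "1 / e \<le> real m" using e by (auto simp: m_def le_nat_iff)
  obtain S where S: "S \<ge> 0" "\<And>D. finite D \<Longrightarrow> (\<Sum>p\<in>D. wt p powr (- 2)) \<le> S"
    using wt_powr_sum_bounded by blast
  have "AE \<omega> in P. \<exists>C. \<forall>q. norm (I (f q) \<omega>) \<le> C * w q"
  proof (rule stable_maximal_bound[OF g, where m = m and W = "S ^ CARD('n)"])
    show "f q \<in> borel_measurable borel" for q unfolding f_def by measurable
    show "norm (f q x) \<le> norm (g x)" for q x
    proof -
      have "norm (f q x) = inverse (a (fst q)) * norm (Psi_hat \<psi> \<alpha> (fst q) (snd q) x)"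
        using a[of "fst q"] by (simp add: f_def norm_mult norm_inverse)
      also have "\<dots> \<le> inverse (a (fst q)) * (a (fst q) * (\<Prod>l\<in>UNIV. B * envelope \<alpha> e (x $ l)))"
        using a[of "fst q"] B(2)[of "fst q" "snd q" x] by (intro mult_left_mono) (auto simp: a_def)
      also have "\<dots> = (\<Prod>l\<in>UNIV. B * envelope \<alpha> e (x $ l))" using a[of "fst q"] by (simp add: mult.assoc[symmetric] del: mult.assoc)
      also have "\<dots> = norm (g x)" unfolding g_def norm_of_real using B by (simp add: abs_of_nonneg prod_nonneg)
      finally show ?thesis .
    qed
    show "w q > 0" for q
    proof -
      have "wtN (fst q) (snd q) > 0" using wtN_ge_1[of "fst q" "snd q"] by linarith
      thus ?thesis by (simp add: w_def)
    qed
    show "m > 0" by (rule m)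
    fix X :: "((int^'n) \<times> (int^'n)) set" assume X: "finite X"
    obtain D where D: "finite D" "X \<subseteq> pairs D" using subset_pairs[OF X] by blast
    have pw: "1 / w q ^ (2*m) \<le> (\<Prod>l\<in>UNIV. wt (fst q $ l, snd q $ l) powr (- 2))" for q
    proof -
      have pos: "wtN (fst q) (snd q) \<ge> 1" by (rule wtN_ge_1)
      have "w q ^ (2*m) = w q powr (real (2*m))"
        using pos by (subst powr_realpow) (auto simp: w_def)
      also have "\<dots> = wtN (fst q) (snd q) powr (e * real (2*m))" by (simp add: w_def powr_powr)
      finally have "1 / w q ^ (2*m) = wtN (fst q) (snd q) powr (- (e * real (2*m)))"
        by (simp add: powr_minus_divide)
      also have "\<dots> \<le> wtN (fst q) (snd q) powr (- 2)"
      proof (rule powr_mono)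
        have "1 \<le> e * real m" using m(2) e by (simp add: divide_le_eq mult.commute)
        thus "- (e * real (2*m)) \<le> - 2" by simp
      qed (rule pos)
      finally show ?thesis by (simp add: wtN_powr)
    qed
    have "(\<Sum>q\<in>X. 1 / w q ^ (2*m)) \<le> (\<Sum>q\<in>X. \<Prod>l\<in>UNIV. wt (fst q $ l, snd q $ l) powr (- 2))"
      by (intro sum_mono pw)
    also have "\<dots> \<le> (\<Sum>q\<in>(pairs D :: ((int^'n) \<times> (int^'n)) set). \<Prod>l\<in>UNIV. wt (fst q $ l, snd q $ l) powr (- 2))"
      using D finite_pairs[OF D(1)] by (intro sum_mono2) (auto intro!: prod_nonneg)
    also have "\<dots> = (\<Prod>l\<in>(UNIV::'n set). \<Sum>p\<in>D. wt p powr (- 2))"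
      using sum_pairs_prod[OF D(1), of "\<lambda>(l::'n) p. wt p powr (- 2)"] by (simp add: case_prod_unfold)
    also have "\<dots> \<le> (\<Prod>l\<in>(UNIV::'n set). S)"
      using S D(1) by (intro prod_mono conjI sum_nonneg) auto
    finally show "(\<Sum>q\<in>X. 1 / w q ^ (2*m)) \<le> S ^ CARD('n)" by simp
  qed
  moreover have "AE \<omega> in P. \<forall>q. I (f q) \<omega> = complex_of_real (inverse (a (fst q))) * wavelet_coeff \<psi> \<alpha> I (fst q) (snd q) \<omega>"
    unfolding AE_all_countable f_def wavelet_coeff_def using I_cmult[OF cnj_Psi_hat_in_Lp_fun] by blast
  ultimately show ?thesis
  proof eventually_elim
    case (elim \<omega>)
    then obtain C where C: "\<And>q. norm (I (f q) \<omega>) \<le> C * w q" by blast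
    show ?case
    proof (intro exI[of _ C] allI)
      fix J K :: "int^'n"
      have aw: "a J \<le> wtN J K powr e"
        unfolding a_def wtN_powr
      proof (intro prod_mono conjI)
        fix l
        have "2 powr \<bar>real_of_int (J $ l)\<bar> * 1 \<le> wt (J $ l, K $ l)" unfolding wt_def split by (intro mult_left_mono) auto
        hence "(2 powr \<bar>real_of_int (J $ l)\<bar>) powr e \<le> wt (J $ l, K $ l) powr e" using e by (intro powr_mono2) auto
        thus "2 powr (e * \<bar>real_of_int (J $ l)\<bar>) \<le> wt (J $ l, K $ l) powr e" by (simp add: powr_powr mult.commute)
      qed auto
      have "I (f (J, K)) \<omega> = complex_of_real (inverse (a J)) * wavelet_coeff \<psi> \<alpha> I J K \<omega>"
        using elim(2)[rule_format, of "(J, K)"] by simp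
      hence "wavelet_coeff \<psi> \<alpha> I J K \<omega> = complex_of_real (a J) * I (f (J, K)) \<omega>"
        using a[of J] by simp
      hence "norm (wavelet_coeff \<psi> \<alpha> I J K \<omega>) = a J * norm (I (f (J, K)) \<omega>)"
        using a[of J] by (simp add: norm_mult)
      also have "\<dots> \<le> wtN J K powr e * (C * wtN J K powr e)"
        using aw C[of "(J, K)"] by (intro mult_mono) (auto simp: w_def)
      also have "\<dots> = C * (wtN J K powr e * wtN J K powr e)" by (simp only: mult_ac)
      also have "wtN J K powr e * wtN J K powr e = wtN J K powr \<delta>" by (simp add: e_def flip: powr_add)
      finally show "norm (wavelet_coeff \<psi> \<alpha> I J K \<omega>) \<le> C * wtN J K powr \<delta>" .
    qed
  qed
qed

section \<open>Identification of the limit\<close>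

definition partial_field :: "nat \<Rightarrow> real^'n \<Rightarrow> real^'n \<Rightarrow> complex" where
  "partial_field n t x = (\<Prod>l\<in>UNIV. partial_kernel \<alpha> (H $ l) M (t $ l) n (x $ l))"

lemma partial_field_eq:
  "partial_field n t x = (\<Sum>q\<in>D_index_prod n M. field_coef \<alpha> H t (fst q) (snd q) * cnj (Psi_hat \<psi> \<alpha> (fst q) (snd q) x))"
proof -
  have "partial_field n t x = (\<Prod>l\<in>UNIV. \<Sum>p\<in>D_index n M. dcoef \<alpha> (H $ l) (t $ l) (fst p) (snd p) * cnj (psi_hat \<psi> \<alpha> (fst p) (snd p) (x $ l)))"
    by (simp add: partial_field_def partial_kernel_def case_prod_unfold)
  also have "\<dots> = (\<Sum>q\<in>D_index_prod n M. \<Prod>l\<in>UNIV. dcoef \<alpha> (H $ l) (t $ l) (fst q $ l) (snd q $ l) * cnj (psi_hat \<psi> \<alpha> (fst q $ l) (snd q $ l) (x $ l)))"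
    unfolding D_index_prod_eq_pairs sum_pairs_prod[OF finite_D_index, symmetric] case_prod_unfold fst_conv snd_conv ..
  also have "\<dots> = (\<Sum>q\<in>D_index_prod n M. field_coef \<alpha> H t (fst q) (snd q) * cnj (Psi_hat \<psi> \<alpha> (fst q) (snd q) x))"
    by (simp add: field_coef_def Psi_hat_def prod.distrib)
  finally show ?thesis .
qed

lemma partial_field_in_Lp_fun: "partial_field n t \<in> Lp_fun \<alpha>"
  unfolding partial_field_eq[abs_def] using alpha_pos
  by (intro Lp_fun_sum cnj_Psi_hat_in_Lp_fun) auto

text \<open>The null set depends on \<open>n\<close> and \<open>t\<close>, since linearity of
  \<open>I\<close> is only almost sure. Pathwise convergence is therefore derived from the
  coefficients, and this formula serves for laws at a fixed \<open>t\<close>.\<close>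

lemma U_star_eq_integral: "AE \<omega> in P. U_star \<psi> \<alpha> H I M n t \<omega> = Re (I (partial_field n t) \<omega>)"
proof -
  have "finite (D_index_prod n M :: ((int^'n) \<times> (int^'n)) set)"
    unfolding D_index_prod_eq_pairs by (intro finite_pairs finite_D_index)
  hence "AE \<omega> in P. I (partial_field n t) \<omega> =
      (\<Sum>q\<in>D_index_prod n M. field_coef \<alpha> H t (fst q) (snd q) * I (\<lambda>x. cnj (Psi_hat \<psi> \<alpha> (fst q) (snd q) x)) \<omega>)"
    unfolding partial_field_eq[abs_def] by (intro I_sum cnj_Psi_hat_in_Lp_fun)
  thus ?thesis
    by eventually_elim (simp add: U_star_eq wavelet_coeff_def case_prod_unfold)
qed

lemma sheet_kernel_eq: "sheet_kernel \<alpha> H t x = (\<Prod>l\<in>UNIV. kernel1 \<alpha> (H $ l) (t $ l) (x $ l))"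
  by (simp add: sheet_kernel_def kernel1_def)

text \<open>Dominated convergence below a product of one-dimensional envelopes, whose exponents may
  differ with the coordinate. Convergence in \<open>power_norm\<close> is exactly what the
  characteristic functions ask for.\<close>

lemma partial_field_converges:
  assumes t: "t \<in> cube M"
  shows "sheet_kernel \<alpha> H t \<in> Lp_fun \<alpha>"
    and "(\<lambda>n. power_norm \<alpha> (\<lambda>x. partial_field n t x - sheet_kernel \<alpha> H t x)) \<longlonglongrightarrow> 0"
proof -
  define Q where "Q l \<delta> B \<longleftrightarrow> \<delta> > 0 \<and> B \<ge> 0 \<and> (\<forall>n \<xi>. norm (partial_kernel \<alpha> (H $ l) M (t $ l) n \<xi>) \<le> B * envelope \<alpha> \<delta> \<xi>) \<and>
      (\<forall>\<xi>. norm (kernel1 \<alpha> (H $ l) (t $ l) \<xi>) \<le> B * envelope \<alpha> \<delta> \<xi>)" for l \<delta> B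
  have "\<exists>\<delta> B. Q l \<delta> B" for l
  proof -
    have h: "0 < H $ l" "H $ l < 1" using H by auto
    obtain \<delta> B where "\<delta> > 0" "B \<ge> 0" "\<And>n \<xi>. norm (partial_kernel \<alpha> (H $ l) M (t $ l) n \<xi>) \<le> B * envelope \<alpha> \<delta> \<xi>"
      "\<And>\<xi>. norm (kernel1 \<alpha> (H $ l) (t $ l) \<xi>) \<le> B * envelope \<alpha> \<delta> \<xi>"
      using partial_kernel_dominated[OF alpha_pos h M cube_component[OF t, of l]] by blast
    hence "Q l \<delta> B" by (simp add: Q_def)
    thus ?thesis by blast
  qed
  then obtain \<delta> B where Q: "\<And>l. Q l (\<delta> l) (B l)" by metis
  have \<delta>: "\<delta> l > 0" and B: "B l \<ge> 0" and pk: "norm (partial_kernel \<alpha> (H $ l) M (t $ l) n \<xi>) \<le> B l * envelope \<alpha> (\<delta> l) \<xi>"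
    and k: "norm (kernel1 \<alpha> (H $ l) (t $ l) \<xi>) \<le> B l * envelope \<alpha> (\<delta> l) \<xi>" for l n \<xi>
    using Q[of l] unfolding Q_def by blast+
  define G where "G x = (\<Prod>l\<in>UNIV. B l * envelope \<alpha> (\<delta> l) (x $ l))" for x :: "real^'n"
  have G0: "G x \<ge> 0" for x unfolding G_def using B by (intro prod_nonneg) auto
  have GL: "(\<lambda>x. complex_of_real (G x)) \<in> Lp_fun \<alpha>"
    unfolding G_def by (rule envelope_prod_in_Lp_fun[OF alpha_pos \<delta> B])
  have Gi: "integrable lborel (\<lambda>x. G x powr \<alpha>)" using GL G0 by (simp add: Lp_fun_def)
  have kb: "norm (sheet_kernel \<alpha> H t x) \<le> G x" for x
    unfolding sheet_kernel_eq G_def prod_norm[symmetric] by (intro prod_mono conjI k) auto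
  have pb: "norm (partial_field n t x) \<le> G x" for n x
    unfolding partial_field_def G_def prod_norm[symmetric] by (intro prod_mono conjI pk) auto
  have km[measurable]: "sheet_kernel \<alpha> H t \<in> borel_measurable borel"
    unfolding sheet_kernel_eq[abs_def] by measurable
  have pm[measurable]: "partial_field n t \<in> borel_measurable borel" for n
    unfolding partial_field_def[abs_def] by measurable
  show "sheet_kernel \<alpha> H t \<in> Lp_fun \<alpha>"
    by (rule Lp_fun_bounded_by[OF _ GL, of _ 1]) (use kb G0 alpha_pos in auto)
  have "(\<lambda>n. LINT x|lborel. norm (partial_field n t x - sheet_kernel \<alpha> H t x) powr \<alpha>) \<longlonglongrightarrow> (LINT x|(lborel :: (real^'n) measure). 0::real)"
  proof (rule integral_dominated_convergence[where w = "\<lambda>x. 2 powr \<alpha> * G x powr \<alpha>"])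
    show "AE x in lborel. (\<lambda>n. norm (partial_field n t x - sheet_kernel \<alpha> H t x) powr \<alpha>) \<longlonglongrightarrow> 0"
    proof (rule AE_I2)
      fix x
      have "(\<lambda>n. partial_field n t x) \<longlonglongrightarrow> sheet_kernel \<alpha> H t x"
        unfolding partial_field_def sheet_kernel_eq
        using H by (intro tendsto_prod partial_kernel_tendsto[OF alpha_pos _ _ M cube_component[OF t]]) auto
      hence "(\<lambda>n. norm (partial_field n t x - sheet_kernel \<alpha> H t x)) \<longlonglongrightarrow> 0"
        by (simp add: tendsto_norm_zero_iff LIM_zero_iff)
      thus "(\<lambda>n. norm (partial_field n t x - sheet_kernel \<alpha> H t x) powr \<alpha>) \<longlonglongrightarrow> 0"
        using alpha_pos by (intro tendsto_zero_powrI[of _ _ _ \<alpha>]) auto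
    qed
    show "AE x in lborel. norm (norm (partial_field n t x - sheet_kernel \<alpha> H t x) powr \<alpha>) \<le> 2 powr \<alpha> * G x powr \<alpha>" for n
    proof (rule AE_I2)
      fix x
      have "norm (partial_field n t x - sheet_kernel \<alpha> H t x) \<le> norm (partial_field n t x) + norm (sheet_kernel \<alpha> H t x)"
        by (rule norm_triangle_ineq4)
      also have "\<dots> \<le> 2 * G x" using pb[of n x] kb[of x] by simp
      finally have "norm (partial_field n t x - sheet_kernel \<alpha> H t x) powr \<alpha> \<le> (2 * G x) powr \<alpha>"
        using alpha_pos by (intro powr_mono2) auto
      thus "norm (norm (partial_field n t x - sheet_kernel \<alpha> H t x) powr \<alpha>) \<le> 2 powr \<alpha> * G x powr \<alpha>"
        using G0 by (simp add: powr_mult)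
    qed
    show "integrable lborel (\<lambda>x. 2 powr \<alpha> * G x powr \<alpha>)" using Gi by simp
  qed measurable
  thus "(\<lambda>n. power_norm \<alpha> (\<lambda>x. partial_field n t x - sheet_kernel \<alpha> H t x)) \<longlonglongrightarrow> 0"
    by (simp add: power_norm_def)
qed

text \<open>At a fixed \<open>t\<close> the difference of \<open>U_star\<close> and the sheet is
  almost surely the real part of one stable integral, whose characteristic function tends to 1
  because its exponent is a multiple of \<open>power_norm\<close>. A pathwise limit must then agree
  with the sheet.\<close>

lemma limit_eq_sheet:
  assumes t: "t \<in> cube M" and U: "U \<in> borel_measurable P"
    and lim: "AE \<omega> in P. (\<lambda>n. U_star \<psi> \<alpha> H I M n t \<omega>) \<longlonglongrightarrow> U \<omega>"
  shows "AE \<omega> in P. U \<omega> = harmonizable_sheet \<alpha> H I t \<omega>" "harmonizable_sheet \<alpha> H I t \<in> borel_measurable P"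
proof -
  note k = partial_field_converges[OF t]
  have [measurable]: "I (sheet_kernel \<alpha> H t) \<in> borel_measurable P" by (rule I_measurable[OF k(1)])
  show Zm[measurable]: "harmonizable_sheet \<alpha> H I t \<in> borel_measurable P"
    unfolding harmonizable_sheet_def[abs_def] by measurable
  note [measurable] = U U_star_measurable
  define X where "X n \<omega> = U_star \<psi> \<alpha> H I M n t \<omega> - harmonizable_sheet \<alpha> H I t \<omega>" for n \<omega>
  have "AE \<omega> in P. U \<omega> - harmonizable_sheet \<alpha> H I t \<omega> = 0"
  proof (rule AE_eq_0_if_char_tendsto_1[of X])
    show "X n \<in> borel_measurable P" for n unfolding X_def[abs_def] by measurable
    show "AE \<omega> in P. (\<lambda>n. X n \<omega>) \<longlonglongrightarrow> U \<omega> - harmonizable_sheet \<alpha> H I t \<omega>"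
      using lim unfolding X_def by eventually_elim (intro tendsto_intros)
    fix u
    have ch: "(CLINT \<omega>|P. iexp (u * X n \<omega>)) = complex_of_real (exp (- (\<bar>u\<bar> powr \<alpha> *
        power_norm \<alpha> (\<lambda>x. partial_field n t x - sheet_kernel \<alpha> H t x))))" for n
    proof -
      define d where "d x = partial_field n t x - sheet_kernel \<alpha> H t x" for x
      have dL: "d \<in> Lp_fun \<alpha>"
        using Lp_fun_add[OF partial_field_in_Lp_fun Lp_fun_cmult[OF k(1), of "-1"], of n t] alpha_pos by (simp add: d_def[abs_def])
      note [measurable] = I_measurable[OF dL]
      have [measurable]: "X n \<in> borel_measurable P" unfolding X_def[abs_def] by measurable
      have "AE \<omega> in P. I d \<omega> = I (partial_field n t) \<omega> - I (sheet_kernel \<alpha> H t) \<omega>"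
        unfolding d_def[abs_def] by (rule I_diff[OF partial_field_in_Lp_fun k(1)])
      with U_star_eq_integral[of n t] have "AE \<omega> in P. X n \<omega> = Re (I d \<omega>)"
        by eventually_elim (simp add: X_def harmonizable_sheet_def)
      hence "(CLINT \<omega>|P. iexp (u * X n \<omega>)) = (CLINT \<omega>|P. iexp (u * Re (I d \<omega>)))"
        by (intro integral_cong_AE) (measurable, auto)
      thus ?thesis unfolding I_char_scaled[OF dL] by (simp add: d_def[abs_def])
    qed
    have "(\<lambda>n. complex_of_real (exp (- (\<bar>u\<bar> powr \<alpha> * power_norm \<alpha> (\<lambda>x. partial_field n t x - sheet_kernel \<alpha> H t x))))) \<longlonglongrightarrow>
        complex_of_real (exp (- (\<bar>u\<bar> powr \<alpha> * 0)))"
      by (intro tendsto_intros k)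
    thus "(\<lambda>n. CLINT \<omega>|P. iexp (u * X n \<omega>)) \<longlonglongrightarrow> 1" unfolding ch by simp
  qed measurable
  thus "AE \<omega> in P. U \<omega> = harmonizable_sheet \<alpha> H I t \<omega>" by eventually_elim simp
qed

section \<open>Almost sure Hoelder convergence\<close>

lemma holder_convergence:
  assumes bound: "\<And>i::nat. \<exists>C. \<forall>J K. norm (wavelet_coeff \<psi> \<alpha> I J K \<omega>) \<le> C * wtN J K powr (1 / real (Suc i))"
    and \<gamma>: "0 < \<gamma>" "\<And>l. \<gamma> < H $ l"
  shows "holder_Cauchy \<gamma> (cube M) (\<lambda>n t. U_star \<psi> \<alpha> H I M n t \<omega>)"
    "\<And>t. t \<in> cube M \<Longrightarrow> convergent (\<lambda>n. U_star \<psi> \<alpha> H I M n t \<omega>)"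
    "holder_limit \<gamma> (cube M) (\<lambda>n t. U_star \<psi> \<alpha> H I M n t \<omega>) (\<lambda>t. lim (\<lambda>n. U_star \<psi> \<alpha> H I M n t \<omega>))"
proof -
  \<comment> \<open>One exponent for all coordinates; the divisors 4 and 2 leave room for the strict
    inequalities required of \<open>d\<close>.\<close>
  define d where "d = Min (range (\<lambda>l. min (1/2) (min ((H $ l - \<gamma>) / 4) ((1 - H $ l) / 2))))"
  have dle: "d \<le> min (1/2) (min ((H $ l - \<gamma>) / 4) ((1 - H $ l) / 2))" for l
    unfolding d_def by (intro Min_le) auto
  have d0: "d > 0" unfolding d_def using H \<gamma> by (subst Min_gr_iff) auto
  have d: "d \<le> 1/2" "\<gamma> + 2 * d < H $ l" "H $ l + d < 1" for l
  proof -
    have "d \<le> 1/2" "d \<le> (H $ l - \<gamma>) / 4" "d \<le> (1 - H $ l) / 2" using dle[of l] by simp_all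
    thus "d \<le> 1/2" "\<gamma> + 2 * d < H $ l" "H $ l + d < 1" using H[of l] \<gamma>(2)[of l] by simp_all
  qed
  \<comment> \<open>Half of the exponent is used up by the random coefficients; the other half gives
    the rate outside \<open>D_index_prod n M\<close>.\<close>
  define \<delta> where "\<delta> = d / 2"
  have \<delta>: "\<delta> > 0" using d0 by (simp add: \<delta>_def)
  obtain i where i: "1 / real (Suc i) < \<delta>" using nat_approx_posE[OF \<delta>] by auto
  obtain C where C0: "\<And>J K. norm (wavelet_coeff \<psi> \<alpha> I J K \<omega>) \<le> C * wtN J K powr (1 / real (Suc i))"
    using bound[of i] by blast
  have Cnn: "C \<ge> 0"
  proof -
    have "0 \<le> C * wtN (0 :: int^'n) 0 powr (1 / real (Suc i))"
      by (rule order_trans[OF norm_ge_zero C0[of 0 0]])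
    moreover have "wtN (0 :: int^'n) 0 powr (1 / real (Suc i)) > 0" using wtN_ge_1[of "0 :: int^'n" 0] by simp
    ultimately show ?thesis by (simp add: zero_le_mult_iff)
  qed
  have C: "norm (wavelet_coeff \<psi> \<alpha> I J K \<omega>) \<le> C * wtN J K powr \<delta>" for J K
    using i Cnn by (intro order_trans[OF C0] mult_left_mono powr_mono wtN_ge_1) auto
  obtain A where A: "A \<ge> 0"
    "\<And>X s t. finite X \<Longrightarrow> s \<in> cube M \<Longrightarrow> t \<in> cube M \<Longrightarrow>
      (\<Sum>(J, K)\<in>X. wtN J K powr d * norm (field_coef \<alpha> H t J K - field_coef \<alpha> H s J K)) \<le> A * norm (t - s) powr \<gamma>"
    using field_coef_increment_sum[OF H \<gamma>(1) d0 d(1) d(2) d(3) M, where \<alpha> = \<alpha>] by blast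
  define u where "u n t = U_star \<psi> \<alpha> H I M n t \<omega>" for n t
  define S where "S X t = (\<Sum>(J, K)\<in>X. field_coef \<alpha> H t J K * wavelet_coeff \<psi> \<alpha> I J K \<omega>)" for X t
  have uS: "u n t = Re (S (D_index_prod n M) t)" for n t by (simp add: u_def S_def U_star_eq)
  have finD: "finite (D_index_prod n M :: ((int^'n) \<times> (int^'n)) set)" for n
    unfolding D_index_prod_eq_pairs by (intro finite_pairs finite_D_index)
  \<comment> \<open>Applied with \<open>r = 1\<close> to whole partial sums, and with
    \<open>r = \<rho> n\<close> to the blocks between \<open>n\<close> and \<open>m\<close>.\<close>
  have gen: "norm (S X t - S X s) \<le> (C * A) * r * norm (t - s) powr \<gamma>"
    if X: "finite X" and st: "s \<in> cube M" "t \<in> cube M" and r: "r \<ge> 0" "\<And>J K. (J, K) \<in> X \<Longrightarrow> 1 \<le> r * wtN J K powr \<delta>" for X s t r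
  proof -
    have "norm (S X t - S X s) = norm (\<Sum>(J, K)\<in>X. (field_coef \<alpha> H t J K - field_coef \<alpha> H s J K) * wavelet_coeff \<psi> \<alpha> I J K \<omega>)"
      by (simp add: S_def case_prod_unfold left_diff_distrib sum_subtractf)
    also have "\<dots> \<le> (\<Sum>(J, K)\<in>X. norm ((field_coef \<alpha> H t J K - field_coef \<alpha> H s J K) * wavelet_coeff \<psi> \<alpha> I J K \<omega>))"
      unfolding case_prod_unfold by (rule norm_sum)
    also have "\<dots> \<le> (\<Sum>(J, K)\<in>X. (C * r) * (wtN J K powr d * norm (field_coef \<alpha> H t J K - field_coef \<alpha> H s J K)))"
    proof (rule sum_mono, clarify)
      fix J K assume JK: "(J, K) \<in> X"
      let ?D = "norm (field_coef \<alpha> H t J K - field_coef \<alpha> H s J K)"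
      have "norm ((field_coef \<alpha> H t J K - field_coef \<alpha> H s J K) * wavelet_coeff \<psi> \<alpha> I J K \<omega>) \<le> ?D * (C * wtN J K powr \<delta>)"
        unfolding norm_mult by (intro mult_left_mono C) auto
      also have "\<dots> = (?D * (C * wtN J K powr \<delta>)) * 1" by simp
      also have "\<dots> \<le> (?D * (C * wtN J K powr \<delta>)) * (r * wtN J K powr \<delta>)"
        using r(2)[OF JK] Cnn by (intro mult_left_mono) auto
      also have "\<dots> = (C * r) * ((wtN J K powr \<delta> * wtN J K powr \<delta>) * ?D)" by (simp only: mult_ac)
      also have "wtN J K powr \<delta> * wtN J K powr \<delta> = wtN J K powr d" by (simp add: \<delta>_def flip: powr_add)
      finally show "norm ((field_coef \<alpha> H t J K - field_coef \<alpha> H s J K) * wavelet_coeff \<psi> \<alpha> I J K \<omega>) \<le>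
        (C * r) * (wtN J K powr d * ?D)" .
    qed
    also have "\<dots> = (C * r) * (\<Sum>(J, K)\<in>X. wtN J K powr d * norm (field_coef \<alpha> H t J K - field_coef \<alpha> H s J K))"
      by (simp add: sum_distrib_left case_prod_unfold)
    also have "\<dots> \<le> (C * r) * (A * norm (t - s) powr \<gamma>)"
      using X st Cnn r by (intro mult_left_mono A) auto
    finally show ?thesis by (simp only: mult_ac)
  qed
  define \<rho> where "\<rho> n = (min 1 M * 2 ^ n) powr (- \<delta>)" for n :: nat
  have mM: "min 1 M > 0" using M by simp
  have \<rho>0: "\<rho> n \<ge> 0" for n by (simp add: \<rho>_def)
  have \<rho>lim: "\<rho> \<longlonglongrightarrow> 0"
  proof -
    have eq: "\<rho> = (\<lambda>n. min 1 M powr (- \<delta>) * (2 powr (- \<delta>)) ^ n)"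
      using mM by (auto simp: \<rho>_def powr_mult powr_powr mult.commute simp flip: powr_realpow)
    have "(\<lambda>n. (2 powr (- \<delta>)) ^ n) \<longlonglongrightarrow> 0"
      using \<delta> by (intro LIMSEQ_realpow_zero powr_less_one) auto
    from tendsto_mult_right_zero[OF this] show ?thesis unfolding eq .
  qed
  have inc: "\<bar>u n t - u n s\<bar> \<le> (C * A) * norm (t - s) powr \<gamma>" if st: "s \<in> cube M" "t \<in> cube M" for n s t
  proof -
    have "norm (S (D_index_prod n M) t - S (D_index_prod n M) s) \<le> (C * A) * 1 * norm (t - s) powr \<gamma>"
      using \<delta> by (intro gen finD st) (simp_all add: ge_one_powr_ge_zero wtN_ge_1)
    thus ?thesis using abs_Re_le_cmod[of "S (D_index_prod n M) t - S (D_index_prod n M) s"] by (simp add: uS)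
  qed
  have dif: "\<bar>(u m t - u n t) - (u m s - u n s)\<bar> \<le> (C * A) * \<rho> n * norm (t - s) powr \<gamma>"
    if mn: "n \<le> m" and st: "s \<in> cube M" "t \<in> cube M" for m n s t
  proof -
    define X where "X = D_index_prod m M - (D_index_prod n M :: ((int^'n) \<times> (int^'n)) set)"
    have sub: "D_index_prod n M \<subseteq> (D_index_prod m M :: ((int^'n) \<times> (int^'n)) set)"
      using D_index_mono[OF mn, of M] M by (auto simp: D_index_prod_def)
    have SX: "S X v = S (D_index_prod m M) v - S (D_index_prod n M) v" for v
      unfolding S_def X_def using sub finD by (simp add: sum_diff)
    have "norm (S X t - S X s) \<le> (C * A) * \<rho> n * norm (t - s) powr \<gamma>"
    proof (rule gen[OF _ st \<rho>0])
      show "finite X" using finD by (simp add: X_def)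
      fix J K assume "(J, K) \<in> X"
      hence w: "min 1 M * 2 ^ n \<le> wtN J K" using wtN_off_D_index[of J K n M] M by (auto simp: X_def)
      have "1 = \<rho> n * (min 1 M * 2 ^ n) powr \<delta>"
        using mM by (simp add: \<rho>_def powr_minus field_simps)
      also have "\<dots> \<le> \<rho> n * wtN J K powr \<delta>"
        using w \<delta> mM by (intro mult_left_mono \<rho>0 powr_mono2) auto
      finally show "1 \<le> \<rho> n * wtN J K powr \<delta>" .
    qed
    moreover have "(u m t - u n t) - (u m s - u n s) = Re (S X t - S X s)" by (simp add: uS SX)
    ultimately show ?thesis using abs_Re_le_cmod[of "S X t - S X s"] by simp
  qed
  \<comment> \<open>The field vanishes at the origin; the corner of the cube is the second, distinct
    point that the Hoelder lemmas ask for.\<close>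
  have z: "(0 :: real^'n) \<in> cube M" "(\<chi> l. M) \<in> cube M" "(0 :: real^'n) \<noteq> (\<chi> l. M)"
    using M by (auto simp: cube_def vec_eq_iff)
  have f0: "field_coef \<alpha> H 0 J K = 0" for J K by (simp add: field_coef_def power_0_left)
    have u0: "u n 0 = 0" for n by (simp add: uS S_def f0 case_prod_unfold)
  have R: "norm (t - 0) \<le> (\<Sum>l\<in>(UNIV::'n set). M)" if t: "t \<in> cube M" for t :: "real^'n"
  proof -
    have "norm t \<le> (\<Sum>l\<in>UNIV. \<bar>t $ l\<bar>)" by (rule norm_le_l1_cart)
    also have "\<dots> \<le> (\<Sum>l\<in>(UNIV::'n set). M)" by (intro sum_mono cube_component t)
    finally show ?thesis by simp
  qed
  have CA: "C * A \<ge> 0" using Cnn A by simp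
  note HL = holder_Cauchy_limit[OF z u0 R \<gamma>(1) CA \<rho>lim \<rho>0 inc dif]
  show "holder_Cauchy \<gamma> (cube M) (\<lambda>n t. U_star \<psi> \<alpha> H I M n t \<omega>)"
    "\<And>t. t \<in> cube M \<Longrightarrow> convergent (\<lambda>n. U_star \<psi> \<alpha> H I M n t \<omega>)"
    "holder_limit \<gamma> (cube M) (\<lambda>n t. U_star \<psi> \<alpha> H I M n t \<omega>) (\<lambda>t. lim (\<lambda>n. U_star \<psi> \<alpha> H I M n t \<omega>))"
    using HL unfolding u_def by blast+
qed

text \<open>A countable family of exponents tending to 0 gives a single null set that serves every
  \<open>\<gamma>\<close> at once.\<close>

lemma AE_wavelet_coeff_bounds:
  "AE \<omega> in P. \<forall>i::nat. \<exists>C. \<forall>J K. norm (wavelet_coeff \<psi> \<alpha> I J K \<omega>) \<le> C * wtN J K powr (1 / real (Suc i))"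
  unfolding AE_all_countable by (intro allI wavelet_coeff_bound) simp

end

theorem theorem2p7:
  fixes P :: "'w measure"
    and \<alpha> M :: real
    and H :: "real^'n"
    and \<psi> :: "real \<Rightarrow> real"
    and I :: "(real^'n \<Rightarrow> complex) \<Rightarrow> 'w \<Rightarrow> complex"
  assumes "prob_space P"
    and "0 < \<alpha>" and "\<alpha> < 2"
    and "\<forall>l. 0 < H $ l \<and> H $ l < 1"
    and "stable_random_integral P \<alpha> I"
    and "lemarie_meyer_wavelet \<psi>"
    and "0 < M"
  shows
    "(AE \<omega> in P. \<forall>\<gamma>\<in>{0<..<Min (range (\<lambda>l. H $ l))}.
        holder_Cauchy \<gamma> (cube M) (\<lambda>n t. U_star \<psi> \<alpha> H I M n t \<omega>)) \<and>
     (\<exists>U :: real^'n \<Rightarrow> 'w \<Rightarrow> real.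
        (AE \<omega> in P. \<forall>\<gamma>\<in>{0<..<Min (range (\<lambda>l. H $ l))}.
          holder_limit \<gamma> (cube M) (\<lambda>n t. U_star \<psi> \<alpha> H I M n t \<omega>) (\<lambda>t. U t \<omega>)) \<and>
        version_on P (cube M) U (harmonizable_sheet \<alpha> H I))"
proof -
  interpret prob_space P by fact
  interpret stable_sheet P \<alpha> I \<psi> H M
    by unfold_locales (use assms in auto)
  \<comment> \<open>One limit for all \<open>\<gamma>\<close>. Where the sequence diverges,
    \<open>lim\<close> is an unspecified number, but the expression remains measurable in the
    outcome.\<close>
  define U where "U t \<omega> = lim (\<lambda>n. U_star \<psi> \<alpha> H I M n t \<omega>)" for t \<omega>
  have \<gamma>H: "\<gamma> < H $ l" if "\<gamma> \<in> {0<..<Min (range (\<lambda>l. H $ l))}" for \<gamma> l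
    using that by (auto intro: less_le_trans)
  have H_Cauchy: "AE \<omega> in P. \<forall>\<gamma>\<in>{0<..<Min (range (\<lambda>l. H $ l))}.
      holder_Cauchy \<gamma> (cube M) (\<lambda>n t. U_star \<psi> \<alpha> H I M n t \<omega>)"
    using AE_wavelet_coeff_bounds
  proof eventually_elim
    case (elim \<omega>)
    show ?case
    proof
      fix \<gamma> assume \<gamma>: "\<gamma> \<in> {0<..<Min (range (\<lambda>l. H $ l))}"
      hence "0 < \<gamma>" by simp
      thus "holder_Cauchy \<gamma> (cube M) (\<lambda>n t. U_star \<psi> \<alpha> H I M n t \<omega>)"
        by (rule holder_convergence(1)[OF spec[OF elim] _ \<gamma>H[OF \<gamma>]])
    qed
  qed
  have H_limit: "AE \<omega> in P. \<forall>\<gamma>\<in>{0<..<Min (range (\<lambda>l. H $ l))}.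
      holder_limit \<gamma> (cube M) (\<lambda>n t. U_star \<psi> \<alpha> H I M n t \<omega>) (\<lambda>t. U t \<omega>)"
    using AE_wavelet_coeff_bounds
  proof eventually_elim
    case (elim \<omega>)
    show ?case
    proof
      fix \<gamma> assume \<gamma>: "\<gamma> \<in> {0<..<Min (range (\<lambda>l. H $ l))}"
      hence "0 < \<gamma>" by simp
      thus "holder_limit \<gamma> (cube M) (\<lambda>n t. U_star \<psi> \<alpha> H I M n t \<omega>) (\<lambda>t. U t \<omega>)"
        unfolding U_def by (rule holder_convergence(3)[OF spec[OF elim] _ \<gamma>H[OF \<gamma>]])
    qed
  qed
  have "version_on P (cube M) U (harmonizable_sheet \<alpha> H I)"
    unfolding version_on_def
  proof (intro ballI conjI)
    fix t :: "real^'n" assume t: "t \<in> cube M"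
    show Um: "U t \<in> borel_measurable P"
      unfolding U_def[abs_def] using U_star_measurable by measurable
    \<comment> \<open>Pointwise convergence at \<open>t\<close> follows from any admissible
      exponent; half the minimum is one.\<close>
    define \<gamma> where "\<gamma> = Min (range (\<lambda>l. H $ l)) / 2"
    have "Min (range (\<lambda>l. H $ l)) > 0" using H by (subst Min_gr_iff) auto
    hence \<gamma>: "\<gamma> \<in> {0<..<Min (range (\<lambda>l. H $ l))}" by (simp add: \<gamma>_def)
    have lim: "AE \<omega> in P. (\<lambda>n. U_star \<psi> \<alpha> H I M n t \<omega>) \<longlonglongrightarrow> U t \<omega>"
      using AE_wavelet_coeff_bounds
    proof eventually_elim
      case (elim \<omega>)
      have "convergent (\<lambda>n. U_star \<psi> \<alpha> H I M n t \<omega>)"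
        by (rule holder_convergence(2)[OF spec[OF elim] _ \<gamma>H[OF \<gamma>] t]) (use \<gamma> in simp)
      thus ?case by (simp add: U_def convergent_LIMSEQ_iff)
    qed
    show "harmonizable_sheet \<alpha> H I t \<in> borel_measurable P" "AE \<omega> in P. U t \<omega> = harmonizable_sheet \<alpha> H I t \<omega>"
      using limit_eq_sheet[OF t Um lim] by blast+
  qed
  with H_Cauchy H_limit show ?thesis by blast
qed

end
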